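(* Fix $\eta\in(0,2)$ and let $\sigma$ be a finite, nonzero Borel measure on $\mathbb S^{d-1}$. Let $\{X_t:t\ge0\}$ be a Lévy process on $\mathbb R^d$ with $X_1\sim ID_0(M,b)$. 1. There exist functions $a_t>0$ and $\zeta_t\in\mathbb R^d$ such that $a_t(X_t-\zeta_t)\to S_\eta(\sigma,0)$ in distribution as $t\downarrow0$ if and only if $M\in RV^0_{-\eta}(\sigma)$. 2. Let $p>0$, $\alpha\in(-\infty,2)\setminus\{0\}$, $\gamma=\alpha\vee0$. If $\eta\in(\gamma,2)$ and $X_1\sim TS^p_\alpha(R,b)$ for some $R\in\mathfrak M^\gamma$, then there exist functions $a_t>0$ and $\zeta_t\in\mathbb R^d$ such that $a_t(X_t-\zeta_t)\to S_\eta(\sigma,0)$ in distribution as $t\downarrow0$ if and only if $R\in RV^0_{-\eta}(\sigma)$.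
   Context: For $\beta\in[0,2]$, $\mathfrak M^\beta$ is the class of Borel measures $M$ on $\mathbb R^d$ with $M(\{0\})=0$ and $\int(|x|^2\wedge|x|^\beta)M(dx)<\infty$. For a Lévy measure $M$ and $b\in\mathbb R^d$, $ID_0(M,b)$ is the infinitely divisible distribution with characteristic function $\exp\{i\langle b,z\rangle+\int(e^{i\langle z,x\rangle}-1-i\langle z,x\rangle/(1+|x|^2))M(dx)\}$. $TS^p_\alpha(R,b)=ID_0(M,b)$ where $M(A)=\int_{\mathbb R^d}\int_0^\infty 1_A(tx)t^{-1-\alpha}e^{-t^p}\,dt\,R(dx)$. The stable distribution $S_\eta(\sigma,b)$ is $ID_0(M,b)$ with $M(A)=\int_{\mathbb S^{d-1}}\int_0^\infty 1_A(ur)r^{-1-\eta}\,dr\,\sigma(du)$. Regular variation of measures: for $\rho\le0$, $a\in\{0,\infty\}$, a nonzero $M\in\mathfrak M^0$ (with unbounded support if $a=\infty$) is in $RV^a_\rho(\sigma)$, for a finite nonzero Borel measure $\sigma$ on $\mathbb S^{d-1}$, if for every $t>0$ and every Borel $D\subset\mathbb S^{d-1}$ with $\sigma(\partial D)=0$, $\lim_{r\to a} M(|x|>rt,\,x/|x|\in D)/M(|x|>r)=t^\rho\sigma(D)/\sigma(\mathbb S^{d-1})$. *)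

theory Defs
  imports "HOL-Probability.Probability"
begin

text \<open>The class M^beta: Borel measures on R^d with M({0}) = 0 and
  finite integral of min(|x|^2, |x|^beta).  For beta = 0 this is the class of
  Levy measures.\<close>
definition Mclass :: "real \<Rightarrow> ('a::euclidean_space) measure \<Rightarrow> bool" where
  "Mclass \<beta> M \<longleftrightarrow> sets M = sets borel \<and> emeasure M {0} = 0 \<and>
     (\<integral>\<^sup>+ x. ennreal (min ((norm x)\<^sup>2) (norm x powr \<beta>)) \<partial>M) < \<infinity>"

definition is_ID0 :: "('a::euclidean_space) measure \<Rightarrow> 'a \<Rightarrow> 'a measure \<Rightarrow> bool" where
  "is_ID0 M b \<mu> \<longleftrightarrow> prob_space \<mu> \<and> sets \<mu> = sets borel \<and>
     (\<forall>z::'a. (CLINT x|\<mu>. exp (\<i> * complex_of_real (z \<bullet> x))) =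
        exp (\<i> * complex_of_real (b \<bullet> z) +
             (CLINT x|M. exp (\<i> * complex_of_real (z \<bullet> x)) - 1
                         - \<i> * complex_of_real ((z \<bullet> x) / (1 + (norm x)\<^sup>2)))))"

definition TS_levy :: "real \<Rightarrow> real \<Rightarrow> ('a::euclidean_space) measure \<Rightarrow> 'a measure" where
  "TS_levy p \<alpha> R = measure_of UNIV (sets borel)
     (\<lambda>A. \<integral>\<^sup>+ x. (\<integral>\<^sup>+ t\<in>{0<..}. indicator A (t *\<^sub>R x) *
              ennreal (t powr (-1 - \<alpha>) * exp (- (t powr p))) \<partial>lborel) \<partial>R)"

definition stable_levy :: "real \<Rightarrow> ('a::euclidean_space) measure \<Rightarrow> 'a measure" where
  "stable_levy \<eta> \<sigma> = measure_of UNIV (sets borel)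
     (\<lambda>A. \<integral>\<^sup>+ u\<in>sphere 0 1. (\<integral>\<^sup>+ r\<in>{0<..}. indicator A (r *\<^sub>R u) *
              ennreal (r powr (-1 - \<eta>)) \<partial>lborel) \<partial>\<sigma>)"

definition sphere_measure :: "('a::euclidean_space) measure \<Rightarrow> bool" where
  "sphere_measure \<sigma> \<longleftrightarrow> sets \<sigma> = sets borel \<and> finite_measure \<sigma> \<and>
     emeasure \<sigma> (UNIV - sphere 0 1) = 0 \<and> emeasure \<sigma> (sphere 0 1) \<noteq> 0"

text \<open>Regular variation at 0: M in RV^0_rho(sigma).  The boundary of D is taken
  relative to the sphere.\<close>
definition RV0 :: "real \<Rightarrow> ('a::euclidean_space) measure \<Rightarrow> 'a measure \<Rightarrow> bool" where
  "RV0 \<rho> \<sigma> M \<longleftrightarrow> Mclass 0 M \<and> emeasure M UNIV \<noteq> 0 \<and>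
     (\<forall>t>0. \<forall>D\<in>sets borel. D \<subseteq> sphere 0 1 \<longrightarrow>
        emeasure \<sigma> (closure D \<inter> closure (sphere 0 1 - D)) = 0 \<longrightarrow>
        ((\<lambda>r. measure M {x. norm x > r * t \<and> sgn x \<in> D} / measure M {x. norm x > r})
           \<longlongrightarrow> t powr \<rho> * measure \<sigma> D / measure \<sigma> (sphere 0 1)) (at_right 0))"

definition weak_conv_on :: "('b \<Rightarrow> ('a::euclidean_space) measure) \<Rightarrow> 'a measure \<Rightarrow> 'b filter \<Rightarrow> bool" where
  "weak_conv_on \<mu> \<nu> F \<longleftrightarrow>
     (\<forall>f::'a \<Rightarrow> real. continuous_on UNIV f \<and> bounded (range f) \<longrightarrow>
        ((\<lambda>t. \<integral>x. f x \<partial>\<mu> t) \<longlongrightarrow> (\<integral>x. f x \<partial>\<nu>)) F)"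

text \<open>Levy process {X_t : t >= 0} on R^d (Sato's definition).\<close>
definition levy_process :: "'w measure \<Rightarrow> (real \<Rightarrow> 'w \<Rightarrow> ('a::euclidean_space)) \<Rightarrow> bool" where
  "levy_process P X \<longleftrightarrow> prob_space P \<and>
     (\<forall>t\<ge>0. X t \<in> borel_measurable P) \<and>
     (AE \<omega> in P. X 0 \<omega> = 0) \<and>
     (\<forall>n::nat. \<forall>s::nat \<Rightarrow> real. 0 \<le> s 0 \<and> (\<forall>j<n. s j < s (Suc j)) \<longrightarrow>
        prob_space.indep_vars P (\<lambda>_. borel) (\<lambda>j \<omega>. X (s (Suc j)) \<omega> - X (s j) \<omega>) {..<n}) \<and>
     (\<forall>s\<ge>0. \<forall>t\<ge>0. distr P borel (\<lambda>\<omega>. X (s + t) \<omega> - X s \<omega>) = distr P borel (X t)) \<and>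
     (\<forall>s\<ge>0. \<forall>\<epsilon>>0. ((\<lambda>t. measure P {\<omega>\<in>space P. dist (X t \<omega>) (X s \<omega>) > \<epsilon>})
                         \<longlongrightarrow> 0) (at s within {0..})) \<and>
     (AE \<omega> in P. \<forall>s\<ge>0. continuous (at_right s) (\<lambda>t. X t \<omega>) \<and>
                       (s > 0 \<longrightarrow> (\<exists>l. ((\<lambda>t. X t \<omega>) \<longlongrightarrow> l) (at_left s))))"

end

theory Submission
  imports Defs
begin

text \<open>
  The exponent of \<open>a (X\<^sub>t - \<zeta>)\<close> belongs to the Levy measure \<open>t M (\<cdot> / a)\<close>, so the limit theorem is about
  the convergence of these measures. Necessity: second differences in \<open>z\<close> of the exponents remove the
  drift and are Fourier transforms of the finite measures \<open>(1 - cos (w \<bullet> x)) M(dx)\<close>; averaged over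
  small \<open>w\<close>, they give weak convergence of Levy measures away from \<open>0\<close>, and eliminating \<open>t\<close> turns
  this into regular variation. Sufficiency: take \<open>t\<close> and \<open>a\<close> linked by \<open>t M(norm x > 1 / a) \<rightarrow> const\<close>;
  Potter bounds make the small jumps uniformly negligible. The limit law exists as an infinite convolution of
  compound Poisson laws of the shells of its Levy measure.

  In the tempered case, the tail of \<open>M\<close> is \<open>\<integral> R(norm x > r / t, x / norm x \<in> D) t\<^bsup>-1-\<alpha>\<^esup> exp (- t\<^sup>p) dt\<close>.
  Dominated convergence passes regular variation from \<open>R\<close> to \<open>M\<close>. Conversely, dilating \<open>r\<close> by
  \<open>k\<^bsup>1/p\<^esup>\<close> multiplies the integrand by powers of \<open>exp (- t\<^sup>p)\<close>, so all moments in that variable converge,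
  and Weierstrass approximation and monotonicity recover the tail of \<open>R\<close>.
\<close>

subsection \<open>Characteristic exponents of Levy measures\<close>

text \<open>The obstacle is that limits are known for characteristic functions, while Levy measures
  sit in their complex logarithms. For necessity only \<open>exp\<close> of a second difference is
  read off \<open>cf\<close>; an a priori bound by 3 < pi for small \<open>w\<close> makes the
  principal branch \<open>Ln\<close> invert it. The same ambiguity of branches in the law at time
  \<open>t\<close> is settled by continuity and connectedness. The continuity theorem is needed for
  finite measures, since Levy measures enter it with a density that tames the origin:
  \<open>1 - cos\<close> integrated over small \<open>w\<close> along the axes, positive except at
  0. Tails are controlled only over directions with null boundary, so the way from tails to
  exponents leads through layer-cake integrals over angles, where almost every superlevel set is
  admissible, and through radial shells. Jumps of the tail functions are absorbed by monotonicity
  against the continuous power \<open>s powr (-\<eta>)\<close>. In the tempered case the part of the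
  tail integral outside the reach of Potter bounds is of order \<open>r powr (-\<alpha>)\<close>; it
  is negligible because the tail of \<open>R\<close> grows faster than \<open>r powr (-c)\<close>
  for some \<open>c > \<alpha>\<close>.\<close>

definition cf :: "'a::euclidean_space measure \<Rightarrow> 'a \<Rightarrow> complex" where
  "cf \<mu> z = (CLINT x|\<mu>. iexp (z \<bullet> x))"

definition levy_kernel :: "'a::euclidean_space \<Rightarrow> 'a \<Rightarrow> complex" where
  "levy_kernel z x = iexp (z \<bullet> x) - 1 - \<i> * complex_of_real ((z \<bullet> x) / (1 + (norm x)\<^sup>2))"

definition levy_exponent :: "'a::euclidean_space measure \<Rightarrow> 'a \<Rightarrow> complex" where
  "levy_exponent M z = (CLINT x|M. levy_kernel z x)"

lemma is_ID0_iff: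
  "is_ID0 M b \<mu> \<longleftrightarrow> prob_space \<mu> \<and> sets \<mu> = sets borel \<and>
     (\<forall>z. cf \<mu> z = exp (\<i> * complex_of_real (b \<bullet> z) + levy_exponent M z))"
  by (simp add: is_ID0_def cf_def levy_exponent_def levy_kernel_def)

lemma norm_iexp_minus_1_le: "cmod (iexp x - 1) \<le> \<bar>x\<bar>"
  using iexp_approx1[of x 0] by simp

lemma norm_iexp_minus_1_le_2: "cmod (iexp x - 1) \<le> 2"
  using norm_triangle_ineq4[of "iexp x" 1] by simp

lemma borel_measurable_levy_kernel [measurable]:
  "(\<lambda>x. levy_kernel z x) \<in> borel_measurable borel"
  unfolding levy_kernel_def by measurable

lemma continuous_levy_kernel: "continuous_on UNIV (\<lambda>z. levy_kernel z x)"
  unfolding levy_kernel_def by (intro continuous_intros) (auto simp: add_nonneg_eq_0_iff)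

lemma continuous_levy_kernel_right: "continuous_on UNIV (\<lambda>x. levy_kernel z x)"
  unfolding levy_kernel_def
  by (intro continuous_intros) (auto simp: add_nonneg_eq_0_iff)

text \<open>Two regimes. For small \<open>x\<close> there is the Taylor remainder of second order
  and the discrepancy \<open>\<theta> - \<theta> / (1 + (norm x)\<^sup>2)\<close>, which is of third
  order in \<open>x\<close>; for large \<open>x\<close> both terms are bounded. The crude constant
  covers both.\<close>

lemma norm_levy_kernel_le:
  fixes z x :: "'a::euclidean_space"
  shows "cmod (levy_kernel z x) \<le> (2 + norm z + (norm z)\<^sup>2) * min ((norm x)\<^sup>2) 1"
proof (cases "norm x \<le> 1")
  case True
  define \<theta> where "\<theta> = z \<bullet> x"
  have th: "\<bar>\<theta>\<bar> \<le> norm z * norm x"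
    unfolding \<theta>_def by (rule Cauchy_Schwarz_ineq2)
  have pos: "1 + (norm x)\<^sup>2 > 0" by (simp add: add_pos_nonneg)
  have "levy_kernel z x = (iexp \<theta> - (\<Sum>k\<le>1. (\<i> * \<theta>)^k / fact k)) + \<i> * complex_of_real (\<theta> - \<theta> / (1 + (norm x)\<^sup>2))"
    unfolding levy_kernel_def \<theta>_def by (simp add: algebra_simps)
  also have "cmod \<dots> \<le> cmod (iexp \<theta> - (\<Sum>k\<le>1. (\<i> * \<theta>)^k / fact k)) + \<bar>\<theta> - \<theta> / (1 + (norm x)\<^sup>2)\<bar>"
    by (rule order_trans[OF norm_triangle_ineq]) (simp add: norm_mult del: of_real_diff of_real_divide)
  also have "\<dots> \<le> \<bar>\<theta>\<bar>\<^sup>2 / 2 + norm z * (norm x)\<^sup>2"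
  proof (rule add_mono)
    show "cmod (iexp \<theta> - (\<Sum>k\<le>1. (\<i> * \<theta>)^k / fact k)) \<le> \<bar>\<theta>\<bar>\<^sup>2 / 2"
      using iexp_approx1[of \<theta> 1] by (simp add: numeral_2_eq_2)
    have "\<theta> - \<theta> / (1 + (norm x)\<^sup>2) = \<theta> * ((norm x)\<^sup>2 / (1 + (norm x)\<^sup>2))"
      using pos by (simp add: field_simps)
    then have "\<bar>\<theta> - \<theta> / (1 + (norm x)\<^sup>2)\<bar> = \<bar>\<theta>\<bar> * ((norm x)\<^sup>2 / (1 + (norm x)\<^sup>2))"
      using pos by (simp add: abs_mult)
    also have "\<dots> \<le> norm z * (norm x)\<^sup>2"
    proof (rule mult_mono)
      show "\<bar>\<theta>\<bar> \<le> norm z"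
        using th True mult_left_le[of "norm x" "norm z"] by simp
      show "(norm x)\<^sup>2 / (1 + (norm x)\<^sup>2) \<le> (norm x)\<^sup>2"
        using pos by (simp add: divide_le_eq) (simp add: algebra_simps)
    qed auto
    finally show "\<bar>\<theta> - \<theta> / (1 + (norm x)\<^sup>2)\<bar> \<le> norm z * (norm x)\<^sup>2" .
  qed
  also have "\<bar>\<theta>\<bar>\<^sup>2 \<le> (norm z)\<^sup>2 * (norm x)\<^sup>2"
    using power_mono[OF th, of 2] by (simp add: power_mult_distrib)
  finally have "cmod (levy_kernel z x) \<le> (norm z)\<^sup>2 * (norm x)\<^sup>2 / 2 + norm z * (norm x)\<^sup>2"
    by simp
  also have "\<dots> \<le> (2 + norm z + (norm z)\<^sup>2) * (norm x)\<^sup>2"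
    by (simp add: algebra_simps)
  also have "(norm x)\<^sup>2 = min ((norm x)\<^sup>2) 1"
    using True by (simp add: power_le_one min_absorb1)
  finally show ?thesis .
next
  case False
  have pos: "1 + (norm x)\<^sup>2 > 0" by (simp add: add_pos_nonneg)
  have "norm x \<le> (norm x)\<^sup>2" using False by (intro self_le_power) auto
  then have nx: "norm x \<le> 1 + (norm x)\<^sup>2" by simp
  have "\<bar>(z \<bullet> x) / (1 + (norm x)\<^sup>2)\<bar> = \<bar>z \<bullet> x\<bar> / (1 + (norm x)\<^sup>2)"
    using pos by simp
  also have "\<dots> \<le> (norm z * norm x) / (1 + (norm x)\<^sup>2)"
    by (rule divide_right_mono) (use pos Cauchy_Schwarz_ineq2 in auto)
  also have "\<dots> \<le> norm z"
    using pos nx by (simp add: divide_le_eq mult_left_mono)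
  finally have b: "\<bar>(z \<bullet> x) / (1 + (norm x)\<^sup>2)\<bar> \<le> norm z" .
  have "cmod (levy_kernel z x) \<le> cmod (iexp (z \<bullet> x) - 1) + \<bar>(z \<bullet> x) / (1 + (norm x)\<^sup>2)\<bar>"
    unfolding levy_kernel_def
    by (rule order_trans[OF norm_triangle_ineq4]) (simp add: norm_mult del: of_real_divide)
  also have "\<dots> \<le> 2 + norm z"
    using b norm_iexp_minus_1_le_2 by (intro add_mono) auto
  also have "\<dots> \<le> (2 + norm z + (norm z)\<^sup>2) * min ((norm x)\<^sup>2) 1"
    using False by (simp add: min_absorb2)
  finally show ?thesis .
qed

lemma Mclass_0_iff:
  "Mclass 0 M \<longleftrightarrow> sets M = sets borel \<and> emeasure M {0} = 0 \<and>
     (\<integral>\<^sup>+ x. ennreal (min ((norm x)\<^sup>2) 1) \<partial>M) < \<infinity>"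
proof -
  \<comment> \<open>\<open>0 powr 0\<close> is 0 rather than 1; at the origin the square makes the
    minimum 0 on either side.\<close>
  have "min ((norm x)\<^sup>2) (norm x powr 0) = min ((norm x)\<^sup>2) 1" for x :: 'a
    by (cases "x = 0") auto
  then show ?thesis unfolding Mclass_def by simp
qed

locale levy_measure =
  fixes M :: "'a::euclidean_space measure"
  assumes Mclass_0: "Mclass 0 M"
begin

lemma sets_M [measurable_cong]: "sets M = sets borel"
  using Mclass_0 by (simp add: Mclass_0_iff)

lemma space_M [simp]: "space M = UNIV"
  using sets_eq_imp_space_eq[OF sets_M] by simp

lemma AE_nonzero: "AE x in M. x \<noteq> 0"
  using Mclass_0 by (intro AE_I[of _ _ "{0}"]) (auto simp: Mclass_0_iff sets_M)

lemma integrable_min: "integrable M (\<lambda>x. min ((norm x)\<^sup>2) 1)"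
  using Mclass_0 by (intro integrableI_nonneg) (auto simp: Mclass_0_iff measurable_cong_sets[OF sets_M refl])

lemma integrable_bound_min:
  fixes f :: "'a \<Rightarrow> 'b::{banach, second_countable_topology}"
  assumes "f \<in> borel_measurable borel" "\<And>x. norm (f x) \<le> C * min ((norm x)\<^sup>2) 1"
  shows "integrable M f"
proof (rule Bochner_Integration.integrable_bound)
  show "integrable M (\<lambda>x. C * min ((norm x)\<^sup>2) 1)" using integrable_min by simp
  show "f \<in> borel_measurable M" using assms(1) by (simp cong: measurable_cong_sets add: sets_M)
  show "AE x in M. norm (f x) \<le> norm (C * min ((norm x)\<^sup>2) 1)"
    unfolding real_norm_def by (intro AE_I2 order_trans[OF assms(2) abs_ge_self])
qed

lemma integrable_levy_kernel: "integrable M (levy_kernel z)"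
  by (rule integrable_bound_min[OF borel_measurable_levy_kernel norm_levy_kernel_le])

lemma norm_gt_le_min:
  assumes "0 < s"
  shows "indicator {x. norm x > s} x \<le> 1 / min (s\<^sup>2) 1 * min ((norm (x::'a))\<^sup>2) 1"
proof -
  have "min (s\<^sup>2) 1 \<le> min ((norm x)\<^sup>2) 1" if "norm x > s"
    using that assms by (intro min.mono power_mono) auto
  moreover have "min (s\<^sup>2) 1 > 0" using assms by simp
  ultimately show ?thesis by (auto simp: indicator_def divide_simps)
qed

lemma emeasure_norm_gt_finite:
  assumes "0 < s"
  shows "emeasure M {x. norm x > s} < \<infinity>"
proof -
  have "integrable M (indicator {x. norm x > s} :: 'a \<Rightarrow> real)"
    by (rule integrable_bound_min[where C="1 / min (s\<^sup>2) 1"])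
      (use norm_gt_le_min[OF assms] in \<open>auto simp: indicator_def\<close>)
  then show ?thesis by (simp add: integrable_indicator_iff)
qed

lemma emeasure_finite_away:
  assumes "0 < s" "A \<subseteq> {x. norm x > s}"
  shows "emeasure M A < \<infinity>"
proof -
  have "{x. norm x > s} \<in> sets M" unfolding sets_M by measurable
  then show ?thesis using emeasure_mono[OF assms(2)] emeasure_norm_gt_finite[OF assms(1)]
    by (metis order_le_less_trans)
qed

text \<open>The sets \<open>norm x > 1 / Suc n\<close> have finite mass and miss only the null set
  \<open>{0}\<close>. Fubini with the averaging variable, the layer-cake level or the tempering
  variable rests on this.\<close>

lemma sigma_finite: "sigma_finite_measure M"
proof
  let ?A = "insert {0} (range (\<lambda>n::nat. {x::'a. norm x > 1 / Suc n}))"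
  have "\<Union>?A = UNIV"
  proof -
    have "\<exists>n::nat. norm x > 1 / Suc n" if "x \<noteq> 0" for x :: 'a
      using nat_approx_posE[of "norm x"] that by (metis zero_less_norm_iff)
    then show ?thesis by auto
  qed
  moreover have "emeasure M {0} = 0" using Mclass_0 by (simp add: Mclass_0_iff)
  ultimately show "\<exists>A. countable A \<and> A \<subseteq> sets M \<and> \<Union>A = space M \<and> (\<forall>a\<in>A. emeasure M a \<noteq> \<infinity>)"
    using emeasure_norm_gt_finite
    by (intro exI[of _ ?A]) (auto simp: sets_M less_top)
qed

lemma integrable_away:
  fixes f :: "'a \<Rightarrow> 'b::{banach, second_countable_topology}"
  assumes "f \<in> borel_measurable borel" "\<And>x. norm (f x) \<le> B" "0 < s" "\<And>x. norm x \<le> s \<Longrightarrow> f x = 0"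
  shows "integrable M f"
proof (rule integrable_bound_min[where C="B / min (s\<^sup>2) 1"])
  fix x :: 'a
  have B: "B \<ge> 0" using assms(2)[of 0] norm_ge_zero order_trans by blast
  show "norm (f x) \<le> B / min (s\<^sup>2) 1 * min ((norm x)\<^sup>2) 1"
  proof (cases "norm x \<le> s")
    case True
    then show ?thesis using assms B by simp
  next
    case False
    then have "1 \<le> 1 / min (s\<^sup>2) 1 * min ((norm x)\<^sup>2) 1"
      using norm_gt_le_min[OF assms(3), of x] by (auto simp: indicator_def)
    then have "B * 1 \<le> B * (1 / min (s\<^sup>2) 1 * min ((norm x)\<^sup>2) 1)"
      using B by (intro mult_left_mono)
    then show ?thesis using assms(2)[of x] by simp
  qed
qed (use assms in auto)

text \<open>Convergent sequences of \<open>z\<close> are bounded, so one multiple of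
  \<open>min ((norm x)\<^sup>2) 1\<close> dominates. Continuity serves to single out the right root
  of unity in \<open>levy_process_cf\<close> and to get measurability in the averaging
  variable.\<close>

lemma continuous_levy_exponent: "continuous_on UNIV (levy_exponent M)"
proof -
  have "((levy_exponent M) \<longlongrightarrow> levy_exponent M z) (at z)" for z
  proof (subst tendsto_at_iff_sequentially, safe)
    fix Z assume Z: "Z \<longlonglongrightarrow> z"
    have "Bseq Z" using Z convergentI convergent_imp_Bseq by blast
    then obtain K where K: "\<And>n. norm (Z n) \<le> K" unfolding Bseq_def by auto
    have "(\<lambda>n. CLINT x|M. levy_kernel (Z n) x) \<longlonglongrightarrow> (CLINT x|M. levy_kernel z x)"
    proof (rule integral_dominated_convergence[where w="\<lambda>x. (2 + K + K\<^sup>2) * min ((norm x)\<^sup>2) 1"])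
      show "integrable M (\<lambda>x. (2 + K + K\<^sup>2) * min ((norm x)\<^sup>2) 1)" using integrable_min by simp
      show "AE x in M. (\<lambda>n. levy_kernel (Z n) x) \<longlonglongrightarrow> levy_kernel z x"
        using continuous_on_tendsto_compose[OF continuous_levy_kernel Z] by simp
      show "AE x in M. cmod (levy_kernel (Z n) x) \<le> (2 + K + K\<^sup>2) * min ((norm x)\<^sup>2) 1" for n
      proof (rule AE_I2)
        fix x
        have "(2 + norm (Z n) + (norm (Z n))\<^sup>2) \<le> 2 + K + K\<^sup>2"
          using K[of n] by (intro add_mono power_mono) auto
        then show "cmod (levy_kernel (Z n) x) \<le> (2 + K + K\<^sup>2) * min ((norm x)\<^sup>2) 1"
          by (intro order_trans[OF norm_levy_kernel_le] mult_right_mono) auto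
      qed
    qed (auto simp: measurable_cong_sets[OF sets_M refl])
    then show "(levy_exponent M \<circ> Z) \<longlonglongrightarrow> levy_exponent M z"
      by (simp add: levy_exponent_def comp_def)
  qed
  then show ?thesis by (simp add: continuous_on_def)
qed

end

section \<open>Dilated Levy measures and the drift they create\<close>

definition dilate_measure :: "real \<Rightarrow> real \<Rightarrow> 'a::euclidean_space measure \<Rightarrow> 'a measure" where
  "dilate_measure t a M = scale_measure (ennreal t) (distr M borel (\<lambda>x. a *\<^sub>R x))"

lemma sets_dilate_measure [simp, measurable_cong]: "sets (dilate_measure t a M) = sets borel"
  by (simp add: dilate_measure_def)

lemma emeasure_dilate_measure:
  assumes "sets M = sets borel" "A \<in> sets borel"
  shows "emeasure (dilate_measure t a M) A = ennreal t * emeasure M {x. a *\<^sub>R x \<in> A}"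
proof -
  note [measurable_cong] = assms(1) and [measurable] = assms(2)
  show ?thesis unfolding dilate_measure_def
    using sets_eq_imp_space_eq[OF assms(1)] by (simp add: emeasure_distr vimage_def)
qed

lemma integrable_dilate_measure_iff:
  fixes f :: "'a::euclidean_space \<Rightarrow> 'b::{banach, second_countable_topology}"
  assumes "sets M = sets borel" "f \<in> borel_measurable borel" "0 < t"
  shows "integrable (dilate_measure t a M) f \<longleftrightarrow> integrable M (\<lambda>x. f (a *\<^sub>R x))"
proof -
  note [measurable_cong] = assms(1) and [measurable] = assms(2)
  show ?thesis unfolding dilate_measure_def
    using assms(3)
    by (auto simp add: integrable_iff_bounded nn_integral_distr nn_integral_scale_measure ennreal_mult_less_top)
qed

lemma scale_measure_eq_density:
  assumes "0 \<le> t"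
  shows "scale_measure (ennreal t) N = density N (\<lambda>_. ennreal t)"
  by (rule measure_eqI) (auto simp: emeasure_density nn_integral_cmult_indicator)

lemma integral_dilate_measure:
  fixes f :: "'a::euclidean_space \<Rightarrow> 'b::{banach, second_countable_topology}"
  assumes "sets M = sets borel" "f \<in> borel_measurable borel" "0 \<le> t"
  shows "(\<integral>x. f x \<partial>dilate_measure t a M) = t *\<^sub>R (\<integral>x. f (a *\<^sub>R x) \<partial>M)"
proof -
  note [measurable_cong] = assms(1) and [measurable] = assms(2)
  show ?thesis unfolding dilate_measure_def
    using assms(3) by (simp add: scale_measure_eq_density integral_density integral_distr)
qed

lemma Mclass_dilate_measure:
  assumes M: "Mclass 0 M" and "0 < t" "0 < a"
  shows "Mclass 0 (dilate_measure t a M)"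
proof -
  interpret levy_measure M by unfold_locales fact
  have "integrable M (\<lambda>x. min ((norm (a *\<^sub>R x))\<^sup>2) 1)"
  proof (rule integrable_bound_min)
    show "norm (min ((norm (a *\<^sub>R x))\<^sup>2) 1) \<le> max (a\<^sup>2) 1 * min ((norm x)\<^sup>2) 1" for x
    proof -
      have "(norm (a *\<^sub>R x))\<^sup>2 \<le> max (a\<^sup>2) 1 * (norm x)\<^sup>2"
        using assms by (auto simp: power_mult_distrib intro!: mult_right_mono)
      moreover have "1 \<le> max (a\<^sup>2) 1 * 1" by simp
      ultimately have "min ((norm (a *\<^sub>R x))\<^sup>2) 1 \<le> min (max (a\<^sup>2) 1 * (norm x)\<^sup>2) (max (a\<^sup>2) 1 * 1)"
        by (rule min.mono)
      then show ?thesis by (simp add: min_mult_distrib_left le_max_iff_disj)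
    qed
  qed simp
  then have "integrable (dilate_measure t a M) (\<lambda>x. min ((norm x)\<^sup>2) 1)"
    using assms by (subst integrable_dilate_measure_iff) (auto simp: sets_M)
  then have "(\<integral>\<^sup>+ x. ennreal (min ((norm x)\<^sup>2) 1) \<partial>dilate_measure t a M) < \<infinity>"
    by (simp add: integrable_iff_bounded)
  moreover have "emeasure (dilate_measure t a M) {0} = 0"
    using assms M by (simp add: emeasure_dilate_measure sets_M Mclass_0_iff)
  ultimately show ?thesis by (simp add: Mclass_0_iff)
qed

text \<open>The centring \<open>x / (1 + (norm x)\<^sup>2)\<close> does not commute with dilation.
  The mismatch \<open>g\<close> is of third order at 0 and bounded at infinity, hence integrable,
  and its integral becomes the drift \<open>d\<close>.\<close>

lemma levy_exponent_dilate_measure: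
  assumes M: "Mclass 0 M" and t: "0 < t" and a: "0 < a"
  obtains d where
    "\<And>z. complex_of_real t * levy_exponent M (a *\<^sub>R z) = levy_exponent (dilate_measure t a M) z + \<i> * complex_of_real (d \<bullet> z)"
proof -
  interpret levy_measure M by unfold_locales fact
  define g where "g x = (a / (1 + (norm (a *\<^sub>R x))\<^sup>2) - a / (1 + (norm x)\<^sup>2)) *\<^sub>R x" for x :: 'a
  have gm: "g \<in> borel_measurable borel" unfolding g_def by measurable
  have pos: "1 + (norm x)\<^sup>2 > 0" for x :: 'a by (simp add: add_pos_nonneg)
  have g: "integrable M g"
  proof (rule integrable_bound_min[OF gm])
    fix x :: 'a
    have eq: "a / (1 + (norm (a *\<^sub>R x))\<^sup>2) - a / (1 + (norm x)\<^sup>2) = a * (1 - a\<^sup>2) * ((norm x)\<^sup>2 / ((1 + (norm (a *\<^sub>R x))\<^sup>2) * (1 + (norm x)\<^sup>2)))"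
      using pos[of x] pos[of "a *\<^sub>R x"] by (simp add: divide_simps power_mult_distrib) (simp add: algebra_simps)
    have "norm (g x) = \<bar>a * (1 - a\<^sup>2)\<bar> * ((norm x)\<^sup>2 * norm x / ((1 + (norm (a *\<^sub>R x))\<^sup>2) * (1 + (norm x)\<^sup>2)))"
      unfolding g_def eq using pos[of x] pos[of "a *\<^sub>R x"] by (simp add: abs_mult)
    \<comment> \<open>The fraction is split in two ways: \<open>n\<^sup>2\<close> over one
      denominator and \<open>n\<close> over the other give \<open>n\<^sup>2\<close>, the opposite
      pairing gives \<open>1 / a\<close>. The factor \<open>max 1 (1/a)\<close> serves both.\<close>
    also have "\<dots> \<le> \<bar>a * (1 - a\<^sup>2)\<bar> * (max 1 (1/a) * min ((norm x)\<^sup>2) 1)"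
    proof (rule mult_left_mono)
      define n where "n = norm x"
      have n: "n \<ge> 0" by (simp add: n_def)
      have p: "1 + a\<^sup>2 * n\<^sup>2 > 0" "1 + n\<^sup>2 > 0" by (simp_all add: add_pos_nonneg)
      have le1: "n / (1 + n\<^sup>2) \<le> 1" using p sum_squares_bound[of n 1] n by (simp add: divide_le_eq)
      have le2: "n / (1 + a\<^sup>2 * n\<^sup>2) \<le> 1 / a"
        using p sum_squares_bound[of "a*n" 1] n a by (simp add: divide_le_eq field_simps power2_eq_square)
      have le3: "n\<^sup>2 / (1 + a\<^sup>2 * n\<^sup>2) \<le> n\<^sup>2" using p by (simp add: divide_le_eq mult_left_mono)
         (simp add: algebra_simps)
      have le4: "n\<^sup>2 / (1 + n\<^sup>2) \<le> 1" using p by (simp add: divide_le_eq)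
      have "n\<^sup>2 * n / ((1 + a\<^sup>2 * n\<^sup>2) * (1 + n\<^sup>2)) = n\<^sup>2 / (1 + a\<^sup>2 * n\<^sup>2) * (n / (1 + n\<^sup>2))" by simp
      also have "\<dots> \<le> n\<^sup>2 * 1" by (rule mult_mono[OF le3 le1]) (use n p in auto)
      finally have A: "n\<^sup>2 * n / ((1 + a\<^sup>2 * n\<^sup>2) * (1 + n\<^sup>2)) \<le> n\<^sup>2" by simp
      have "n\<^sup>2 * n / ((1 + a\<^sup>2 * n\<^sup>2) * (1 + n\<^sup>2)) = n\<^sup>2 / (1 + n\<^sup>2) * (n / (1 + a\<^sup>2 * n\<^sup>2))" by simp
      also have "\<dots> \<le> 1 * (1/a)" by (rule mult_mono[OF le4 le2]) (use n p in auto)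
      finally have B: "n\<^sup>2 * n / ((1 + a\<^sup>2 * n\<^sup>2) * (1 + n\<^sup>2)) \<le> 1/a" by simp
      have "n\<^sup>2 * n / ((1 + a\<^sup>2 * n\<^sup>2) * (1 + n\<^sup>2)) \<le> min (max 1 (1/a) * n\<^sup>2) (max 1 (1/a) * 1)"
      proof (rule min.boundedI)
        show "n\<^sup>2 * n / ((1 + a\<^sup>2 * n\<^sup>2) * (1 + n\<^sup>2)) \<le> max 1 (1/a) * n\<^sup>2"
          using A mult_right_mono[of 1 "max 1 (1/a)" "n\<^sup>2"] by simp
      qed (use B in simp)
      then show "(norm x)\<^sup>2 * norm x / ((1 + (norm (a *\<^sub>R x))\<^sup>2) * (1 + (norm x)\<^sup>2)) \<le> max 1 (1/a) * min ((norm x)\<^sup>2) 1"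
        unfolding n_def using a by (simp add: power_mult_distrib min_mult_distrib_left le_max_iff_disj)
    qed simp
    finally show "norm (g x) \<le> (\<bar>a * (1 - a\<^sup>2)\<bar> * max 1 (1/a)) * min ((norm x)\<^sup>2) 1" by (simp add: mult.assoc)
  qed
  show ?thesis
  proof
    fix z :: 'a
    have k: "levy_kernel (a *\<^sub>R z) x = levy_kernel z (a *\<^sub>R x) + \<i> * complex_of_real (g x \<bullet> z)" for x
      unfolding levy_kernel_def g_def by (simp add: algebra_simps inner_commute)
    have i1: "integrable M (\<lambda>x. levy_kernel z (a *\<^sub>R x))"
    proof -
      interpret D: levy_measure "dilate_measure t a M" by unfold_locales (rule Mclass_dilate_measure[OF M t a])
      show ?thesis using D.integrable_levy_kernel[of z] t by (subst (asm) integrable_dilate_measure_iff) (auto simp: sets_M)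
    qed
    have "levy_exponent M (a *\<^sub>R z) = (CLINT x|M. levy_kernel z (a *\<^sub>R x)) + \<i> * complex_of_real ((\<integral>x. g x \<partial>M) \<bullet> z)"
      unfolding levy_exponent_def k using i1 g by simp
    moreover have "levy_exponent (dilate_measure t a M) z = t * (CLINT x|M. levy_kernel z (a *\<^sub>R x))"
      unfolding levy_exponent_def using t by (subst integral_dilate_measure) (auto simp: sets_M scaleR_conv_of_real)
    ultimately show "complex_of_real t * levy_exponent M (a *\<^sub>R z) =
        levy_exponent (dilate_measure t a M) z + \<i> * complex_of_real ((t *\<^sub>R (\<integral>x. g x \<partial>M)) \<bullet> z)"
      by (simp add: algebra_simps)
  qed
qed

subsection \<open>The continuity theorem on Euclidean spaces\<close>

lemma norm_integral_le_integral:
  fixes f :: "'b \<Rightarrow> 'c::{banach, second_countable_topology}"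
  assumes "integrable M f" "integrable M g" "\<And>x. x \<in> space M \<Longrightarrow> norm (f x) \<le> g x"
  shows "norm (\<integral>x. f x \<partial>M) \<le> (\<integral>x. g x \<partial>M)"
  using assms by (intro order_trans[OF integral_norm_bound] integral_mono) auto

text \<open>The three-term estimate behind the smoothing, truncation and polynomial approximations
  below: the approximants \<open>u\<close> may depend on \<open>e\<close>, but for fixed
  \<open>e\<close> they must converge.\<close>

lemma tendsto_by_approximation:
  fixes x :: "'c \<Rightarrow> 'b::real_normed_vector"
  assumes "\<And>e. 0 < e \<Longrightarrow> \<exists>u v. (u \<longlongrightarrow> v) F \<and> (\<forall>\<^sub>F n in F. norm (x n - u n) \<le> e) \<and> norm (y - v) \<le> e"
  shows "(x \<longlongrightarrow> y) F"
proof (rule tendstoI)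
  fix e :: real assume "0 < e"
  then obtain u v where uv: "(u \<longlongrightarrow> v) F" "\<forall>\<^sub>F n in F. norm (x n - u n) \<le> e/4" "norm (y - v) \<le> e/4"
    using assms[of "e/4"] by auto
  have "\<forall>\<^sub>F n in F. dist (u n) v < e/4" using uv(1) \<open>0 < e\<close> by (intro tendstoD) auto
  with uv(2) show "\<forall>\<^sub>F n in F. dist (x n) y < e"
  proof eventually_elim
    case (elim n)
    have "dist (x n) y \<le> dist (x n) (u n) + dist (u n) v + dist y v"
      using dist_triangle[of "x n" y "u n"] dist_triangle[of "u n" y v] dist_commute[of v y] by linarith
    then show ?case using elim uv(3) \<open>0 < e\<close> by (simp add: dist_norm)
  qed
qed

section \<open>Gaussian smoothing and its Fourier representation\<close>

lemma (in pair_sigma_finite) integrable_mult_fst_snd: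
  fixes f :: "'a \<Rightarrow> real" and g :: "'b \<Rightarrow> real"
  assumes f: "integrable M1 f" and g: "integrable M2 g"
  shows "integrable (M1 \<Otimes>\<^sub>M M2) (\<lambda>p. f (fst p) * g (snd p))"
proof (rule Fubini_integrable)
  note [measurable] = borel_measurable_integrable[OF f] borel_measurable_integrable[OF g]
  show "(\<lambda>p. f (fst p) * g (snd p)) \<in> borel_measurable (M1 \<Otimes>\<^sub>M M2)" by measurable
  show "integrable M1 (\<lambda>x. \<integral>y. norm (f (fst (x, y)) * g (snd (x, y))) \<partial>M2)"
    using f by (simp add: abs_mult)
  show "AE x in M1. integrable M2 (\<lambda>y. f (fst (x, y)) * g (snd (x, y)))"
    using g by simp
qed

definition gauss_density :: "'a::euclidean_space \<Rightarrow> real" where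
  "gauss_density y = (\<Prod>b\<in>Basis. std_normal_density (y \<bullet> b))"

lemma borel_measurable_gauss_density [measurable]: "gauss_density \<in> borel_measurable borel"
  unfolding gauss_density_def by measurable

lemma gauss_density_nonneg: "0 \<le> gauss_density y"
  unfolding gauss_density_def by (intro prod_nonneg) auto

text \<open>The radial form shows that the Fourier transform
  \<open>exp (- (norm z)\<^sup>2 / 2)\<close> is a multiple of the density itself. This self-duality
  drives the inversion in \<open>integral_gauss_smooth\<close>.\<close>

lemma gauss_density_eq:
  fixes y :: "'a::euclidean_space"
  shows "gauss_density y = (1 / sqrt (2 * pi)) ^ DIM('a) * exp (- (norm y)\<^sup>2 / 2)"
proof -
  have "(norm y)\<^sup>2 = (\<Sum>b\<in>Basis. (y \<bullet> b)\<^sup>2)"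
    by (simp add: norm_eq_sqrt_inner euclidean_inner[of y y] power2_eq_square sum_nonneg)
  then have "exp (- (norm y)\<^sup>2 / 2) = (\<Prod>b\<in>Basis. exp (- (y \<bullet> b)\<^sup>2 / 2))"
    by (simp add: exp_sum[symmetric] sum_negf sum_divide_distrib)
  then show ?thesis unfolding gauss_density_def std_normal_density_def
    by (simp only: prod.distrib prod_constant)
qed

lemma std_normal_density_iexp:
  "complex_integrable lborel (\<lambda>x. complex_of_real (std_normal_density x) * iexp (t * x))"
  "(CLINT x|lborel. complex_of_real (std_normal_density x) * iexp (t * x)) = exp (- t\<^sup>2 / 2)"
proof -
  have i: "integrable lborel std_normal_density" by (rule integrable_normal_density) simp
  show "complex_integrable lborel (\<lambda>x. complex_of_real (std_normal_density x) * iexp (t * x))"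
    by (rule Bochner_Integration.integrable_bound[OF i]) (auto simp: norm_mult)
  have "char std_normal_distribution t = exp (- t\<^sup>2 / 2)"
    by (simp add: char_std_normal_distribution)
  then show "(CLINT x|lborel. complex_of_real (std_normal_density x) * iexp (t * x)) = exp (- t\<^sup>2 / 2)"
    unfolding char_def by (subst (asm) integral_density) (auto simp: scaleR_conv_of_real)
qed

text \<open>\<open>lborel\<close> is the image of a product of real Lebesgue measures under
  coordinates, so the integral factors over \<open>Basis\<close> into one-dimensional normal
  characteristic functions.\<close>

lemma gauss_density_iexp:
  fixes z :: "'a::euclidean_space"
  shows "complex_integrable lborel (\<lambda>y. complex_of_real (gauss_density y) * iexp (z \<bullet> y))" (is ?A)
    and "(CLINT y|lborel. complex_of_real (gauss_density y) * iexp (z \<bullet> y)) = exp (- (norm z)\<^sup>2 / 2)" (is ?B)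
proof -
  interpret product_sigma_finite "\<lambda>_::'a. lborel :: real measure" ..
  let ?h = "\<lambda>f. (\<Sum>b\<in>Basis. f b *\<^sub>R b) :: 'a"
  let ?g = "\<lambda>b x. complex_of_real (std_normal_density x) * iexp ((z \<bullet> b) * x)"
  have hm: "?h \<in> measurable (\<Pi>\<^sub>M b\<in>Basis. lborel) borel" by measurable
  have eq: "complex_of_real (gauss_density (?h f)) * iexp (z \<bullet> ?h f) = (\<Prod>b\<in>Basis. ?g b (f b))" for f
  proof -
    have "iexp (z \<bullet> ?h f) = (\<Prod>b\<in>Basis. iexp ((z \<bullet> b) * f b))"
      by (simp add: inner_sum_right exp_sum[symmetric] sum_distrib_left mult_ac)
    moreover have "gauss_density (?h f) = (\<Prod>b\<in>Basis. std_normal_density (f b))"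
      unfolding gauss_density_def by (intro prod.cong) (simp_all add: inner_sum_left inner_Basis if_distrib if_distribR sum.delta cong: if_cong)
    ultimately show ?thesis by (simp add: prod.distrib)
  qed
  have "integrable (\<Pi>\<^sub>M b\<in>Basis. lborel) (\<lambda>f. \<Prod>b\<in>Basis. ?g b (f b))"
    by (rule product_integrable_prod) (simp, rule std_normal_density_iexp)
  then show ?A
    by (subst lborel_eq, subst integrable_distr_eq[OF hm]) (simp_all only: eq, measurable)
  have "(CLINT y|lborel. complex_of_real (gauss_density y) * iexp (z \<bullet> y)) =
      (CLINT f|(\<Pi>\<^sub>M b\<in>Basis. lborel). \<Prod>b\<in>Basis. ?g b (f b))"
    by (subst lborel_eq, subst integral_distr[OF hm]) (simp_all only: eq, measurable)
  also have "\<dots> = (\<Prod>b\<in>Basis. CLINT x|lborel. ?g b x)"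
    by (rule product_integral_prod) (simp, rule std_normal_density_iexp)
  also have "\<dots> = (\<Prod>b\<in>Basis. complex_of_real (exp (- (z \<bullet> b)\<^sup>2 / 2)))"
    by (simp only: std_normal_density_iexp)
  also have "\<dots> = exp (- (norm z)\<^sup>2 / 2)"
  proof -
    have "(norm z)\<^sup>2 = (\<Sum>b\<in>Basis. (z \<bullet> b)\<^sup>2)"
      by (simp add: norm_eq_sqrt_inner euclidean_inner[of z z] power2_eq_square sum_nonneg)
    then have "exp (- (norm z)\<^sup>2 / 2) = (\<Prod>b\<in>Basis. exp (- (z \<bullet> b)\<^sup>2 / 2))"
      by (simp add: exp_sum[symmetric] sum_negf sum_divide_distrib)
    then show ?thesis by simp
  qed
  finally show ?B .
qed

lemma integrable_gauss_density: "integrable lborel (gauss_density :: 'a::euclidean_space \<Rightarrow> real)"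
  using gauss_density_iexp(1)[of "0::'a"] by (simp add: complex_of_real_integrable_eq)

lemma integral_gauss_density: "(\<integral>y. gauss_density (y::'a::euclidean_space) \<partial>lborel) = 1"
proof -
  have "(CLINT y|lborel. complex_of_real (gauss_density (y::'a))) = 1"
    using gauss_density_iexp(2)[of "0::'a"] by simp
  then show ?thesis
    by (metis integral_complex_of_real of_real_eq_1_iff)
qed

definition gauss_smooth :: "real \<Rightarrow> ('a::euclidean_space \<Rightarrow> real) \<Rightarrow> 'a \<Rightarrow> real" where
  "gauss_smooth \<epsilon> f x = (\<integral>u. f (x - \<epsilon> *\<^sub>R u) * gauss_density u \<partial>lborel)"

lemma borel_measurable_gauss_smooth [measurable]:
  fixes f :: "'a::euclidean_space \<Rightarrow> real"
  assumes [measurable]: "f \<in> borel_measurable borel"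
  shows "gauss_smooth \<epsilon> f \<in> borel_measurable borel"
  unfolding gauss_smooth_def by measurable

lemma abs_gauss_smooth_le:
  fixes f :: "'a::euclidean_space \<Rightarrow> real"
  assumes [measurable]: "f \<in> borel_measurable borel" and B: "\<And>x. \<bar>f x\<bar> \<le> B"
  shows "\<bar>gauss_smooth \<epsilon> f x\<bar> \<le> B"
proof -
  have i: "integrable lborel (\<lambda>u::'a. B * gauss_density u)"
    by (intro integrable_mult_right integrable_gauss_density)
  have le: "norm (f (x - \<epsilon> *\<^sub>R u) * gauss_density u) \<le> B * gauss_density u" for u
    by (auto simp: abs_mult gauss_density_nonneg B intro!: mult_right_mono)
  have "norm (gauss_smooth \<epsilon> f x) \<le> (\<integral>u. B * gauss_density u \<partial>(lborel::'a measure))"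
    unfolding gauss_smooth_def
  proof (rule norm_integral_le_integral[OF _ i le])
    show "integrable lborel (\<lambda>u. f (x - \<epsilon> *\<^sub>R u) * gauss_density u)"
      by (rule Bochner_Integration.integrable_bound[OF i])
        (use le in \<open>auto intro: order_trans[OF _ abs_ge_self]\<close>)
  qed
  then show ?thesis by (simp add: integral_gauss_density)
qed

text \<open>A Parseval formula: the right side sees \<open>\<mu>\<close> only through
  \<open>cf \<mu>\<close>. Self-duality rewrites the Gaussian kernel as a superposition of
  exponentials, and Fubini moves the integral over \<open>\<mu>\<close> inside. Integrability of
  \<open>f\<close> over \<open>lborel\<close> makes the triple integral absolutely
  convergent.\<close>

lemma integral_gauss_smooth:
  fixes f :: "'a::euclidean_space \<Rightarrow> real"
  assumes f: "integrable lborel f" and \<mu>: "finite_measure \<mu>" "sets \<mu> = sets borel" and "0 < \<epsilon>"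
  shows "complex_of_real (\<integral>x. gauss_smooth \<epsilon> f x \<partial>\<mu>) = complex_of_real (1 / (\<epsilon> * sqrt (2 * pi)) ^ DIM('a)) *
    (CLINT p|(lborel \<Otimes>\<^sub>M lborel). complex_of_real (f (fst p) * gauss_density (snd p)) * iexp (- ((fst p \<bullet> snd p) / \<epsilon>)) * cf \<mu> (snd p /\<^sub>R \<epsilon>))"
proof -
  interpret \<mu>: finite_measure \<mu> by fact
  have L: "pair_sigma_finite (lborel :: 'a measure) (lborel :: 'a measure)" ..
  interpret P: pair_sigma_finite "lborel \<Otimes>\<^sub>M lborel :: ('a \<times> 'a) measure" \<mu>
    by (intro pair_sigma_finite.intro sigma_finite_pair_measure sigma_finite_lborel \<mu>.sigma_finite_measure_axioms)
  note [measurable_cong] = \<mu>(2)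
  have fm [measurable]: "f \<in> borel_measurable borel" using f by auto
  define K where "K = (sqrt (2 * pi)) ^ DIM('a)"
  have K: "K > 0" by (simp add: K_def)
  let ?h = "\<lambda>p x. complex_of_real (f (fst p) * gauss_density (snd p)) * iexp (((x - fst p) \<bullet> snd p) / \<epsilon>)"
  have g: "complex_of_real (gauss_density v) = (CLINT u|lborel. complex_of_real (gauss_density u) * iexp (v \<bullet> u)) / K" for v :: 'a
    unfolding gauss_density_iexp(2) by (simp add: gauss_density_eq K_def power_divide)
  have int: "integrable (lborel \<Otimes>\<^sub>M lborel) (\<lambda>p::'a\<times>'a. f (fst p) * gauss_density (snd p))"
    by (rule pair_sigma_finite.integrable_mult_fst_snd[OF L f integrable_gauss_density])
  have hi: "integrable (lborel \<Otimes>\<^sub>M lborel) (\<lambda>p. ?h p x)" for x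
    by (rule Bochner_Integration.integrable_bound[OF int]) (auto simp: norm_mult)
  have S: "complex_of_real (gauss_smooth \<epsilon> f x) = (CLINT p|(lborel \<Otimes>\<^sub>M lborel). ?h p x) / (\<epsilon> ^ DIM('a) * K)" for x
  proof -
    have pt: "complex_of_real (f y * gauss_density ((x - y) /\<^sub>R \<epsilon>)) = (CLINT u|lborel. ?h (y, u) x) / K" for y
    proof -
      have "?h (y, u) x = complex_of_real (f y) * (complex_of_real (gauss_density u) * iexp (((x - y) /\<^sub>R \<epsilon>) \<bullet> u))" for u
        by (simp add: divide_inverse mult_ac)
      then have "(CLINT u|lborel. ?h (y, u) x) = complex_of_real (f y) * (CLINT u|lborel. complex_of_real (gauss_density u) * iexp (((x - y) /\<^sub>R \<epsilon>) \<bullet> u))"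
        by (simp only: integral_mult_right_zero)
      then show ?thesis by (simp only: of_real_mult g[of "(x - y) /\<^sub>R \<epsilon>"] times_divide_eq_right)
    qed
    \<comment> \<open>Substitution \<open>y = x - \<epsilon> *\<^sub>R u\<close>; its Jacobian is
      the source of the power of \<open>\<epsilon>\<close> in the constant.\<close>
    have "(\<integral>y. f y * gauss_density ((x - y) /\<^sub>R \<epsilon>) \<partial>lborel) = (\<integral>u. \<epsilon> ^ DIM('a) * (f (x - \<epsilon> *\<^sub>R u) * gauss_density u) \<partial>lborel)"
      using \<open>0 < \<epsilon>\<close> by (subst lborel_affine[of "-\<epsilon>" x]) (auto simp: integral_density integral_distr)
    then have "gauss_smooth \<epsilon> f x = (\<integral>y. f y * gauss_density ((x - y) /\<^sub>R \<epsilon>) \<partial>lborel) / \<epsilon> ^ DIM('a)"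
      using \<open>0 < \<epsilon>\<close> by (simp add: gauss_smooth_def)
    then have "complex_of_real (gauss_smooth \<epsilon> f x) = complex_of_real (\<integral>y. f y * gauss_density ((x - y) /\<^sub>R \<epsilon>) \<partial>lborel) / \<epsilon> ^ DIM('a)"
      by simp
    also have "complex_of_real (\<integral>y. f y * gauss_density ((x - y) /\<^sub>R \<epsilon>) \<partial>lborel) = (CLINT y|lborel. complex_of_real (f y * gauss_density ((x - y) /\<^sub>R \<epsilon>)))"
      by (rule integral_complex_of_real[symmetric])
    also have "\<dots> = (CLINT y|lborel. (CLINT u|lborel. ?h (y, u) x) / K)"
      by (simp only: pt)
    also have "\<dots> = (CLINT y|lborel. (CLINT u|lborel. ?h (y, u) x)) / K"
      by simp
    also have "(CLINT y|lborel. (CLINT u|lborel. ?h (y, u) x)) = (CLINT p|(lborel \<Otimes>\<^sub>M lborel). ?h p x)"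
      using pair_sigma_finite.integral_fst'[OF L hi[of x]] by simp
    finally show ?thesis by (simp add: mult.commute)
  qed
  have hi2: "integrable ((lborel \<Otimes>\<^sub>M lborel) \<Otimes>\<^sub>M \<mu>) (\<lambda>(p, x). ?h p x)"
  proof -
    have "integrable ((lborel \<Otimes>\<^sub>M lborel) \<Otimes>\<^sub>M \<mu>) (\<lambda>q::('a\<times>'a)\<times>'a. f (fst (fst q)) * gauss_density (snd (fst q)))"
      using P.integrable_mult_fst_snd[OF int, of "\<lambda>_. 1"] by simp
    then show ?thesis
      by (rule Bochner_Integration.integrable_bound) (auto simp: norm_mult)
  qed
  have pt2: "(CLINT x|\<mu>. ?h p x) = complex_of_real (f (fst p) * gauss_density (snd p)) * iexp (- ((fst p \<bullet> snd p) / \<epsilon>)) * cf \<mu> (snd p /\<^sub>R \<epsilon>)" for p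
  proof -
    have "?h p x = complex_of_real (f (fst p) * gauss_density (snd p)) * iexp (- ((fst p \<bullet> snd p) / \<epsilon>)) * iexp ((snd p /\<^sub>R \<epsilon>) \<bullet> x)" for x
      unfolding mult.assoc exp_add[symmetric]
      by (simp add: algebra_simps inner_commute diff_divide_distrib divide_inverse)
    then show ?thesis by (simp only: cf_def integral_mult_right_zero)
  qed
  have "complex_of_real (\<integral>x. gauss_smooth \<epsilon> f x \<partial>\<mu>) = (CLINT x|\<mu>. complex_of_real (gauss_smooth \<epsilon> f x))"
    by simp
  also have "\<dots> = (CLINT x|\<mu>. (CLINT p|(lborel \<Otimes>\<^sub>M lborel). ?h p x)) / (\<epsilon> ^ DIM('a) * K)"
    unfolding S by simp
  also have "(CLINT x|\<mu>. (CLINT p|(lborel \<Otimes>\<^sub>M lborel). ?h p x)) = (CLINT p|(lborel \<Otimes>\<^sub>M lborel). (CLINT x|\<mu>. ?h p x))"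
    using P.Fubini_integral[OF hi2] .
  finally have "complex_of_real (\<integral>x. gauss_smooth \<epsilon> f x \<partial>\<mu>) =
      (CLINT p|(lborel \<Otimes>\<^sub>M lborel). (CLINT x|\<mu>. ?h p x)) / (\<epsilon> ^ DIM('a) * K)" .
  then show ?thesis
    unfolding pt2 by (simp add: power_mult_distrib K_def)
qed

lemma gauss_smooth_uniform_approx:
  fixes f :: "'a::euclidean_space \<Rightarrow> real"
  assumes f: "uniformly_continuous_on UNIV f" and B: "\<And>x. \<bar>f x\<bar> \<le> B" and "0 < e"
  shows "\<exists>\<epsilon>>0. \<forall>x. \<bar>gauss_smooth \<epsilon> f x - f x\<bar> \<le> e"
proof -
  have fm [measurable]: "f \<in> borel_measurable borel"
    using f by (intro borel_measurable_continuous_onI uniformly_continuous_imp_continuous)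
  have B0: "B \<ge> 0" using B[of 0] by simp
  have ig: "integrable lborel (\<lambda>u. indicator {u::'a. norm u > real n} u * gauss_density u)" for n
    by (rule Bochner_Integration.integrable_bound[OF integrable_gauss_density]) (auto simp: indicator_def gauss_density_nonneg)
  have "(\<lambda>n. \<integral>u. indicator {u::'a. norm u > real n} u * gauss_density u \<partial>lborel) \<longlonglongrightarrow> (\<integral>(u::'a). 0 \<partial>lborel)"
  proof (rule integral_dominated_convergence[where w=gauss_density])
    show "AE u::'a in lborel. (\<lambda>n. indicator {u. norm u > real n} u * gauss_density u) \<longlonglongrightarrow> 0"
    proof (rule AE_I2)
      fix u :: 'a
      obtain N where "norm u \<le> real N" using real_arch_simple by blast
      then have "\<forall>\<^sub>F n in sequentially. indicator {u. norm u > real n} u * gauss_density u = 0"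
        by (intro eventually_sequentiallyI[of N]) (auto simp: indicator_def)
      then show "(\<lambda>n. indicator {u. norm u > real n} u * gauss_density u) \<longlonglongrightarrow> 0"
        by (rule tendsto_eventually)
    qed
  qed (auto simp: integrable_gauss_density indicator_def gauss_density_nonneg)
  then have "(\<lambda>n. \<integral>u. indicator {u::'a. norm u > real n} u * gauss_density u \<partial>lborel) \<longlonglongrightarrow> 0" by simp
  \<comment> \<open>This threshold keeps \<open>2 * B\<close> times the Gaussian tail below
    \<open>e / 2\<close>, also when \<open>B = 0\<close>.\<close>
  from order_tendstoD(2)[OF this, of "e / (4 * B + 1)"] \<open>0 < e\<close> B0
  obtain n where n: "(\<integral>u. indicator {u::'a. norm u > real n} u * gauss_density u \<partial>lborel) < e / (4 * B + 1)"
    by (auto simp: eventually_sequentially)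
  obtain \<delta> where \<delta>: "\<delta> > 0" "\<And>x y. dist x y < \<delta> \<Longrightarrow> dist (f x) (f y) < e/2"
    using f \<open>0 < e\<close> unfolding uniformly_continuous_on_def by (metis UNIV_I half_gt_zero dist_commute)
  \<comment> \<open>With this bandwidth a displacement \<open>\<epsilon> *\<^sub>R u\<close> with
    \<open>norm u \<le> real n\<close> stays below the modulus of continuity
    \<open>\<delta>\<close>; larger \<open>u\<close> carry little Gaussian mass.\<close>
  define \<epsilon> where "\<epsilon> = \<delta> / (real n + 1)"
  have \<epsilon>: "\<epsilon> > 0" "\<epsilon> * real n < \<delta>" using \<delta> by (auto simp: \<epsilon>_def field_simps)
  have "\<bar>gauss_smooth \<epsilon> f x - f x\<bar> \<le> e" for x
  proof -
    have i1: "integrable lborel (\<lambda>u. f (x - \<epsilon> *\<^sub>R u) * gauss_density u)"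
      by (rule Bochner_Integration.integrable_bound[OF integrable_mult_right[OF integrable_gauss_density, of B]])
        (auto simp: abs_mult gauss_density_nonneg intro!: mult_right_mono order_trans[OF B abs_ge_self])
    have i2: "integrable lborel (\<lambda>u::'a. f x * gauss_density u)"
      by (intro integrable_mult_right integrable_gauss_density)
    have "gauss_smooth \<epsilon> f x - f x = (\<integral>u. f (x - \<epsilon> *\<^sub>R u) * gauss_density u \<partial>lborel) - (\<integral>(u::'a). f x * gauss_density u \<partial>lborel)"
      by (simp add: gauss_smooth_def integral_gauss_density)
    also have "\<dots> = (\<integral>u. f (x - \<epsilon> *\<^sub>R u) * gauss_density u - f x * gauss_density u \<partial>lborel)"
      by (rule Bochner_Integration.integral_diff[symmetric, OF i1 i2])
    also have "\<bar>\<dots>\<bar> \<le> (\<integral>u. e/2 * gauss_density u + 2 * B * (indicator {u::'a. norm u > real n} u * gauss_density u) \<partial>lborel)"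
      unfolding real_norm_def[symmetric]
    proof (rule norm_integral_le_integral)
      fix u :: 'a
      have "\<bar>f (x - \<epsilon> *\<^sub>R u) - f x\<bar> \<le> e/2 + 2 * B * indicator {u. norm u > real n} u"
      proof (cases "norm u > real n")
        case True
        have "\<bar>f (x - \<epsilon> *\<^sub>R u) - f x\<bar> \<le> 2 * B"
          using B[of "x - \<epsilon> *\<^sub>R u"] B[of x] by linarith
        then show ?thesis using True \<open>0 < e\<close> by simp
      next
        case False
        then have "\<epsilon> * norm u \<le> \<epsilon> * real n" using \<epsilon>(1) by (intro mult_left_mono) auto
        then have "\<epsilon> * norm u < \<delta>" using \<epsilon>(2) by linarith
        then have "dist (x - \<epsilon> *\<^sub>R u) x < \<delta>" using \<epsilon>(1) by (simp add: dist_norm)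
        then show ?thesis using \<delta>(2) False by (fastforce simp: dist_norm)
      qed
      then have "\<bar>f (x - \<epsilon> *\<^sub>R u) - f x\<bar> * gauss_density u \<le> (e/2 + 2 * B * indicator {u. norm u > real n} u) * gauss_density u"
        by (intro mult_right_mono gauss_density_nonneg)
      moreover have "norm (f (x - \<epsilon> *\<^sub>R u) * gauss_density u - f x * gauss_density u) = \<bar>f (x - \<epsilon> *\<^sub>R u) - f x\<bar> * gauss_density u"
        unfolding left_diff_distrib[symmetric] by (simp add: abs_mult gauss_density_nonneg)
      ultimately show "norm (f (x - \<epsilon> *\<^sub>R u) * gauss_density u - f x * gauss_density u) \<le> e/2 * gauss_density u + 2 * B * (indicator {u. norm u > real n} u * gauss_density u)"
        by (simp add: algebra_simps)
    qed (intro Bochner_Integration.integrable_diff Bochner_Integration.integrable_add integrable_mult_right integrable_gauss_density i1 ig)+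
    also have "\<dots> = e/2 + 2 * B * (\<integral>u. indicator {u::'a. norm u > real n} u * gauss_density u \<partial>lborel)"
      by (subst Bochner_Integration.integral_add) (intro integrable_mult_right ig integrable_gauss_density | simp add: integral_gauss_density)+
    also have "\<dots> \<le> e/2 + 2 * B * (e / (4 * B + 1))"
      using n B0 by (intro add_left_mono mult_left_mono) auto
    also have "\<dots> \<le> e" using B0 \<open>0 < e\<close> by (simp add: field_simps)
    finally show ?thesis .
  qed
  then show ?thesis using \<epsilon>(1) by blast
qed

section \<open>From characteristic functions to weak convergence of finite measures\<close>

lemma uniformly_continuous_on_compact_support:
  fixes f :: "'a::euclidean_space \<Rightarrow> real"
  assumes f: "continuous_on UNIV f" and R: "\<And>x. norm x \<ge> R \<Longrightarrow> f x = 0"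
  shows "uniformly_continuous_on UNIV f"
  unfolding uniformly_continuous_on_def
proof safe
  fix e :: real assume "0 < e"
  have "uniformly_continuous_on (cball 0 (R + 1)) f"
    using f by (intro compact_uniformly_continuous) (auto intro: continuous_on_subset)
  then obtain d where d: "d > 0" "\<And>x y. x \<in> cball 0 (R+1) \<Longrightarrow> y \<in> cball 0 (R+1) \<Longrightarrow> dist y x < d \<Longrightarrow> dist (f y) (f x) < e"
    unfolding uniformly_continuous_on_def using \<open>0 < e\<close> by metis
  have "dist (f y) (f x) < e" if "dist y x < min d (1/2)" for x y
  proof (cases "norm x \<le> R + 1/2")
    case True
    have "norm y \<le> norm x + dist y x" by (metis dist_norm norm_triangle_sub)
    then show ?thesis using d(2)[of x y] True that by auto
  next
    case False
    have "norm x \<le> norm y + dist y x" by (metis dist_commute dist_norm norm_triangle_sub)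
    then show ?thesis using R[of x] R[of y] False that \<open>0 < e\<close> by auto
  qed
  then show "\<exists>d>0. \<forall>x\<in>UNIV. \<forall>x'\<in>UNIV. dist x' x < d \<longrightarrow> dist (f x') (f x) < e"
    using \<open>d > 0\<close> by (intro exI[of _ "min d (1/2)"]) auto
qed

lemma cf_0: "finite_measure \<mu> \<Longrightarrow> cf \<mu> 0 = complex_of_real (measure \<mu> (space \<mu>))"
  by (simp add: cf_def scaleR_conv_of_real)

lemma norm_cf_le:
  assumes "finite_measure \<mu>" "sets \<mu> = sets borel"
  shows "cmod (cf \<mu> z) \<le> measure \<mu> (space \<mu>)"
proof -
  interpret finite_measure \<mu> by fact
  note [measurable_cong] = assms(2)
  have "cmod (cf \<mu> z) \<le> (\<integral>x. 1 \<partial>\<mu>)"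
    unfolding cf_def by (rule norm_integral_le_integral) (auto intro!: integrable_const_bound[where B=1])
  then show ?thesis by simp
qed

lemma measurable_cf [measurable]:
  assumes "finite_measure \<mu>" "sets \<mu> = sets borel"
  shows "cf \<mu> \<in> borel_measurable borel"
proof -
  interpret finite_measure \<mu> by fact
  note [measurable_cong] = assms(2)
  show ?thesis unfolding cf_def by measurable
qed

lemma integrable_finite_bounded:
  fixes f :: "'a::euclidean_space \<Rightarrow> 'b::{banach,second_countable_topology}"
  assumes "finite_measure \<mu>" "sets \<mu> = sets borel" "f \<in> borel_measurable borel" "\<And>x. norm (f x) \<le> B"
  shows "integrable \<mu> f"
  using assms by (intro finite_measure.integrable_const_bound[where B=B]) (auto cong: measurable_cong_sets)

theorem levy_continuity_compact_support:
  fixes \<mu> :: "nat \<Rightarrow> 'a::euclidean_space measure"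
  assumes fin: "\<And>n. finite_measure (\<mu> n)" "\<And>n. sets (\<mu> n) = sets borel" "finite_measure \<nu>" "sets \<nu> = sets borel"
    and cf: "\<And>z. (\<lambda>n. cf (\<mu> n) z) \<longlonglongrightarrow> cf \<nu> z"
    and f: "continuous_on UNIV f" and R: "\<And>x. norm x \<ge> R \<Longrightarrow> f x = (0::real)"
  shows "(\<lambda>n. \<integral>x. f x \<partial>\<mu> n) \<longlonglongrightarrow> (\<integral>x. f x \<partial>\<nu>)"
proof -
  have fm [measurable]: "f \<in> borel_measurable borel" using f by (rule borel_measurable_continuous_onI)
  have uc: "uniformly_continuous_on UNIV f" using uniformly_continuous_on_compact_support[OF f R] .
  have "compact (f ` cball 0 R)" using f by (intro compact_continuous_image) (auto intro: continuous_on_subset)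
  then obtain B0 where "\<And>x. norm x \<le> R \<Longrightarrow> \<bar>f x\<bar> \<le> B0"
    by (metis compact_imp_bounded bounded_iff image_eqI mem_cball_0 real_norm_def)
  then have B: "\<bar>f x\<bar> \<le> max B0 0" for x using R[of x] by (cases "norm x \<le> R") (force)+
  have mass: "(\<lambda>n. measure (\<mu> n) (space (\<mu> n))) \<longlonglongrightarrow> measure \<nu> (space \<nu>)"
    using cf[of 0] fin by (simp add: cf_0 tendsto_of_real_iff)
  then have "Bseq (\<lambda>n. measure (\<mu> n) (space (\<mu> n)))"
    by (intro convergent_imp_Bseq convergentI)
  then obtain C where C: "\<And>n. measure (\<mu> n) (space (\<mu> n)) \<le> C" "C > 0"
    unfolding Bseq_def by auto
  have C\<nu>: "measure \<nu> (space \<nu>) \<le> C" by (rule LIMSEQ_le_const2[OF mass]) (use C in auto)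
  have fi: "integrable lborel f"
  proof -
    have "integrable lborel (\<lambda>x. indicator (cball 0 R) x *\<^sub>R f x)"
      using f by (intro borel_integrable_compact) (auto intro: continuous_on_subset)
    moreover have "(\<lambda>x. indicator (cball 0 R) x *\<^sub>R f x) = f" using R by (auto simp: indicator_def fun_eq_iff)
    ultimately show ?thesis by (simp only:)
  qed
  have smooth: "(\<lambda>n. \<integral>x. gauss_smooth \<epsilon> f x \<partial>\<mu> n) \<longlonglongrightarrow> (\<integral>x. gauss_smooth \<epsilon> f x \<partial>\<nu>)" if "\<epsilon> > 0" for \<epsilon>
  proof -
    have L: "pair_sigma_finite (lborel :: 'a measure) (lborel :: 'a measure)" ..
    let ?k = "\<lambda>p::'a\<times>'a. complex_of_real (f (fst p) * gauss_density (snd p)) * iexp (- ((fst p \<bullet> snd p) / \<epsilon>))"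
    have int: "integrable (lborel \<Otimes>\<^sub>M lborel) (\<lambda>p::'a\<times>'a. \<bar>f (fst p) * gauss_density (snd p)\<bar> * C)"
      using pair_sigma_finite.integrable_mult_fst_snd[OF L fi integrable_gauss_density] by simp
    note [measurable] = measurable_cf[OF fin(1,2)] measurable_cf[OF fin(3,4)]
    have "(\<lambda>n. CLINT p|(lborel \<Otimes>\<^sub>M lborel). ?k p * cf (\<mu> n) (snd p /\<^sub>R \<epsilon>)) \<longlonglongrightarrow> (CLINT p|(lborel \<Otimes>\<^sub>M lborel). ?k p * cf \<nu> (snd p /\<^sub>R \<epsilon>))"
    proof (rule integral_dominated_convergence[OF _ _ int])
      show "AE p in lborel \<Otimes>\<^sub>M lborel. (\<lambda>n. ?k p * cf (\<mu> n) (snd p /\<^sub>R \<epsilon>)) \<longlonglongrightarrow> ?k p * cf \<nu> (snd p /\<^sub>R \<epsilon>)"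
        by (intro AE_I2 tendsto_mult tendsto_const cf)
      show "AE p in lborel \<Otimes>\<^sub>M lborel. cmod (?k p * cf (\<mu> n) (snd p /\<^sub>R \<epsilon>)) \<le> \<bar>f (fst p) * gauss_density (snd p)\<bar> * C" for n
      proof (rule AE_I2)
        fix p :: "'a \<times> 'a"
        have "cmod (cf (\<mu> n) (snd p /\<^sub>R \<epsilon>)) \<le> C" using norm_cf_le[OF fin(1,2)] C order_trans by blast
        then show "cmod (?k p * cf (\<mu> n) (snd p /\<^sub>R \<epsilon>)) \<le> \<bar>f (fst p) * gauss_density (snd p)\<bar> * C"
          unfolding norm_mult norm_of_real norm_exp_i_times mult_1_right by (rule mult_left_mono) simp
      qed
    qed measurable
    then have "(\<lambda>n. complex_of_real (\<integral>x. gauss_smooth \<epsilon> f x \<partial>\<mu> n)) \<longlonglongrightarrow> complex_of_real (\<integral>x. gauss_smooth \<epsilon> f x \<partial>\<nu>)"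
      unfolding integral_gauss_smooth[OF fi fin(1,2) that] integral_gauss_smooth[OF fi fin(3,4) that]
      by (rule tendsto_mult_left)
    then show ?thesis by (simp only: tendsto_of_real_iff)
  qed
  show ?thesis
  proof (rule tendsto_by_approximation)
    fix e :: real assume "0 < e"
    then obtain \<epsilon> where \<epsilon>: "\<epsilon> > 0" "\<And>x. \<bar>gauss_smooth \<epsilon> f x - f x\<bar> \<le> e / C"
      using gauss_smooth_uniform_approx[OF uc B, of "e/C"] C(2) by auto
    have close: "norm ((\<integral>x. f x \<partial>\<mu>) - (\<integral>x. gauss_smooth \<epsilon> f x \<partial>\<mu>)) \<le> e"
      if \<mu>: "finite_measure \<mu>" "sets \<mu> = sets borel" "measure \<mu> (space \<mu>) \<le> C" for \<mu>
    proof -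
      interpret finite_measure \<mu> by fact
      have i: "integrable \<mu> f" "integrable \<mu> (gauss_smooth \<epsilon> f)"
        using B abs_gauss_smooth_le[OF fm B]
        by (auto intro!: integrable_finite_bounded[OF \<mu>(1,2)] fm)
      have "norm ((\<integral>x. f x \<partial>\<mu>) - (\<integral>x. gauss_smooth \<epsilon> f x \<partial>\<mu>)) = norm (\<integral>x. f x - gauss_smooth \<epsilon> f x \<partial>\<mu>)"
        using i by simp
      also have "\<dots> \<le> (\<integral>x. e / C \<partial>\<mu>)"
        using i \<epsilon>(2) by (intro norm_integral_le_integral) (auto simp: abs_minus_commute)
      also have "\<dots> = measure \<mu> (space \<mu>) * (e / C)" by simp
      also have "\<dots> \<le> C * (e / C)" using \<mu>(3) C(2) \<open>0 < e\<close> by (intro mult_right_mono) auto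
      also have "\<dots> = e" using C(2) by simp
      finally show ?thesis .
    qed
    show "\<exists>u v. u \<longlonglongrightarrow> v \<and> (\<forall>\<^sub>F n in sequentially. norm ((\<integral>x. f x \<partial>\<mu> n) - u n) \<le> e) \<and> norm ((\<integral>x. f x \<partial>\<nu>) - v) \<le> e"
      using smooth[OF \<epsilon>(1)] close fin C C\<nu>
      by (intro exI[of _ "\<lambda>n. \<integral>x. gauss_smooth \<epsilon> f x \<partial>\<mu> n"] exI[of _ "\<integral>x. gauss_smooth \<epsilon> f x \<partial>\<nu>"]) auto
  qed
qed

definition cutoff :: "real \<Rightarrow> 'a::euclidean_space \<Rightarrow> real" where
  "cutoff R x = max 0 (min 1 (R + 1 - norm x))"

lemma continuous_cutoff [continuous_intros]: "continuous_on A (cutoff R)"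
  unfolding cutoff_def by (intro continuous_intros)

lemma cutoff_bounds: "0 \<le> cutoff R x" "cutoff R x \<le> 1"
  and cutoff_eq_0: "R + 1 \<le> norm x \<Longrightarrow> cutoff R x = 0"
  and cutoff_eq_1: "norm x \<le> R \<Longrightarrow> cutoff R x = 1"
  by (auto simp: cutoff_def)

lemma borel_measurable_cutoff [measurable]: "cutoff R \<in> borel_measurable borel"
  by (intro borel_measurable_continuous_onI continuous_intros)

lemma cutoff_tail_tendsto_0:
  fixes \<nu> :: "'a::euclidean_space measure"
  assumes \<nu>: "finite_measure \<nu>" "sets \<nu> = sets borel"
  shows "(\<lambda>n. \<integral>x. 1 - cutoff (real n) x \<partial>\<nu>) \<longlonglongrightarrow> 0"
proof -
  interpret finite_measure \<nu> by fact
  note [measurable_cong] = \<nu>(2)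
  have "(\<lambda>n. \<integral>x. 1 - cutoff (real n) x \<partial>\<nu>) \<longlonglongrightarrow> (\<integral>x. 0 \<partial>\<nu>)"
  proof (rule integral_dominated_convergence[where w="\<lambda>_. 1"])
    show "AE x in \<nu>. (\<lambda>n. 1 - cutoff (real n) x) \<longlonglongrightarrow> 0"
    proof (rule AE_I2)
      fix x :: 'a
      obtain N where "norm x \<le> real N" using real_arch_simple by blast
      then have "\<forall>\<^sub>F n in sequentially. 1 - cutoff (real n) x = 0"
        by (intro eventually_sequentiallyI[of N]) (auto simp: cutoff_eq_1)
      then show "(\<lambda>n. 1 - cutoff (real n) x) \<longlonglongrightarrow> 0" by (rule tendsto_eventually)
    qed
  qed (auto simp: cutoff_bounds)
  then show ?thesis by simp
qed

text \<open>Tightness comes out of the hypotheses: total masses converge through \<open>cf\<close>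
  at 0 and integrals of a cutoff converge by the compactly supported case, so the mass outside the
  cutoff converges to that of \<open>\<nu>\<close>, which is small.\<close>

theorem levy_continuity_euclidean:
  fixes \<mu> :: "nat \<Rightarrow> 'a::euclidean_space measure"
  assumes fin: "\<And>n. finite_measure (\<mu> n)" "\<And>n. sets (\<mu> n) = sets borel" "finite_measure \<nu>" "sets \<nu> = sets borel"
    and cf: "\<And>z. (\<lambda>n. cf (\<mu> n) z) \<longlonglongrightarrow> cf \<nu> z"
    and f: "continuous_on UNIV f" and B: "\<And>x. \<bar>f x\<bar> \<le> (B::real)"
  shows "(\<lambda>n. \<integral>x. f x \<partial>\<mu> n) \<longlonglongrightarrow> (\<integral>x. f x \<partial>\<nu>)"
proof (rule tendsto_by_approximation)
  fix e :: real assume "0 < e"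
  have fm [measurable]: "f \<in> borel_measurable borel" using f by (rule borel_measurable_continuous_onI)
  have B0: "B \<ge> 0" using B[of 0] by simp
  have mass: "(\<lambda>n. measure (\<mu> n) (space (\<mu> n))) \<longlonglongrightarrow> measure \<nu> (space \<nu>)"
    using cf[of 0] fin by (simp add: cf_0 tendsto_of_real_iff)
  from order_tendstoD(2)[OF cutoff_tail_tendsto_0[OF fin(3,4)], of "e / (B + 1)"] \<open>0 < e\<close> B0
  obtain N where N: "(\<integral>x. 1 - cutoff (real N) x \<partial>\<nu>) < e / (B + 1)"
    by (auto simp: eventually_sequentially)
  let ?c = "cutoff (real N) :: 'a \<Rightarrow> real"
  have ci: "integrable \<mu> ?c" if "finite_measure \<mu>" "sets \<mu> = sets borel" for \<mu>
    using that by (intro integrable_finite_bounded[where B=1]) (auto simp: cutoff_bounds)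
  have tail: "(\<integral>x. 1 - ?c x \<partial>\<mu>) = measure \<mu> (space \<mu>) - (\<integral>x. ?c x \<partial>\<mu>)"
    if "finite_measure \<mu>" "sets \<mu> = sets borel" for \<mu>
    using ci[OF that] finite_measure.integrable_const[OF that(1), of "1::real"] by simp
  have "(\<lambda>n. \<integral>x. 1 - ?c x \<partial>\<mu> n) \<longlonglongrightarrow> (\<integral>x. 1 - ?c x \<partial>\<nu>)"
    unfolding tail[OF fin(1,2)] tail[OF fin(3,4)]
    by (intro tendsto_diff mass levy_continuity_compact_support[OF fin cf, where R="real N + 1"] continuous_intros cutoff_eq_0)
  from order_tendstoD(2)[OF this N]
  have ev: "\<forall>\<^sub>F n in sequentially. (\<integral>x. 1 - ?c x \<partial>\<mu> n) < e / (B + 1)" .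
  have close: "norm ((\<integral>x. f x \<partial>\<mu>) - (\<integral>x. f x * ?c x \<partial>\<mu>)) \<le> e"
    if \<mu>: "finite_measure \<mu>" "sets \<mu> = sets borel" "(\<integral>x. 1 - ?c x \<partial>\<mu>) < e / (B + 1)" for \<mu>
  proof -
    interpret finite_measure \<mu> by fact
    have le: "\<bar>f x * ?c x\<bar> \<le> B" for x
      using B[of x] cutoff_bounds[of "real N" x] B0 mult_mono[of "\<bar>f x\<bar>" B "?c x" 1] by (simp add: abs_mult)
    have i: "integrable \<mu> f" "integrable \<mu> (\<lambda>x. f x * ?c x)"
      using B le by (auto intro!: integrable_finite_bounded[OF \<mu>(1,2)])
    have "norm ((\<integral>x. f x \<partial>\<mu>) - (\<integral>x. f x * ?c x \<partial>\<mu>)) = norm (\<integral>x. f x - f x * ?c x \<partial>\<mu>)"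
      using i by simp
    also have "\<dots> \<le> (\<integral>x. B * (1 - ?c x) \<partial>\<mu>)"
    proof (rule norm_integral_le_integral)
      show "norm (f x - f x * ?c x) \<le> B * (1 - ?c x)" for x
      proof -
        have "f x - f x * ?c x = f x * (1 - ?c x)" by (simp add: algebra_simps)
        then show ?thesis using B[of x] cutoff_bounds[of "real N" x] by (simp add: abs_mult mult_right_mono)
      qed
    qed (use i ci[OF \<mu>(1,2)] in auto)
    also have "\<dots> = B * (\<integral>x. 1 - ?c x \<partial>\<mu>)" by simp
    also have "\<dots> \<le> B * (e / (B + 1))" using \<mu>(3) B0 by (intro mult_left_mono) auto
    also have "\<dots> \<le> e" using B0 \<open>0 < e\<close> by (simp add: field_simps)
    finally show ?thesis .
  qed
  have "(\<lambda>n. \<integral>x. f x * ?c x \<partial>\<mu> n) \<longlonglongrightarrow> (\<integral>x. f x * ?c x \<partial>\<nu>)"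
    by (intro levy_continuity_compact_support[OF fin cf, where R="real N + 1"] continuous_intros f) (simp add: cutoff_eq_0)
  moreover have "\<forall>\<^sub>F n in sequentially. norm ((\<integral>x. f x \<partial>\<mu> n) - (\<integral>x. f x * ?c x \<partial>\<mu> n)) \<le> e"
    using ev by eventually_elim (rule close[OF fin(1,2)])
  ultimately show "\<exists>u v. u \<longlonglongrightarrow> v \<and> (\<forall>\<^sub>F n in sequentially. norm ((\<integral>x. f x \<partial>\<mu> n) - u n) \<le> e) \<and> norm ((\<integral>x. f x \<partial>\<nu>) - v) \<le> e"
    using close[OF fin(3,4) N] by blast
qed

lemma continuous_cf:
  assumes "finite_measure \<mu>" "sets \<mu> = sets borel"
  shows "continuous_on UNIV (cf \<mu>)"
proof -
  interpret finite_measure \<mu> by fact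
  note [measurable_cong] = assms(2)
  have "(cf \<mu> \<longlongrightarrow> cf \<mu> z) (at z)" for z
    unfolding tendsto_at_iff_sequentially
  proof safe
    fix Z assume Z: "Z \<longlonglongrightarrow> z"
    have "(\<lambda>n. CLINT x|\<mu>. iexp (Z n \<bullet> x)) \<longlonglongrightarrow> (CLINT x|\<mu>. iexp (z \<bullet> x))"
      by (rule integral_dominated_convergence[where w="\<lambda>_. 1"])
        (auto intro!: AE_I2 tendsto_intros Z)
    then show "(cf \<mu> \<circ> Z) \<longlonglongrightarrow> cf \<mu> z" by (simp add: cf_def comp_def)
  qed
  then show ?thesis by (simp add: continuous_on_def)
qed

section \<open>Characteristic functions along a Levy process\<close>

lemma cf_distr:
  assumes "f \<in> borel_measurable N"
  shows "cf (distr N borel f) z = (CLINT \<omega>|N. iexp (z \<bullet> f \<omega>))"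
  unfolding cf_def by (subst integral_distr[OF assms]) auto

lemma levy_exponent_0 [simp]: "levy_exponent M 0 = 0"
  by (simp add: levy_exponent_def levy_kernel_def)

context
  fixes P :: "'w measure" and X :: "real \<Rightarrow> 'w \<Rightarrow> 'a::euclidean_space"
  assumes levy: "levy_process P X"
begin

lemma levy_process_measurable: "0 \<le> t \<Longrightarrow> X t \<in> borel_measurable P"
  using levy by (auto simp: levy_process_def)

lemma levy_process_cf_add:
  assumes "0 < s" "0 < t"
  shows "cf (distr P borel (X (s + t))) z = cf (distr P borel (X s)) z * cf (distr P borel (X t)) z"
proof -
  interpret prob_space P using levy by (simp add: levy_process_def)
  note [measurable] = levy_process_measurable[of 0] levy_process_measurable[of s]
    levy_process_measurable[of "s + t"] levy_process_measurable[of t]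
  have [measurable]: "X s \<in> borel_measurable P" "X 0 \<in> borel_measurable P" "X t \<in> borel_measurable P" "X (s + t) \<in> borel_measurable P"
    using assms levy_process_measurable by auto
  \<comment> \<open>The partition \<open>0, s, s + t\<close>. Only the increments with index 0 and 1
    are used, so \<open>u\<close> may be constant from index 2 on.\<close>
  define u where "u j = (if j = 0 then 0 else if j = 1 then s else s + t)" for j :: nat
  have "\<forall>n. \<forall>s::nat \<Rightarrow> real. 0 \<le> s 0 \<and> (\<forall>j<n. s j < s (Suc j)) \<longrightarrow>
        indep_vars (\<lambda>_. borel) (\<lambda>j \<omega>. X (s (Suc j)) \<omega> - X (s j) \<omega>) {..<n}"
    using levy unfolding levy_process_def by blast
  moreover have "0 \<le> u 0 \<and> (\<forall>j<2. u j < u (Suc j))"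
    using assms by (auto simp: u_def less_2_cases_iff)
  ultimately have "indep_vars (\<lambda>_. borel) (\<lambda>j \<omega>. X (u (Suc j)) \<omega> - X (u j) \<omega>) {..<2}"
    by blast
  then have "indep_vars (\<lambda>_. borel) (\<lambda>j \<omega>. iexp (z \<bullet> (X (u (Suc j)) \<omega> - X (u j) \<omega>))) {..<2}"
    by (rule indep_vars_compose2) measurable
  then have "(CLINT \<omega>|P. (\<Prod>j<2. iexp (z \<bullet> (X (u (Suc j)) \<omega> - X (u j) \<omega>)))) =
      (\<Prod>j<2. CLINT \<omega>|P. iexp (z \<bullet> (X (u (Suc j)) \<omega> - X (u j) \<omega>)))"
  proof (rule indep_vars_lebesgue_integral[rotated])
    show "integrable P (\<lambda>\<omega>. iexp (z \<bullet> (X (u (Suc i)) \<omega> - X (u i) \<omega>)))" if "i \<in> {..<2}" for i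
      using that assms by (intro integrable_const_bound[where B=1]) (auto simp: u_def less_2_cases_iff)
  qed simp
  then have eq: "(CLINT \<omega>|P. iexp (z \<bullet> (X s \<omega> - X 0 \<omega>)) * iexp (z \<bullet> (X (s + t) \<omega> - X s \<omega>))) =
      (CLINT \<omega>|P. iexp (z \<bullet> (X s \<omega> - X 0 \<omega>))) * (CLINT \<omega>|P. iexp (z \<bullet> (X (s + t) \<omega> - X s \<omega>)))"
    by (simp add: numeral_2_eq_2 lessThan_Suc u_def mult.commute)
  \<comment> \<open>\<open>X 0\<close> vanishes only almost surely, so the increments from 0 are
    replaced under the integral and not pointwise.\<close>
  have X0: "AE \<omega> in P. X 0 \<omega> = 0" using levy by (simp add: levy_process_def)
  have "(CLINT \<omega>|P. iexp (z \<bullet> (X s \<omega> - X 0 \<omega>)) * iexp (z \<bullet> (X (s + t) \<omega> - X s \<omega>))) = (CLINT \<omega>|P. iexp (z \<bullet> X (s + t) \<omega>))"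
    using X0 by (intro integral_cong_AE) (auto simp: exp_add[symmetric] algebra_simps)
  moreover have "(CLINT \<omega>|P. iexp (z \<bullet> (X s \<omega> - X 0 \<omega>))) = (CLINT \<omega>|P. iexp (z \<bullet> X s \<omega>))"
    using X0 by (intro integral_cong_AE) auto
  moreover have "(CLINT \<omega>|P. iexp (z \<bullet> (X (s + t) \<omega> - X s \<omega>))) = (CLINT \<omega>|P. iexp (z \<bullet> X t \<omega>))"
  proof -
    have "distr P borel (\<lambda>\<omega>. X (s + t) \<omega> - X s \<omega>) = distr P borel (X t)"
      using levy assms by (auto simp: levy_process_def)
    then show ?thesis
      using cf_distr[of "\<lambda>\<omega>. X (s + t) \<omega> - X s \<omega>" P z] cf_distr[of "X t" P z] by simp
  qed
  ultimately show ?thesis using eq by (simp add: cf_distr)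
qed

lemma levy_process_cf_multiple:
  assumes "0 < h"
  shows "cf (distr P borel (X (real (Suc n) * h))) z = cf (distr P borel (X h)) z ^ Suc n"
proof (induction n)
  case (Suc n)
  have eq: "real (Suc (Suc n)) * h = real (Suc n) * h + h" by (simp add: algebra_simps)
  have "0 < real (Suc n) * h" using assms by simp
  from levy_process_cf_add[OF this assms] Suc show ?case
    unfolding eq by (simp add: mult.commute)
qed simp

text \<open>Right-continuity of the paths combined with dominated convergence; this is why the times
  approach \<open>t\<close> strictly from above.\<close>

lemma levy_process_cf_tendsto:
  assumes "0 \<le> t" "\<And>n. t < T n" "T \<longlonglongrightarrow> t"
  shows "(\<lambda>n. cf (distr P borel (X (T n))) z) \<longlonglongrightarrow> cf (distr P borel (X t)) z"
proof -
  interpret prob_space P using levy by (simp add: levy_process_def)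
  have T: "0 \<le> T n" for n using assms(1) assms(2)[of n] by simp
  have [measurable]: "X t \<in> borel_measurable P" "\<And>n. X (T n) \<in> borel_measurable P"
    using assms(1) T levy_process_measurable by auto
  have "(\<lambda>n. CLINT \<omega>|P. iexp (z \<bullet> X (T n) \<omega>)) \<longlonglongrightarrow> (CLINT \<omega>|P. iexp (z \<bullet> X t \<omega>))"
  proof (rule integral_dominated_convergence[where w="\<lambda>_. 1"])
    have "AE \<omega> in P. \<forall>s\<ge>0. continuous (at_right s) (\<lambda>t. X t \<omega>) \<and>
                       (s > 0 \<longrightarrow> (\<exists>l. ((\<lambda>t. X t \<omega>) \<longlongrightarrow> l) (at_left s)))"
      using levy by (simp add: levy_process_def)
    then show "AE \<omega> in P. (\<lambda>n. iexp (z \<bullet> X (T n) \<omega>)) \<longlonglongrightarrow> iexp (z \<bullet> X t \<omega>)"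
    proof eventually_elim
      case (elim \<omega>)
      then have "((\<lambda>t. X t \<omega>) \<longlongrightarrow> X t \<omega>) (at_right t)" using assms(1) by (simp add: continuous_within)
      moreover have "filterlim T (at_right t) sequentially"
        unfolding filterlim_at using assms(3) by (auto intro!: always_eventually simp: assms(2) less_imp_neq[symmetric])
      ultimately have "(\<lambda>n. X (T n) \<omega>) \<longlonglongrightarrow> X t \<omega>" by (rule filterlim_compose)
      then show ?case by (intro tendsto_intros)
    qed
  qed auto
  then show ?thesis by (simp add: cf_distr)
qed

text \<open>The law at time \<open>1 / N\<close> is an N-th convolution root of the law of
  \<open>X 1\<close>, which fixes its characteristic function only up to an N-th root of unity
  depending on \<open>z\<close>. Continuity in \<open>z\<close> removes the ambiguity; rational
  times follow by taking powers, real times as limits from the right.\<close>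

lemma levy_process_cf:
  assumes M: "Mclass 0 M" and X1: "is_ID0 M b (distr P borel (X 1))" and "0 < t"
  shows "cf (distr P borel (X t)) z = exp (complex_of_real t * (\<i> * complex_of_real (b \<bullet> z) + levy_exponent M z))"
proof -
  interpret prob_space P using levy by (simp add: levy_process_def)
  define \<psi> where "\<psi> z = \<i> * complex_of_real (b \<bullet> z) + levy_exponent M z" for z
  have \<psi>cont: "continuous_on UNIV \<psi>"
    unfolding \<psi>_def
    by (intro continuous_intros levy_measure.continuous_levy_exponent levy_measure.intro M)
  have prob: "prob_space (distr P borel (X s))" if "0 \<le> s" for s
    using levy_process_measurable[OF that] by (rule prob_space_distr)
  have inv: "cf (distr P borel (X (1 / real (Suc n)))) z = exp (\<psi> z / of_nat (Suc n))" for n z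
  proof -
    let ?N = "Suc n"
    \<comment> \<open>\<open>?w\<close> compares the true root with
      \<open>exp (\<psi> z / N)\<close>. Its N-th power is 1, so it maps a connected space
      continuously into a finite set and equals its value 1 at 0.\<close>
    let ?w = "\<lambda>z. cf (distr P borel (X (1 / real ?N))) z * exp (- \<psi> z / of_nat ?N)"
    have "?w z ^ ?N = 1" for z
    proof -
      have "?w z ^ ?N = cf (distr P borel (X (1 / real ?N))) z ^ ?N * exp (- \<psi> z / of_nat ?N) ^ ?N"
        by (rule power_mult_distrib)
      also have "exp (- \<psi> z / of_nat ?N) ^ ?N = exp (- \<psi> z)"
        by (subst exp_of_nat_mult[symmetric]) (simp del: of_nat_Suc)
      also have "cf (distr P borel (X (1 / real ?N))) z ^ ?N = exp (\<psi> z)"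
        using levy_process_cf_multiple[of "1 / real ?N" n z] X1 by (simp add: is_ID0_iff \<psi>_def del: of_nat_Suc)
      also have "exp (\<psi> z) * exp (- \<psi> z) = 1" by (simp add: exp_add[symmetric])
      finally show ?thesis .
    qed
    then have "?w ` UNIV \<subseteq> {w. w ^ ?N = 1}" by auto
    moreover have "finite {w::complex. w ^ ?N = 1}" by (rule finite_roots_unity) simp
    ultimately have "finite (?w ` UNIV)" by (rule finite_subset)
    moreover have "continuous_on UNIV ?w"
      using prob[of "1 / real ?N"]
      by (intro continuous_intros continuous_cf \<psi>cont) (auto intro: prob_space.finite_measure simp del: of_nat_Suc)
    ultimately have "?w constant_on UNIV"
      by (intro continuous_finite_range_constant) auto
    then have "?w z = ?w 0" unfolding constant_on_def by (metis UNIV_I)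
    also have "\<dots> = 1"
      using prob[of "1 / real ?N"] prob_space.prob_space[OF prob[of "1 / real ?N"]]
      by (simp add: \<psi>_def cf_0 prob_space.finite_measure del: of_nat_Suc)
    finally have w: "?w z = 1" .
    have "exp (- \<psi> z / of_nat ?N) * exp (\<psi> z / of_nat ?N) = 1"
      unfolding exp_add[symmetric] by simp
    then have "cf (distr P borel (X (1 / real ?N))) z = ?w z * exp (\<psi> z / of_nat ?N)"
      by (simp only: mult.assoc mult_1_right)
    with w show ?thesis by (simp only: mult_1_left)
  qed
  have rat: "cf (distr P borel (X (real (Suc k) / real (Suc n)))) z = exp (complex_of_real (real (Suc k) / real (Suc n)) * \<psi> z)" for k n
  proof -
    have "cf (distr P borel (X (real (Suc k) / real (Suc n)))) z = exp (\<psi> z / of_nat (Suc n)) ^ Suc k"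
      using levy_process_cf_multiple[of "1 / real (Suc n)" k z] inv[of n z] by (simp del: of_nat_Suc power_Suc)
    also have "\<dots> = exp (of_nat (Suc k) * (\<psi> z / of_nat (Suc n)))"
      by (rule exp_of_nat_mult[symmetric])
    finally show ?thesis by (simp add: field_simps)
  qed
  \<comment> \<open>Rounding down and then adding one makes \<open>T n\<close> rational, strictly
    above \<open>t\<close> and within \<open>1 / Suc n\<close> of it.\<close>
  define T where "T n = real (Suc (nat \<lfloor>t * real (Suc n)\<rfloor>)) / real (Suc n)" for n
  have T1: "t < T n" for n
  proof -
    have "t * real (Suc n) < real (Suc (nat \<lfloor>t * real (Suc n)\<rfloor>))" using \<open>0 < t\<close> by linarith
    then show ?thesis unfolding T_def by (simp add: pos_less_divide_eq del: of_nat_Suc)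
  qed
  have T2: "T n \<le> t + 1 / real (Suc n)" for n
  proof -
    have "0 \<le> t * real (Suc n)" using \<open>0 < t\<close> by simp
    then have "real (Suc (nat \<lfloor>t * real (Suc n)\<rfloor>)) \<le> t * real (Suc n) + 1" by linarith
    then have "T n \<le> (t * real (Suc n) + 1) / real (Suc n)"
      unfolding T_def by (rule divide_right_mono) simp
    then show ?thesis by (simp add: add_divide_distrib del: of_nat_Suc)
  qed
  have T: "T \<longlonglongrightarrow> t"
  proof (rule tendsto_sandwich[where f="\<lambda>_. t" and h="\<lambda>n. t + 1 / real (Suc n)"])
    show "(\<lambda>n. t + 1 / real (Suc n)) \<longlonglongrightarrow> t"
      using tendsto_add[OF tendsto_const LIMSEQ_inverse_real_of_nat, of t] by (simp add: inverse_eq_divide)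
  qed (use T1 T2 in \<open>auto intro!: always_eventually less_imp_le\<close>)
  have "(\<lambda>n. cf (distr P borel (X (T n))) z) \<longlonglongrightarrow> cf (distr P borel (X t)) z"
    using \<open>0 < t\<close> T1 T by (intro levy_process_cf_tendsto) auto
  moreover have "(\<lambda>n. cf (distr P borel (X (T n))) z) \<longlonglongrightarrow> exp (complex_of_real t * \<psi> z)"
    unfolding T_def rat unfolding T_def[symmetric] by (intro tendsto_intros T)
  ultimately show ?thesis unfolding \<psi>_def by (rule LIMSEQ_unique)
qed

text \<open>One \<open>\<beta>\<close> serves all centrings \<open>\<zeta>\<close>, so that
  \<open>\<zeta>\<close> can afterwards be chosen to cancel the drift.\<close>

lemma is_ID0_levy_process_rescaled:
  assumes M: "Mclass 0 M" and X1: "is_ID0 M b (distr P borel (X 1))" and "0 < t" "0 < a"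
  obtains \<beta> where "\<And>\<zeta>. is_ID0 (dilate_measure t a M) (\<beta> - a *\<^sub>R \<zeta>) (distr P borel (\<lambda>\<omega>. a *\<^sub>R (X t \<omega> - \<zeta>)))"
proof -
  interpret prob_space P using levy by (simp add: levy_process_def)
  have [measurable]: "X t \<in> borel_measurable P" using levy_process_measurable \<open>0 < t\<close> by simp
  obtain d where d: "\<And>z. complex_of_real t * levy_exponent M (a *\<^sub>R z) =
      levy_exponent (dilate_measure t a M) z + \<i> * complex_of_real (d \<bullet> z)"
    using levy_exponent_dilate_measure[OF M \<open>0 < t\<close> \<open>0 < a\<close>] by blast
  show ?thesis
  proof
    fix \<zeta> :: 'a
    have "cf (distr P borel (\<lambda>\<omega>. a *\<^sub>R (X t \<omega> - \<zeta>))) z =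
        exp (\<i> * complex_of_real ((((t * a) *\<^sub>R b + d) - a *\<^sub>R \<zeta>) \<bullet> z) + levy_exponent (dilate_measure t a M) z)" for z
    proof -
      have eq: "iexp (z \<bullet> (a *\<^sub>R (X t \<omega> - \<zeta>))) = iexp (- a * (\<zeta> \<bullet> z)) * iexp ((a *\<^sub>R z) \<bullet> X t \<omega>)" for \<omega>
        by (simp add: exp_add[symmetric] algebra_simps inner_commute)
      have "cf (distr P borel (\<lambda>\<omega>. a *\<^sub>R (X t \<omega> - \<zeta>))) z = (CLINT \<omega>|P. iexp (- a * (\<zeta> \<bullet> z)) * iexp ((a *\<^sub>R z) \<bullet> X t \<omega>))"
        by (subst cf_distr) (simp_all only: eq, measurable)
      also have "\<dots> = iexp (- a * (\<zeta> \<bullet> z)) * cf (distr P borel (X t)) (a *\<^sub>R z)"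
        by (subst cf_distr) (simp_all only: integral_mult_right_zero, measurable)
      also have "\<dots> = iexp (- a * (\<zeta> \<bullet> z)) * exp (\<i> * complex_of_real (t * a * (b \<bullet> z)) + complex_of_real t * levy_exponent M (a *\<^sub>R z))"
        by (simp add: levy_process_cf[OF M X1 \<open>0 < t\<close>] algebra_simps)
      also have "\<dots> = exp (\<i> * complex_of_real ((((t * a) *\<^sub>R b + d) - a *\<^sub>R \<zeta>) \<bullet> z) + levy_exponent (dilate_measure t a M) z)"
        unfolding d exp_add[symmetric] by (simp add: algebra_simps)
      finally show ?thesis .
    qed
    then show "is_ID0 (dilate_measure t a M) (((t * a) *\<^sub>R b + d) - a *\<^sub>R \<zeta>) (distr P borel (\<lambda>\<omega>. a *\<^sub>R (X t \<omega> - \<zeta>)))"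
      by (simp add: is_ID0_iff prob_space_distr)
  qed
qed

end

subsection \<open>Weak limits determine Levy measures\<close>

lemma levy_kernel_second_difference:
  "2 * levy_kernel z x - levy_kernel (z + w) x - levy_kernel (z - w) x =
     2 * (iexp (z \<bullet> x) * complex_of_real (1 - cos (w \<bullet> x)))"
proof -
  have "iexp ((z + w) \<bullet> x) + iexp ((z - w) \<bullet> x) = 2 * (iexp (z \<bullet> x) * complex_of_real (cos (w \<bullet> x)))"
    unfolding cis_conv_exp[symmetric] inner_add_left inner_diff_left
    by (simp add: complex_eq_iff cos_add cos_diff sin_add sin_diff)
  then have "iexp ((z + w) \<bullet> x) = 2 * (iexp (z \<bullet> x) * complex_of_real (cos (w \<bullet> x))) - iexp ((z - w) \<bullet> x)"
    by (simp only: eq_diff_eq)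
  then show ?thesis
    unfolding levy_kernel_def by (simp add: algebra_simps add_divide_distrib diff_divide_distrib)
qed

lemma one_minus_cos_le: "1 - cos x \<le> x\<^sup>2 / 2" for x :: real
proof -
  have "cos x = 1 - 2 * (sin (x/2))\<^sup>2" using cos_double_sin[of "x/2"] by simp
  moreover have "(sin (x/2))\<^sup>2 \<le> (x/2)\<^sup>2"
    using abs_sin_x_le_abs_x[of "x/2"] by (simp only: abs_le_square_iff)
  ultimately show ?thesis by (simp add: power_divide)
qed

lemma one_minus_cos_inner_le:
  fixes w x :: "'a::euclidean_space"
  shows "1 - cos (w \<bullet> x) \<le> (2 + (norm w)\<^sup>2) * min ((norm x)\<^sup>2) 1"
proof (cases "norm x \<le> 1")
  case True
  then have eq: "min ((norm x)\<^sup>2) 1 = (norm x)\<^sup>2" by (simp add: power_le_one)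
  have "(w \<bullet> x)\<^sup>2 \<le> (norm w * norm x)\<^sup>2"
    using Cauchy_Schwarz_ineq2[of w x] by (simp add: abs_le_square_iff[symmetric] abs_mult)
  then have "1 - cos (w \<bullet> x) \<le> (norm w)\<^sup>2 * (norm x)\<^sup>2"
    using one_minus_cos_le[of "w \<bullet> x"] by (simp add: power_mult_distrib) (smt (verit) zero_le_power2)
  also have "\<dots> \<le> (2 + (norm w)\<^sup>2) * (norm x)\<^sup>2" by (simp add: algebra_simps)
  finally show ?thesis unfolding eq .
next
  case False
  then have eq: "min ((norm x)\<^sup>2) 1 = 1" by (simp add: min_absorb2)
  have "1 - cos (w \<bullet> x) \<le> 2" using cos_ge_minus_one[of "w \<bullet> x"] by linarith
  then show ?thesis unfolding eq by (smt (verit) zero_le_power2)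
qed

definition levy_second_diff :: "'a::euclidean_space measure \<Rightarrow> 'a \<Rightarrow> 'a \<Rightarrow> complex" where
  "levy_second_diff M w z = (CLINT x|M. iexp (z \<bullet> x) * complex_of_real (1 - cos (w \<bullet> x)))"

context levy_measure
begin

lemma integrable_second_diff:
  "complex_integrable M (\<lambda>x. iexp (z \<bullet> x) * complex_of_real (1 - cos (w \<bullet> x)))"
proof (rule integrable_bound_min[where C="2 + (norm w)\<^sup>2"])
  show "cmod (iexp (z \<bullet> x) * complex_of_real (1 - cos (w \<bullet> x))) \<le> (2 + (norm w)\<^sup>2) * min ((norm x)\<^sup>2) 1" for x
    unfolding norm_mult norm_exp_i_times norm_of_real using one_minus_cos_inner_le[of w x] by simp
qed simp

lemma integrable_one_minus_cos: "integrable M (\<lambda>x. 1 - cos (w \<bullet> x))"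
  using integrable_second_diff[of 0 w] complex_of_real_integrable_eq[of M "\<lambda>x. 1 - cos (w \<bullet> x)"] by simp

lemma levy_second_diff_eq:
  "2 * levy_second_diff M w z = 2 * levy_exponent M z - levy_exponent M (z + w) - levy_exponent M (z - w)"
proof -
  have "2 * levy_exponent M z - levy_exponent M (z + w) - levy_exponent M (z - w) =
      (CLINT x|M. 2 * levy_kernel z x - levy_kernel (z + w) x - levy_kernel (z - w) x)"
    unfolding levy_exponent_def by (simp add: integrable_levy_kernel)
  also have "\<dots> = (CLINT x|M. 2 * (iexp (z \<bullet> x) * complex_of_real (1 - cos (w \<bullet> x))))"
    by (simp only: levy_kernel_second_difference)
  also have "\<dots> = 2 * levy_second_diff M w z"
    unfolding levy_second_diff_def by (rule integral_mult_right_zero)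
  finally show ?thesis by simp
qed

lemma levy_second_diff_0: "levy_second_diff M w 0 = complex_of_real (\<integral>x. 1 - cos (w \<bullet> x) \<partial>M)"
proof -
  have "levy_second_diff M w 0 = (CLINT x|M. complex_of_real (1 - cos (w \<bullet> x)))"
    by (simp add: levy_second_diff_def)
  also have "\<dots> = complex_of_real (\<integral>x. 1 - cos (w \<bullet> x) \<partial>M)" by (rule integral_complex_of_real)
  finally show ?thesis .
qed

lemma norm_levy_second_diff_le: "cmod (levy_second_diff M w z) \<le> (\<integral>x. 1 - cos (w \<bullet> x) \<partial>M)"
  unfolding levy_second_diff_def
proof (rule norm_integral_le_integral[OF integrable_second_diff integrable_one_minus_cos])
  show "cmod (iexp (z \<bullet> x) * complex_of_real (1 - cos (w \<bullet> x))) \<le> 1 - cos (w \<bullet> x)" for x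
    unfolding norm_mult norm_exp_i_times norm_of_real by simp
qed

context
  fixes \<mu> b assumes ID: "is_ID0 M b \<mu>"
begin

text \<open>No logarithm of \<open>cf\<close> is taken. The drift is linear in \<open>z\<close> and
  cancels, and after \<open>exp\<close> the second difference is this quotient, which converges as
  soon as the characteristic functions converge to a limit without zeros.\<close>

lemma exp_second_diff:
  "exp (2 * levy_second_diff M w z) = (cf \<mu> z)\<^sup>2 / (cf \<mu> (z + w) * cf \<mu> (z - w))"
proof -
  define \<psi> where "\<psi> z = \<i> * complex_of_real (b \<bullet> z) + levy_exponent M z" for z
  have cf: "cf \<mu> z = exp (\<psi> z)" for z using ID by (simp add: is_ID0_iff \<psi>_def)
  have "2 * levy_second_diff M w z = \<psi> z + \<psi> z - (\<psi> (z + w) + \<psi> (z - w))"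
    unfolding levy_second_diff_eq \<psi>_def by (simp add: algebra_simps)
  then show ?thesis unfolding cf by (simp only: exp_diff exp_add power2_eq_square)
qed

text \<open>A number within 1/2 of 1 has modulus at least 1/2, so the quotient at
  \<open>z = 0\<close> is at most 4, and \<open>4 \<le> exp 3\<close> by
  \<open>1 + x \<le> exp x\<close>. The value 3 is small enough to stay below pi.\<close>

lemma second_diff_bound:
  assumes "cmod (cf \<mu> w - 1) \<le> 1/2" "cmod (cf \<mu> (- w) - 1) \<le> 1/2"
  shows "2 * (\<integral>x. 1 - cos (w \<bullet> x) \<partial>M) \<le> 3"
proof -
  let ?I = "\<integral>x. 1 - cos (w \<bullet> x) \<partial>M"
  have half: "1/2 \<le> cmod c" if "cmod (c - 1) \<le> 1/2" for c
    using norm_triangle_ineq2[of 1 "1 - c"] that by (simp add: norm_minus_commute)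
  have "cf \<mu> 0 = 1" using ID by (simp add: is_ID0_iff levy_exponent_def levy_kernel_def)
  then have "exp (2 * ?I) = 1 / (cmod (cf \<mu> w) * cmod (cf \<mu> (- w)))"
    using arg_cong[OF exp_second_diff[of w 0], of cmod]
    unfolding levy_second_diff_0 by (simp add: norm_divide norm_mult)
  also have "\<dots> \<le> 1 / (1/2 * (1/2))"
    using half[OF assms(1)] half[OF assms(2)] by (intro divide_left_mono mult_mono mult_pos_pos) auto
  also have "\<dots> \<le> exp (3::real)" using exp_ge_add_one_self[of "3::real"] by simp
  finally show ?thesis by simp
qed

end

end

text \<open>In the disc of radius 3 < pi the principal logarithm inverts \<open>exp\<close>, and
  \<open>exp v\<close> stays off the branch cut, where \<open>Ln\<close> would be
  discontinuous.\<close>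

lemma exp_tendsto_imp_tendsto:
  fixes u :: "nat \<Rightarrow> complex"
  assumes "(\<lambda>n. exp (u n)) \<longlonglongrightarrow> exp v" "\<And>n. cmod (u n) \<le> 3" "cmod v \<le> 3"
  shows "u \<longlonglongrightarrow> v"
proof -
  have Im: "- pi < Im c \<and> Im c < pi" if "cmod c \<le> 3" for c
    using abs_Im_le_cmod[of c] that pi_gt3 by linarith
  have ln: "Ln (exp c) = c" if "cmod c \<le> 3" for c using Im[OF that] by (intro Ln_exp) auto
  have "exp v \<notin> \<real>\<^sub>\<le>\<^sub>0"
  proof
    assume a: "exp v \<in> \<real>\<^sub>\<le>\<^sub>0"
    then have "sin (Im v) = 0" "Re (exp v) \<le> 0" by (auto simp: complex_nonpos_Reals_iff Im_exp)
    moreover have "Im v = 0" using sin_eq_0_pi[of "Im v"] Im[OF assms(3)] \<open>sin (Im v) = 0\<close> by auto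
    ultimately show False by (simp add: Re_exp)
  qed
  then have "(\<lambda>n. Ln (exp (u n))) \<longlonglongrightarrow> Ln (exp v)"
    using assms(1) by (intro isCont_tendsto_compose[where g=Ln]) (auto intro: continuous_at_Ln)
  then show ?thesis using assms by (simp add: ln)
qed

section \<open>The averaged weight and the weighted Levy measure\<close>

definition sinc_gap :: "real \<Rightarrow> real" where
  "sinc_gap x = 1 - sinc x"

lemma continuous_on_sinc_gap [continuous_intros]:
  "continuous_on A f \<Longrightarrow> continuous_on A (\<lambda>x. sinc_gap (f x))"
  unfolding sinc_gap_def by (intro continuous_intros)

lemma sinc_gap_0 [simp]: "sinc_gap 0 = 0"
  by (simp add: sinc_gap_def)

lemma sinc_gap_minus [simp]: "sinc_gap (- x) = sinc_gap x"
  by (simp add: sinc_gap_def)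

lemma sinc_gap_abs: "sinc_gap \<bar>x\<bar> = sinc_gap x"
  by (simp add: abs_if)

lemma sinc_gap_pos: assumes "x \<noteq> 0" shows "0 < sinc_gap x"
proof -
  have "0 < sinc_gap x" if "0 < x" for x :: real
  proof -
    have "sin x < x"
    proof (cases "x \<le> 1")
      case True
      have "(\<lambda>x. x - sin x) 0 < (\<lambda>x. x - sin x) x"
      proof (rule DERIV_pos_imp_increasing_open[OF that])
        fix y :: real assume "0 < y" "y < x"
        then have "cos y < cos 0" using True pi_gt3 by (intro cos_monotone_0_pi) auto
        then show "\<exists>z. ((\<lambda>x. x - sin x) has_real_derivative z) (at y) \<and> 0 < z"
          by (intro exI[of _ "1 - cos y"]) (auto intro!: derivative_eq_intros)
      qed (intro continuous_intros)
      then show ?thesis by simp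
    next
      case False
      then show ?thesis using sin_le_one[of x] by linarith
    qed
    then show ?thesis using that by (simp add: sinc_gap_def)
  qed
  from this[of "\<bar>x\<bar>"] show ?thesis using assms by (simp add: sinc_gap_abs)
qed

lemma sinc_gap_nonneg: "0 \<le> sinc_gap x"
  using sinc_gap_pos[of x] by (cases "x = 0") auto

text \<open>On the compact interval \<open>{s..2}\<close> the positive continuous function has a
  positive minimum; beyond 2 the bound \<open>sin x / x \<le> 1 / 2\<close> takes over.\<close>

lemma sinc_gap_lower_bound:
  assumes "0 < s"
  obtains c where "0 < c" "\<And>x. s \<le> \<bar>x\<bar> \<Longrightarrow> c \<le> sinc_gap x"
proof -
  have "\<exists>c>0. \<forall>x\<in>{s..2}. c \<le> sinc_gap x"
  proof (cases "s \<le> 2")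
    case True
    have "continuous_on {s..2} sinc_gap" using continuous_on_sinc_gap[OF continuous_on_id] .
    then obtain x where "x \<in> {s..2}" "\<forall>y\<in>{s..2}. sinc_gap x \<le> sinc_gap y"
      using continuous_attains_inf[of "{s..2}" sinc_gap] True by auto
    then show ?thesis using sinc_gap_pos[of x] assms by (intro exI[of _ "sinc_gap x"]) auto
  next
    case False then show ?thesis by (intro exI[of _ 1]) auto
  qed
  then obtain c where c: "c > 0" "\<And>x. x \<in> {s..2} \<Longrightarrow> c \<le> sinc_gap x" by blast
  have pos: "min c (1/2) \<le> sinc_gap x" if "s \<le> x" for x
  proof (cases "x \<le> 2")
    case True then show ?thesis using c(2)[of x] that by auto
  next
    case False
    then have "sin x * 2 \<le> x" using sin_le_one[of x] by linarith
    then have "sin x / x \<le> 1 / 2" using False by (simp add: divide_le_eq)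
    then have "1/2 \<le> sinc_gap x" using False by (auto simp: sinc_gap_def)
    then show ?thesis by simp
  qed
  have "min c (1/2) \<le> sinc_gap x" if "s \<le> \<bar>x\<bar>" for x
    using pos[OF that] by (simp only: sinc_gap_abs)
  then show ?thesis using that[of "min c (1/2)"] c(1) by auto
qed

text \<open>The origin of \<open>sinc_gap\<close>: it is the mean of \<open>1 - cos (u * x)\<close>
  over \<open>u\<close> in the unit interval.\<close>

lemma one_minus_cos_integral:
  assumes "0 < \<delta>"
  shows "(\<integral>u. indicator {0..\<delta>} u * (1 - cos (u * y)) \<partial>lborel) = \<delta> * sinc_gap (\<delta> * y)"
proof (cases "y = 0")
  case False
  have "(\<integral>u. (1 - cos (u * y)) * indicator {0..\<delta>} u \<partial>lborel) = (\<delta> - sin (\<delta> * y) / y) - (0 - sin (0 * y) / y)"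
    using assms False by (intro integral_FTC_Icc_real) (auto intro!: derivative_eq_intros continuous_intros)
  then show ?thesis using False assms by (simp add: sinc_gap_def mult.commute right_diff_distrib)
qed simp

text \<open>The integral of \<open>1 - cos (w \<bullet> x)\<close> over the segments
  \<open>w = u *\<^sub>R b\<close> with \<open>0 \<le> u \<le> \<delta>\<close> and \<open>b\<close>
  in the basis. A single axis would give a weight vanishing on a hyperplane; the sum over all axes
  vanishes only at 0 when \<open>0 < \<delta>\<close>, while every integral in \<open>w\<close>
  stays one-dimensional.\<close>

definition levy_weight :: "real \<Rightarrow> 'a::euclidean_space \<Rightarrow> real" where
  "levy_weight \<delta> x = (\<Sum>b\<in>Basis. \<delta> * sinc_gap (\<delta> * (x \<bullet> b)))"

lemma continuous_levy_weight: "continuous_on A (levy_weight \<delta>)"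
  unfolding levy_weight_def by (intro continuous_intros)

lemma borel_measurable_levy_weight [measurable]: "levy_weight \<delta> \<in> borel_measurable borel"
  by (intro borel_measurable_continuous_onI continuous_levy_weight)

lemma levy_weight_lower_bound:
  assumes "0 < \<delta>" "0 < s"
  obtains c where "0 < c" "\<And>x::'a::euclidean_space. s \<le> norm x \<Longrightarrow> c \<le> levy_weight \<delta> x"
proof -
  obtain c where c: "c > 0" "\<And>x. \<delta> * (s / DIM('a)) \<le> \<bar>x\<bar> \<Longrightarrow> c \<le> sinc_gap x"
    using sinc_gap_lower_bound[of "\<delta> * (s / DIM('a))"] assms by auto
  have "\<delta> * c \<le> levy_weight \<delta> x" if x: "s \<le> norm x" for x :: 'a
  proof -
    \<comment> \<open>If every coordinate were below \<open>s / DIM('a)\<close>, the l1 bound on the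
      norm would give \<open>norm x < s\<close>.\<close>
    have "\<exists>b\<in>Basis. s / DIM('a) \<le> \<bar>x \<bullet> b\<bar>"
    proof (rule ccontr)
      assume "\<not> ?thesis"
      then have "(\<Sum>b\<in>Basis. \<bar>x \<bullet> b\<bar>) < (\<Sum>b\<in>(Basis::'a set). s / DIM('a))"
        by (intro sum_strict_mono) (auto simp: not_le)
      also have "\<dots> = s" by simp
      finally show False using norm_le_l1[of x] x by linarith
    qed
    then obtain b where b: "b \<in> Basis" "s / DIM('a) \<le> \<bar>x \<bullet> b\<bar>" by blast
    have "\<delta> * (s / DIM('a)) \<le> \<bar>\<delta> * (x \<bullet> b)\<bar>"
      unfolding abs_mult using b(2) assms(1) by (simp add: mult_left_mono del: times_divide_eq_right)
    then have "\<delta> * c \<le> \<delta> * sinc_gap (\<delta> * (x \<bullet> b))"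
      using assms(1) by (intro mult_left_mono c(2)) auto
    also have "\<dots> \<le> levy_weight \<delta> x"
      unfolding levy_weight_def using b(1) assms(1)
      by (intro member_le_sum mult_nonneg_nonneg sinc_gap_nonneg) auto
    finally show ?thesis .
  qed
  then show ?thesis using that[of "\<delta> * c"] assms(1) c(1) by simp
qed

lemma levy_weight_nonneg: "0 < \<delta> \<Longrightarrow> 0 \<le> levy_weight \<delta> x"
  unfolding levy_weight_def by (intro sum_nonneg mult_nonneg_nonneg sinc_gap_nonneg) auto

definition levy_weighted :: "real \<Rightarrow> 'a::euclidean_space measure \<Rightarrow> 'a measure" where
  "levy_weighted \<delta> M = density M (\<lambda>x. ennreal (levy_weight \<delta> x))"

context levy_measure
begin

text \<open>Fubini in the averaging variable: the Fourier transform of the weighted measure is an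
  integral of second differences over a bounded range of \<open>w\<close>. Bounded convergence of
  the second differences therefore yields convergence of the transforms.\<close>

lemma weight_fubini:
  assumes "0 < \<delta>"
  shows "integrable M (levy_weight \<delta>)"
    and "(CLINT x|M. complex_of_real (levy_weight \<delta> x) * iexp (z \<bullet> x)) =
      (\<Sum>b\<in>Basis. CLINT u|lborel. indicator {0..\<delta>} u *\<^sub>R levy_second_diff M (u *\<^sub>R b) z)"
proof -
  have PS: "pair_sigma_finite (lborel :: real measure) M"
    by (intro pair_sigma_finite.intro sigma_finite_lborel sigma_finite)
  let ?h = "\<lambda>b u x. indicator {0..\<delta>} u *\<^sub>R (iexp (z \<bullet> x) * complex_of_real (1 - cos ((u *\<^sub>R b) \<bullet> x)))"
  have ind: "integrable lborel (indicator {0..\<delta>} :: real \<Rightarrow> real)" by (rule integrable_real_indicator) (use assms in auto)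
  have int: "integrable (lborel \<Otimes>\<^sub>M M) (\<lambda>(u, x). ?h b u x)" if "b \<in> Basis" for b
  proof (rule Bochner_Integration.integrable_bound)
    show "integrable (lborel \<Otimes>\<^sub>M M) (\<lambda>p. indicator {0..\<delta>} (fst p) * ((2 + \<delta>\<^sup>2) * min ((norm (snd p))\<^sup>2) 1))"
      by (rule pair_sigma_finite.integrable_mult_fst_snd[OF PS ind]) (use integrable_min in simp)
    show "AE p in lborel \<Otimes>\<^sub>M M. norm (case p of (u, x) \<Rightarrow> ?h b u x) \<le> norm (indicator {0..\<delta>} (fst p) * ((2 + \<delta>\<^sup>2) * min ((norm (snd p))\<^sup>2) 1))"
    proof (rule AE_I2, clarify)
      fix u x
      have "1 - cos ((u *\<^sub>R b) \<bullet> x) \<le> (2 + \<delta>\<^sup>2) * min ((norm x)\<^sup>2) 1" if u: "u \<in> {0..\<delta>}"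
      proof (rule order_trans[OF one_minus_cos_inner_le mult_right_mono])
        show "2 + (norm (u *\<^sub>R b))\<^sup>2 \<le> 2 + \<delta>\<^sup>2" using u \<open>b \<in> Basis\<close> by (auto intro!: power_mono)
      qed simp
      then show "norm (?h b u x) \<le> norm (indicator {0..\<delta>} (fst (u, x)) * ((2 + \<delta>\<^sup>2) * min ((norm (snd (u, x)))\<^sup>2) 1))"
        by (cases "u \<in> {0..\<delta>}") (auto simp: norm_mult simp del: of_real_diff inner_scaleR_left)
    qed
  qed measurable
  have inner: "(CLINT u|lborel. ?h b u x) = complex_of_real (\<delta> * sinc_gap (\<delta> * (x \<bullet> b))) * iexp (z \<bullet> x)" for b x
  proof -
    have "(CLINT u|lborel. ?h b u x) = (CLINT u|lborel. iexp (z \<bullet> x) * complex_of_real (indicator {0..\<delta>} u * (1 - cos (u * (x \<bullet> b)))))"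
      by (intro Bochner_Integration.integral_cong) (auto simp: scaleR_conv_of_real inner_commute)
    also have "\<dots> = iexp (z \<bullet> x) * (CLINT u|lborel. complex_of_real (indicator {0..\<delta>} u * (1 - cos (u * (x \<bullet> b)))))"
      by (rule integral_mult_right_zero)
    also have "(CLINT u|lborel. complex_of_real (indicator {0..\<delta>} u * (1 - cos (u * (x \<bullet> b))))) = complex_of_real (\<delta> * sinc_gap (\<delta> * (x \<bullet> b)))"
      using one_minus_cos_integral[OF assms, of "x \<bullet> b"] integral_complex_of_real[of lborel "\<lambda>u. indicator {0..\<delta>} u * (1 - cos (u * (x \<bullet> b)))"]
      by (simp only:)
    finally show ?thesis by (simp only: mult.commute)
  qed
  have swap: "(CLINT u|lborel. indicator {0..\<delta>} u *\<^sub>R levy_second_diff M (u *\<^sub>R b) z) =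
      (CLINT x|M. complex_of_real (\<delta> * sinc_gap (\<delta> * (x \<bullet> b))) * iexp (z \<bullet> x))" if "b \<in> Basis" for b
  proof -
    have "(CLINT u|lborel. indicator {0..\<delta>} u *\<^sub>R levy_second_diff M (u *\<^sub>R b) z) = (CLINT u|lborel. CLINT x|M. ?h b u x)"
      unfolding levy_second_diff_def by simp
    also have "\<dots> = (CLINT x|M. CLINT u|lborel. ?h b u x)"
      using pair_sigma_finite.Fubini_integral[OF PS int[OF that]] by simp
    finally show ?thesis unfolding inner .
  qed
  have i1: "complex_integrable M (\<lambda>x. complex_of_real (\<delta> * sinc_gap (\<delta> * (x \<bullet> b))) * iexp (z \<bullet> x))" if "b \<in> Basis" for b
    using pair_sigma_finite.integrable_snd[OF PS int[OF that]] unfolding inner .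
  have "complex_integrable M (\<lambda>x. complex_of_real (levy_weight \<delta> x) * iexp (z \<bullet> x))"
    unfolding levy_weight_def of_real_sum sum_distrib_right using i1 by (intro Bochner_Integration.integrable_sum)
  then have "integrable M (\<lambda>x. norm (complex_of_real (levy_weight \<delta> x) * iexp (z \<bullet> x)))" by (rule integrable_norm)
  then show "integrable M (levy_weight \<delta>)" by (simp add: norm_mult levy_weight_nonneg[OF assms])
  show "(CLINT x|M. complex_of_real (levy_weight \<delta> x) * iexp (z \<bullet> x)) =
      (\<Sum>b\<in>Basis. CLINT u|lborel. indicator {0..\<delta>} u *\<^sub>R levy_second_diff M (u *\<^sub>R b) z)"
    unfolding levy_weight_def of_real_sum sum_distrib_right
    by (subst Bochner_Integration.integral_sum[OF i1]) (simp_all only: swap cong: sum.cong)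
qed

lemma weighted_measure:
  assumes "0 < \<delta>"
  shows "finite_measure (levy_weighted \<delta> M)" "sets (levy_weighted \<delta> M) = sets borel"
    and "cf (levy_weighted \<delta> M) z = (\<Sum>b\<in>Basis. CLINT u|lborel. indicator {0..\<delta>} u *\<^sub>R levy_second_diff M (u *\<^sub>R b) z)"
    and "\<And>f. f \<in> borel_measurable borel \<Longrightarrow> (\<integral>x. f x \<partial>levy_weighted \<delta> M) = (\<integral>x. levy_weight \<delta> x * (f x :: real) \<partial>M)"
proof -
  note meas = measurable_cong_sets[OF sets_M refl]
  have nonneg: "0 \<le> levy_weight \<delta> x" for x :: 'a by (rule levy_weight_nonneg[OF assms(1)])
  show "sets (levy_weighted \<delta> M) = sets borel" by (simp add: levy_weighted_def sets_M)
  show "finite_measure (levy_weighted \<delta> M)"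
  proof
    have "emeasure (levy_weighted \<delta> M) (space (levy_weighted \<delta> M)) = (\<integral>\<^sup>+x. ennreal (levy_weight \<delta> x) \<partial>M)"
      unfolding levy_weighted_def using sets.top[of M] by (simp add: emeasure_density meas)
    then show "emeasure (levy_weighted \<delta> M) (space (levy_weighted \<delta> M)) \<noteq> \<infinity>"
      using weight_fubini(1)[OF assms(1)] by (simp add: integrable_iff_bounded nonneg less_top)
  qed
  show "cf (levy_weighted \<delta> M) z = (\<Sum>b\<in>Basis. CLINT u|lborel. indicator {0..\<delta>} u *\<^sub>R levy_second_diff M (u *\<^sub>R b) z)"
    unfolding weight_fubini(2)[OF assms(1), symmetric] cf_def levy_weighted_def
    by (subst integral_density) (auto simp: nonneg meas scaleR_conv_of_real)
  show "(\<integral>x. f x \<partial>levy_weighted \<delta> M) = (\<integral>x. levy_weight \<delta> x * (f x :: real) \<partial>M)" if "f \<in> borel_measurable borel" for f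
    unfolding levy_weighted_def using that
    by (subst integral_density) (auto simp: nonneg meas)
qed

end

section \<open>Levy measures of weakly convergent infinitely divisible laws\<close>

lemma cf_eq_cos_sin:
  fixes \<mu> :: "'a::euclidean_space measure"
  assumes "finite_measure \<mu>" "sets \<mu> = sets borel"
  shows "cf \<mu> z = complex_of_real (\<integral>x. cos (z \<bullet> x) \<partial>\<mu>) + \<i> * complex_of_real (\<integral>x. sin (z \<bullet> x) \<partial>\<mu>)"
proof -
  have i: "integrable \<mu> (\<lambda>x. cos (z \<bullet> x))" "integrable \<mu> (\<lambda>x. sin (z \<bullet> x))"
    by (rule integrable_finite_bounded[OF assms, where B=1]; simp)+
  have "iexp (z \<bullet> x) = complex_of_real (cos (z \<bullet> x)) + \<i> * complex_of_real (sin (z \<bullet> x))" for x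
    unfolding cis_conv_exp[symmetric] by (simp add: complex_eq_iff)
  then have "cf \<mu> z = (CLINT x|\<mu>. complex_of_real (cos (z \<bullet> x)) + \<i> * complex_of_real (sin (z \<bullet> x)))"
    by (simp only: cf_def)
  also have "\<dots> = (CLINT x|\<mu>. complex_of_real (cos (z \<bullet> x))) + (CLINT x|\<mu>. \<i> * complex_of_real (sin (z \<bullet> x)))"
    using i by (intro Bochner_Integration.integral_add) (simp_all add: complex_of_real_integrable_eq)
  finally show ?thesis by simp
qed

lemma weak_conv_cf_tendsto:
  fixes \<mu> :: "nat \<Rightarrow> 'a::euclidean_space measure"
  assumes fin: "\<And>n. finite_measure (\<mu> n)" "\<And>n. sets (\<mu> n) = sets borel" "finite_measure \<nu>" "sets \<nu> = sets borel"
    and weak: "\<And>f::'a \<Rightarrow> real. continuous_on UNIV f \<Longrightarrow> bounded (range f) \<Longrightarrow> (\<lambda>n. \<integral>x. f x \<partial>\<mu> n) \<longlonglongrightarrow> (\<integral>x. f x \<partial>\<nu>)"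
  shows "(\<lambda>n. cf (\<mu> n) z) \<longlonglongrightarrow> cf \<nu> z"
proof -
  have "(\<lambda>n. \<integral>x. cos (z \<bullet> x) \<partial>\<mu> n) \<longlonglongrightarrow> (\<integral>x. cos (z \<bullet> x) \<partial>\<nu>)" "(\<lambda>n. \<integral>x. sin (z \<bullet> x) \<partial>\<mu> n) \<longlonglongrightarrow> (\<integral>x. sin (z \<bullet> x) \<partial>\<nu>)"
    by (intro weak continuous_intros; auto simp: bounded_iff intro!: exI[of _ 1])+
  then show ?thesis
    unfolding cf_eq_cos_sin[OF fin(1,2)] cf_eq_cos_sin[OF fin(3,4)] by (intro tendsto_intros)
qed

text \<open>The bound is uniform over the ball \<open>norm w \<le> \<delta>\<close>, and its right
  side is the integral of a bounded continuous function. It therefore passes along a weakly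
  convergent sequence and one \<open>\<delta>\<close> works for all large \<open>n\<close>.\<close>

lemma norm_cf_minus_1_le:
  fixes \<mu> :: "'a::euclidean_space measure"
  assumes \<mu>: "prob_space \<mu>" "sets \<mu> = sets borel" and w: "norm w \<le> \<delta>"
  shows "cmod (cf \<mu> w - 1) \<le> (\<integral>x. min 2 (\<delta> * norm x) \<partial>\<mu>)"
proof -
  interpret prob_space \<mu> by fact
  have fin: "finite_measure \<mu>" by (rule prob_space.finite_measure[OF \<mu>(1)])
  have \<delta>: "0 \<le> \<delta>" using w norm_ge_zero order_trans by blast
  have i: "integrable \<mu> (\<lambda>x. iexp (w \<bullet> x))" "integrable \<mu> (\<lambda>x. min 2 (\<delta> * norm x))"
    using \<delta> by (auto intro!: integrable_finite_bounded[OF fin \<mu>(2), where B=1] integrable_finite_bounded[OF fin \<mu>(2), where B=2])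
  have "cf \<mu> w - 1 = (CLINT x|\<mu>. iexp (w \<bullet> x) - 1)"
    unfolding cf_def using i by (subst Bochner_Integration.integral_diff) (auto simp: prob_space)
  also have "cmod \<dots> \<le> (\<integral>x. min 2 (\<delta> * norm x) \<partial>\<mu>)"
  proof (rule norm_integral_le_integral)
    fix x
    have "\<bar>w \<bullet> x\<bar> \<le> \<delta> * norm x"
      using Cauchy_Schwarz_ineq2[of w x] mult_right_mono[OF w norm_ge_zero[of x]] by linarith
    then show "cmod (iexp (w \<bullet> x) - 1) \<le> min 2 (\<delta> * norm x)"
      using norm_iexp_minus_1_le[of "w \<bullet> x"] norm_iexp_minus_1_le_2[of "w \<bullet> x"] by simp
  qed (use i in auto)
  finally show ?thesis .
qed

text \<open>Characteristic functions converge, hence second differences for small \<open>w\<close>,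
  hence the transforms of the weighted measures, hence the weighted measures weakly. A test function
  vanishing near 0 can be divided by the weight, which undoes the weighting; mass collapsing into
  the origin stays invisible.\<close>

theorem ID_weak_limit_levy_measure:
  fixes M :: "nat \<Rightarrow> 'a::euclidean_space measure"
  assumes M: "\<And>n. Mclass 0 (M n)" "Mclass 0 L"
    and ID: "\<And>n. is_ID0 (M n) (\<beta> n) (\<mu> n)" "is_ID0 L \<beta>0 \<nu>"
    and weak: "\<And>f::'a \<Rightarrow> real. continuous_on UNIV f \<Longrightarrow> bounded (range f) \<Longrightarrow> (\<lambda>n. \<integral>x. f x \<partial>\<mu> n) \<longlonglongrightarrow> (\<integral>x. f x \<partial>\<nu>)"
    and g: "continuous_on UNIV g" "\<And>x. \<bar>g x\<bar> \<le> (B::real)" "0 < s" "\<And>x. norm x \<le> s \<Longrightarrow> g x = 0"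
  shows "(\<lambda>n. \<integral>x. g x \<partial>M n) \<longlonglongrightarrow> (\<integral>x. g x \<partial>L)"
proof -
  have prob: "prob_space (\<mu> n)" "sets (\<mu> n) = sets borel" "prob_space \<nu>" "sets \<nu> = sets borel" for n
    using ID by (auto simp: is_ID0_iff)
  have fin: "finite_measure (\<mu> n)" "finite_measure \<nu>" for n
    using prob by (auto intro: prob_space.finite_measure)
  have LM: "levy_measure (M n)" "levy_measure L" for n using M by (auto intro: levy_measure.intro)
  have cfc: "(\<lambda>n. cf (\<mu> n) z) \<longlonglongrightarrow> cf \<nu> z" for z
    by (rule weak_conv_cf_tendsto[OF fin(1) prob(2) fin(2) prob(4) weak])
  \<comment> \<open>\<open>\<delta>\<close> is chosen from the limit law alone; weak convergence
    then carries the strict inequality over to all \<open>n \<ge> N\<close>.\<close>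
  have "(\<lambda>m. \<integral>x. min 2 (inverse (real (Suc m)) * norm x) \<partial>\<nu>) \<longlonglongrightarrow> (\<integral>x. 0 \<partial>\<nu>)"
  proof (rule integral_dominated_convergence[where w="\<lambda>_. 2"])
    show "integrable \<nu> (\<lambda>_. 2::real)" using fin(2) by (simp add: finite_measure.integrable_const)
    show "AE x in \<nu>. (\<lambda>m. min 2 (inverse (real (Suc m)) * norm x)) \<longlonglongrightarrow> 0"
    proof (rule AE_I2)
      fix x :: 'a
      have "(\<lambda>m. min 2 (inverse (real (Suc m)) * norm x)) \<longlonglongrightarrow> min 2 (0 * norm x)"
        by (intro tendsto_intros LIMSEQ_inverse_real_of_nat)
      then show "(\<lambda>m. min 2 (inverse (real (Suc m)) * norm x)) \<longlonglongrightarrow> 0" by simp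
    qed
  qed (auto simp: measurable_cong_sets[OF prob(4) refl])
  then have "(\<lambda>m. \<integral>x. min 2 (inverse (real (Suc m)) * norm x) \<partial>\<nu>) \<longlonglongrightarrow> 0" by simp
  from order_tendstoD(2)[OF this, of "1/2"] obtain m where m: "(\<integral>x. min 2 (inverse (real (Suc m)) * norm x) \<partial>\<nu>) < 1/2"
    by (auto simp: eventually_sequentially)
  define \<delta> where "\<delta> = inverse (real (Suc m))"
  have \<delta>: "0 < \<delta>" "(\<integral>x. min 2 (\<delta> * norm x) \<partial>\<nu>) < 1/2" using m by (simp_all add: \<delta>_def)
  have "(\<lambda>n. \<integral>x. min 2 (\<delta> * norm x) \<partial>\<mu> n) \<longlonglongrightarrow> (\<integral>x. min 2 (\<delta> * norm x) \<partial>\<nu>)"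
    using \<delta>(1) by (intro weak continuous_intros) (auto simp: bounded_iff intro!: exI[of _ 2])
  from order_tendstoD(2)[OF this \<delta>(2)] obtain N where N: "\<And>n. n \<ge> N \<Longrightarrow> (\<integral>x. min 2 (\<delta> * norm x) \<partial>\<mu> n) < 1/2"
    by (auto simp: eventually_sequentially)
  have small: "2 * (\<integral>x. 1 - cos (w \<bullet> x) \<partial>M (n + N)) \<le> 3" "2 * (\<integral>x. 1 - cos (w \<bullet> x) \<partial>L) \<le> 3" if w: "norm w \<le> \<delta>" for w n
  proof -
    have w': "norm (- w) \<le> \<delta>" using w by simp
    show "2 * (\<integral>x. 1 - cos (w \<bullet> x) \<partial>M (n + N)) \<le> 3"
      using N[of "n + N"] norm_cf_minus_1_le[OF prob(1,2) w, of "n + N"] norm_cf_minus_1_le[OF prob(1,2) w', of "n + N"]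
      by (intro levy_measure.second_diff_bound[OF LM(1) ID(1)]) auto
    show "2 * (\<integral>x. 1 - cos (w \<bullet> x) \<partial>L) \<le> 3"
      using \<delta>(2) norm_cf_minus_1_le[OF prob(3,4) w] norm_cf_minus_1_le[OF prob(3,4) w']
      by (intro levy_measure.second_diff_bound[OF LM(2) ID(2)]) auto
  qed
  \<comment> \<open>The bound from \<open>small\<close> places twice the second difference in the
    disc of radius 3, where convergence of exponentials implies convergence.\<close>
  have sd: "(\<lambda>n. levy_second_diff (M (n + N)) w z) \<longlonglongrightarrow> levy_second_diff L w z" if w: "norm w \<le> \<delta>" for w z
  proof -
    have nz: "cf \<nu> z \<noteq> 0" for z using ID(2) by (simp add: is_ID0_iff)
    have "(\<lambda>n. 2 * levy_second_diff (M (n + N)) w z) \<longlonglongrightarrow> 2 * levy_second_diff L w z"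
    proof (rule exp_tendsto_imp_tendsto)
      show "(\<lambda>n. exp (2 * levy_second_diff (M (n + N)) w z)) \<longlonglongrightarrow> exp (2 * levy_second_diff L w z)"
        unfolding levy_measure.exp_second_diff[OF LM(1) ID(1)] levy_measure.exp_second_diff[OF LM(2) ID(2)]
        using nz by (intro tendsto_intros LIMSEQ_ignore_initial_segment[OF cfc]) auto
      show "cmod (2 * levy_second_diff (M (n + N)) w z) \<le> 3" for n
        using levy_measure.norm_levy_second_diff_le[OF LM(1), of "n + N" w z] small(1)[OF w, of n] by (simp add: norm_mult)
      show "cmod (2 * levy_second_diff L w z) \<le> 3"
        using levy_measure.norm_levy_second_diff_le[OF LM(2), of w z] small(2)[OF w] by (simp add: norm_mult)
    qed
    then have "(\<lambda>n. 2 * levy_second_diff (M (n + N)) w z / 2) \<longlonglongrightarrow> 2 * levy_second_diff L w z / 2"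
      by (intro tendsto_intros) auto
    then show ?thesis by simp
  qed
  \<comment> \<open>Measurability in \<open>u\<close> is read off the continuous exponent through
    the second-difference identity.\<close>
  have sdm: "(\<lambda>u. levy_second_diff K (u *\<^sub>R b) z) \<in> borel_measurable borel" if "levy_measure K" for K :: "'a measure" and b z
  proof -
    have "levy_second_diff K (u *\<^sub>R b) z = (2 * levy_exponent K z - levy_exponent K (z + u *\<^sub>R b) - levy_exponent K (z - u *\<^sub>R b)) / 2" for u
      unfolding levy_measure.levy_second_diff_eq[OF that, symmetric] by simp
    moreover have "continuous_on UNIV (\<lambda>u::real. (2 * levy_exponent K z - levy_exponent K (z + u *\<^sub>R b) - levy_exponent K (z - u *\<^sub>R b)) / 2)"
      by (intro continuous_intros continuous_on_compose2[OF levy_measure.continuous_levy_exponent[OF that]]) auto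
    ultimately show ?thesis by (simp only: borel_measurable_continuous_onI)
  qed
  note W = levy_measure.weighted_measure[OF _ \<delta>(1)]
  have cfW: "(\<lambda>n. cf (levy_weighted \<delta> (M (n + N))) z) \<longlonglongrightarrow> cf (levy_weighted \<delta> L) z" for z
    unfolding W(3)[OF LM(1)] W(3)[OF LM(2)]
  proof (intro tendsto_sum)
    fix b :: 'a assume b: "b \<in> Basis"
    note [measurable] = sdm[OF LM(1)] sdm[OF LM(2)]
    have le: "norm (indicator {0..\<delta>} u *\<^sub>R levy_second_diff (M (n + N)) (u *\<^sub>R b) z) \<le> 3 / 2 * indicator {0..\<delta>} u" for n u
    proof (cases "u \<in> {0..\<delta>}")
      case True
      then have "norm (u *\<^sub>R b) \<le> \<delta>" using b by simp
      then show ?thesis using True small(1)[of "u *\<^sub>R b" n] levy_measure.norm_levy_second_diff_le[OF LM(1), of "n + N" "u *\<^sub>R b" z] by simp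
    qed simp
    show "(\<lambda>n. CLINT u|lborel. indicator {0..\<delta>} u *\<^sub>R levy_second_diff (M (n + N)) (u *\<^sub>R b) z) \<longlonglongrightarrow>
        (CLINT u|lborel. indicator {0..\<delta>} u *\<^sub>R levy_second_diff L (u *\<^sub>R b) z)"
    proof (rule integral_dominated_convergence[where w="\<lambda>u. 3 / 2 * indicator {0..\<delta>} u"])
      have "integrable lborel (indicator {0..\<delta>} :: real \<Rightarrow> real)" by (rule integrable_real_indicator) (use \<delta> in auto)
      then show "integrable lborel (\<lambda>u. 3 / 2 * indicator {0..\<delta>} u :: real)" by (intro integrable_mult_right)
      show "AE u in lborel. (\<lambda>n. indicator {0..\<delta>} u *\<^sub>R levy_second_diff (M (n + N)) (u *\<^sub>R b) z) \<longlonglongrightarrow> indicator {0..\<delta>} u *\<^sub>R levy_second_diff L (u *\<^sub>R b) z"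
      proof (rule AE_I2)
        fix u
        show "(\<lambda>n. indicator {0..\<delta>} u *\<^sub>R levy_second_diff (M (n + N)) (u *\<^sub>R b) z) \<longlonglongrightarrow> indicator {0..\<delta>} u *\<^sub>R levy_second_diff L (u *\<^sub>R b) z"
          using b by (cases "u \<in> {0..\<delta>}") (auto intro!: tendsto_intros sd)
      qed
      show "AE u in lborel. norm (indicator {0..\<delta>} u *\<^sub>R levy_second_diff (M (n + N)) (u *\<^sub>R b) z) \<le> 3 / 2 * indicator {0..\<delta>} u" for n
        by (rule AE_I2) (rule le)
    qed measurable
  qed
  obtain c where c: "c > 0" "\<And>x::'a. s \<le> norm x \<Longrightarrow> c \<le> levy_weight \<delta> x"
    using levy_weight_lower_bound[OF \<delta>(1) g(3)] by blast
  \<comment> \<open>The quotient of \<open>g\<close> by the weight. Off 0 the weight is continuous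
    and positive, inside the ball of radius \<open>s\<close> the quotient is 0, and these two open
    sets cover the space.\<close>
  define f where "f x = (if x = 0 then 0 else g x / levy_weight \<delta> x)" for x
  have wpos: "0 < levy_weight \<delta> x" if "x \<noteq> 0" for x :: 'a
    using levy_weight_lower_bound[OF \<delta>(1), of "norm x"] that by (metis order.refl order_less_le_trans zero_less_norm_iff)
  have fc: "continuous_on UNIV f"
  proof -
    have "continuous_on (- {0} \<union> ball 0 s) f"
    proof (rule continuous_on_open_Un)
      have "continuous_on (- {0}) (\<lambda>x. g x / levy_weight \<delta> x)"
        using wpos by (intro continuous_intros continuous_levy_weight continuous_on_subset[OF g(1)]) (auto, metis less_irrefl)
      then show "continuous_on (- {0}) f" by (rule continuous_on_eq) (auto simp: f_def)
      show "continuous_on (ball 0 s) f"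
        by (rule continuous_on_eq[OF continuous_on_const[of _ 0]]) (auto simp: f_def g(4))
    qed auto
    moreover have "- {0} \<union> ball (0::'a) s = UNIV" using g(3) by auto
    ultimately show ?thesis by simp
  qed
  have fb: "\<bar>f x\<bar> \<le> B / c" for x
  proof -
    have B: "0 \<le> B" using g(2)[of 0] by linarith
    show ?thesis
    proof (cases "norm x \<le> s")
      case True then show ?thesis using g(4)[of x] B c(1) by (simp add: f_def)
    next
      case False
      then show ?thesis using g(2)[of x] c B by (auto simp: f_def intro!: frac_le order_trans[OF _ abs_ge_self])
    qed
  qed
  have fg: "levy_weight \<delta> x * f x = g x" for x
    using wpos[of x] g(3) g(4)[of 0] by (auto simp: f_def)
  have fm: "f \<in> borel_measurable borel" using fc by (rule borel_measurable_continuous_onI)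
  have "(\<lambda>n. \<integral>x. f x \<partial>levy_weighted \<delta> (M (n + N))) \<longlonglongrightarrow> (\<integral>x. f x \<partial>levy_weighted \<delta> L)"
    by (rule levy_continuity_euclidean[OF W(1)[OF LM(1)] W(2)[OF LM(1)] W(1)[OF LM(2)] W(2)[OF LM(2)] cfW fc fb])
  then have "(\<lambda>n. \<integral>x. g x \<partial>M (n + N)) \<longlonglongrightarrow> (\<integral>x. g x \<partial>L)"
    unfolding W(4)[OF LM(1) fm] W(4)[OF LM(2) fm] fg .
  then show ?thesis by (rule LIMSEQ_offset)
qed

subsection \<open>Stable and tempered stable Levy measures\<close>

text \<open>An image measure, hence countably additive by construction. The
  \<open>measure_of\<close> definitions of \<open>TS_levy\<close> and \<open>stable_levy\<close> are
  identified with it below, which certifies that their set functions really are measures.\<close>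

definition radial_mixture :: "(real \<Rightarrow> real) \<Rightarrow> 'a::euclidean_space measure \<Rightarrow> 'a measure" where
  "radial_mixture w R = distr (R \<Otimes>\<^sub>M density lborel (\<lambda>t. ennreal (w t) * indicator {0<..} t)) borel (\<lambda>(x, t). t *\<^sub>R x)"

lemma sets_radial_mixture [simp, measurable_cong]: "sets (radial_mixture w R) = sets borel"
  by (simp add: radial_mixture_def)

lemma nn_integral_radial_mixture:
  fixes R :: "'a::euclidean_space measure"
  assumes R: "sets R = sets borel" and w: "w \<in> borel_measurable borel" and f: "f \<in> borel_measurable borel"
  shows "(\<integral>\<^sup>+y. f y \<partial>radial_mixture w R) = (\<integral>\<^sup>+x. (\<integral>\<^sup>+t\<in>{0<..}. f (t *\<^sub>R x) * ennreal (w t) \<partial>lborel) \<partial>R)"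
proof -
  note [measurable_cong] = R and [measurable] = w f
  let ?N = "density lborel (\<lambda>t. ennreal (w t) * indicator {0<..} t)"
  have sf: "sigma_finite_measure ?N"
    by (subst sigma_finite_measure.sigma_finite_iff_density_finite[OF sigma_finite_lborel]) (auto simp: ennreal_mult_eq_top_iff indicator_def)
  have m: "(\<lambda>(x, t). t *\<^sub>R x) \<in> borel_measurable (R \<Otimes>\<^sub>M ?N)" by measurable
  have "(\<integral>\<^sup>+y. f y \<partial>radial_mixture w R) = (\<integral>\<^sup>+p. f (snd p *\<^sub>R fst p) \<partial>(R \<Otimes>\<^sub>M ?N))"
    unfolding radial_mixture_def by (subst nn_integral_distr[OF m]) (auto simp: case_prod_beta')
  also have "\<dots> = (\<integral>\<^sup>+x. (\<integral>\<^sup>+t. f (t *\<^sub>R x) \<partial>?N) \<partial>R)"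
    by (subst sigma_finite_measure.nn_integral_fst[OF sf, symmetric]) auto
  also have "\<dots> = (\<integral>\<^sup>+x. (\<integral>\<^sup>+t\<in>{0<..}. f (t *\<^sub>R x) * ennreal (w t) \<partial>lborel) \<partial>R)"
    by (intro nn_integral_cong, subst nn_integral_density) (auto simp: mult_ac)
  finally show ?thesis .
qed

lemma emeasure_radial_mixture:
  fixes R :: "'a::euclidean_space measure"
  assumes R: "sets R = sets borel" and w: "w \<in> borel_measurable borel" and A: "A \<in> sets borel"
  shows "emeasure (radial_mixture w R) A = (\<integral>\<^sup>+x. (\<integral>\<^sup>+t\<in>{0<..}. indicator A (t *\<^sub>R x) * ennreal (w t) \<partial>lborel) \<partial>R)"
  using nn_integral_radial_mixture[OF R w, of "indicator A"] A by (simp add: nn_integral_indicator)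

lemma TS_levy_eq_radial_mixture:
  assumes "sets R = sets borel"
  shows "TS_levy p \<alpha> R = radial_mixture (\<lambda>t. t powr (-1 - \<alpha>) * exp (- (t powr p))) R"
proof -
  have "TS_levy p \<alpha> R = measure_of UNIV (sets borel) (emeasure (radial_mixture (\<lambda>t. t powr (-1 - \<alpha>) * exp (- (t powr p))) R))"
    unfolding TS_levy_def
    by (rule measure_of_eq) (auto simp: sets.sigma_sets_eq[of borel, simplified] emeasure_radial_mixture[OF assms])
  also have "\<dots> = radial_mixture (\<lambda>t. t powr (-1 - \<alpha>) * exp (- (t powr p))) R"
    using measure_of_of_measure[of "radial_mixture (\<lambda>t. t powr (-1 - \<alpha>) * exp (- (t powr p))) R"]
    by (simp add: radial_mixture_def)
  finally show ?thesis .
qed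

lemma sphere_measure_AE:
  assumes "sphere_measure \<sigma>"
  shows "AE u in \<sigma>. u \<in> sphere 0 1"
  using assms by (intro AE_I[of _ _ "UNIV - sphere 0 1"]) (auto simp: sphere_measure_def)

lemma stable_levy_eq_radial_mixture:
  assumes "sphere_measure \<sigma>"
  shows "stable_levy \<eta> \<sigma> = radial_mixture (\<lambda>t. t powr (-1 - \<eta>)) \<sigma>"
proof -
  have s: "sets \<sigma> = sets borel" using assms by (simp add: sphere_measure_def)
  \<comment> \<open>\<open>\<sigma>\<close> lives on the sphere, so restricting the integral to the
    sphere changes nothing.\<close>
  have eq: "(\<integral>\<^sup>+ u\<in>sphere 0 1. g u \<partial>\<sigma>) = (\<integral>\<^sup>+ u. g u \<partial>\<sigma>)" for g
    using sphere_measure_AE[OF assms] by (intro nn_integral_cong_AE) (auto simp del: mem_sphere_0)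
  have "stable_levy \<eta> \<sigma> = measure_of UNIV (sets borel) (emeasure (radial_mixture (\<lambda>t. t powr (-1 - \<eta>)) \<sigma>))"
    unfolding stable_levy_def eq
    by (rule measure_of_eq) (auto simp: sets.sigma_sets_eq[of borel, simplified] emeasure_radial_mixture[OF s])
  also have "\<dots> = radial_mixture (\<lambda>t. t powr (-1 - \<eta>)) \<sigma>"
    using measure_of_of_measure[of "radial_mixture (\<lambda>t. t powr (-1 - \<eta>)) \<sigma>"]
    by (simp add: radial_mixture_def)
  finally show ?thesis .
qed

lemma nn_integral_powr_Ioi:
  assumes "0 < \<eta>" "0 < s"
  shows "(\<integral>\<^sup>+t. ennreal (t powr (-1 - \<eta>)) * indicator {s<..} t \<partial>lborel) = ennreal (s powr (-\<eta>) / \<eta>)"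
proof -
  have "(\<integral>\<^sup>+t. ennreal (t powr (-1 - \<eta>)) * indicator {s<..} t \<partial>lborel) = (\<integral>\<^sup>+t. ennreal (t powr (-1 - \<eta>)) * indicator {s..} t \<partial>lborel)"
    using AE_lborel_singleton[of s] by (intro nn_integral_cong_AE) (auto simp: indicator_def)
  also have "\<dots> = ennreal (s powr (-\<eta>) / \<eta>)"
    using has_integral_powr_to_inf[of "-1 - \<eta>" s] assms
    by (intro nn_integral_has_integral_lebesgue') auto
  finally show ?thesis .
qed

lemma nn_integral_powr_Ioc:
  assumes "\<alpha> > -1" "0 \<le> s"
  shows "(\<integral>\<^sup>+t. ennreal (t powr \<alpha>) * indicator {0<..s} t \<partial>lborel) = ennreal (s powr (\<alpha> + 1) / (\<alpha> + 1))"
proof -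
  have "(\<integral>\<^sup>+t. ennreal (t powr \<alpha>) * indicator {0<..s} t \<partial>lborel) = (\<integral>\<^sup>+t. ennreal (t powr \<alpha>) * indicator {0..s} t \<partial>lborel)"
    using AE_lborel_singleton[of 0] by (intro nn_integral_cong_AE) (auto simp: indicator_def)
  also have "\<dots> = ennreal (s powr (\<alpha> + 1) / (\<alpha> + 1))"
    using has_integral_powr_from_0[OF assms] assms
    by (intro nn_integral_has_integral_lebesgue') auto
  finally show ?thesis .
qed

section \<open>Polar tails, the stable Levy measure and continuity sets of directions\<close>

definition polar_tail :: "real \<Rightarrow> 'a::euclidean_space set \<Rightarrow> 'a set" where
  "polar_tail s D = {x. norm x > s \<and> sgn x \<in> D}"

lemma borel_measurable_sgn [measurable]: "(sgn :: 'a::euclidean_space \<Rightarrow> 'a) \<in> borel_measurable borel"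
  unfolding sgn_div_norm[abs_def] by measurable

lemma sets_polar_tail [measurable]: "D \<in> sets borel \<Longrightarrow> polar_tail s D \<in> sets borel"
  using sets.Int[of "{x. norm x > s}" borel "sgn -` D"] measurable_sets[OF borel_measurable_sgn, of D]
  by (simp add: polar_tail_def vimage_def Collect_conj_eq)

lemma polar_tail_subset: "polar_tail s D \<subseteq> {x. norm x > s}"
  by (auto simp: polar_tail_def)

lemma polar_tail_sphere: "0 \<le> s \<Longrightarrow> polar_tail s (sphere 0 1) = {x. norm x > s}"
  by (auto simp: polar_tail_def norm_sgn)

lemma polar_tail_antimono: "s \<le> s' \<Longrightarrow> polar_tail s' D \<subseteq> polar_tail s D"
  by (auto simp: polar_tail_def)

lemma scaleR_mem_polar_tail:
  "0 < t \<Longrightarrow> t *\<^sub>R x \<in> polar_tail s D \<longleftrightarrow> x \<in> polar_tail (s / t) D"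
  by (auto simp: polar_tail_def sgn_scaleR field_simps)

lemma emeasure_stable_levy_polar_tail:
  fixes \<sigma> :: "'a::euclidean_space measure"
  assumes \<sigma>: "sphere_measure \<sigma>" and "0 < \<eta>" "0 < s" and D: "D \<in> sets borel"
  shows "emeasure (stable_levy \<eta> \<sigma>) (polar_tail s D) = emeasure \<sigma> D * ennreal (s powr (-\<eta>) / \<eta>)"
proof -
  have S: "sets \<sigma> = sets borel" using \<sigma> by (simp add: sphere_measure_def)
  have "emeasure (stable_levy \<eta> \<sigma>) (polar_tail s D) = (\<integral>\<^sup>+u. (\<integral>\<^sup>+t\<in>{0<..}. indicator (polar_tail s D) (t *\<^sub>R u) * ennreal (t powr (-1 - \<eta>)) \<partial>lborel) \<partial>\<sigma>)"
    unfolding stable_levy_eq_radial_mixture[OF \<sigma>] using D by (intro emeasure_radial_mixture[OF S]) auto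
  also have "\<dots> = (\<integral>\<^sup>+u. indicator D u * ennreal (s powr (-\<eta>) / \<eta>) \<partial>\<sigma>)"
  proof (intro nn_integral_cong_AE)
    show "AE u in \<sigma>. (\<integral>\<^sup>+t\<in>{0<..}. indicator (polar_tail s D) (t *\<^sub>R u) * ennreal (t powr (-1 - \<eta>)) \<partial>lborel) = indicator D u * ennreal (s powr (-\<eta>) / \<eta>)"
      using sphere_measure_AE[OF \<sigma>]
    proof eventually_elim
      case (elim u)
      then have u: "norm u = 1" "sgn u = u" by (auto simp: sgn_div_norm)
      have "(\<integral>\<^sup>+t\<in>{0<..}. indicator (polar_tail s D) (t *\<^sub>R u) * ennreal (t powr (-1 - \<eta>)) \<partial>lborel) =
          (\<integral>\<^sup>+t. indicator D u * (ennreal (t powr (-1 - \<eta>)) * indicator {s<..} t) \<partial>lborel)"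
        using u \<open>0 < s\<close> by (intro nn_integral_cong) (auto simp: indicator_def polar_tail_def sgn_scaleR)
      also have "\<dots> = indicator D u * ennreal (s powr (-\<eta>) / \<eta>)"
        using assms by (subst nn_integral_cmult) (auto simp: nn_integral_powr_Ioi)
      finally show ?case .
    qed
  qed
  also have "\<dots> = emeasure \<sigma> D * ennreal (s powr (-\<eta>) / \<eta>)"
    using D S by (simp add: nn_integral_multc)
  finally show ?thesis .
qed

lemma measure_stable_levy_polar_tail:
  fixes \<sigma> :: "'a::euclidean_space measure"
  assumes \<sigma>: "sphere_measure \<sigma>" and "0 < \<eta>" "0 < s" and D: "D \<in> sets borel"
  shows "measure (stable_levy \<eta> \<sigma>) (polar_tail s D) = measure \<sigma> D * s powr (-\<eta>) / \<eta>"
  using emeasure_stable_levy_polar_tail[OF assms] \<open>0 < \<eta>\<close>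
  by (simp add: measure_def enn2real_mult)

text \<open>Split at \<open>t = 1\<close>: below, the integrand is at most
  \<open>t powr (1 - \<eta>)\<close>, integrable as \<open>\<eta> < 2\<close>; above, it is at most
  \<open>t powr (-1 - \<eta>)\<close>, integrable as \<open>0 < \<eta>\<close>.\<close>

lemma Mclass_stable_levy:
  fixes \<sigma> :: "'a::euclidean_space measure"
  assumes \<sigma>: "sphere_measure \<sigma>" and \<eta>: "0 < \<eta>" "\<eta> < 2"
  shows "Mclass 0 (stable_levy \<eta> \<sigma>)"
proof -
  have S: "sets \<sigma> = sets borel" using \<sigma> by (simp add: sphere_measure_def)
  have fin: "emeasure \<sigma> (space \<sigma>) < \<infinity>" using finite_measure.emeasure_finite[of \<sigma> "space \<sigma>"] \<sigma> by (simp add: sphere_measure_def less_top)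
  have sets: "sets (stable_levy \<eta> \<sigma>) = sets borel" by (simp add: stable_levy_eq_radial_mixture[OF \<sigma>])
  have "emeasure (stable_levy \<eta> \<sigma>) {0} = (\<integral>\<^sup>+u. (\<integral>\<^sup>+t\<in>{0<..}. indicator {0} (t *\<^sub>R u) * ennreal (t powr (-1 - \<eta>)) \<partial>lborel) \<partial>\<sigma>)"
    unfolding stable_levy_eq_radial_mixture[OF \<sigma>] by (intro emeasure_radial_mixture[OF S]) auto
  also have "\<dots> = (\<integral>\<^sup>+u. 0 \<partial>\<sigma>)"
  proof (intro nn_integral_cong_AE)
    show "AE u in \<sigma>. (\<integral>\<^sup>+t\<in>{0<..}. indicator {0} (t *\<^sub>R u) * ennreal (t powr (-1 - \<eta>)) \<partial>lborel) = 0"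
      using sphere_measure_AE[OF \<sigma>]
    proof eventually_elim
      case (elim u)
      then have "indicator {0} (t *\<^sub>R u) * ennreal (t powr (-1 - \<eta>)) * indicator {0<..} t = 0" for t
        by (auto simp: indicator_def)
      then show ?case by (simp only: nn_integral_const) simp
    qed
  qed
  finally have 0: "emeasure (stable_levy \<eta> \<sigma>) {0} = 0" by simp
  have "(\<integral>\<^sup>+ x. ennreal (min ((norm x)\<^sup>2) 1) \<partial>stable_levy \<eta> \<sigma>) =
      (\<integral>\<^sup>+u. (\<integral>\<^sup>+t\<in>{0<..}. ennreal (min ((norm (t *\<^sub>R u))\<^sup>2) 1) * ennreal (t powr (-1 - \<eta>)) \<partial>lborel) \<partial>\<sigma>)"
    unfolding stable_levy_eq_radial_mixture[OF \<sigma>] by (intro nn_integral_radial_mixture[OF S]) auto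
  also have "\<dots> \<le> (\<integral>\<^sup>+u. ennreal (1 / (2 - \<eta>)) + ennreal (1 / \<eta>) \<partial>\<sigma>)"
  proof (intro nn_integral_mono_AE)
    show "AE u in \<sigma>. (\<integral>\<^sup>+t\<in>{0<..}. ennreal (min ((norm (t *\<^sub>R u))\<^sup>2) 1) * ennreal (t powr (-1 - \<eta>)) \<partial>lborel) \<le> ennreal (1 / (2 - \<eta>)) + ennreal (1 / \<eta>)"
      using sphere_measure_AE[OF \<sigma>]
    proof eventually_elim
      case (elim u)
      then have u: "norm u = 1" by auto
      have "(\<integral>\<^sup>+t\<in>{0<..}. ennreal (min ((norm (t *\<^sub>R u))\<^sup>2) 1) * ennreal (t powr (-1 - \<eta>)) \<partial>lborel)
          \<le> (\<integral>\<^sup>+t. ennreal (t powr (1 - \<eta>)) * indicator {0<..1} t + ennreal (t powr (-1 - \<eta>)) * indicator {1<..} t \<partial>lborel)"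
      proof (intro nn_integral_mono)
        fix t :: real
        have "min ((norm (t *\<^sub>R u))\<^sup>2) 1 * t powr (-1 - \<eta>) \<le> t powr (1 - \<eta>)" if "0 < t"
        proof -
          have "min ((norm (t *\<^sub>R u))\<^sup>2) 1 * t powr (-1 - \<eta>) \<le> t\<^sup>2 * t powr (-1 - \<eta>)"
            using u by (intro mult_right_mono) auto
          also have "\<dots> = t powr (1 - \<eta>)"
            using that by (simp add: powr_numeral[symmetric] powr_add[symmetric] del: powr_numeral)
          finally show ?thesis .
        qed
        moreover have "min ((norm (t *\<^sub>R u))\<^sup>2) 1 * t powr (-1 - \<eta>) \<le> 1 * t powr (-1 - \<eta>)"
          by (intro mult_right_mono) auto
        ultimately show "ennreal (min ((norm (t *\<^sub>R u))\<^sup>2) 1) * ennreal (t powr (-1 - \<eta>)) * indicator {0<..} t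
          \<le> ennreal (t powr (1 - \<eta>)) * indicator {0<..1} t + ennreal (t powr (-1 - \<eta>)) * indicator {1<..} t"
          by (cases "t \<le> 1") (auto simp: indicator_def ennreal_mult[symmetric] intro!: ennreal_leI)
      qed
      also have "\<dots> = ennreal (1 / (2 - \<eta>)) + ennreal (1 / \<eta>)"
        using nn_integral_powr_Ioc[of "1 - \<eta>" 1] nn_integral_powr_Ioi[of \<eta> 1] \<eta> by (subst nn_integral_add) auto
      finally show ?case .
    qed
  qed
  also have "\<dots> = (ennreal (1 / (2 - \<eta>)) + ennreal (1 / \<eta>)) * emeasure \<sigma> (space \<sigma>)" by (rule nn_integral_const)
  also have "\<dots> < \<infinity>" using fin by (simp add: ennreal_mult_less_top)
  finally show ?thesis using sets 0 by (simp add: Mclass_0_iff)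
qed

definition sphere_cont_set :: "'a::euclidean_space measure \<Rightarrow> 'a set \<Rightarrow> bool" where
  "sphere_cont_set \<sigma> D \<longleftrightarrow> D \<in> sets borel \<and> D \<subseteq> sphere 0 1 \<and>
     emeasure \<sigma> (closure D \<inter> closure (sphere 0 1 - D)) = 0"

lemma sphere_cont_set_sphere: "sphere_cont_set \<sigma> (sphere 0 1)"
  by (simp add: sphere_cont_set_def)

lemma sphere_cont_set_compl: "sphere_cont_set \<sigma> D \<Longrightarrow> sphere_cont_set \<sigma> (sphere 0 1 - D)"
  by (auto simp: sphere_cont_set_def double_diff Int_commute)

text \<open>The sphere is closed and so contains \<open>closure D\<close>; hence
  \<open>closure D - D\<close> lies in the relative boundary, which is null.\<close>

lemma emeasure_closure_sphere_cont_set: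
  assumes \<sigma>: "sphere_measure \<sigma>" and D: "sphere_cont_set \<sigma> D"
  shows "measure \<sigma> (closure D) = measure \<sigma> D"
proof -
  have S: "sets \<sigma> = sets borel" and fin: "finite_measure \<sigma>" using \<sigma> by (simp_all add: sphere_measure_def)
  have Dm: "D \<in> sets borel" "D \<subseteq> sphere 0 1" and null: "emeasure \<sigma> (closure D \<inter> closure (sphere 0 1 - D)) = 0"
    using D by (auto simp: sphere_cont_set_def)
  have "closure D \<subseteq> sphere 0 1" using Dm(2) by (intro closure_minimal) auto
  then have "closure D - D \<subseteq> closure D \<inter> closure (sphere 0 1 - D)"
    using closure_subset[of "sphere 0 1 - D"] by blast
  then have "emeasure \<sigma> (closure D - D) \<le> 0"
    unfolding null[symmetric] by (intro emeasure_mono) (auto simp: S)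
  then have "closure D - D \<in> null_sets \<sigma>" using Dm S by auto
  then have "emeasure \<sigma> (D \<union> (closure D - D)) = emeasure \<sigma> D"
    using Dm S by (intro emeasure_Un_null_set) auto
  moreover have "D \<union> (closure D - D) = closure D" using closure_subset[of D] by blast
  ultimately show ?thesis by (simp add: measure_def)
qed

context levy_measure
begin

lemma integrable_indicator_away:
  assumes "A \<in> sets borel" "0 < s" "A \<subseteq> {x. norm x > s}"
  shows "integrable M (indicator A :: 'a \<Rightarrow> real)"
  using emeasure_finite_away[OF assms(2,3)] assms(1) by (intro integrable_real_indicator) (auto simp: sets_M)

lemma measure_mono_away:
  assumes "B \<in> sets borel" "A \<in> sets borel" "0 < s" "B \<subseteq> {x. norm x > s}" "A \<subseteq> B"
  shows "measure M A \<le> measure M B"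
  using emeasure_finite_away[OF assms(3,4)] assms(1,2,5)
  by (intro measure_mono_fmeasurable) (auto simp: fmeasurable_def sets_M)

lemma measure_polar_tail_mono:
  assumes "0 < s" "s \<le> s'" "D \<in> sets borel"
  shows "measure M (polar_tail s' D) \<le> measure M (polar_tail s D)"
  using assms polar_tail_subset[of s D] polar_tail_antimono[of s s' D]
  by (intro measure_mono_away[where s=s]) auto

lemma measure_polar_tail_le:
  assumes "0 < s" "D \<in> sets borel"
  shows "measure M (polar_tail s D) \<le> measure M {x. norm x > s}"
  using assms polar_tail_subset[of s D]
  by (intro measure_mono_away[where s=s]) auto

lemma measure_norm_gt_antimono:
  assumes "0 < s" "s \<le> s'"
  shows "measure M {x. norm x > s'} \<le> measure M {x. norm x > s}"
  using assms by (intro measure_mono_away[where s=s]) auto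

text \<open>Turns upper bounds on the complementary directions into lower bounds on
  \<open>D\<close>. The subtraction is legitimate because tails away from 0 have finite
  mass.\<close>

lemma measure_polar_tail_compl:
  assumes "0 < s" "D \<in> sets borel"
  shows "measure M (polar_tail s D) = measure M {x. norm x > s} - measure M (polar_tail s (sphere 0 1 - D))"
proof -
  have "{x. norm x > s} = polar_tail s D \<union> polar_tail s (sphere 0 1 - D)"
    using assms by (auto simp: polar_tail_def norm_sgn)
  moreover have "polar_tail s D \<inter> polar_tail s (sphere 0 1 - D) = {}" by (auto simp: polar_tail_def)
  moreover have "emeasure M (polar_tail s B) \<noteq> \<infinity>" for B
    using emeasure_finite_away[OF assms(1) polar_tail_subset] by (simp add: less_top)
  ultimately show ?thesis
    using assms by (simp add: measure_Union sets_M)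
qed

end

subsection \<open>Regular variation from scaled tails\<close>

text \<open>The closed set \<open>C\<close> of points with \<open>s \<le> norm x\<close> and
  direction in \<open>closure D\<close> is approached from above by \<open>f k\<close>. It may reach
  the sphere of radius \<open>s\<close>, so its mass is compared with a tail at a slightly smaller
  radius \<open>s'\<close>, using continuity of \<open>s powr (-\<eta>)\<close>; passing from
  \<open>closure D\<close> back to \<open>D\<close> uses the null boundary.\<close>

lemma portmanteau_upper:
  fixes \<sigma> :: "'a::euclidean_space measure" and M :: "nat \<Rightarrow> 'a measure"
  assumes M: "\<And>n. Mclass 0 (M n)" and \<sigma>: "sphere_measure \<sigma>" and \<eta>: "0 < \<eta>" "\<eta> < 2"
    and conv: "\<And>g s. continuous_on UNIV g \<Longrightarrow> (\<And>x. \<bar>g x\<bar> \<le> (1::real)) \<Longrightarrow> 0 < s \<Longrightarrow> (\<And>x. norm x \<le> s \<Longrightarrow> g x = 0) \<Longrightarrow>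
       (\<lambda>n. \<integral>x. g x \<partial>M n) \<longlonglongrightarrow> (\<integral>x. g x \<partial>stable_levy \<eta> \<sigma>)"
    and D: "sphere_cont_set \<sigma> D" and "0 < s" "0 < e"
  shows "\<forall>\<^sub>F n in sequentially. measure (M n) (polar_tail s D) < measure (stable_levy \<eta> \<sigma>) (polar_tail s D) + e"
\<comment> \<open>An empty \<open>D\<close> is separate because \<open>infdist\<close> to the empty
  set is 0, which would make \<open>f k\<close> constantly 1.\<close>
proof (cases "D = {}")
  case True
  then show ?thesis using \<open>0 < e\<close> by (simp add: polar_tail_def)
next
  case False
  let ?L = "stable_levy \<eta> \<sigma>"
  have LM: "levy_measure (M n)" "levy_measure ?L" for n
    using M Mclass_stable_levy[OF \<sigma> \<eta>] by (auto intro: levy_measure.intro)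
  have Dm: "D \<in> sets borel" "D \<subseteq> sphere 0 1" using D by (auto simp: sphere_cont_set_def)
  define C where "C = {x \<in> {x. s \<le> norm x}. sgn x \<in> closure D}"
  have "continuous_on {x::'a. s \<le> norm x} sgn" using \<open>0 < s\<close> by (intro continuous_on_sgn continuous_intros) auto
  moreover have "closed {x::'a. s \<le> norm x}" by (intro closed_Collect_le continuous_intros)
  ultimately have C: "closed C"
    using continuous_closed_preimage[of "{x::'a. s \<le> norm x}" sgn "closure D"]
    by (simp add: C_def vimage_def Int_def)
  obtain d where "d \<in> D" using False by auto
  then have d: "norm d = 1" "d \<in> closure D" using Dm(2) closure_subset by auto
  then have "sgn d = d" by (simp add: sgn_div_norm)
  then have "s *\<^sub>R d \<in> C" using d \<open>0 < s\<close> by (simp add: C_def sgn_scaleR)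
  then have C0: "C \<noteq> {}" by auto
  \<comment> \<open>The slope is at least \<open>2 / s\<close>, so \<open>f k\<close> vanishes at
    distance \<open>s / 2\<close> from \<open>C\<close> and in particular for
    \<open>norm x \<le> s / 2\<close>. This makes it an admissible test function for
    \<open>conv\<close>.\<close>
  define f where "f k x = max 0 (1 - (2/s + real k) * infdist x C)" for k x
  have fc: "continuous_on UNIV (f k)" for k unfolding f_def by (intro continuous_intros)
  have fb: "\<bar>f k x\<bar> \<le> 1" for k x
    unfolding f_def using infdist_nonneg[of x C] \<open>0 < s\<close> by (auto simp: abs_if)
  have f0: "f k x = 0" if "norm x \<le> s/2" for k x
  proof -
    have "s/2 \<le> infdist x C"
      unfolding infdist_notempty[OF C0]
    proof (rule cINF_greatest[OF C0])
      fix c assume "c \<in> C"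
      then have "s \<le> norm c" by (simp add: C_def)
      then show "s/2 \<le> dist x c" using that norm_triangle_ineq2[of c x] by (simp add: dist_norm norm_minus_commute)
    qed
    then have "(2/s) * (s/2) \<le> (2/s + real k) * infdist x C"
      using \<open>0 < s\<close> infdist_nonneg[of x C] by (intro mult_mono) auto
    then show ?thesis using \<open>0 < s\<close> by (simp add: f_def)
  qed
  have f1: "f k x = 1" if "x \<in> C" for k x using that by (simp add: f_def)
  have Cm: "C \<in> sets borel" "C \<subseteq> {x. norm x > s/2}" using C \<open>0 < s\<close> by (auto simp: C_def)
  have "(\<lambda>k. \<integral>x. f k x \<partial>?L) \<longlonglongrightarrow> (\<integral>x. indicator C x \<partial>?L)"
  proof (rule integral_dominated_convergence[where w="indicator {x. norm x > s/2}"])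
    show "integrable ?L (indicator {x. norm x > s/2} :: 'a \<Rightarrow> real)"
      using \<open>0 < s\<close> by (intro levy_measure.integrable_indicator_away[OF LM(2), where s="s/2"]) auto
    show "AE x in ?L. (\<lambda>k. f k x) \<longlonglongrightarrow> indicator C x"
    proof (rule AE_I2)
      fix x
      show "(\<lambda>k. f k x) \<longlonglongrightarrow> indicator C x"
      proof (cases "x \<in> C")
        case False
        then have pos: "0 < infdist x C" using C C0 infdist_pos_not_in_closed by blast
        obtain N where N: "1 / infdist x C \<le> real N" using real_arch_simple by blast
        have "f k x = 0" if "N \<le> k" for k
        proof -
          have "1 / infdist x C \<le> 2/s + real k" using N that \<open>0 < s\<close> by (smt (verit) divide_nonneg_pos of_nat_mono)
          then have "1 \<le> (2/s + real k) * infdist x C" using pos by (simp add: divide_le_eq)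
          then show ?thesis by (simp add: f_def)
        qed
        then show ?thesis using False by (intro tendsto_eventually eventually_sequentiallyI[of N]) auto
      qed (simp add: f1)
    qed
    show "AE x in ?L. norm (f k x) \<le> indicator {x. norm x > s/2} x" for k
      using fb[of k] f0[of _ k] by (intro AE_I2) (auto simp: indicator_def)
  qed (use Cm fc in \<open>auto simp: measurable_cong_sets[OF levy_measure.sets_M[OF LM(2)] refl] intro: borel_measurable_continuous_onI\<close>)
  moreover have "(\<integral>x. indicator C x \<partial>?L) < measure ?L (polar_tail s D) + e"
  proof -
    have "(\<lambda>s. measure \<sigma> D * s powr (-\<eta>) / \<eta>) \<midarrow>s\<rightarrow> measure \<sigma> D * s powr (-\<eta>) / \<eta>"
      using \<open>0 < s\<close> \<eta> by (intro tendsto_intros) auto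
    then have "((\<lambda>s. measure \<sigma> D * s powr (-\<eta>) / \<eta>) \<longlongrightarrow> measure \<sigma> D * s powr (-\<eta>) / \<eta>) (at_left s)"
      by (rule filterlim_mono[OF _ order_refl at_le]) simp
    from order_tendstoD(2)[OF this, of "measure \<sigma> D * s powr (-\<eta>) / \<eta> + e"] \<open>0 < e\<close>
    have "\<forall>\<^sub>F s' in at_left s. measure \<sigma> D * s' powr (-\<eta>) / \<eta> < measure \<sigma> D * s powr (-\<eta>) / \<eta> + e" by simp
    moreover have "\<forall>\<^sub>F s' in at_left s. 0 < s' \<and> s' < s"
      using \<open>0 < s\<close> eventually_at_left_real[of 0 s] by (auto elim: eventually_mono)
    ultimately have "\<forall>\<^sub>F s' in at_left s. measure \<sigma> D * s' powr (-\<eta>) / \<eta> < measure \<sigma> D * s powr (-\<eta>) / \<eta> + e \<and> 0 < s' \<and> s' < s"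
      by (rule eventually_conj)
    then obtain s' where s': "measure \<sigma> D * s' powr (-\<eta>) / \<eta> < measure \<sigma> D * s powr (-\<eta>) / \<eta> + e" "0 < s'" "s' < s"
      using eventually_happens'[OF trivial_limit_at_left_real] by blast
    have "(\<integral>x. indicator C x \<partial>?L) = measure ?L C" using Cm levy_measure.sets_M[OF LM(2)] by simp
    also have "\<dots> \<le> measure ?L (polar_tail s' (closure D))"
    proof (rule levy_measure.measure_mono_away[OF LM(2)])
      show "C \<subseteq> polar_tail s' (closure D)" using s'(3) by (auto simp: C_def polar_tail_def)
    qed (use s'(2) Cm polar_tail_subset in auto)
    also have "\<dots> = measure \<sigma> D * s' powr (-\<eta>) / \<eta>"
      using s' \<eta> by (simp add: measure_stable_levy_polar_tail[OF \<sigma>] emeasure_closure_sphere_cont_set[OF \<sigma> D])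
    also have "\<dots> < measure \<sigma> D * s powr (-\<eta>) / \<eta> + e" by (rule s')
    also have "\<dots> = measure ?L (polar_tail s D) + e"
      using Dm \<open>0 < s\<close> \<eta> by (simp add: measure_stable_levy_polar_tail[OF \<sigma>])
    finally show ?thesis .
  qed
  ultimately have "\<forall>\<^sub>F k in sequentially. (\<integral>x. f k x \<partial>?L) < measure ?L (polar_tail s D) + e"
    by (rule order_tendstoD(2))
  then obtain k where k: "(\<integral>x. f k x \<partial>?L) < measure ?L (polar_tail s D) + e"
    by (auto simp: eventually_sequentially)
  have "(\<lambda>n. \<integral>x. f k x \<partial>M n) \<longlonglongrightarrow> (\<integral>x. f k x \<partial>?L)"
    using \<open>0 < s\<close> by (intro conv[OF fc fb, of "s/2"] f0) auto
  from order_tendstoD(2)[OF this k] show ?thesis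
  proof eventually_elim
    case (elim n)
    have "measure (M n) (polar_tail s D) = (\<integral>x. indicator (polar_tail s D) x \<partial>M n)"
      using Dm levy_measure.sets_M[OF LM(1)] by simp
    also have "\<dots> \<le> (\<integral>x. f k x \<partial>M n)"
    proof (rule integral_mono)
      show "integrable (M n) (indicator (polar_tail s D) :: 'a \<Rightarrow> real)"
        using Dm \<open>0 < s\<close> polar_tail_subset by (intro levy_measure.integrable_indicator_away[OF LM(1)]) auto
      show "integrable (M n) (f k)"
        using \<open>0 < s\<close> fb f0 fc by (intro levy_measure.integrable_away[OF LM(1), where B=1 and s="s/2"]) (auto intro: borel_measurable_continuous_onI)
      show "indicator (polar_tail s D) x \<le> f k x" for x
        using f1[of x k] closure_subset[of D] by (auto simp: indicator_def f_def C_def polar_tail_def)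
    qed
    finally show ?case using elim by simp
  qed
qed

text \<open>The set \<open>norm x > s\<close> is open: the continuous functions \<open>f k\<close>
  increase to its indicator and already vanish on \<open>norm x \<le> s\<close>, so they are
  admissible and bound its mass from below.\<close>

lemma portmanteau_lower_ball:
  fixes \<sigma> :: "'a::euclidean_space measure" and M :: "nat \<Rightarrow> 'a measure"
  assumes M: "\<And>n. Mclass 0 (M n)" and L: "Mclass 0 L"
    and conv: "\<And>g s. continuous_on UNIV g \<Longrightarrow> (\<And>x. \<bar>g x\<bar> \<le> (1::real)) \<Longrightarrow> 0 < s \<Longrightarrow> (\<And>x. norm x \<le> s \<Longrightarrow> g x = 0) \<Longrightarrow>
       (\<lambda>n. \<integral>x. g x \<partial>M n) \<longlonglongrightarrow> (\<integral>x. g x \<partial>L)"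
    and "0 < s" "0 < e"
  shows "\<forall>\<^sub>F n in sequentially. measure L {x. norm x > s} - e < measure (M n) {x. norm x > s}"
proof -
  have LM: "levy_measure (M n)" "levy_measure L" for n using M L by (auto intro: levy_measure.intro)
  define f where "f k x = min 1 (max 0 (real k * (norm x - s)))" for k and x :: 'a
  have fc: "continuous_on UNIV (f k)" for k unfolding f_def by (intro continuous_intros)
  have fb: "\<bar>f k x\<bar> \<le> 1" for k x by (simp add: f_def)
  have f0: "f k x = 0" if "norm x \<le> s" for k x
    using that by (simp add: f_def mult_nonneg_nonpos)
  have fle: "f k x \<le> indicator {x. norm x > s} x" for k x
    using f0[of x k] fb[of k x] by (auto simp: indicator_def)
  have "(\<lambda>k. \<integral>x. f k x \<partial>L) \<longlonglongrightarrow> (\<integral>x. indicator {x. norm x > s} x \<partial>L)"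
  proof (rule integral_dominated_convergence[where w="indicator {x. norm x > s}"])
    show "integrable L (indicator {x. norm x > s} :: 'a \<Rightarrow> real)"
      using \<open>0 < s\<close> by (intro levy_measure.integrable_indicator_away[OF LM(2), where s=s]) auto
    show "AE x in L. (\<lambda>k. f k x) \<longlonglongrightarrow> indicator {x. norm x > s} x"
    proof (rule AE_I2)
      fix x :: 'a
      show "(\<lambda>k. f k x) \<longlonglongrightarrow> indicator {x. norm x > s} x"
      proof (cases "norm x > s")
        case True
        obtain N where N: "1 / (norm x - s) \<le> real N" using real_arch_simple by blast
        have "f k x = 1" if "N \<le> k" for k
        proof -
          have "1 / (norm x - s) \<le> real k" using N that by (meson of_nat_mono order_trans)
          then have "1 \<le> real k * (norm x - s)" using True by (simp add: divide_le_eq)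
          then show ?thesis by (simp add: f_def)
        qed
        then show ?thesis using True by (intro tendsto_eventually eventually_sequentiallyI[of N]) auto
      qed (simp add: f0)
    qed
    show "AE x in L. norm (f k x) \<le> indicator {x. norm x > s} x" for k
      using fle[of k] by (intro AE_I2) (auto simp: f_def)
  qed (use fc in \<open>auto simp: measurable_cong_sets[OF levy_measure.sets_M[OF LM(2)] refl] intro: borel_measurable_continuous_onI\<close>)
  then have "(\<lambda>k. \<integral>x. f k x \<partial>L) \<longlonglongrightarrow> measure L {x. norm x > s}"
    by (simp add: levy_measure.sets_M[OF LM(2)] levy_measure.space_M[OF LM(2)])
  from order_tendstoD(1)[OF this, of "measure L {x. norm x > s} - e"] \<open>0 < e\<close>
  obtain k where k: "measure L {x. norm x > s} - e < (\<integral>x. f k x \<partial>L)" by (auto simp: eventually_sequentially)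
  have "(\<lambda>n. \<integral>x. f k x \<partial>M n) \<longlonglongrightarrow> (\<integral>x. f k x \<partial>L)"
    using \<open>0 < s\<close> by (intro conv[OF fc fb, of s] f0) auto
  from order_tendstoD(1)[OF this k] show ?thesis
  proof eventually_elim
    case (elim n)
    have "(\<integral>x. f k x \<partial>M n) \<le> (\<integral>x. indicator {x. norm x > s} x \<partial>M n)"
    proof (rule integral_mono)
      show "integrable (M n) (indicator {x. norm x > s} :: 'a \<Rightarrow> real)"
        using \<open>0 < s\<close> by (intro levy_measure.integrable_indicator_away[OF LM(1)]) auto
      show "integrable (M n) (f k)"
        using \<open>0 < s\<close> fb f0 fc by (intro levy_measure.integrable_away[OF LM(1), where B=1 and s=s]) (auto intro: borel_measurable_continuous_onI)
    qed (rule fle)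
    also have "\<dots> = measure (M n) {x. norm x > s}"
      by (simp add: levy_measure.sets_M[OF LM(1)] levy_measure.space_M[OF LM(1)])
    finally show ?case using elim by simp
  qed
qed

lemma polar_tail_limit:
  fixes \<sigma> :: "'a::euclidean_space measure" and M :: "nat \<Rightarrow> 'a measure"
  assumes M: "\<And>n. Mclass 0 (M n)" and \<sigma>: "sphere_measure \<sigma>" and \<eta>: "0 < \<eta>" "\<eta> < 2"
    and conv: "\<And>g s. continuous_on UNIV g \<Longrightarrow> (\<And>x. \<bar>g x\<bar> \<le> (1::real)) \<Longrightarrow> 0 < s \<Longrightarrow> (\<And>x. norm x \<le> s \<Longrightarrow> g x = 0) \<Longrightarrow>
       (\<lambda>n. \<integral>x. g x \<partial>M n) \<longlonglongrightarrow> (\<integral>x. g x \<partial>stable_levy \<eta> \<sigma>)"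
    and D: "sphere_cont_set \<sigma> D" and "0 < s"
  shows "(\<lambda>n. measure (M n) (polar_tail s D)) \<longlonglongrightarrow> measure (stable_levy \<eta> \<sigma>) (polar_tail s D)"
proof (rule order_tendstoI)
  let ?L = "stable_levy \<eta> \<sigma>"
  have LM: "levy_measure (M n)" "levy_measure ?L" for n
    using M Mclass_stable_levy[OF \<sigma> \<eta>] by (auto intro: levy_measure.intro)
  have Dm: "D \<in> sets borel" using D by (auto simp: sphere_cont_set_def)
  fix a assume "measure ?L (polar_tail s D) < a"
  then have e: "0 < a - measure ?L (polar_tail s D)" by simp
  have "\<forall>\<^sub>F n in sequentially. measure (M n) (polar_tail s D) < measure ?L (polar_tail s D) + (a - measure ?L (polar_tail s D))"
    by (rule portmanteau_upper[OF M \<sigma> \<eta> conv D \<open>0 < s\<close> e])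
  then show "\<forall>\<^sub>F n in sequentially. measure (M n) (polar_tail s D) < a" by simp
next
  let ?L = "stable_levy \<eta> \<sigma>"
  have LM: "levy_measure (M n)" "levy_measure ?L" for n
    using M Mclass_stable_levy[OF \<sigma> \<eta>] by (auto intro: levy_measure.intro)
  have Dm: "D \<in> sets borel" using D by (auto simp: sphere_cont_set_def)
  fix a assume a: "a < measure ?L (polar_tail s D)"
  \<comment> \<open>Half of the gap, because \<open>e\<close> is lost twice: once in the
    complementary directions and once in the full tail.\<close>
  define e where "e = (measure ?L (polar_tail s D) - a) / 2"
  have e: "0 < e" using a by (simp add: e_def)
  have "\<forall>\<^sub>F n in sequentially. measure (M n) (polar_tail s (sphere 0 1 - D)) < measure ?L (polar_tail s (sphere 0 1 - D)) + e"
    by (rule portmanteau_upper[OF M \<sigma> \<eta> conv sphere_cont_set_compl[OF D] \<open>0 < s\<close> e])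
  moreover have "\<forall>\<^sub>F n in sequentially. measure ?L {x. norm x > s} - e < measure (M n) {x. norm x > s}"
    by (rule portmanteau_lower_ball[OF M Mclass_stable_levy[OF \<sigma> \<eta>] conv \<open>0 < s\<close> e])
  ultimately show "\<forall>\<^sub>F n in sequentially. a < measure (M n) (polar_tail s D)"
  proof eventually_elim
    case (elim n)
    then show ?case
      using levy_measure.measure_polar_tail_compl[OF LM(1) \<open>0 < s\<close> Dm, of n] levy_measure.measure_polar_tail_compl[OF LM(2) \<open>0 < s\<close> Dm]
      unfolding e_def by argo
  qed
qed

section \<open>Eliminating time from the scaled tails\<close>

lemma RV0_iff:
  "RV0 \<rho> \<sigma> M \<longleftrightarrow> Mclass 0 M \<and> emeasure M UNIV \<noteq> 0 \<and>
     (\<forall>t>0. \<forall>D. sphere_cont_set \<sigma> D \<longrightarrow>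
        ((\<lambda>r. measure M (polar_tail (r * t) D) / measure M {x. norm x > r})
           \<longlongrightarrow> t powr \<rho> * measure \<sigma> D / measure \<sigma> (sphere 0 1)) (at_right 0))"
  unfolding RV0_def sphere_cont_set_def polar_tail_def by blast

lemma sphere_measure_pos: "sphere_measure \<sigma> \<Longrightarrow> 0 < measure \<sigma> (sphere 0 1)"
  by (auto simp: sphere_measure_def finite_measure.emeasure_eq_measure zero_less_measure_iff)

text \<open>Limits at fixed arguments suffice for a moving argument \<open>u r\<close>: monotonicity
  bounds \<open>F (u r) r\<close> by values at fixed points on either side of \<open>u0\<close>, and
  continuity of \<open>\<phi>\<close> closes the gap.\<close>

lemma antimono_family_tendsto:
  fixes F :: "real \<Rightarrow> 'b \<Rightarrow> real"
  assumes lim: "\<And>s. 0 < s \<Longrightarrow> (F s \<longlongrightarrow> \<phi> s) G"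
    and mono: "\<forall>\<^sub>F r in G. \<forall>s s'. 0 < s \<longrightarrow> s \<le> s' \<longrightarrow> F s' r \<le> F s r"
    and u: "(u \<longlongrightarrow> u0) G" "0 < u0" and \<phi>: "isCont \<phi> u0"
  shows "((\<lambda>r. F (u r) r) \<longlongrightarrow> \<phi> u0) G"
proof (rule order_tendstoI)
  fix a assume a: "a < \<phi> u0"
  have "(\<phi> \<longlongrightarrow> \<phi> u0) (at_right u0)" using \<phi> unfolding isCont_def by (rule filterlim_mono[OF _ order_refl at_le]) simp
  from order_tendstoD(1)[OF this a] have "\<forall>\<^sub>F s in at_right u0. a < \<phi> s" .
  moreover have "\<forall>\<^sub>F s in at_right u0. u0 < s" by (rule eventually_at_right_less)
  ultimately have "\<forall>\<^sub>F s in at_right u0. a < \<phi> s \<and> u0 < s" by (rule eventually_conj)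
  then obtain s where s: "a < \<phi> s" "u0 < s" using eventually_happens'[OF trivial_limit_at_right_real] by blast
  have "\<forall>\<^sub>F r in G. a < F s r" using order_tendstoD(1)[OF lim s(1)] s(2) u(2) by simp
  moreover have "\<forall>\<^sub>F r in G. u r < s" "\<forall>\<^sub>F r in G. 0 < u r" using order_tendstoD[OF u(1)] s(2) u(2) by auto
  ultimately show "\<forall>\<^sub>F r in G. a < F (u r) r"
    using mono
  proof eventually_elim
    case (elim r)
    then have "F s r \<le> F (u r) r" by simp
    then show ?case using elim(1) by simp
  qed
next
  fix a assume a: "\<phi> u0 < a"
  have "(\<phi> \<longlongrightarrow> \<phi> u0) (at_left u0)" using \<phi> unfolding isCont_def by (rule filterlim_mono[OF _ order_refl at_le]) simp
  from order_tendstoD(2)[OF this a] have "\<forall>\<^sub>F s in at_left u0. \<phi> s < a" .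
  moreover have "\<forall>\<^sub>F s in at_left u0. s \<in> {0<..<u0}" using u(2) by (rule eventually_at_left_real)
  ultimately have "\<forall>\<^sub>F s in at_left u0. \<phi> s < a \<and> s \<in> {0<..<u0}" by (rule eventually_conj)
  then obtain s where s: "\<phi> s < a" "0 < s" "s < u0" using eventually_happens'[OF trivial_limit_at_left_real] by auto
  have "\<forall>\<^sub>F r in G. F s r < a" using order_tendstoD(2)[OF lim s(1)] s(2) by simp
  moreover have "\<forall>\<^sub>F r in G. s < u r" using order_tendstoD[OF u(1)] s(3) by auto
  ultimately show "\<forall>\<^sub>F r in G. F (u r) r < a"
    using mono
  proof eventually_elim
    case (elim r)
    then have "F (u r) r \<le> F s r" using s(2) by simp
    then show ?case using elim(1) by simp
  qed
qed

text \<open>Time is set to \<open>1 / H r\<close>, which normalises \<open>t * H r\<close> to 1.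
  Comparison with the limits of \<open>t * H (s / a t)\<close> forces \<open>r * a (1 / H r)\<close>
  to converge to \<open>s0\<close>, so the tail at \<open>r * t\<close> becomes a scaled tail with
  convergent argument.\<close>

lemma RV0_of_scaled_tails:
  fixes \<sigma> M :: "'a::euclidean_space measure"
  assumes M: "Mclass 0 M" and \<sigma>: "sphere_measure \<sigma>" and \<eta>: "0 < \<eta>"
    and a: "\<And>t. 0 < t \<Longrightarrow> 0 < a t"
    and lim: "\<And>s D. 0 < s \<Longrightarrow> sphere_cont_set \<sigma> D \<Longrightarrow>
      ((\<lambda>t. t * measure M (polar_tail (s / a t) D)) \<longlongrightarrow> measure \<sigma> D * s powr (-\<eta>) / \<eta>) (at_right 0)"
  shows "RV0 (-\<eta>) \<sigma> M"
proof -
  interpret levy_measure M by unfold_locales fact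
  define H where "H r = measure M {x. norm x > r}" for r
  define c where "c = measure \<sigma> (sphere 0 1) / \<eta>"
  have c: "0 < c" using sphere_measure_pos[OF \<sigma>] \<eta> by (simp add: c_def)
  have tpos: "\<forall>\<^sub>F t in at_right 0. (0::real) < t" by (rule eventually_at_right_less)
  have Hlim: "((\<lambda>t. t * H (s / a t)) \<longlongrightarrow> c * s powr (-\<eta>)) (at_right 0)" if "0 < s" for s
  proof (rule Lim_transform_eventually)
    show "((\<lambda>t. t * measure M (polar_tail (s / a t) (sphere 0 1))) \<longlongrightarrow> c * s powr (-\<eta>)) (at_right 0)"
      using lim[OF that sphere_cont_set_sphere] by (simp add: c_def)
    show "\<forall>\<^sub>F t in at_right 0. t * measure M (polar_tail (s / a t) (sphere 0 1)) = t * H (s / a t)"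
      using tpos
    proof eventually_elim
      case (elim t)
      then show ?case using a[of t] that by (subst polar_tail_sphere) (auto simp: H_def less_imp_le)
    qed
  qed
  have Hanti: "H r' \<le> H r" if "0 < r" "r \<le> r'" for r r'
    using that unfolding H_def by (rule measure_norm_gt_antimono)
  \<comment> \<open>\<open>t * H (1 / a t)\<close> tends to a positive constant while
    \<open>t\<close> tends to 0, so \<open>H\<close> is unbounded near 0. This makes
    \<open>1 / H r\<close> an admissible small time.\<close>
  have Hinf: "filterlim H at_top (at_right 0)"
    unfolding filterlim_at_top
  proof
    fix K :: real
    have "((\<lambda>t. t * H (1 / a t)) \<longlongrightarrow> c) (at_right 0)" using Hlim[of 1] by simp
    then have "\<forall>\<^sub>F t in at_right 0. c / 2 < t * H (1 / a t)" by (rule order_tendstoD) (use c in simp)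
    moreover have "\<forall>\<^sub>F t in at_right 0. t < c / (2 * (\<bar>K\<bar> + 1))"
      by (rule eventually_mono[OF eventually_at_right_real[of 0 "c / (2 * (\<bar>K\<bar> + 1))"]]) (use c in auto)
    ultimately have "\<forall>\<^sub>F t in at_right 0. c / 2 < t * H (1 / a t) \<and> t < c / (2 * (\<bar>K\<bar> + 1)) \<and> 0 < t"
      using tpos by eventually_elim auto
    then obtain t where t: "c / 2 < t * H (1 / a t)" "t < c / (2 * (\<bar>K\<bar> + 1))" "0 < t"
      using eventually_happens'[OF trivial_limit_at_right_real] by blast
    have "t * (\<bar>K\<bar> + 1) < c / 2" using t(2) by (simp add: field_simps)
    then have "t * (\<bar>K\<bar> + 1) < t * H (1 / a t)" using t(1) by linarith
    then have K: "K \<le> H (1 / a t)" using t(3) by simp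
    have "\<forall>\<^sub>F r in at_right 0. r \<in> {0<..<1 / a t}"
      using a[OF t(3)] by (intro eventually_at_right_real) auto
    then show "\<forall>\<^sub>F r in at_right 0. K \<le> H r"
    proof eventually_elim
      case (elim r)
      then show ?case using K Hanti[of r "1 / a t"] by auto
    qed
  qed
  then have Hpos: "\<forall>\<^sub>F r in at_right 0. 0 < H r" by (simp add: filterlim_at_top_dense)
  have tau: "filterlim (\<lambda>r. 1 / H r) (at_right 0) (at_right 0)"
    unfolding filterlim_at using Hpos tendsto_inverse_0_at_top[OF Hinf]
    by (auto simp: inverse_eq_divide elim: eventually_mono)
  have scale: "((\<lambda>r. measure M (polar_tail (s / a (1 / H r)) D) / H r) \<longlongrightarrow> measure \<sigma> D * s powr (-\<eta>) / \<eta>) (at_right 0)"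
    if "0 < s" "sphere_cont_set \<sigma> D" for s D
    using filterlim_compose[OF lim[OF that] tau] by simp
  have Hscale: "((\<lambda>r. H (s / a (1 / H r)) / H r) \<longlongrightarrow> c * s powr (-\<eta>)) (at_right 0)" if "0 < s" for s
    using filterlim_compose[OF Hlim[OF that] tau] by simp
  \<comment> \<open>The solution of \<open>c * s powr (-\<eta>) = 1\<close>, the level at which the
    scaled tail agrees with \<open>H r\<close> in the limit.\<close>
  define s0 where "s0 = c powr (1 / \<eta>)"
  have s0: "0 < s0" using c by (simp add: s0_def)
  have cs0: "c = s0 powr \<eta>" using c \<eta> by (simp add: s0_def powr_powr)
  have cs: "c * s powr (-\<eta>) = (s0 / s) powr \<eta>" if "0 < s" for s
    using that s0 unfolding cs0 by (simp add: powr_divide powr_minus_divide)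
  have apos: "\<forall>\<^sub>F r in at_right 0. 0 < a (1 / H r)" using Hpos by eventually_elim (simp add: a)
  \<comment> \<open>For \<open>s < s0\<close> the limit of \<open>H (s / a (1 / H r)) / H r\<close>
    exceeds 1, which by monotonicity of \<open>H\<close> excludes
    \<open>r \<le> s / a (1 / H r)\<close>. The case above \<open>s0\<close> is symmetric.\<close>
  have u: "((\<lambda>r. r * a (1 / H r)) \<longlongrightarrow> s0) (at_right 0)"
  proof (rule order_tendstoI)
    fix s assume "s < s0"
    show "\<forall>\<^sub>F r in at_right 0. s < r * a (1 / H r)"
    proof (cases "0 < s")
      case True
      have "1 < c * s powr (-\<eta>)"
        unfolding cs[OF True] using True \<open>s < s0\<close> \<eta> by (intro gr_one_powr) auto
      from order_tendstoD(1)[OF Hscale[OF True] this] Hpos apos tpos show ?thesis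
      proof eventually_elim
        case (elim r)
        show ?case
        proof (rule ccontr)
          assume "\<not> ?case"
          then have "r \<le> s / a (1 / H r)" using elim by (simp add: field_simps)
          then have "H (s / a (1 / H r)) \<le> H r" using elim by (intro Hanti) auto
          then show False using elim by (simp add: pos_less_divide_eq)
        qed
      qed
    next
      case False
      from apos tpos show ?thesis
      proof eventually_elim
        case (elim r)
        then have "0 < r * a (1 / H r)" by simp
        then show ?case using False by linarith
      qed
    qed
  next
    fix s assume "s0 < s"
    then have s: "0 < s" using s0 by simp
    have "c * s powr (-\<eta>) < 1"
      unfolding cs[OF s] using powr_less_mono2[of \<eta> "s0 / s" 1] \<open>s0 < s\<close> s0 s \<eta> by simp
    from order_tendstoD(2)[OF Hscale[OF s] this] Hpos apos tpos
    show "\<forall>\<^sub>F r in at_right 0. r * a (1 / H r) < s"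
    proof eventually_elim
      case (elim r)
      show ?case
      proof (rule ccontr)
        assume "\<not> ?case"
        then have "s / a (1 / H r) \<le> r" using elim by (simp add: field_simps)
        then have "H r \<le> H (s / a (1 / H r))" using elim s by (intro Hanti) auto
        then show False using elim by (simp add: pos_divide_less_eq)
      qed
    qed
  qed
  have main: "((\<lambda>r. measure M (polar_tail (r * t) D) / H r) \<longlongrightarrow> t powr (-\<eta>) * measure \<sigma> D / measure \<sigma> (sphere 0 1)) (at_right 0)"
    if "0 < t" and D: "sphere_cont_set \<sigma> D" for t D
  proof -
    \<comment> \<open>The radius \<open>r * t\<close> is multiplied and divided by
      \<open>a (1 / H r)\<close>, so that it is a scaled radius whose argument tends to
      \<open>s0 * t\<close>.\<close>
    have "((\<lambda>r. measure M (polar_tail ((r * a (1 / H r) * t) / a (1 / H r)) D) / H r) \<longlongrightarrow> measure \<sigma> D * (s0 * t) powr (-\<eta>) / \<eta>) (at_right 0)"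
    proof (rule antimono_family_tendsto[where F="\<lambda>s r. measure M (polar_tail (s / a (1 / H r)) D) / H r"
          and \<phi>="\<lambda>s. measure \<sigma> D * s powr (-\<eta>) / \<eta>" and u="\<lambda>r. r * a (1 / H r) * t"])
      show "((\<lambda>r. measure M (polar_tail (s / a (1 / H r)) D) / H r) \<longlongrightarrow> measure \<sigma> D * s powr (-\<eta>) / \<eta>) (at_right 0)" if "0 < s" for s
        using scale[OF that D] .
      show "\<forall>\<^sub>F r in at_right 0. \<forall>s s'. 0 < s \<longrightarrow> s \<le> s' \<longrightarrow>
          measure M (polar_tail (s' / a (1 / H r)) D) / H r \<le> measure M (polar_tail (s / a (1 / H r)) D) / H r"
        using Hpos apos
      proof eventually_elim
        case (elim r)
        then show ?case
          using D by (auto intro!: divide_right_mono measure_polar_tail_mono simp: sphere_cont_set_def)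
      qed
      show "((\<lambda>r. r * a (1 / H r) * t) \<longlongrightarrow> s0 * t) (at_right 0)" by (intro tendsto_mult u tendsto_const)
      show "0 < s0 * t" using s0 that by simp
      then show "isCont (\<lambda>s. measure \<sigma> D * s powr (-\<eta>) / \<eta>) (s0 * t)" using \<eta> by (intro continuous_intros) auto
    qed
    also have "measure \<sigma> D * (s0 * t) powr (-\<eta>) / \<eta> = t powr (-\<eta>) * measure \<sigma> D / measure \<sigma> (sphere 0 1)"
    proof -
      have "(s0 * t) powr (-\<eta>) = t powr (-\<eta>) / c"
        using s0 that unfolding cs0 by (simp add: powr_mult powr_minus divide_inverse)
      then show ?thesis using \<eta> by (simp add: c_def)
    qed
    finally show ?thesis
    proof (rule Lim_transform_eventually)
      show "\<forall>\<^sub>F r in at_right 0. measure M (polar_tail ((r * a (1 / H r) * t) / a (1 / H r)) D) / H r = measure M (polar_tail (r * t) D) / H r"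
        using apos by eventually_elim simp
    qed
  qed
  have "emeasure M UNIV \<noteq> 0"
  proof
    assume "emeasure M UNIV = 0"
    then have "H r = 0" for r
      using emeasure_mono[of "{x. norm x > r}" UNIV M] by (simp add: H_def measure_def sets_M)
    then show False using eventually_happens'[OF trivial_limit_at_right_real Hpos] by auto
  qed
  then show ?thesis unfolding RV0_iff using M main unfolding H_def by blast
qed

section \<open>Mass at infinity and at the origin, and the layer-cake formula for angles\<close>

context levy_measure
begin

lemma measure_norm_gt_tendsto_0: "(\<lambda>n. measure M {x. norm x > real (Suc n)}) \<longlonglongrightarrow> 0"
proof -
  have "(\<lambda>n. \<integral>x. indicator {x. norm x > real (Suc n)} x \<partial>M) \<longlonglongrightarrow> (\<integral>x. (0::real) \<partial>M)"
  proof (rule integral_dominated_convergence[where w="indicator {x. norm x > 1/2}"])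
    show "integrable M (indicator {x. norm x > 1/2} :: 'a \<Rightarrow> real)"
      by (rule integrable_indicator_away[where s="1/2"]) auto
    show "AE x in M. (\<lambda>n. indicator {x. norm x > real (Suc n)} x :: real) \<longlonglongrightarrow> 0"
    proof (rule AE_I2)
      fix x :: 'a
      obtain N where "norm x \<le> real N" using real_arch_simple by blast
      then show "(\<lambda>n. indicator {x. norm x > real (Suc n)} x :: real) \<longlonglongrightarrow> 0"
        by (intro tendsto_eventually eventually_sequentiallyI[of N]) (auto simp: indicator_def)
    qed
  qed (auto simp: indicator_def measurable_cong_sets[OF sets_M refl])
  then show ?thesis by (simp add: sets_M)
qed

lemma integrable_small: "integrable M (\<lambda>x. indicator {x. norm x \<le> s} x * min ((norm x)\<^sup>2) 1)"
  by (rule integrable_bound_min[where C=1]) (auto simp: indicator_def)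

lemma small_jumps_tendsto_0:
  "(\<lambda>n. \<integral>x. indicator {x. norm x \<le> inverse (real (Suc n))} x * min ((norm x)\<^sup>2) 1 \<partial>M) \<longlonglongrightarrow> 0"
proof -
  have "(\<lambda>n. \<integral>x. indicator {x. norm x \<le> inverse (real (Suc n))} x * min ((norm x)\<^sup>2) 1 \<partial>M) \<longlonglongrightarrow> (\<integral>x. 0 \<partial>M)"
  proof (rule integral_dominated_convergence[where w="\<lambda>x. min ((norm x)\<^sup>2) 1"])
    show "AE x in M. (\<lambda>n. indicator {x. norm x \<le> inverse (real (Suc n))} x * min ((norm x)\<^sup>2) 1) \<longlonglongrightarrow> 0"
      using AE_nonzero
    proof eventually_elim
      case (elim x)
      then have "0 < norm x" by simp
      from order_tendstoD(2)[OF LIMSEQ_inverse_real_of_nat this]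
      have "\<forall>\<^sub>F n in sequentially. indicator {x. norm x \<le> inverse (real (Suc n))} x * min ((norm x)\<^sup>2) 1 = 0"
        by (rule eventually_mono) (simp add: indicator_def del: of_nat_Suc)
      then show ?case by (rule tendsto_eventually)
    qed
  qed (use integrable_min in \<open>auto simp: indicator_def measurable_cong_sets[OF sets_M refl]\<close>)
  then show ?thesis by simp
qed

text \<open>\<open>g (sgn x)\<close> is the length of the set of levels in \<open>{0..1}\<close>
  below it. An integral over angles thus becomes an average of polar tails over superlevel sets of
  \<open>g\<close>.\<close>

lemma layer_cake:
  fixes g :: "'a \<Rightarrow> real"
  assumes [measurable]: "g \<in> borel_measurable borel" and g: "\<And>x. 0 \<le> g x" "\<And>x. g x \<le> 1" and "0 < s"
  shows "(\<integral>x. indicator {x. norm x > s} x * g (sgn x) \<partial>M) =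
    (\<integral>u. indicator {0..1} u * measure M (polar_tail s {y \<in> sphere 0 1. u < g y}) \<partial>lborel)"
proof -
  have PS: "pair_sigma_finite (lborel :: real measure) M"
    by (intro pair_sigma_finite.intro sigma_finite_lborel sigma_finite)
  note [measurable_cong] = sets_M
  let ?h = "\<lambda>u x. indicator {0..1} u * (indicator {x. norm x > s} x * (if u < g (sgn x) then 1 else 0)) :: real"
  have ind: "integrable lborel (indicator {0..1} :: real \<Rightarrow> real)" by (rule integrable_real_indicator) auto
  have ind2: "integrable M (indicator {x. norm x > s} :: 'a \<Rightarrow> real)"
    using \<open>0 < s\<close> by (intro integrable_indicator_away[where s=s]) auto
  have int: "integrable (lborel \<Otimes>\<^sub>M M) (\<lambda>(u, x). ?h u x)"
    by (rule Bochner_Integration.integrable_bound[OF pair_sigma_finite.integrable_mult_fst_snd[OF PS ind ind2]])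
      (auto simp: indicator_def)
  have inner: "(\<integral>u. ?h u x \<partial>lborel) = indicator {x. norm x > s} x * g (sgn x)" for x
  proof -
    have "(\<integral>u. ?h u x \<partial>lborel) = (\<integral>u. indicator {x. norm x > s} x * indicator {0..<g (sgn x)} u \<partial>lborel)"
      using g(2)[of "sgn x"] by (intro Bochner_Integration.integral_cong) (auto simp: indicator_def)
    then show ?thesis using g(1)[of "sgn x"] by simp
  qed
  have outer: "(\<integral>x. ?h u x \<partial>M) = indicator {0..1} u * measure M (polar_tail s {y \<in> sphere 0 1. u < g y})" for u
  proof -
    have "(\<integral>x. ?h u x \<partial>M) = (\<integral>x. indicator {0..1} u * indicator (polar_tail s {y \<in> sphere 0 1. u < g y}) x \<partial>M)"
      using \<open>0 < s\<close> by (intro Bochner_Integration.integral_cong) (auto simp: indicator_def polar_tail_def norm_sgn)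
    then show ?thesis by (simp add: sets_M)
  qed
  have "(\<integral>u. (\<integral>x. ?h u x \<partial>M) \<partial>lborel) = (\<integral>x. (\<integral>u. ?h u x \<partial>lborel) \<partial>M)"
    using pair_sigma_finite.Fubini_integral[OF PS int] by simp
  then show ?thesis unfolding inner outer by simp
qed

end

subsection \<open>Convergence of exponents from convergence of tails\<close>

locale polar_tail_convergence =
  fixes M :: "nat \<Rightarrow> 'a::euclidean_space measure" and L \<sigma> :: "'a measure"
  assumes Mclass_M: "\<And>n. Mclass 0 (M n)" and Mclass_L: "Mclass 0 L" and sphere_\<sigma>: "sphere_measure \<sigma>"
    and tails: "\<And>s D. 0 < s \<Longrightarrow> sphere_cont_set \<sigma> D \<Longrightarrow> (\<lambda>n. measure (M n) (polar_tail s D)) \<longlonglongrightarrow> measure L (polar_tail s D)"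
begin

lemma levy_M: "levy_measure (M n)" and levy_L: "levy_measure L"
  using Mclass_M Mclass_L by (auto intro: levy_measure.intro)

lemma norm_gt_tendsto:
  assumes "0 < s"
  shows "(\<lambda>n. measure (M n) {x. norm x > s}) \<longlonglongrightarrow> measure L {x. norm x > s}"
  using tails[OF assms sphere_cont_set_sphere] assms by (simp add: polar_tail_sphere)

lemma norm_gt_bounded:
  assumes "0 < s"
  obtains C where "0 < C" "\<And>n. measure (M n) {x. norm x > s} \<le> C" "measure L {x. norm x > s} \<le> C"
proof -
  have "Bseq (\<lambda>n. measure (M n) {x. norm x > s})"
    using norm_gt_tendsto[OF assms] by (intro convergent_imp_Bseq convergentI)
  then obtain C where C: "C > 0" "\<And>n. measure (M n) {x. norm x > s} \<le> C" unfolding Bseq_def by auto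
  moreover have "measure L {x. norm x > s} \<le> C"
    by (rule LIMSEQ_le_const2[OF norm_gt_tendsto[OF assms]]) (use C in auto)
  ultimately show ?thesis using that by blast
qed

text \<open>The relative boundary of the superlevel set at \<open>u\<close> lies in the level set of
  \<open>g\<close> at \<open>u\<close>. The image of the finite measure \<open>\<sigma>\<close>
  under \<open>g\<close> has at most countably many atoms, so almost every level gives a continuity
  set, and dominated convergence in \<open>u\<close> applies.\<close>

lemma angular_limit_01:
  fixes g :: "'a \<Rightarrow> real"
  assumes gc: "continuous_on UNIV g" and g: "\<And>x. 0 \<le> g x" "\<And>x. g x \<le> 1" and s: "0 < s"
  shows "(\<lambda>n. \<integral>x. indicator {x. norm x > s} x * g (sgn x) \<partial>M n) \<longlonglongrightarrow> (\<integral>x. indicator {x. norm x > s} x * g (sgn x) \<partial>L)"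
proof -
  have gm [measurable]: "g \<in> borel_measurable borel" using gc by (rule borel_measurable_continuous_onI)
  have S: "sets \<sigma> = sets borel" and fin: "finite_measure \<sigma>" using sphere_\<sigma> by (auto simp: sphere_measure_def)
  interpret G: finite_measure "distr \<sigma> borel g"
    using fin S by (intro finite_measure.finite_measure_distr) (auto cong: measurable_cong_sets)
  define D where "D u = {y \<in> sphere 0 1. u < g y}" for u
  have Dm: "D u \<in> sets borel" "D u \<subseteq> sphere 0 1" for u unfolding D_def by auto
  have null: "countable {u. measure (distr \<sigma> borel g) {u} \<noteq> 0}" by (rule G.countable_support)
  have D: "sphere_cont_set \<sigma> (D u)" if "measure (distr \<sigma> borel g) {u} = 0" for u
  proof -
    have c1: "closure (D u) \<subseteq> {y. u \<le> g y}"
      using gc by (intro closure_minimal closed_Collect_le continuous_intros) (auto simp: D_def)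
    have c2: "closure (sphere 0 1 - D u) \<subseteq> {y. g y \<le> u}"
      using gc by (intro closure_minimal closed_Collect_le continuous_intros) (auto simp: D_def)
    have "closure (D u) \<inter> closure (sphere 0 1 - D u) \<subseteq> g -` {u} \<inter> space \<sigma>"
    proof
      fix x assume "x \<in> closure (D u) \<inter> closure (sphere 0 1 - D u)"
      then have "u \<le> g x" "g x \<le> u" using c1 c2 by auto
      then show "x \<in> g -` {u} \<inter> space \<sigma>" using sets_eq_imp_space_eq[OF S] by simp
    qed
    then have "emeasure \<sigma> (closure (D u) \<inter> closure (sphere 0 1 - D u)) \<le> emeasure \<sigma> (g -` {u} \<inter> space \<sigma>)"
      by (intro emeasure_mono) (use S gm in \<open>auto intro!: measurable_sets cong: measurable_cong_sets\<close>)
    also have "\<dots> = emeasure (distr \<sigma> borel g) {u}"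
      using S gm by (subst emeasure_distr) (auto cong: measurable_cong_sets)
    also have "\<dots> = 0" using that by (simp add: G.emeasure_eq_measure)
    finally show ?thesis using Dm by (simp add: sphere_cont_set_def)
  qed
  obtain C where C: "0 < C" "\<And>n. measure (M n) {x. norm x > s} \<le> C" "measure L {x. norm x > s} \<le> C"
    using norm_gt_bounded[OF s] by blast
  \<comment> \<open>Superlevel sets shrink as \<open>u\<close> grows, so the tail is antitone in
    \<open>u\<close>; monotone functions are Borel.\<close>
  have meas: "(\<lambda>u. measure K (polar_tail s (D u))) \<in> borel_measurable borel" if K: "levy_measure K" for K :: "'a measure"
  proof -
    have "mono (\<lambda>u. - measure K (polar_tail s (D u)))"
    proof (rule monoI)
      fix u v :: real assume "u \<le> v"
      then have "polar_tail s (D v) \<subseteq> polar_tail s (D u)" by (auto simp: polar_tail_def D_def)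
      then show "- measure K (polar_tail s (D u)) \<le> - measure K (polar_tail s (D v))"
        using levy_measure.measure_mono_away[OF K sets_polar_tail[OF Dm(1)] sets_polar_tail[OF Dm(1)] s polar_tail_subset, of s v u]
        by simp
    qed
    then have "(\<lambda>u. - measure K (polar_tail s (D u))) \<in> borel_measurable borel"
      by (rule borel_measurable_mono)
    then have "(\<lambda>u. - (- measure K (polar_tail s (D u)))) \<in> borel_measurable borel" by (rule borel_measurable_uminus)
    then show ?thesis by simp
  qed
  note [measurable] = meas[OF levy_M] meas[OF levy_L]
  have "(\<lambda>n. \<integral>u. indicator {0..1} u * measure (M n) (polar_tail s (D u)) \<partial>lborel) \<longlonglongrightarrow> (\<integral>u. indicator {0..1} u * measure L (polar_tail s (D u)) \<partial>lborel)"
  proof (rule integral_dominated_convergence[where w="\<lambda>u. C * indicator {0..1} u"])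
    have "integrable lborel (indicator {0..1} :: real \<Rightarrow> real)" by (rule integrable_real_indicator) auto
    then show "integrable lborel (\<lambda>u::real. C * indicator {0..1} u)" by (intro integrable_mult_right)
    have "AE u in lborel. u \<notin> {u. measure (distr \<sigma> borel g) {u} \<noteq> 0}"
      by (rule AE_not_in) (rule countable_imp_null_set_lborel[OF null])
    then show "AE u in lborel. (\<lambda>n. indicator {0..1} u * measure (M n) (polar_tail s (D u))) \<longlonglongrightarrow> indicator {0..1} u * measure L (polar_tail s (D u))"
      by eventually_elim (auto intro!: tendsto_mult tendsto_const tails s D)
    show "AE u in lborel. norm (indicator {0..1} u * measure (M n) (polar_tail s (D u))) \<le> C * indicator {0..1} u" for n
      using order_trans[OF levy_measure.measure_polar_tail_le[OF levy_M s Dm(1)] C(2)]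
      by (intro AE_I2) (auto simp: indicator_def)
  qed measurable
  then show ?thesis
    unfolding levy_measure.layer_cake[OF levy_M gm g s] levy_measure.layer_cake[OF levy_L gm g s] D_def .
qed

lemma integrable_indicator_mult:
  fixes g :: "'a \<Rightarrow> real"
  assumes K: "levy_measure K" and "g \<in> borel_measurable borel" "\<And>x. \<bar>g x\<bar> \<le> B" "0 < s"
  shows "integrable K (\<lambda>x. indicator {x. norm x > s} x * g x)"
proof (rule levy_measure.integrable_away[OF K, where B=B and s=s])
  show "norm (indicator {x. norm x > s} x * g x) \<le> B" for x
    using assms(3)[of x] by (auto simp: indicator_def)
qed (use assms in \<open>auto simp: indicator_def\<close>)

lemma angular_limit:
  fixes g :: "'a \<Rightarrow> real"
  assumes gc: "continuous_on UNIV g" and g: "\<And>x. \<bar>g x\<bar> \<le> B" and s: "0 < s"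
  shows "(\<lambda>n. \<integral>x. indicator {x. norm x > s} x * g (sgn x) \<partial>M n) \<longlonglongrightarrow> (\<integral>x. indicator {x. norm x > s} x * g (sgn x) \<partial>L)"
proof -
  have gm [measurable]: "g \<in> borel_measurable borel" using gc by (rule borel_measurable_continuous_onI)
  \<comment> \<open>The extra 1 keeps the divisor \<open>2 * A\<close> positive when
    \<open>B = 0\<close>.\<close>
  define A where "A = B + 1"
  have A: "0 < A" "\<bar>g x\<bar> \<le> A" for x using g[of 0] g[of x] unfolding A_def by linarith+
  define h where "h x = (g x + A) / (2 * A)" for x
  have h: "0 \<le> h x" "h x \<le> 1" for x using A(1) A(2)[of x] by (auto simp: h_def field_simps abs_le_iff)
  have hc: "continuous_on UNIV h" unfolding h_def using A(1) by (intro continuous_intros gc) auto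
  have hm: "(\<lambda>x. h (sgn x)) \<in> borel_measurable borel"
    using borel_measurable_continuous_onI[OF hc] by measurable
  have eq: "(\<integral>x. indicator {x. norm x > s} x * g (sgn x) \<partial>K) =
      2 * A * (\<integral>x. indicator {x. norm x > s} x * h (sgn x) \<partial>K) - A * measure K {x. norm x > s}" if K: "levy_measure K" for K :: "'a measure"
  proof -
    have i1: "integrable K (\<lambda>x. 2 * A * (indicator {x. norm x > s} x * h (sgn x)))"
      using h hm s by (intro integrable_mult_right integrable_indicator_mult[OF K, where B=1]) auto
    have i2: "integrable K (\<lambda>x. A * (indicator {x. norm x > s} x * 1))"
      using s by (intro integrable_mult_right integrable_indicator_mult[OF K, where B=1]) auto
    have "(\<integral>x. indicator {x. norm x > s} x * g (sgn x) \<partial>K) =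
       (\<integral>x. 2 * A * (indicator {x. norm x > s} x * h (sgn x)) - A * (indicator {x. norm x > s} x * 1) \<partial>K)"
      using A(1) by (intro Bochner_Integration.integral_cong) (auto simp: h_def indicator_def field_simps)
    also have "\<dots> = (\<integral>x. 2 * A * (indicator {x. norm x > s} x * h (sgn x)) \<partial>K) - (\<integral>x. A * (indicator {x. norm x > s} x * 1) \<partial>K)"
      by (rule Bochner_Integration.integral_diff[OF i1 i2])
    also have "\<dots> = 2 * A * (\<integral>x. indicator {x. norm x > s} x * h (sgn x) \<partial>K) - A * measure K {x. norm x > s}"
      by (simp add: levy_measure.sets_M[OF K] levy_measure.space_M[OF K])
    finally show ?thesis .
  qed
  show ?thesis
    unfolding eq[OF levy_M] eq[OF levy_L]
    by (intro tendsto_intros angular_limit_01 hc h s norm_gt_tendsto)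
qed

text \<open>On each shell \<open>f x\<close> is replaced by the value of \<open>f\<close> in the
  same direction at the inner radius. The indicator of a shell is written as a difference of two
  tails, so the approximant integrates to finitely many angular integrals. Everything beyond the
  last radius is charged to \<open>B\<close>.\<close>

lemma radial_step_approx:
  fixes f :: "'a \<Rightarrow> real"
  assumes B: "\<And>x. \<bar>f x\<bar> \<le> B" and w: "\<And>x y. norm x \<le> s + real m * h \<Longrightarrow> norm y \<le> s + real m * h \<Longrightarrow> dist x y \<le> h \<Longrightarrow> \<bar>f x - f y\<bar> \<le> w"
    and h: "0 < h" and s: "0 < s" and w0: "0 \<le> w"
  shows "\<bar>indicator {x. norm x > s} x * f x -
      (\<Sum>j<m. indicator {x. norm x > s + real j * h} x * f ((s + real j * h) *\<^sub>R sgn x) - indicator {x. norm x > s + real (Suc j) * h} x * f ((s + real j * h) *\<^sub>R sgn x))\<bar>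
    \<le> w * indicator {x. norm x > s} x + B * indicator {x. norm x > s + real m * h} x"
    (is "\<bar>_ - ?S\<bar> \<le> _")
proof -
  have B0: "0 \<le> B" using B[of 0] by linarith
  have S: "?S = (\<Sum>j<m. if s + real j * h < norm x \<and> norm x \<le> s + real (Suc j) * h then f ((s + real j * h) *\<^sub>R sgn x) else 0)"
  proof (rule sum.cong[OF refl])
    fix j
    have "s + real j * h \<le> s + real (Suc j) * h" using h by (simp add: algebra_simps)
    then show "indicator {x. norm x > s + real j * h} x * f ((s + real j * h) *\<^sub>R sgn x) - indicator {x. norm x > s + real (Suc j) * h} x * f ((s + real j * h) *\<^sub>R sgn x) =
      (if s + real j * h < norm x \<and> norm x \<le> s + real (Suc j) * h then f ((s + real j * h) *\<^sub>R sgn x) else 0)"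
      by (auto simp: indicator_def simp del: of_nat_Suc)
  qed
  consider "norm x \<le> s" | "s < norm x" "norm x \<le> s + real m * h" | "s + real m * h < norm x" by linarith
  then show ?thesis
  proof cases
    case 1
    have "?S = 0" unfolding S
    proof (intro sum.neutral ballI)
      fix j
      have "0 \<le> real j * h" using h by simp
      then show "(if s + real j * h < norm x \<and> norm x \<le> s + real (Suc j) * h then f ((s + real j * h) *\<^sub>R sgn x) else 0) = 0"
        using 1 by auto
    qed
    then show ?thesis using 1 w0 B0 by (auto simp: indicator_def)
  next
    case 2
    \<comment> \<open>\<open>k\<close> numbers the first outer radius that reaches
      \<open>norm x\<close>, so the shell containing \<open>x\<close> has index
      \<open>k - 1\<close>, and the uniqueness shown next leaves a single term of the sum.\<close>
    define k where "k = (LEAST k. norm x \<le> s + real k * h)"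
    have k: "norm x \<le> s + real k * h" "k \<le> m"
      unfolding k_def using 2(2) by (auto intro: LeastI Least_le)
    have "k \<noteq> 0" using k(1) 2(1) by (cases k) auto
    then obtain j where j: "k = Suc j" by (cases k) auto
    have lt: "s + real j * h < norm x"
      using not_less_Least[of j "\<lambda>k. norm x \<le> s + real k * h"] j unfolding k_def by auto
    have "i = j" if "s + real i * h < norm x" "norm x \<le> s + real (Suc i) * h" for i
    proof (rule antisym)
      have "real i * h < real (Suc j) * h" using that(1) k(1)[unfolded j] by linarith
      then have "real i < real (Suc j)" using h by (simp only: mult_less_cancel_right_pos)
      then show "i \<le> j" by linarith
      have "real j * h < real (Suc i) * h" using that(2) lt by linarith
      then have "real j < real (Suc i)" using h by (simp only: mult_less_cancel_right_pos)
      then show "j \<le> i" by linarith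
    qed
    then have iff: "s + real i * h < norm x \<and> norm x \<le> s + real (Suc i) * h \<longleftrightarrow> i = j" for i
      using lt k(1)[unfolded j] by blast
    have "?S = (\<Sum>i<m. if i = j then f ((s + real i * h) *\<^sub>R sgn x) else 0)"
      unfolding S iff ..
    then have Sj: "?S = f ((s + real j * h) *\<^sub>R sgn x)" using k(2) j by simp
    have x0: "x \<noteq> 0" using 2 s by auto
    have sj: "0 < s + real j * h" using s h by (simp add: add_pos_nonneg)
    have "x - (s + real j * h) *\<^sub>R sgn x = (norm x - (s + real j * h)) *\<^sub>R sgn x"
      using x0 by (simp add: sgn_div_norm algebra_simps)
    then have "dist x ((s + real j * h) *\<^sub>R sgn x) = \<bar>norm x - (s + real j * h)\<bar>"
      using x0 by (simp add: dist_norm norm_sgn)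
    also have "\<dots> \<le> h" using lt k(1) j by (simp add: algebra_simps)
    finally have d: "dist x ((s + real j * h) *\<^sub>R sgn x) \<le> h" .
    have "norm ((s + real j * h) *\<^sub>R sgn x) \<le> s + real m * h"
      using x0 sj lt 2(2) by (simp add: norm_sgn)
    then have "\<bar>f x - f ((s + real j * h) *\<^sub>R sgn x)\<bar> \<le> w" by (intro w 2(2) d)
    then show ?thesis unfolding Sj using 2 by simp
  next
    case 3
    have "?S = 0" unfolding S
    proof (intro sum.neutral ballI)
      fix j assume "j \<in> {..<m}"
      then have "real (Suc j) * h \<le> real m * h" using h by (intro mult_right_mono) auto
      then show "(if s + real j * h < norm x \<and> norm x \<le> s + real (Suc j) * h then f ((s + real j * h) *\<^sub>R sgn x) else 0) = 0"
        using 3 by auto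
    qed
    moreover have "0 \<le> real m * h" using h by simp
    ultimately show ?thesis using 3 B[of x] w0 by (auto simp: indicator_def)
  qed
qed

text \<open>The mass beyond a large radius \<open>K\<close> is small for all large \<open>n\<close>,
  because it converges to the tail of \<open>L\<close>. On the remaining bounded range uniform
  continuity controls the step approximation, whose integrals converge by
  \<open>angular_limit\<close>.\<close>

lemma away_limit:
  fixes f :: "'a \<Rightarrow> real"
  assumes fc: "continuous_on UNIV f" and B: "\<And>x. \<bar>f x\<bar> \<le> B" and s: "0 < s"
  shows "(\<lambda>n. \<integral>x. indicator {x. norm x > s} x * f x \<partial>M n) \<longlonglongrightarrow> (\<integral>x. indicator {x. norm x > s} x * f x \<partial>L)"
proof (rule tendsto_by_approximation)
  fix e :: real assume "0 < e"
  have fm [measurable]: "f \<in> borel_measurable borel" using fc by (rule borel_measurable_continuous_onI)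
  have B0: "0 \<le> B" using B[of 0] by linarith
  obtain C where C: "0 < C" "\<And>n. measure (M n) {x. norm x > s} \<le> C" "measure L {x. norm x > s} \<le> C"
    using norm_gt_bounded[OF s] by blast
  from order_tendstoD(2)[OF levy_measure.measure_norm_gt_tendsto_0[OF levy_L], of "e / (2 * (B + 1))"] \<open>0 < e\<close> B0
  obtain k0 where k0: "\<And>k. k \<ge> k0 \<Longrightarrow> measure L {x. norm x > real (Suc k)} < e / (2 * (B + 1))" by (auto simp: eventually_sequentially)
  obtain k1 where k1: "s < real k1" using reals_Archimedean2 by blast
  \<comment> \<open>The index \<open>k0\<close> makes the tail of \<open>L\<close> small, the index
    \<open>k1\<close> ensures \<open>s < K\<close>.\<close>
  define K where "K = real (Suc (max k0 k1))"
  have K: "s < K" "measure L {x. norm x > K} < e / (2 * (B + 1))" using k1 k0[of "max k0 k1"] by (auto simp: K_def simp del: of_nat_Suc)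
  have ev: "\<forall>\<^sub>F n in sequentially. measure (M n) {x. norm x > K} < e / (2 * (B + 1))"
    using K s by (intro order_tendstoD(2)[OF norm_gt_tendsto]) auto
  have "uniformly_continuous_on (cball 0 K) f"
    using fc by (intro compact_uniformly_continuous) (auto intro: continuous_on_subset)
  moreover have "0 < e / (2 * C)" using \<open>0 < e\<close> C(1) by simp
  ultimately obtain d where d: "d > 0" "\<And>x y. norm x \<le> K \<Longrightarrow> norm y \<le> K \<Longrightarrow> dist y x < d \<Longrightarrow> dist (f y) (f x) < e / (2 * C)"
    unfolding uniformly_continuous_on_def by (metis mem_cball_0)
  obtain m where m: "(K - s) / d < real m" using reals_Archimedean2 by blast
  have m0: "0 < real m" using m d(1) K(1) by (smt (verit) divide_pos_pos)
  \<comment> \<open>The \<open>m\<close> shells fill the range from \<open>s\<close> to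
    \<open>K\<close> exactly, and \<open>m\<close> was taken large enough for their width to fall
    below \<open>d\<close>.\<close>
  define h where "h = (K - s) / real m"
  have h: "0 < h" "h < d" "s + real m * h = K"
    using m m0 d(1) K(1) by (auto simp: h_def field_simps)
  let ?S = "\<lambda>x. \<Sum>j<m. indicator {x. norm x > s + real j * h} x * f ((s + real j * h) *\<^sub>R sgn x) - indicator {x. norm x > s + real (Suc j) * h} x * f ((s + real j * h) *\<^sub>R sgn x)"
  have pt: "\<bar>indicator {x. norm x > s} x * f x - ?S x\<bar> \<le> e / (2 * C) * indicator {x. norm x > s} x + B * indicator {x. norm x > K} x" for x
    unfolding h(3)[symmetric]
  proof (rule radial_step_approx[OF B _ h(1) s])
    show "\<bar>f x - f y\<bar> \<le> e / (2 * C)" if "norm x \<le> s + real m * h" "norm y \<le> s + real m * h" "dist x y \<le> h" for x y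
      using d(2)[of y x] that h by (simp add: dist_real_def)
    show "0 \<le> e / (2 * C)" using \<open>0 < e\<close> C(1) by simp
  qed
  have sj: "0 < s + real j * h" for j using s h(1) by (simp add: add_pos_nonneg)
  have gm: "(\<lambda>x. f (r *\<^sub>R sgn x)) \<in> borel_measurable borel" for r by measurable
  have i1: "integrable Q (\<lambda>x. indicator {x. norm x > s + real i * h} x * f ((s + real j * h) *\<^sub>R sgn x))" if "levy_measure Q" for Q i j
    by (rule integrable_indicator_mult[OF that gm B sj])
  have iS: "integrable Q ?S" if "levy_measure Q" for Q
    by (intro Bochner_Integration.integrable_sum Bochner_Integration.integrable_diff i1[OF that])
  have intS: "(\<integral>x. ?S x \<partial>Q) = (\<Sum>j<m. (\<integral>x. indicator {x. norm x > s + real j * h} x * f ((s + real j * h) *\<^sub>R sgn x) \<partial>Q) - (\<integral>x. indicator {x. norm x > s + real (Suc j) * h} x * f ((s + real j * h) *\<^sub>R sgn x) \<partial>Q))" if "levy_measure Q" for Q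
    by (subst Bochner_Integration.integral_sum)
      (intro Bochner_Integration.integrable_diff i1[OF that] sum.cong refl Bochner_Integration.integral_diff)+
  have lim: "(\<lambda>n. \<integral>x. ?S x \<partial>M n) \<longlonglongrightarrow> (\<integral>x. ?S x \<partial>L)"
    unfolding intS[OF levy_M] intS[OF levy_L]
    by (intro tendsto_sum tendsto_diff angular_limit[where B=B] sj B continuous_on_compose2[OF fc] continuous_intros) auto
  have close: "norm ((\<integral>x. indicator {x. norm x > s} x * f x \<partial>Q) - (\<integral>x. ?S x \<partial>Q)) \<le> e"
    if Q: "levy_measure Q" and le: "measure Q {x. norm x > s} \<le> C" "measure Q {x. norm x > K} < e / (2 * (B + 1))" for Q
  proof -
    have i: "integrable Q (\<lambda>x. indicator {x. norm x > s} x * f x)" by (rule integrable_indicator_mult[OF Q fm B s])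
    have j: "integrable Q (\<lambda>x. indicator {x. norm x > s} x :: real)" "integrable Q (\<lambda>x. indicator {x. norm x > K} x :: real)"
      using s K(1) levy_measure.integrable_indicator_away[OF Q, of "{x. norm x > s}" s] levy_measure.integrable_indicator_away[OF Q, of "{x. norm x > K}" K] by auto
    have "norm ((\<integral>x. indicator {x. norm x > s} x * f x \<partial>Q) - (\<integral>x. ?S x \<partial>Q)) = norm (\<integral>x. indicator {x. norm x > s} x * f x - ?S x \<partial>Q)"
      by (subst Bochner_Integration.integral_diff[OF i iS[OF Q]]) (rule refl)
    also have "\<dots> \<le> (\<integral>x. e / (2 * C) * indicator {x. norm x > s} x + B * indicator {x. norm x > K} x \<partial>Q)"
    proof (rule norm_integral_le_integral)
      show "norm (indicator {x. norm x > s} x * f x - ?S x) \<le> e / (2 * C) * indicator {x. norm x > s} x + B * indicator {x. norm x > K} x" for x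
        using pt[of x] by (simp only: real_norm_def)
    qed (intro Bochner_Integration.integrable_diff Bochner_Integration.integrable_add integrable_mult_right i iS[OF Q] j)+
    also have "\<dots> = e / (2 * C) * measure Q {x. norm x > s} + B * measure Q {x. norm x > K}"
      by (subst Bochner_Integration.integral_add)
        (use j in \<open>simp_all add: levy_measure.sets_M[OF Q] levy_measure.space_M[OF Q]\<close>)
    also have "\<dots> \<le> e / (2 * C) * C + B * (e / (2 * (B + 1)))"
      using le \<open>0 < e\<close> C(1) B0 by (intro add_mono mult_left_mono) auto
    also have "\<dots> \<le> e" using \<open>0 < e\<close> C(1) B0 by (simp add: field_simps)
    finally show ?thesis .
  qed
  have "\<forall>\<^sub>F n in sequentially. norm ((\<integral>x. indicator {x. norm x > s} x * f x \<partial>M n) - (\<integral>x. ?S x \<partial>M n)) \<le> e"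
    using ev by eventually_elim (rule close[OF levy_M C(2)])
  then show "\<exists>u v. u \<longlonglongrightarrow> v \<and> (\<forall>\<^sub>F n in sequentially. norm ((\<integral>x. indicator {x. norm x > s} x * f x \<partial>M n) - u n) \<le> e) \<and>
      norm ((\<integral>x. indicator {x. norm x > s} x * f x \<partial>L) - v) \<le> e"
    using lim close[OF levy_L C(3) K(2)] by blast
qed

text \<open>Away from 0 the kernel is bounded and continuous, so \<open>away_limit\<close> handles
  its real and imaginary parts. Limits of tails at fixed levels give no uniform control near 0; that
  is supplied by the hypothesis on small jumps.\<close>

lemma levy_exponent_limit:
  assumes small: "\<And>e. 0 < e \<Longrightarrow> \<exists>s>0. (\<forall>\<^sub>F n in sequentially. (\<integral>x. indicator {x. norm x \<le> s} x * min ((norm x)\<^sup>2) 1 \<partial>M n) \<le> e) \<and>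
      (\<integral>x. indicator {x. norm x \<le> s} x * min ((norm x)\<^sup>2) 1 \<partial>L) \<le> e"
  shows "(\<lambda>n. levy_exponent (M n) z) \<longlonglongrightarrow> levy_exponent L z"
proof (rule tendsto_by_approximation)
  fix e :: real assume "0 < e"
  define C where "C = 2 + norm z + (norm z)\<^sup>2"
  have C: "0 < C" by (simp add: C_def add_pos_nonneg)
  obtain s where s: "0 < s" "\<forall>\<^sub>F n in sequentially. (\<integral>x. indicator {x. norm x \<le> s} x * min ((norm x)\<^sup>2) 1 \<partial>M n) \<le> e / C"
      "(\<integral>x. indicator {x. norm x \<le> s} x * min ((norm x)\<^sup>2) 1 \<partial>L) \<le> e / C"
    using small[of "e / C"] \<open>0 < e\<close> C by auto
  let ?k = "\<lambda>x. indicator {x. norm x > s} x *\<^sub>R levy_kernel z x"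
  have bound: "cmod (levy_kernel z x) \<le> C" for x
    using norm_levy_kernel_le[of z x] mult_left_mono[of "min ((norm x)\<^sup>2) 1" 1 C, OF _ less_imp_le[OF C]]
    unfolding C_def by simp
  have ik: "integrable Q ?k" if "levy_measure Q" for Q
    using bound C s(1) by (intro levy_measure.integrable_away[OF that, where B=C and s=s]) (auto simp: indicator_def)
  have lim: "(\<lambda>n. \<integral>x. ?k x \<partial>M n) \<longlonglongrightarrow> (\<integral>x. ?k x \<partial>L)"
    unfolding tendsto_complex_iff
  proof
    have Re: "Re (\<integral>x. ?k x \<partial>Q) = (\<integral>x. indicator {x. norm x > s} x * Re (levy_kernel z x) \<partial>Q)" if "levy_measure Q" for Q
      using integral_bounded_linear[OF bounded_linear_Re ik[OF that]] by simp
    have Im: "Im (\<integral>x. ?k x \<partial>Q) = (\<integral>x. indicator {x. norm x > s} x * Im (levy_kernel z x) \<partial>Q)" if "levy_measure Q" for Q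
      using integral_bounded_linear[OF bounded_linear_Im ik[OF that]] by simp
    show "(\<lambda>n. Re (\<integral>x. ?k x \<partial>M n)) \<longlonglongrightarrow> Re (\<integral>x. ?k x \<partial>L)"
      unfolding Re[OF levy_M] Re[OF levy_L]
      by (rule away_limit[where B=C])
        (intro continuous_intros continuous_levy_kernel_right s order_trans[OF abs_Re_le_cmod bound])+
    show "(\<lambda>n. Im (\<integral>x. ?k x \<partial>M n)) \<longlonglongrightarrow> Im (\<integral>x. ?k x \<partial>L)"
      unfolding Im[OF levy_M] Im[OF levy_L]
      by (rule away_limit[where B=C])
        (intro continuous_intros continuous_levy_kernel_right s order_trans[OF abs_Im_le_cmod bound])+
  qed
  have close: "norm (levy_exponent Q z - (\<integral>x. ?k x \<partial>Q)) \<le> e"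
    if Q: "levy_measure Q" and le: "(\<integral>x. indicator {x. norm x \<le> s} x * min ((norm x)\<^sup>2) 1 \<partial>Q) \<le> e / C" for Q
  proof -
    have "levy_exponent Q z - (\<integral>x. ?k x \<partial>Q) = (CLINT x|Q. levy_kernel z x - ?k x)"
      unfolding levy_exponent_def by (rule Bochner_Integration.integral_diff[symmetric, OF levy_measure.integrable_levy_kernel[OF Q] ik[OF Q]])
    also have "cmod \<dots> \<le> (\<integral>x. C * (indicator {x. norm x \<le> s} x * min ((norm x)\<^sup>2) 1) \<partial>Q)"
    proof (rule norm_integral_le_integral)
      show "cmod (levy_kernel z x - ?k x) \<le> C * (indicator {x. norm x \<le> s} x * min ((norm x)\<^sup>2) 1)" for x
        using norm_levy_kernel_le[of z x] by (auto simp: indicator_def C_def)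
    qed (intro Bochner_Integration.integrable_diff integrable_mult_right levy_measure.integrable_small[OF Q] levy_measure.integrable_levy_kernel[OF Q] ik[OF Q])+
    also have "\<dots> = C * (\<integral>x. indicator {x. norm x \<le> s} x * min ((norm x)\<^sup>2) 1 \<partial>Q)" by (rule integral_mult_right_zero)
    also have "\<dots> \<le> C * (e / C)" using le C by (intro mult_left_mono) auto
    also have "\<dots> = e" using C by simp
    finally show ?thesis .
  qed
  have "\<forall>\<^sub>F n in sequentially. norm (levy_exponent (M n) z - (\<integral>x. ?k x \<partial>M n)) \<le> e"
    using s(2) by eventually_elim (rule close[OF levy_M])
  then show "\<exists>u v. u \<longlonglongrightarrow> v \<and> (\<forall>\<^sub>F n in sequentially. norm (levy_exponent (M n) z - u n) \<le> e) \<and> norm (levy_exponent L z - v) \<le> e"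
    using lim close[OF levy_L s(3)] by blast
qed

end

subsection \<open>Potter bounds and normalizing functions\<close>

lemma dyadic_bracket:
  fixes s :: real
  assumes "1 \<le> s"
  obtains k :: nat where "2 ^ k \<le> s" "s < 2 ^ Suc k"
proof -
  obtain n where n: "s < 2 ^ n" using real_arch_pow[of 2 s] by auto
  define m where "m = (LEAST n. s < 2 ^ n)"
  have m: "s < 2 ^ m" unfolding m_def using n by (rule LeastI)
  have "m \<noteq> 0" using m assms by (cases m) auto
  then obtain k where k: "m = Suc k" by (cases m) auto
  have "\<not> s < 2 ^ k" using not_less_Least[of k "\<lambda>n. s < 2 ^ n"] k unfolding m_def by auto
  then show ?thesis using m k that[of k] by simp
qed

lemma eventually_at_right_0_real:
  "(\<forall>\<^sub>F r in at_right (0::real). Q r) \<longleftrightarrow> (\<exists>r0>0. \<forall>r. 0 < r \<and> r < r0 \<longrightarrow> Q r)"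
  by (auto simp: eventually_at_right_field)

locale regularly_varying_tail =
  fixes U :: "real \<Rightarrow> real" and \<eta> :: real
  assumes antimono: "0 < r \<Longrightarrow> r \<le> r' \<Longrightarrow> U r' \<le> U r"
    and pos: "\<forall>\<^sub>F r in at_right 0. 0 < U r"
    and ratio: "0 < t \<Longrightarrow> ((\<lambda>r. U (r * t) / U r) \<longlongrightarrow> t powr (-\<eta>)) (at_right 0)"
    and \<eta>_pos: "0 < \<eta>"
begin

text \<open>At \<open>t = 1/2\<close> the limit ratio is \<open>2 powr \<eta>\<close>, strictly
  below \<open>2 powr b\<close>, so halving a small radius costs at most the factor
  \<open>2 powr b\<close>. Iteration reaches dyadic \<open>t\<close>; the prefactor pays for
  rounding up to the next power of two.\<close>

lemma potter_upper:
  assumes b: "\<eta> < b"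
  obtains r0 where "0 < r0" "\<And>r t. 0 < r \<Longrightarrow> r < r0 \<Longrightarrow> 1 \<le> t \<Longrightarrow> U (r / t) \<le> 2 powr b * t powr b * U r"
proof -
  have "(1/2) powr (-\<eta>) < 2 powr b"
    using b by (simp add: powr_divide powr_minus_divide)
  from order_tendstoD(2)[OF ratio this] have "\<forall>\<^sub>F r in at_right 0. U (r * (1/2)) / U r < 2 powr b" by simp
  with pos have "\<forall>\<^sub>F r in at_right 0. 0 < U r \<and> U (r / 2) \<le> 2 powr b * U r"
    by eventually_elim (simp add: divide_less_eq)
  then obtain r0 where r0: "0 < r0" "\<And>r. 0 < r \<Longrightarrow> r < r0 \<Longrightarrow> 0 < U r \<and> U (r / 2) \<le> 2 powr b * U r"
    unfolding eventually_at_right_0_real by blast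
  have iter: "U (r / 2 ^ k) \<le> (2 powr b) ^ k * U r" if "0 < r" "r < r0" for r k
  proof (induction k)
    case (Suc k)
    have "r / 2 ^ k \<le> r" using that(1) by (simp add: divide_le_eq)
    then have "U (r / 2 ^ k / 2) \<le> 2 powr b * U (r / 2 ^ k)"
      using r0(2)[of "r / 2 ^ k"] that by simp
    also have "\<dots> \<le> 2 powr b * ((2 powr b) ^ k * U r)" by (rule mult_left_mono[OF Suc]) simp
    finally show ?case by (simp add: mult_ac)
  qed simp
  show ?thesis
  proof (rule that[OF r0(1)])
    fix r t :: real assume r: "0 < r" "r < r0" and t: "1 \<le> t"
    obtain k where k: "2 ^ k \<le> t" "t < 2 ^ Suc k" using dyadic_bracket[OF t] .
    have "U (r / t) \<le> U (r / 2 ^ Suc k)"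
      using r k t by (intro antimono divide_left_mono) auto
    also have "\<dots> \<le> (2 powr b) ^ Suc k * U r" by (rule iter[OF r])
    also have "(2 powr b) ^ Suc k = 2 powr b * (2 ^ k) powr b"
      by (simp add: powr_power powr_realpow[symmetric] powr_powr mult.commute)
    also have "\<dots> * U r \<le> 2 powr b * t powr b * U r"
      using k(1) b \<eta>_pos r0(2)[OF r] by (intro mult_right_mono mult_left_mono powr_mono2) auto
    finally show "U (r / t) \<le> 2 powr b * t powr b * U r" .
  qed
qed

text \<open>The same scheme with doublings, each of which multiplies \<open>U\<close> by at most
  \<open>2 powr (-c)\<close>. The condition \<open>r / t < r0\<close> keeps all intermediate radii
  where the doubling estimate holds.\<close>

lemma potter_lower:
  assumes c: "0 < c" "c < \<eta>"
  obtains r0 where "0 < r0" "\<And>r. 0 < r \<Longrightarrow> r < r0 \<Longrightarrow> 0 < U r"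
    "\<And>r t. 0 < r \<Longrightarrow> 0 < t \<Longrightarrow> t \<le> 1 \<Longrightarrow> r / t < r0 \<Longrightarrow> U (r / t) \<le> 2 powr c * t powr c * U r"
proof -
  have "2 powr (-\<eta>) < 2 powr (-c)" using c by simp
  from order_tendstoD(2)[OF ratio this] have "\<forall>\<^sub>F r in at_right 0. U (r * 2) / U r < 2 powr (-c)" by simp
  with pos have "\<forall>\<^sub>F r in at_right 0. 0 < U r \<and> U (r * 2) \<le> 2 powr (-c) * U r"
    by eventually_elim (simp add: divide_less_eq)
  then obtain r0 where r0: "0 < r0" "\<And>r. 0 < r \<Longrightarrow> r < r0 \<Longrightarrow> 0 < U r \<and> U (r * 2) \<le> 2 powr (-c) * U r"
    unfolding eventually_at_right_0_real by blast
  have iter: "U (r * 2 ^ k) \<le> (2 powr (-c)) ^ k * U r" if "0 < r" "r * 2 ^ k < r0" for r k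
    using that(2)
  proof (induction k)
    case (Suc k)
    have "r * 2 ^ k \<le> r * 2 ^ Suc k" using that(1) by (intro mult_left_mono power_increasing) auto
    then have less: "r * 2 ^ k < r0" using Suc.prems by linarith
    have "U (r * 2 ^ k * 2) \<le> 2 powr (-c) * U (r * 2 ^ k)"
      using r0(2)[of "r * 2 ^ k"] that(1) less by simp
    also have "\<dots> \<le> 2 powr (-c) * ((2 powr (-c)) ^ k * U r)" by (rule mult_left_mono[OF Suc.IH[OF less]]) simp
    finally show ?case by (simp add: mult_ac)
  qed simp
  show ?thesis
  proof (rule that[OF r0(1)])
    fix r assume "0 < r" "r < r0"
    then show "0 < U r" using r0(2) by blast
  next
    fix r t :: real assume r: "0 < r" and t: "0 < t" "t \<le> 1" and rt: "r / t < r0"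
    have "1 \<le> 1 / t" using t by simp
    then obtain k where k: "2 ^ k \<le> 1 / t" "1 / t < 2 ^ Suc k" using dyadic_bracket by blast
    have le: "r * 2 ^ k \<le> r / t" using mult_left_mono[OF k(1), of r] r by simp
    have "r \<le> r / t" using t r by (simp add: le_divide_eq)
    then have "0 < U r" using r0(2)[of r] r rt by simp
    have "U (r / t) \<le> U (r * 2 ^ k)" using r le by (intro antimono) auto
    also have "\<dots> \<le> (2 powr (-c)) ^ k * U r" using le rt by (intro iter r) simp
    also have "(2 powr (-c)) ^ k = 2 powr c * (2 ^ Suc k) powr (-c)"
    proof -
      have "(2::real) ^ Suc k = 2 powr real (Suc k)" by (rule powr_realpow[symmetric]) simp
      then have "2 powr c * (2 ^ Suc k) powr (-c) = 2 powr (c + real (Suc k) * (-c))"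
        by (simp only: powr_powr powr_add)
      then show ?thesis by (simp add: powr_power algebra_simps)
    qed
    also have "\<dots> * U r \<le> 2 powr c * (1 / t) powr (-c) * U r"
      using k(2) c(1) t \<open>0 < U r\<close> by (intro mult_right_mono mult_left_mono powr_mono2') auto
    also have "(1 / t) powr (-c) = t powr c" using t by (simp add: powr_divide powr_minus_divide)
    finally show "U (r / t) \<le> 2 powr c * t powr c * U r" .
  qed
qed

text \<open>\<open>potter_lower\<close> with the large radius frozen at \<open>r1\<close>; the
  constant \<open>C\<close> collects \<open>U r1\<close> and the Potter factors.\<close>

lemma lower_growth:
  assumes c: "0 < c" "c < \<eta>"
  obtains r0 C where "0 < r0" "0 < C" "\<And>r. 0 < r \<Longrightarrow> r < r0 \<Longrightarrow> C * r powr (-c) \<le> U r"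
proof -
  obtain r0 where r0: "0 < r0" "\<And>r. 0 < r \<Longrightarrow> r < r0 \<Longrightarrow> 0 < U r"
    "\<And>r t. 0 < r \<Longrightarrow> 0 < t \<Longrightarrow> t \<le> 1 \<Longrightarrow> r / t < r0 \<Longrightarrow> U (r / t) \<le> 2 powr c * t powr c * U r"
    using potter_lower[OF c] by blast
  define r1 where "r1 = r0 / 2"
  have r1: "0 < r1" "r1 < r0" using r0(1) by (auto simp: r1_def)
  define C where "C = U r1 * r1 powr c / 2 powr c"
  have "0 < C" using r0(2)[OF r1] r1 by (simp add: C_def)
  moreover have "C * r powr (-c) \<le> U r" if r: "0 < r" "r < r1" for r
  proof -
    have "U (r / (r / r1)) \<le> 2 powr c * (r / r1) powr c * U r"
      using r r1 by (intro r0(3)) auto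
    then have "U r1 \<le> 2 powr c * (r powr c / r1 powr c) * U r" using r r1 by (simp add: powr_divide)
    then have "U r1 * r1 powr c / (2 powr c * r powr c) \<le> U r"
      using r r1 by (simp add: field_simps)
    then show ?thesis using r by (simp add: C_def powr_minus_divide)
  qed
  ultimately show ?thesis using that[of r1 C] r1(1) by blast
qed

lemma at_top: "filterlim U at_top (at_right 0)"
proof -
  obtain r0 C where C: "0 < r0" "0 < C" "\<And>r. 0 < r \<Longrightarrow> r < r0 \<Longrightarrow> C * r powr (-(\<eta>/2)) \<le> U r"
    using lower_growth[of "\<eta>/2"] \<eta>_pos by auto
  have "filterlim (\<lambda>r. r powr (-(\<eta>/2))) at_top (at_right (0::real))"
    using \<eta>_pos by real_asymp
  then have "filterlim (\<lambda>r. C * r powr (-(\<eta>/2))) at_top (at_right (0::real))"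
    using C(2) by (intro filterlim_tendsto_pos_mult_at_top[OF tendsto_const]) auto
  then show ?thesis
    by (rule filterlim_at_top_mono) (use C in \<open>auto simp: eventually_at_right_0_real intro!: exI[of _ r0]\<close>)
qed

text \<open>A generalised inverse of \<open>U\<close> at height \<open>c0 / t\<close>. As
  \<open>U\<close> may jump there, only the one-sided inequalities in \<open>Q\<close> are
  available; regular variation makes the values on both sides of \<open>\<rho> t\<close> agree up to
  the factors \<open>(1 + e) powr \<eta>\<close> and \<open>(1 - e) powr \<eta>\<close>.\<close>

lemma asymptotic_inverse:
  assumes c0: "0 < c0"
  obtains \<rho> where "\<And>t. 0 < t \<Longrightarrow> 0 < \<rho> t" "filterlim \<rho> (at_right 0) (at_right 0)"
    "((\<lambda>t. t * U (\<rho> t)) \<longlongrightarrow> c0) (at_right 0)"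
proof -
  define Q where "Q r t \<longleftrightarrow> 0 < r \<and> (\<forall>r'>r. U r' \<le> c0 / t) \<and> (\<forall>r'. 0 < r' \<and> r' < r \<longrightarrow> c0 / t < U r')" for r t
  have ex: "\<exists>r. Q r t" if t: "0 < t" "U 1 \<le> c0 / t" for t
  proof -
    \<comment> \<open>The crossing point is the infimum of the radii whose tail is at most
      \<open>c0 / t\<close>. The blow-up of \<open>U\<close> at 0 keeps it positive, and
      \<open>U 1 \<le> c0 / t\<close> keeps the set inhabited.\<close>
    define S where "S = {r. 0 < r \<and> U r \<le> c0 / t}"
    have "\<forall>\<^sub>F r in at_right 0. c0 / t < U r" using at_top by (simp add: filterlim_at_top_dense)
    then obtain \<delta> where \<delta>: "0 < \<delta>" "\<And>r. 0 < r \<Longrightarrow> r < \<delta> \<Longrightarrow> c0 / t < U r"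
      unfolding eventually_at_right_0_real by blast
    have S: "1 \<in> S" using t by (simp add: S_def)
    have low: "\<delta> \<le> r" if "r \<in> S" for r
      using \<delta>(2)[of r] that by (force simp: S_def)
    have bdd: "bdd_below S" by (rule bdd_belowI[of _ \<delta>]) (rule low)
    have "\<delta> \<le> Inf S" using S low by (intro cInf_greatest) auto
    moreover have "U r' \<le> c0 / t" if "Inf S < r'" for r'
    proof -
      have "S \<noteq> {}" using S by blast
      then have "\<exists>r\<in>S. r < r'" using that cInf_less_iff[OF _ bdd] by simp
      then obtain r where "r \<in> S" "r < r'" by blast
      then show ?thesis using antimono[of r r'] by (auto simp: S_def)
    qed
    moreover have "c0 / t < U r'" if "0 < r'" "r' < Inf S" for r'
    proof -
      have "r' \<notin> S" using that(2) cInf_lower[OF _ bdd, of r'] by auto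
      then show ?thesis using that(1) by (simp add: S_def)
    qed
    ultimately show ?thesis using \<delta>(1) unfolding Q_def by (intro exI[of _ "Inf S"]) auto
  qed
  \<comment> \<open>The default 1 covers times for which no such radius exists and keeps
    \<open>\<rho>\<close> positive everywhere.\<close>
  define \<rho> where "\<rho> t = (if \<exists>r. Q r t then SOME r. Q r t else 1)" for t
  have \<rho>: "Q (\<rho> t) t" if "0 < t" "U 1 \<le> c0 / t" for t
    using ex[OF that] someI_ex[OF ex[OF that]] unfolding \<rho>_def by simp
  have \<rho>pos: "0 < \<rho> t" for t
  proof (cases "\<exists>r. Q r t")
    case True
    then have "Q (\<rho> t) t" using someI_ex[OF True] unfolding \<rho>_def by simp
    then show ?thesis by (simp add: Q_def)
  qed (simp add: \<rho>_def)
  have big: "\<forall>\<^sub>F t in at_right 0. 0 < t \<and> K < c0 / t" for K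
  proof -
    have "filterlim (\<lambda>t. c0 / t) at_top (at_right 0)" using c0 by real_asymp
    then have "\<forall>\<^sub>F t in at_right 0. K < c0 / t" by (simp add: filterlim_at_top_dense)
    with eventually_at_right_less[of 0] show ?thesis by eventually_elim simp
  qed
  have evQ: "\<forall>\<^sub>F t in at_right 0. 0 < t \<and> Q (\<rho> t) t"
    using big[of "U 1"] by eventually_elim (simp add: \<rho>)
  have \<rho>0: "filterlim \<rho> (at_right 0) (at_right 0)"
  proof -
    have "(\<rho> \<longlongrightarrow> 0) (at_right 0)"
    proof (rule tendstoI)
      fix e :: real assume "0 < e"
      from evQ big[of "U (e/2)"] show "\<forall>\<^sub>F t in at_right 0. dist (\<rho> t) 0 < e"
      proof eventually_elim
        case (elim t)
        have "\<rho> t \<le> e/2"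
        proof (rule ccontr)
          assume "\<not> ?thesis"
          then have "e/2 < \<rho> t" "0 < e/2" using \<open>0 < e\<close> by auto
          then have "c0 / t < U (e/2)" using elim unfolding Q_def by blast
          then show False using elim by linarith
        qed
        then show ?case using \<rho>pos[of t] \<open>0 < e\<close> by simp
      qed
    qed
    then show ?thesis unfolding filterlim_at using \<rho>pos by (auto simp: less_imp_neq[symmetric])
  qed
  have evU: "\<forall>\<^sub>F t in at_right 0. 0 < U (\<rho> t * s)" if "0 < s" for s
  proof -
    have "filterlim (\<lambda>t. \<rho> t * s) (at_right 0) (at_right 0)"
      unfolding filterlim_at using \<rho>pos that tendsto_mult[OF _ tendsto_const, of \<rho> 0 "at_right 0" s] \<rho>0
      by (auto simp: filterlim_at less_imp_neq[symmetric] intro!: always_eventually)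
    then show ?thesis using pos by (rule filterlim_iff[THEN iffD1, rule_format])
  qed
  have ratio': "((\<lambda>t. U (\<rho> t) / U (\<rho> t * s)) \<longlongrightarrow> s powr \<eta>) (at_right 0)" if "0 < s" for s
  proof -
    have "((\<lambda>t. inverse (U (\<rho> t * s) / U (\<rho> t))) \<longlongrightarrow> inverse (s powr (-\<eta>))) (at_right 0)"
      using that by (intro tendsto_inverse filterlim_compose[OF ratio[OF that] \<rho>0]) auto
    then show ?thesis by (simp add: powr_minus)
  qed
  have "((\<lambda>t. t * U (\<rho> t)) \<longlongrightarrow> c0) (at_right 0)"
  proof (rule order_tendstoI)
    fix a assume a: "c0 < a"
    have "((\<lambda>e. c0 * (1 + e) powr \<eta>) \<longlongrightarrow> c0 * (1 + 0) powr \<eta>) (at_right 0)" by (intro tendsto_intros) auto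
    from order_tendstoD(2)[OF this, of a] a have "\<forall>\<^sub>F e in at_right 0. c0 * (1 + e) powr \<eta> < a" by simp
    with eventually_at_right_less[of "0::real"] have "\<forall>\<^sub>F e in at_right 0. 0 < e \<and> c0 * (1 + e) powr \<eta> < a"
      by eventually_elim simp
    then obtain e where e: "0 < e" "c0 * (1 + e) powr \<eta> < a" using eventually_happens'[OF trivial_limit_at_right_real] by blast
    \<comment> \<open>The radius \<open>\<rho> t * (1 + e)\<close> lies beyond the crossing, where
      \<open>U\<close> is at most \<open>c0 / t\<close>; the ratio limit carries this bound back to
      \<open>\<rho> t\<close> itself.\<close>
    have "((\<lambda>t. c0 * (U (\<rho> t) / U (\<rho> t * (1 + e)))) \<longlongrightarrow> c0 * (1 + e) powr \<eta>) (at_right 0)"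
      using e by (intro tendsto_mult tendsto_const ratio') auto
    moreover have "0 < 1 + e" using e by simp
    ultimately have "\<forall>\<^sub>F t in at_right 0. c0 * (U (\<rho> t) / U (\<rho> t * (1 + e))) < a" "\<forall>\<^sub>F t in at_right 0. 0 < U (\<rho> t * (1 + e))"
      using order_tendstoD(2)[OF _ e(2)] evU by blast+
    then show "\<forall>\<^sub>F t in at_right 0. t * U (\<rho> t) < a" using evQ evU[OF zero_less_one]
    proof eventually_elim
      case (elim t)
      have U: "0 < U (\<rho> t * (1 + e))" "0 < U (\<rho> t)" using elim e by auto
      have "\<rho> t < \<rho> t * (1 + e)" using \<rho>pos[of t] e by simp
      then have "U (\<rho> t * (1 + e)) \<le> c0 / t" using elim unfolding Q_def by blast
      then have "t * U (\<rho> t * (1 + e)) \<le> c0" using elim by (simp add: field_simps)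
      then have "t * U (\<rho> t * (1 + e)) * (U (\<rho> t) / U (\<rho> t * (1 + e))) \<le> c0 * (U (\<rho> t) / U (\<rho> t * (1 + e)))"
        using U by (intro mult_right_mono) auto
      then show ?case using elim U by simp
    qed
  next
    fix a assume a: "a < c0"
    have "((\<lambda>e. c0 * (1 - e) powr \<eta>) \<longlongrightarrow> c0 * (1 - 0) powr \<eta>) (at_right 0)" by (intro tendsto_intros) auto
    from order_tendstoD(1)[OF this, of a] a have "\<forall>\<^sub>F e in at_right 0. a < c0 * (1 - e) powr \<eta>" by simp
    with eventually_at_right_real[of 0 "1::real"] have "\<forall>\<^sub>F e in at_right 0. (0 < e \<and> e < 1) \<and> a < c0 * (1 - e) powr \<eta>"
      by (auto elim: eventually_elim2)
    then obtain e where e: "0 < e" "e < 1" "a < c0 * (1 - e) powr \<eta>" using eventually_happens'[OF trivial_limit_at_right_real] by blast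
    have "((\<lambda>t. c0 * (U (\<rho> t) / U (\<rho> t * (1 - e)))) \<longlongrightarrow> c0 * (1 - e) powr \<eta>) (at_right 0)"
      using e by (intro tendsto_mult tendsto_const ratio') auto
    moreover have "0 < 1 - e" using e by simp
    ultimately have "\<forall>\<^sub>F t in at_right 0. a < c0 * (U (\<rho> t) / U (\<rho> t * (1 - e)))" "\<forall>\<^sub>F t in at_right 0. 0 < U (\<rho> t * (1 - e))"
      using order_tendstoD(1)[OF _ e(3)] evU by blast+
    then show "\<forall>\<^sub>F t in at_right 0. a < t * U (\<rho> t)" using evQ evU[OF zero_less_one]
    proof eventually_elim
      case (elim t)
      have U: "0 < U (\<rho> t * (1 - e))" "0 < U (\<rho> t)" using elim e by auto
      have "0 < \<rho> t * (1 - e)" "\<rho> t * (1 - e) < \<rho> t" using \<rho>pos[of t] e by simp_all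
      then have "c0 / t < U (\<rho> t * (1 - e))" using elim unfolding Q_def by blast
      then have "c0 \<le> t * U (\<rho> t * (1 - e))" using elim by (simp add: field_simps)
      then have "c0 * (U (\<rho> t) / U (\<rho> t * (1 - e))) \<le> t * U (\<rho> t * (1 - e)) * (U (\<rho> t) / U (\<rho> t * (1 - e)))"
        using U by (intro mult_right_mono) auto
      then show ?case using elim U by simp
    qed
  qed
  then show ?thesis using that \<rho>pos \<rho>0 by blast
qed

end

section \<open>The two directions of the limit theorem\<close>

lemma RV0_regularly_varying_tail:
  fixes M :: "'a::euclidean_space measure"
  assumes RV: "RV0 (-\<eta>) \<sigma> M" and \<sigma>: "sphere_measure \<sigma>" and \<eta>: "0 < \<eta>"
  shows "regularly_varying_tail (\<lambda>r. measure M {x. norm x > r}) \<eta>"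
proof -
  have M: "Mclass 0 M" "emeasure M UNIV \<noteq> 0" using RV by (auto simp: RV0_iff)
  interpret levy_measure M by unfold_locales fact
  show ?thesis
  proof
    show "measure M {x. norm x > r'} \<le> measure M {x. norm x > r}" if "0 < r" "r \<le> r'" for r r'
      using that by (rule measure_norm_gt_antimono)
    \<comment> \<open>If all these tails vanished, \<open>M\<close> would be carried by the null set
      \<open>{0}\<close>, against \<open>emeasure M UNIV \<noteq> 0\<close>.\<close>
    have "\<exists>n::nat. measure M {x. norm x > inverse (real (Suc n))} \<noteq> 0"
    proof (rule ccontr)
      assume "\<not> ?thesis"
      then have z: "emeasure M {x. norm x > inverse (real (Suc n))} = 0" for n
        using emeasure_norm_gt_finite[of "inverse (real (Suc n))"] by (simp add: emeasure_eq_ennreal_measure)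
      have "AE x in M. \<forall>n. \<not> norm x > inverse (real (Suc n))"
        unfolding AE_all_countable using z by (intro allI AE_I[OF _ z]) (auto simp: sets_M)
      then have "AE x in M. False"
        using AE_nonzero
      proof eventually_elim
        case (elim x)
        then show False using reals_Archimedean[of "norm x"] by auto
      qed
      then have "space M \<in> null_sets M" using AE_iff_null[of M "\<lambda>_. False"] by simp
      then show False using M(2) by (auto simp: null_sets_def)
    qed
    then obtain n where n: "0 < measure M {x. norm x > inverse (real (Suc n))}" by (auto simp: zero_less_measure_iff)
    show "\<forall>\<^sub>F r in at_right 0. 0 < measure M {x. norm x > r}"
      unfolding eventually_at_right_0_real
    proof (intro exI conjI allI impI)
      show "0 < measure M {x. norm x > r}" if "0 < r \<and> r < inverse (real (Suc n))" for r
        using n measure_norm_gt_antimono[of r "inverse (real (Suc n))"] that by simp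
    qed simp
    show "((\<lambda>r. measure M {x. norm x > r * t} / measure M {x. norm x > r}) \<longlongrightarrow> t powr (-\<eta>)) (at_right 0)" if "0 < t" for t
    proof (rule Lim_transform_eventually)
      show "((\<lambda>r. measure M (polar_tail (r * t) (sphere 0 1)) / measure M {x. norm x > r}) \<longlongrightarrow> t powr (-\<eta>)) (at_right 0)"
        using RV that sphere_cont_set_sphere sphere_measure_pos[OF \<sigma>] unfolding RV0_iff by fastforce
      show "\<forall>\<^sub>F r in at_right 0. measure M (polar_tail (r * t) (sphere 0 1)) / measure M {x. norm x > r} = measure M {x. norm x > r * t} / measure M {x. norm x > r}"
        using eventually_at_right_less[of 0] by eventually_elim (use that in \<open>simp add: polar_tail_sphere\<close>)
    qed
  qed (rule \<eta>)
qed

lemma measure_dilate_polar_tail: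
  fixes M :: "'a::euclidean_space measure"
  assumes "sets M = sets borel" "D \<in> sets borel" "0 < a" "0 \<le> t"
  shows "measure (dilate_measure t a M) (polar_tail s D) = t * measure M (polar_tail (s / a) D)"
  using assms by (simp add: measure_def emeasure_dilate_measure scaleR_mem_polar_tail enn2real_mult)

lemma measure_dilate_norm_gt:
  fixes M :: "'a::euclidean_space measure"
  assumes "sets M = sets borel" "0 < a" "0 \<le> t"
  shows "measure (dilate_measure t a M) {x. norm x > s} = t * measure M {x. norm x > s / a}"
proof -
  have "{x::'a. a *\<^sub>R x \<in> {x. norm x > s}} = {x. norm x > s / a}"
    using assms(2) by (auto simp: field_simps)
  then show ?thesis using assms by (simp add: measure_def emeasure_dilate_measure enn2real_mult)
qed

text \<open>The rescaled variables are infinitely divisible with dilated Levy measures, so their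
  weak limit forces convergence of the tails of \<open>dilate_measure\<close>. These are exactly the
  scaled tails of \<open>M\<close> required by \<open>RV0_of_scaled_tails\<close>.\<close>

theorem weak_limit_imp_RV0:
  fixes P :: "'w measure" and X :: "real \<Rightarrow> 'w \<Rightarrow> 'a::euclidean_space"
  assumes eta: "0 < \<eta>" "\<eta> < 2" and \<sigma>: "sphere_measure \<sigma>"
    and levy: "levy_process P X" and M: "Mclass 0 M" and X1: "is_ID0 M b (distr P borel (X 1))"
    and a: "\<And>t. 0 < t \<Longrightarrow> 0 < a t" and \<nu>: "is_ID0 (stable_levy \<eta> \<sigma>) 0 \<nu>"
    and conv: "weak_conv_on (\<lambda>t. distr P borel (\<lambda>\<omega>. a t *\<^sub>R (X t \<omega> - \<zeta> t))) \<nu> (at_right 0)"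
  shows "RV0 (-\<eta>) \<sigma> M"
proof (rule RV0_of_scaled_tails[OF M \<sigma> eta(1) a])
  fix s :: real and D assume s: "0 < s" and D: "sphere_cont_set \<sigma> D"
  have S: "sets M = sets borel" using M by (simp add: Mclass_0_iff)
  have Dm: "D \<in> sets borel" using D by (simp add: sphere_cont_set_def)
  show "((\<lambda>t. t * measure M (polar_tail (s / a t) D)) \<longlongrightarrow> measure \<sigma> D * s powr (-\<eta>) / \<eta>) (at_right 0)"
    unfolding tendsto_at_iff_sequentially
  proof safe
    fix T :: "nat \<Rightarrow> real" assume T: "\<forall>n. T n \<in> {0<..} - {0}" "T \<longlonglongrightarrow> 0"
    have Tpos: "0 < T n" for n using T(1) by auto
    let ?M = "\<lambda>n. dilate_measure (T n) (a (T n)) M"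
    let ?\<mu> = "\<lambda>n. distr P borel (\<lambda>\<omega>. a (T n) *\<^sub>R (X (T n) \<omega> - \<zeta> (T n)))"
    have MM: "Mclass 0 (?M n)" for n by (rule Mclass_dilate_measure[OF M Tpos a[OF Tpos]])
    have "\<exists>\<beta>. is_ID0 (?M n) \<beta> (?\<mu> n)" for n
      using is_ID0_levy_process_rescaled[OF levy M X1 Tpos a[OF Tpos], of n n] by metis
    then obtain \<beta> where \<beta>: "\<And>n. is_ID0 (?M n) (\<beta> n) (?\<mu> n)" by metis
    have weak: "(\<lambda>n. \<integral>x. f x \<partial>?\<mu> n) \<longlonglongrightarrow> (\<integral>x. f x \<partial>\<nu>)"
      if "continuous_on UNIV f" "bounded (range f)" for f :: "'a \<Rightarrow> real"
    proof -
      have "((\<lambda>t. \<integral>x. f x \<partial>distr P borel (\<lambda>\<omega>. a t *\<^sub>R (X t \<omega> - \<zeta> t))) \<longlongrightarrow> (\<integral>x. f x \<partial>\<nu>)) (at_right 0)"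
        using conv that by (simp add: weak_conv_on_def)
      then show ?thesis using T unfolding tendsto_at_iff_sequentially comp_def by blast
    qed
    have "(\<lambda>n. measure (?M n) (polar_tail s D)) \<longlonglongrightarrow> measure (stable_levy \<eta> \<sigma>) (polar_tail s D)"
      by (rule polar_tail_limit[OF MM \<sigma> eta _ D s])
        (rule ID_weak_limit_levy_measure[OF MM Mclass_stable_levy[OF \<sigma> eta] \<beta> \<nu> weak])
    then show "((\<lambda>t. t * measure M (polar_tail (s / a t) D)) \<circ> T) \<longlonglongrightarrow> measure \<sigma> D * s powr (-\<eta>) / \<eta>"
      using eta s by (simp add: comp_def measure_dilate_polar_tail[OF S Dm a[OF Tpos] less_imp_le[OF Tpos]]
          measure_stable_levy_polar_tail[OF \<sigma> eta(1) s Dm])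
  qed
qed

text \<open>Dyadic shells: where \<open>s / 2 ^ Suc k < norm x \<le> s / 2 ^ k\<close> the square is
  at most \<open>s\<^sup>2 / 4 ^ k\<close>, while the mass of the shell grows at most like
  \<open>q ^ k\<close>. The condition \<open>q < 4\<close> makes the series a convergent geometric
  one.\<close>

lemma (in levy_measure) small_jumps_bound:
  assumes s: "0 < s" and q: "0 < q" "q < 4" and K: "0 \<le> K"
    and le: "\<And>k. measure M {x. norm x > s / 2 ^ Suc k} \<le> K * q ^ k"
  shows "(\<integral>x. indicator {x. norm x \<le> s} x * min ((norm x)\<^sup>2) 1 \<partial>M) \<le> s\<^sup>2 * K / (1 - q / 4)"
proof -
  note [measurable_cong] = sets_M
  have le_suminf: "F k \<le> (\<Sum>i. F i)" for F :: "nat \<Rightarrow> ennreal" and k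
    using sum_le_suminf[OF summableI, of "{k}" F] by simp
  have "(\<integral>\<^sup>+x. ennreal (indicator {x. norm x \<le> s} x * min ((norm x)\<^sup>2) 1) \<partial>M) \<le>
      (\<integral>\<^sup>+x. (\<Sum>k. ennreal (s\<^sup>2 / 4 ^ k) * indicator {x. norm x > s / 2 ^ Suc k} x) \<partial>M)"
  proof (intro nn_integral_mono)
    fix x :: 'a
    show "ennreal (indicator {x. norm x \<le> s} x * min ((norm x)\<^sup>2) 1) \<le> (\<Sum>k. ennreal (s\<^sup>2 / 4 ^ k) * indicator {x. norm x > s / 2 ^ Suc k} x)"
    proof (cases "0 < norm x \<and> norm x \<le> s")
      case True
      then have "1 \<le> s / norm x" by simp
      then obtain k where k: "2 ^ k \<le> s / norm x" "s / norm x < 2 ^ Suc k" using dyadic_bracket by blast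
      have "norm x \<le> s / 2 ^ k" using k(1) True by (simp add: field_simps)
      then have "(norm x)\<^sup>2 \<le> (s / 2 ^ k)\<^sup>2" by (intro power_mono) auto
      also have "(s / 2 ^ k)\<^sup>2 = s\<^sup>2 / 4 ^ k" by (simp add: power_divide power_mult[symmetric] mult.commute[of k 2] power_mult)
      finally have "ennreal (indicator {x. norm x \<le> s} x * min ((norm x)\<^sup>2) 1) \<le> ennreal (s\<^sup>2 / 4 ^ k)"
        by (intro ennreal_leI) (auto simp: indicator_def)
      also have "\<dots> = ennreal (s\<^sup>2 / 4 ^ k) * indicator {x. norm x > s / 2 ^ Suc k} x"
        using k(2) True by (simp add: field_simps)
      also have "\<dots> \<le> (\<Sum>k. ennreal (s\<^sup>2 / 4 ^ k) * indicator {x. norm x > s / 2 ^ Suc k} x)"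
        by (rule le_suminf)
      finally show ?thesis .
    next
      case False
      then have "indicator {x. norm x \<le> s} x * min ((norm x)\<^sup>2) 1 = 0" by (auto simp: indicator_def)
      then show ?thesis by (simp only: ennreal_0 zero_le)
    qed
  qed
  also have "\<dots> = (\<Sum>k. ennreal (s\<^sup>2 / 4 ^ k) * emeasure M {x. norm x > s / 2 ^ Suc k})"
    by (subst nn_integral_suminf) (simp_all add: nn_integral_cmult_indicator sets_M)
  also have "\<dots> \<le> (\<Sum>k. ennreal (s\<^sup>2 * K * (q / 4) ^ k))"
  proof (intro suminf_le summableI)
    fix k
    have "emeasure M {x. norm x > s / 2 ^ Suc k} = ennreal (measure M {x. norm x > s / 2 ^ Suc k})"
      using emeasure_norm_gt_finite[of "s / 2 ^ Suc k"] s by (intro emeasure_eq_ennreal_measure) auto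
    also have "\<dots> \<le> ennreal (K * q ^ k)" by (intro ennreal_leI le)
    finally have "ennreal (s\<^sup>2 / 4 ^ k) * emeasure M {x. norm x > s / 2 ^ Suc k} \<le> ennreal (s\<^sup>2 / 4 ^ k) * ennreal (K * q ^ k)"
      by (intro mult_left_mono) auto
    also have "\<dots> = ennreal (s\<^sup>2 * K * (q / 4) ^ k)"
      using K q by (subst ennreal_mult[symmetric]) (auto simp: power_divide)
    finally show "ennreal (s\<^sup>2 / 4 ^ k) * emeasure M {x. norm x > s / 2 ^ Suc k} \<le> ennreal (s\<^sup>2 * K * (q / 4) ^ k)" .
  qed
  also have "\<dots> = ennreal (s\<^sup>2 * K * (1 / (1 - q / 4)))"
    using K q by (intro suminf_ennreal_eq sums_mult geometric_sums) auto
  finally have "(\<integral>\<^sup>+x. ennreal (indicator {x. norm x \<le> s} x * min ((norm x)\<^sup>2) 1) \<partial>M) \<le> ennreal (s\<^sup>2 * K / (1 - q / 4))" by simp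
  moreover have "(\<integral>\<^sup>+x. ennreal (indicator {x. norm x \<le> s} x * min ((norm x)\<^sup>2) 1) \<partial>M) =
      ennreal (\<integral>x. indicator {x. norm x \<le> s} x * min ((norm x)\<^sup>2) 1 \<partial>M)"
    by (rule nn_integral_eq_integral[OF integrable_small]) auto
  moreover have "0 \<le> s\<^sup>2 * K / (1 - q / 4)" using K q by simp
  ultimately show ?thesis by simp
qed

text \<open>Space is normalised by the asymptotic inverse of the tail at height
  \<open>c0 / t\<close>, which gives the scaled full tail the right limit at level 1. Regular
  variation supplies all other levels and directions, a Potter bound the small jumps.\<close>

theorem RV0_imp_weak_limit:
  fixes P :: "'w measure" and X :: "real \<Rightarrow> 'w \<Rightarrow> 'a::euclidean_space"
  assumes eta: "0 < \<eta>" "\<eta> < 2" and \<sigma>: "sphere_measure \<sigma>"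
    and levy: "levy_process P X" and M: "Mclass 0 M" and X1: "is_ID0 M b (distr P borel (X 1))"
    and \<nu>: "is_ID0 (stable_levy \<eta> \<sigma>) 0 \<nu>" and RV: "RV0 (-\<eta>) \<sigma> M"
  obtains a \<zeta> where "\<And>t. 0 < t \<Longrightarrow> 0 < a t"
    "weak_conv_on (\<lambda>t. distr P borel (\<lambda>\<omega>. a t *\<^sub>R (X t \<omega> - \<zeta> t))) \<nu> (at_right 0)"
proof -
  define U where "U r = measure M {x. norm x > r}" for r
  interpret U: regularly_varying_tail U \<eta>
    unfolding U_def[abs_def] by (rule RV0_regularly_varying_tail[OF RV \<sigma> eta(1)])
  define c0 where "c0 = measure \<sigma> (sphere 0 1) / \<eta>"
  have c0: "0 < c0" using sphere_measure_pos[OF \<sigma>] eta by (simp add: c0_def)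
  have S: "sets M = sets borel" using M by (simp add: Mclass_0_iff)
  obtain \<rho> where \<rho>: "\<And>t. 0 < t \<Longrightarrow> 0 < \<rho> t" "filterlim \<rho> (at_right 0) (at_right 0)" "((\<lambda>t. t * U (\<rho> t)) \<longlongrightarrow> c0) (at_right 0)"
    using U.asymptotic_inverse[OF c0] by blast
  define a where "a t = 1 / \<rho> t" for t
  have a: "0 < a t" if "0 < t" for t using \<rho>(1)[OF that] by (simp add: a_def)
  have "\<exists>\<zeta>. 0 < t \<longrightarrow> is_ID0 (dilate_measure t (a t) M) 0 (distr P borel (\<lambda>\<omega>. a t *\<^sub>R (X t \<omega> - \<zeta>)))" for t
  proof (cases "0 < t")
    case True
    obtain \<beta> where "\<And>\<zeta>. is_ID0 (dilate_measure t (a t) M) (\<beta> - a t *\<^sub>R \<zeta>) (distr P borel (\<lambda>\<omega>. a t *\<^sub>R (X t \<omega> - \<zeta>)))"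
      using is_ID0_levy_process_rescaled[OF levy M X1 True a[OF True]] by blast
    \<comment> \<open>Centring at \<open>\<beta>\<close> divided by \<open>a t\<close> cancels the
      drift, so every rescaled law has drift 0, like the limit.\<close>
    from this[of "(1 / a t) *\<^sub>R \<beta>"] show ?thesis using a[OF True] by auto
  qed auto
  then obtain \<zeta> where \<zeta>: "\<And>t. 0 < t \<Longrightarrow> is_ID0 (dilate_measure t (a t) M) 0 (distr P borel (\<lambda>\<omega>. a t *\<^sub>R (X t \<omega> - \<zeta> t)))"
    by metis
  have tpos: "\<forall>\<^sub>F t in at_right 0. (0::real) < t" by (rule eventually_at_right_less)
  have Upos: "\<forall>\<^sub>F t in at_right 0. 0 < U (\<rho> t)" using U.pos \<rho>(2) by (rule filterlim_iff[THEN iffD1, rule_format, rotated])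
  have tails: "((\<lambda>t. t * measure M (polar_tail (s / a t) D)) \<longlongrightarrow> measure \<sigma> D * s powr (-\<eta>) / \<eta>) (at_right 0)"
    if "0 < s" "sphere_cont_set \<sigma> D" for s D
  proof -
    have "((\<lambda>r. measure M (polar_tail (r * s) D) / U r) \<longlongrightarrow> s powr (-\<eta>) * measure \<sigma> D / measure \<sigma> (sphere 0 1)) (at_right 0)"
      using RV that unfolding RV0_iff U_def by blast
    from filterlim_compose[OF this \<rho>(2)]
    have "((\<lambda>t. (t * U (\<rho> t)) * (measure M (polar_tail (\<rho> t * s) D) / U (\<rho> t))) \<longlongrightarrow> c0 * (s powr (-\<eta>) * measure \<sigma> D / measure \<sigma> (sphere 0 1))) (at_right 0)"
      by (intro tendsto_mult \<rho>(3))
    also have "c0 * (s powr (-\<eta>) * measure \<sigma> D / measure \<sigma> (sphere 0 1)) = measure \<sigma> D * s powr (-\<eta>) / \<eta>"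
      using sphere_measure_pos[OF \<sigma>] by (simp add: c0_def)
    finally show ?thesis
    proof (rule Lim_transform_eventually)
      show "\<forall>\<^sub>F t in at_right 0. (t * U (\<rho> t)) * (measure M (polar_tail (\<rho> t * s) D) / U (\<rho> t)) = t * measure M (polar_tail (s / a t) D)"
        using Upos by eventually_elim (simp add: a_def mult.commute)
    qed
  qed
  \<comment> \<open>The exponent lies midway between \<open>\<eta>\<close> and 2: above
    \<open>\<eta>\<close> for the Potter bound, below 2 so that \<open>q < 4\<close> in the dyadic
    sum.\<close>
  define q where "q = 2 powr ((\<eta> + 2) / 2)"
  have q: "1 < q" "q < 4"
  proof -
    have "q < 2 powr 2" unfolding q_def using eta by (intro powr_less_mono) auto
    then show "q < 4" by simp
    show "1 < q" unfolding q_def using eta by simp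
  qed
  obtain r0 where r0: "0 < r0" "\<And>r t. 0 < r \<Longrightarrow> r < r0 \<Longrightarrow> 1 \<le> t \<Longrightarrow> U (r / t) \<le> q * t powr ((\<eta> + 2) / 2) * U r"
    using U.potter_upper[of "(\<eta> + 2) / 2"] eta unfolding q_def by auto
  have small: "\<forall>\<^sub>F t in at_right 0. (\<integral>x. indicator {x. norm x \<le> s} x * min ((norm x)\<^sup>2) 1 \<partial>dilate_measure t (a t) M) \<le> 2 * c0 * q\<^sup>2 / (1 - q / 4) * s powr (2 - \<eta>)"
    if s: "0 < s" for s
  proof -
    have "((\<lambda>t. t * measure M (polar_tail (s / a t) (sphere 0 1))) \<longlongrightarrow> c0 * s powr (-\<eta>)) (at_right 0)"
      using tails[OF s sphere_cont_set_sphere] by (simp add: c0_def)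
    from order_tendstoD(2)[OF this, of "2 * c0 * s powr (-\<eta>)"]
    have ev1: "\<forall>\<^sub>F t in at_right 0. t * measure M (polar_tail (s / a t) (sphere 0 1)) < 2 * c0 * s powr (-\<eta>)"
      using c0 s by simp
    have "\<forall>\<^sub>F r in at_right 0. r < r0 / s"
      using eventually_at_right_real[of 0 "r0 / s"] r0(1) s by (auto elim: eventually_mono)
    then have "\<forall>\<^sub>F t in at_right 0. \<rho> t < r0 / s" using \<rho>(2) by (rule filterlim_iff[THEN iffD1, rule_format, rotated])
    with ev1 tpos show ?thesis
    proof eventually_elim
      case (elim t)
      interpret D: levy_measure "dilate_measure t (a t) M"
        by unfold_locales (rule Mclass_dilate_measure[OF M elim(2) a[OF elim(2)]])
      have r: "0 < s / a t" "s / a t < r0" using elim \<rho>(1)[OF elim(2)] s by (auto simp: a_def field_simps)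
      have tU: "t * U (s / a t) \<le> 2 * c0 * s powr (-\<eta>)"
        using elim(1) r(1) by (simp add: polar_tail_sphere U_def)
      \<comment> \<open>Two factors \<open>q\<close> stand outside the geometric term: one is the
        Potter prefactor, the other comes from \<open>2 ^ Suc k\<close> in place of
        \<open>2 ^ k\<close>.\<close>
      have "(\<integral>x. indicator {x. norm x \<le> s} x * min ((norm x)\<^sup>2) 1 \<partial>dilate_measure t (a t) M) \<le> s\<^sup>2 * (q\<^sup>2 * (2 * c0 * s powr (-\<eta>))) / (1 - q / 4)"
      proof (rule D.small_jumps_bound[OF s])
        fix k
        have "measure (dilate_measure t (a t) M) {x. norm x > s / 2 ^ Suc k} = t * U ((s / a t) / 2 ^ Suc k)"
          using measure_dilate_norm_gt[OF S a[OF elim(2)] less_imp_le[OF elim(2)], of "s / 2 ^ Suc k"] by (simp add: U_def mult.commute)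
        also have "\<dots> \<le> t * (q * (2 ^ Suc k) powr ((\<eta> + 2) / 2) * U (s / a t))"
        proof (intro mult_left_mono r0(2)[OF r])
          show "(1::real) \<le> 2 ^ Suc k" by (rule one_le_power) simp
        qed (use elim in simp)
        also have "((2::real) ^ Suc k) powr ((\<eta> + 2) / 2) = q ^ Suc k"
        proof -
          have "(2::real) ^ Suc k = 2 powr real (Suc k)" by (rule powr_realpow[symmetric]) simp
          moreover have "q ^ Suc k = 2 powr ((\<eta> + 2) / 2 * real (Suc k))"
            unfolding q_def by (subst powr_power) (auto simp: mult.commute)
          ultimately show ?thesis by (simp only: powr_powr mult.commute)
        qed
        also have "t * (q * q ^ Suc k * U (s / a t)) = q\<^sup>2 * (t * U (s / a t)) * q ^ k" by (simp add: power2_eq_square)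
        also have "\<dots> \<le> q\<^sup>2 * (2 * c0 * s powr (-\<eta>)) * q ^ k"
          using tU q by (intro mult_right_mono mult_left_mono) auto
        finally show "measure (dilate_measure t (a t) M) {x. norm x > s / 2 ^ Suc k} \<le> q\<^sup>2 * (2 * c0 * s powr (-\<eta>)) * q ^ k" .
      qed (use q c0 in auto)
      also have "s\<^sup>2 * (q\<^sup>2 * (2 * c0 * s powr (-\<eta>))) / (1 - q / 4) = 2 * c0 * q\<^sup>2 / (1 - q / 4) * (s powr 2 * s powr (-\<eta>))"
        using s by simp
      also have "s powr 2 * s powr (-\<eta>) = s powr (2 - \<eta>)" using s by (simp add: powr_add[symmetric] del: powr_numeral)
      finally show ?case .
    qed
  qed
  have "weak_conv_on (\<lambda>t. distr P borel (\<lambda>\<omega>. a t *\<^sub>R (X t \<omega> - \<zeta> t))) \<nu> (at_right 0)"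
    unfolding weak_conv_on_def tendsto_at_iff_sequentially
  proof safe
    fix f :: "'a \<Rightarrow> real" and T :: "nat \<Rightarrow> real"
    assume f: "continuous_on UNIV f" "bounded (range f)" and T: "\<forall>n. T n \<in> {0<..} - {0}" "T \<longlonglongrightarrow> 0"
    have Tpos: "0 < T n" for n using T(1) by auto
    have T0: "filterlim T (at_right 0) sequentially" unfolding filterlim_at using T(2) Tpos by (auto intro!: always_eventually simp: less_imp_neq[OF Tpos, symmetric])
    let ?M = "\<lambda>n. dilate_measure (T n) (a (T n)) M"
    let ?\<mu> = "\<lambda>n. distr P borel (\<lambda>\<omega>. a (T n) *\<^sub>R (X (T n) \<omega> - \<zeta> (T n)))"
    let ?L = "stable_levy \<eta> \<sigma>"
    have McL: "Mclass 0 ?L" by (rule Mclass_stable_levy[OF \<sigma> eta])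
    interpret C: polar_tail_convergence ?M ?L \<sigma>
    proof
      show "Mclass 0 (?M n)" for n by (rule Mclass_dilate_measure[OF M Tpos a[OF Tpos]])
      show "(\<lambda>n. measure (?M n) (polar_tail s D)) \<longlonglongrightarrow> measure ?L (polar_tail s D)"
        if s: "0 < s" and D: "sphere_cont_set \<sigma> D" for s D
      proof -
        have Dm: "D \<in> sets borel" using D by (simp add: sphere_cont_set_def)
        show ?thesis
          unfolding measure_dilate_polar_tail[OF S Dm a[OF Tpos] less_imp_le[OF Tpos]] measure_stable_levy_polar_tail[OF \<sigma> eta(1) s Dm]
          by (rule filterlim_compose[OF tails[OF s D] T0])
      qed
    qed (rule McL \<sigma>)+
    have expo: "(\<lambda>n. levy_exponent (?M n) z) \<longlonglongrightarrow> levy_exponent ?L z" for z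
    proof (rule C.levy_exponent_limit)
      fix e :: real assume "0 < e"
      \<comment> \<open>The bound from \<open>small\<close> tends to 0 with \<open>s\<close> because
        \<open>2 - \<eta>\<close> is positive, so that \<open>0 powr (2 - \<eta>)\<close> is the
        true limit of the powers.\<close>
      have "((\<lambda>s. 2 * c0 * q\<^sup>2 / (1 - q / 4) * s powr (2 - \<eta>)) \<longlongrightarrow> 2 * c0 * q\<^sup>2 / (1 - q / 4) * 0 powr (2 - \<eta>)) (at_right 0)"
        using eta by (intro tendsto_intros tendsto_powr') (auto simp: eventually_at_right_0_real intro!: exI[of _ 1])
      from order_tendstoD(2)[OF this, of e] \<open>0 < e\<close>
      have "\<forall>\<^sub>F s in at_right 0. 2 * c0 * q\<^sup>2 / (1 - q / 4) * s powr (2 - \<eta>) < e" by simp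
      then obtain s0 where s0: "0 < s0" "\<And>s. 0 < s \<Longrightarrow> s < s0 \<Longrightarrow> 2 * c0 * q\<^sup>2 / (1 - q / 4) * s powr (2 - \<eta>) < e"
        unfolding eventually_at_right_0_real by blast
      have "\<forall>\<^sub>F n in sequentially. (\<integral>x. indicator {x. norm x \<le> inverse (real (Suc n))} x * min ((norm x)\<^sup>2) 1 \<partial>?L) < e \<and> inverse (real (Suc n)) < s0"
        using order_tendstoD(2)[OF levy_measure.small_jumps_tendsto_0[OF C.levy_L] \<open>0 < e\<close>]
          order_tendstoD(2)[OF LIMSEQ_inverse_real_of_nat s0(1)] by (rule eventually_conj)
      then obtain n where n: "(\<integral>x. indicator {x. norm x \<le> inverse (real (Suc n))} x * min ((norm x)\<^sup>2) 1 \<partial>?L) < e" "inverse (real (Suc n)) < s0"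
        by (auto simp: eventually_sequentially)
      define s where "s = inverse (real (Suc n))"
      have s: "0 < s" "s < s0" using n(2) by (auto simp: s_def)
      have "\<forall>\<^sub>F n in sequentially. (\<integral>x. indicator {x. norm x \<le> s} x * min ((norm x)\<^sup>2) 1 \<partial>?M n) \<le> 2 * c0 * q\<^sup>2 / (1 - q / 4) * s powr (2 - \<eta>)"
        using small[OF s(1)] T0 by (rule filterlim_iff[THEN iffD1, rule_format, rotated])
      then have "\<forall>\<^sub>F n in sequentially. (\<integral>x. indicator {x. norm x \<le> s} x * min ((norm x)\<^sup>2) 1 \<partial>?M n) \<le> e"
        using s0(2)[OF s] by (auto elim!: eventually_mono)
      then show "\<exists>s>0. (\<forall>\<^sub>F n in sequentially. (\<integral>x. indicator {x. norm x \<le> s} x * min ((norm x)\<^sup>2) 1 \<partial>?M n) \<le> e) \<and>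
          (\<integral>x. indicator {x. norm x \<le> s} x * min ((norm x)\<^sup>2) 1 \<partial>?L) \<le> e"
        using n(1) s(1) unfolding s_def by (intro exI[of _ "inverse (real (Suc n))"]) auto
    qed
    have ID: "is_ID0 (?M n) 0 (?\<mu> n)" for n by (rule \<zeta>[OF Tpos])
    have cfc: "(\<lambda>n. cf (?\<mu> n) z) \<longlonglongrightarrow> cf \<nu> z" for z
    proof -
      have "cf (?\<mu> n) z = exp (levy_exponent (?M n) z)" for n using ID by (simp add: is_ID0_iff)
      moreover have "cf \<nu> z = exp (levy_exponent ?L z)" using \<nu> by (simp add: is_ID0_iff)
      ultimately show ?thesis by (simp only:) (intro tendsto_exp expo)
    qed
    have fin: "finite_measure (?\<mu> n)" "sets (?\<mu> n) = sets borel" "finite_measure \<nu>" "sets \<nu> = sets borel" for n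
      using ID \<nu> by (auto simp: is_ID0_iff prob_space.finite_measure)
    obtain B where "\<And>x. \<bar>f x\<bar> \<le> B" using f(2) unfolding bounded_iff by auto
    then show "((\<lambda>t. \<integral>x. f x \<partial>distr P borel (\<lambda>\<omega>. a t *\<^sub>R (X t \<omega> - \<zeta> t))) \<circ> T) \<longlonglongrightarrow> (\<integral>x. f x \<partial>\<nu>)"
      unfolding comp_def by (intro levy_continuity_euclidean[OF fin cfc f(1)])
  qed
  then show ?thesis using that a by blast
qed

subsection \<open>Existence of infinitely divisible laws\<close>

lemma prob_cf_mult:
  fixes \<mu> \<nu> :: "'a::euclidean_space measure"
  assumes \<mu>: "prob_space \<mu>" "sets \<mu> = sets borel" and \<nu>: "prob_space \<nu>" "sets \<nu> = sets borel"
  obtains \<xi> :: "'a measure" where "prob_space \<xi>" "sets \<xi> = sets borel" "\<And>z. cf \<xi> z = cf \<mu> z * cf \<nu> z"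
proof -
  interpret pair_prob_space \<mu> \<nu>
    using \<mu>(1) \<nu>(1) by (simp add: pair_prob_space_def pair_sigma_finite_def prob_space_imp_sigma_finite)
  note [measurable_cong] = \<mu>(2) \<nu>(2)
  let ?\<xi> = "distr (\<mu> \<Otimes>\<^sub>M \<nu>) borel (\<lambda>p. fst p + snd p)"
  have "cf ?\<xi> z = cf \<mu> z * cf \<nu> z" for z
  proof -
    have "cf ?\<xi> z = (CLINT p|(\<mu> \<Otimes>\<^sub>M \<nu>). iexp (z \<bullet> fst p) * iexp (z \<bullet> snd p))"
      by (subst cf_distr) (auto simp: exp_add[symmetric] inner_add_right algebra_simps)
    also have "\<dots> = (CLINT x|\<mu>. CLINT y|\<nu>. iexp (z \<bullet> x) * iexp (z \<bullet> y))"
      by (subst integral_fst'[symmetric]) (auto intro!: P.integrable_const_bound[where B=1] simp: norm_mult)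
    also have "\<dots> = cf \<mu> z * cf \<nu> z" by (simp add: cf_def)
    finally show ?thesis .
  qed
  moreover have "prob_space ?\<xi>" by (rule P.prob_space_distr) measurable
  ultimately show ?thesis using that[of ?\<xi>] by simp
qed

lemma prob_return_borel: "prob_space (return borel (x::'a::euclidean_space))"
  by (rule prob_space_return) simp

lemma cf_return: "cf (return borel (x::'a::euclidean_space)) z = iexp (z \<bullet> x)"
  unfolding cf_def by (subst integral_return) auto

lemma prob_cf_power:
  fixes \<mu> :: "'a::euclidean_space measure"
  assumes \<mu>: "prob_space \<mu>" "sets \<mu> = sets borel"
  shows "\<exists>\<xi> :: 'a measure. prob_space \<xi> \<and> sets \<xi> = sets borel \<and> (\<forall>z. cf \<xi> z = cf \<mu> z ^ n)"
proof (induction n)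
  case 0
  show ?case using prob_return_borel[of "0::'a"] by (intro exI[of _ "return borel 0"]) (simp add: cf_return)
next
  case (Suc n)
  then obtain \<xi> :: "'a measure" where \<xi>: "prob_space \<xi>" "sets \<xi> = sets borel" "\<And>z. cf \<xi> z = cf \<mu> z ^ n" by blast
  obtain \<xi>' :: "'a measure" where "prob_space \<xi>'" "sets \<xi>' = sets borel" "\<And>z. cf \<xi>' z = cf \<mu> z * cf \<xi> z"
    using prob_cf_mult[OF \<mu> \<xi>(1,2)] by blast
  then show ?case using \<xi>(3) by auto
qed

text \<open>The mixture of the convolution powers \<open>\<nu> n\<close> with Poisson weights,
  realised by drawing an index from \<open>N\<close> and evaluating that coordinate of an
  independent family. The exponential series then gives the transform.\<close>

lemma compound_poisson_prob:
  fixes \<mu> :: "'a::euclidean_space measure"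
  assumes \<mu>: "prob_space \<mu>" "sets \<mu> = sets borel" and l: "0 < l"
  obtains \<xi> :: "'a measure" where "prob_space \<xi>" "sets \<xi> = sets borel" "\<And>z. cf \<xi> z = exp (complex_of_real l * (cf \<mu> z - 1))"
proof -
  obtain \<nu> :: "nat \<Rightarrow> 'a measure" where \<nu>: "\<And>n. prob_space (\<nu> n)" "\<And>n. sets (\<nu> n) = sets borel" "\<And>n z. cf (\<nu> n) z = cf \<mu> z ^ n"
    using prob_cf_power[OF \<mu>] by metis
  note [measurable_cong] = \<nu>(2)
  define N where "N = measure_pmf (poisson_pmf l)"
  define Q where "Q = Pi\<^sub>M (UNIV :: nat set) \<nu>"
  interpret N: prob_space N unfolding N_def by (rule measure_pmf.prob_space_axioms)
  interpret Q: prob_space Q unfolding Q_def by (rule prob_space_PiM) (rule \<nu>(1))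
  interpret NQ: pair_prob_space N Q ..
  have sN: "sets N = UNIV" by (simp add: N_def)
  have comp: "(\<lambda>\<omega>. \<omega> n) \<in> measurable Q borel" for n
    unfolding Q_def using measurable_component_singleton[of n UNIV \<nu>] by (simp add: measurable_cong_sets[OF refl \<nu>(2)])
  \<comment> \<open>Evaluation at a random index is measurable because the index set is
    countable.\<close>
  have Y: "(\<lambda>p. snd p (fst p)) \<in> measurable (N \<Otimes>\<^sub>M Q) borel"
  proof -
    have "(\<lambda>p. (\<lambda>n p. snd p n) (fst p) p) \<in> measurable (N \<Otimes>\<^sub>M Q) borel"
    proof (rule measurable_compose_countable)
      show "fst \<in> measurable (N \<Otimes>\<^sub>M Q) (count_space UNIV)"
        using measurable_fst[of N Q] by (simp add: measurable_cong_sets[OF refl, of "count_space UNIV" N] sN)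
      show "(\<lambda>p. snd p n) \<in> measurable (N \<Otimes>\<^sub>M Q) borel" for n
        using measurable_compose[OF measurable_snd comp] .
    qed
    then show ?thesis by simp
  qed
  let ?\<xi> = "distr (N \<Otimes>\<^sub>M Q) borel (\<lambda>p. snd p (fst p))"
  have inner: "(CLINT \<omega>|Q. iexp (z \<bullet> \<omega> n)) = cf \<mu> z ^ n" for n z
  proof -
    have "distr Q (\<nu> n) (\<lambda>\<omega>. \<omega> n) = \<nu> n" unfolding Q_def by (rule distr_PiM_component) (auto intro: \<nu>(1))
    then have "distr Q borel (\<lambda>\<omega>. \<omega> n) = \<nu> n" using distr_cong[OF refl \<nu>(2)[symmetric], of Q "\<lambda>\<omega>. \<omega> n" "\<lambda>\<omega>. \<omega> n" n] by simp
    then show ?thesis using cf_distr[OF comp, of n z] \<nu>(3) by simp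
  qed
  have "cf ?\<xi> z = exp (complex_of_real l * (cf \<mu> z - 1))" for z
  proof -
    let ?\<phi> = "cf \<mu> z"
    have \<phi>: "cmod ?\<phi> \<le> 1"
      using norm_cf_le[of \<mu> z] \<mu> prob_space.prob_space[OF \<mu>(1)] by (simp add: prob_space.finite_measure)
    have "cf ?\<xi> z = (CLINT p|(N \<Otimes>\<^sub>M Q). iexp (z \<bullet> snd p (fst p)))" by (rule cf_distr[OF Y])
    also have "\<dots> = (CLINT n|N. CLINT \<omega>|Q. iexp (z \<bullet> \<omega> n))"
      using Y by (subst NQ.integral_fst'[symmetric]) (auto intro!: NQ.P.integrable_const_bound[where B=1] borel_measurable_inner)
    also have "\<dots> = (CLINT n|N. ?\<phi> ^ n)" unfolding inner ..
    also have "\<dots> = (CLINT n|count_space UNIV. pmf (poisson_pmf l) n *\<^sub>R ?\<phi> ^ n)"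
      unfolding N_def measure_pmf_eq_density by (subst integral_density) auto
    also have "\<dots> = (CLINT n|count_space UNIV. exp (- complex_of_real l) * ((complex_of_real l * ?\<phi>) ^ n /\<^sub>R fact n))"
      using l by (intro Bochner_Integration.integral_cong)
        (simp_all add: scaleR_conv_of_real exp_of_real[symmetric] power_mult_distrib field_simps)
    also have "\<dots> = exp (- complex_of_real l) * (CLINT n|count_space UNIV. (complex_of_real l * ?\<phi>) ^ n /\<^sub>R fact n)"
      by (rule integral_mult_right_zero)
    also have "(CLINT n|count_space UNIV. (complex_of_real l * ?\<phi>) ^ n /\<^sub>R fact n) = exp (complex_of_real l * ?\<phi>)"
    proof -
      have "integrable (count_space UNIV) (\<lambda>n. (complex_of_real l * ?\<phi>) ^ n /\<^sub>R fact n)"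
        unfolding integrable_count_space_nat_iff by (rule summable_norm_exp)
      from sums_unique2[OF sums_integral_count_space_nat[OF this] exp_converges] show ?thesis .
    qed
    also have "exp (- complex_of_real l) * exp (complex_of_real l * ?\<phi>) = exp (complex_of_real l * (?\<phi> - 1))"
      by (simp add: exp_add[symmetric] algebra_simps)
    finally show ?thesis .
  qed
  moreover have "prob_space ?\<xi>" by (rule NQ.P.prob_space_distr[OF Y])
  ultimately show ?thesis using that[of ?\<xi>] by simp
qed

text \<open>For finite mass \<open>l\<close> the exponent splits into \<open>cf m z - l\<close> and
  a linear term: a compound Poisson law with intensity \<open>l\<close> and jump law
  \<open>m / l\<close>, shifted by \<open>- c\<close> to account for the centring.\<close>

lemma finite_levy_measure_ID0:
  fixes m :: "'a::euclidean_space measure"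
  assumes m: "finite_measure m" "sets m = sets borel"
  shows "\<exists>\<mu>. is_ID0 m 0 \<mu>"
proof -
  interpret finite_measure m by fact
  note [measurable_cong] = m(2)
  define l where "l = measure m (space m)"
  have i1: "complex_integrable m (\<lambda>x. iexp (z \<bullet> x))" for z
    by (rule integrable_finite_bounded[OF m, where B=1]) auto
  have bnd: "norm ((1 / (1 + (norm x)\<^sup>2)) *\<^sub>R x) \<le> 1" for x :: 'a
  proof -
    have "2 * norm x \<le> (norm x)\<^sup>2 + 1" using sum_squares_bound[of "norm x" 1] by simp
    then have "norm x \<le> 1 + (norm x)\<^sup>2" using norm_ge_zero[of x] by linarith
    then show ?thesis by (simp add: divide_le_eq add_pos_nonneg)
  qed
  define g where "g x = (1 / (1 + (norm x)\<^sup>2)) *\<^sub>R x" for x :: 'a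
  have i2: "integrable m g"
    unfolding g_def by (rule integrable_finite_bounded[OF m _ bnd]) measurable
  define c where "c = (\<integral>x. g x \<partial>m)"
  have expo: "levy_exponent m z = (cf m z - complex_of_real l) + iexp_arg" if "iexp_arg = \<i> * complex_of_real (z \<bullet> (- c))" for z iexp_arg
  proof -
    have k: "levy_kernel z x = iexp (z \<bullet> x) - 1 - \<i> * complex_of_real (g x \<bullet> z)" for x
      by (simp add: levy_kernel_def g_def inner_commute)
    have "levy_exponent m z = cf m z - complex_of_real l - \<i> * complex_of_real (c \<bullet> z)"
      unfolding levy_exponent_def k c_def cf_def l_def using i1 i2 by (simp add: scaleR_conv_of_real)
    then show ?thesis using that by (simp add: inner_commute)
  qed
  have "\<exists>\<xi> :: 'a measure. prob_space \<xi> \<and> sets \<xi> = sets borel \<and> (\<forall>z. cf \<xi> z = exp (cf m z - complex_of_real l))"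
  \<comment> \<open>With mass 0 there is no jump law to normalise; the point mass at 0 serves
    instead.\<close>
  proof (cases "l = 0")
    case True
    then have "emeasure m (space m) = 0" by (simp add: l_def emeasure_eq_measure)
    then have "AE x in m. False" by (intro AE_I[of _ _ "space m"]) auto
    then have "cf m z = 0" for z unfolding cf_def by (intro integral_eq_zero_AE) auto
    then show ?thesis using True prob_return_borel[of "0::'a"] by (intro exI[of _ "return borel 0"]) (simp add: cf_return)
  next
    case False
    then have l: "0 < l" by (simp add: l_def zero_less_measure_iff)
    let ?F = "density m (\<lambda>_. ennreal (1 / l))"
    have F: "prob_space ?F" "sets ?F = sets borel"
    proof
      show "emeasure ?F (space ?F) = 1"
        using l by (simp add: emeasure_density emeasure_eq_measure l_def[symmetric] ennreal_mult[symmetric])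
    qed (simp add: m(2))
    have cfF: "cf ?F z = cf m z / l" for z
      unfolding cf_def using l by (subst integral_density) (auto simp: scaleR_conv_of_real)
    obtain \<xi> :: "'a measure" where "prob_space \<xi>" "sets \<xi> = sets borel" "\<And>z. cf \<xi> z = exp (complex_of_real l * (cf ?F z - 1))"
      using compound_poisson_prob[OF F l] by blast
    moreover have "complex_of_real l * (cf ?F z - 1) = cf m z - complex_of_real l" for z
      unfolding cfF using l by (simp add: right_diff_distrib)
    ultimately show ?thesis by auto
  qed
  then obtain \<xi> :: "'a measure" where \<xi>: "prob_space \<xi>" "sets \<xi> = sets borel" "\<And>z. cf \<xi> z = exp (cf m z - complex_of_real l)" by blast
  obtain \<mu> :: "'a measure" where "prob_space \<mu>" "sets \<mu> = sets borel" "\<And>z. cf \<mu> z = cf \<xi> z * cf (return borel (- c)) z"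
    using prob_cf_mult[OF \<xi>(1,2) prob_return_borel[of "- c"]] by auto
  then have "is_ID0 m 0 \<mu>"
    unfolding is_ID0_iff cf_return \<xi>(3) exp_add[symmetric] using expo[OF refl] by simp
  then show ?thesis ..
qed

section \<open>Second moments of laws with small jumps and the convolution of shells\<close>

lemma second_moment_le:
  fixes \<mu> :: "'a::euclidean_space measure"
  assumes \<mu>: "prob_space \<mu>" "sets \<mu> = sets borel"
    and le: "\<And>s. 0 < s \<Longrightarrow> s \<le> 1 \<Longrightarrow> 1 - Re (cf \<mu> (s *\<^sub>R b)) \<le> K * s\<^sup>2"
  shows "(\<integral>\<^sup>+x. ennreal ((b \<bullet> x)\<^sup>2) \<partial>\<mu>) \<le> ennreal (2 * K)"
proof -
  interpret prob_space \<mu> by fact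
  note [measurable_cong] = \<mu>(2)
  have fin: "finite_measure \<mu>" by (rule finite_measure_axioms)
  define t where "t n = inverse (real (Suc n))" for n
  have t: "0 < t n" "t n \<le> 1" for n by (simp_all add: t_def inverse_le_1_iff)
  have t0: "filterlim t (at_right 0) sequentially"
    unfolding filterlim_at using t(1) LIMSEQ_inverse_real_of_nat by (auto simp: t_def[abs_def] intro!: always_eventually)
  \<comment> \<open>These quotients tend to \<open>(b \<bullet> x)\<^sup>2\<close>, and their
    integrals are controlled by \<open>1 - Re (cf \<mu> (t n *\<^sub>R b))\<close>; Fatou then
    bounds the second moment.\<close>
  define f where "f n x = 2 * (1 - cos (t n * (b \<bullet> x))) / (t n)\<^sup>2" for n x
  have fm [measurable]: "f n \<in> borel_measurable borel" for n unfolding f_def by measurable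
  have f0: "0 \<le> f n x" for n x by (simp add: f_def)
  have lim: "(\<lambda>n. f n x) \<longlonglongrightarrow> (b \<bullet> x)\<^sup>2" for x
  proof -
    have "((\<lambda>s. 2 * (1 - cos (s * y)) / s\<^sup>2) \<longlongrightarrow> y * y) (at_right 0)" for y :: real
    proof (cases y "0::real" rule: linorder_cases)
      case less then show ?thesis by real_asymp
    next
      case equal then show ?thesis by simp
    next
      case greater then show ?thesis by real_asymp
    qed
    from filterlim_compose[OF this t0] show ?thesis by (simp add: f_def power2_eq_square)
  qed
  have int: "(\<integral>\<^sup>+x. ennreal (f n x) \<partial>\<mu>) \<le> ennreal (2 * K)" for n
  proof -
    have i: "integrable \<mu> (\<lambda>x. cos ((t n *\<^sub>R b) \<bullet> x))"
      by (rule integrable_finite_bounded[OF fin \<mu>(2), where B=1]) auto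
    have Re: "Re (cf \<mu> (t n *\<^sub>R b)) = (\<integral>x. cos ((t n *\<^sub>R b) \<bullet> x) \<partial>\<mu>)"
      unfolding cf_eq_cos_sin[OF fin \<mu>(2)] by simp
    have feq: "f n x = 2 / (t n)\<^sup>2 * (1 - cos ((t n *\<^sub>R b) \<bullet> x))" for x by (simp add: f_def)
    have "integrable \<mu> (f n)" unfolding feq[abs_def] using i by simp
    then have "(\<integral>\<^sup>+x. ennreal (f n x) \<partial>\<mu>) = ennreal (\<integral>x. f n x \<partial>\<mu>)"
      by (rule nn_integral_eq_integral) (simp add: f0)
    also have "(\<integral>x. f n x \<partial>\<mu>) = 2 / (t n)\<^sup>2 * (1 - Re (cf \<mu> (t n *\<^sub>R b)))"
      unfolding feq Re using i by (simp add: prob_space)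
    also have "\<dots> \<le> 2 / (t n)\<^sup>2 * (K * (t n)\<^sup>2)"
      by (intro mult_left_mono le t) auto
    also have "\<dots> = 2 * K" using t(1)[of n] by simp
    finally show ?thesis using ennreal_leI by auto
  qed
  have "(\<integral>\<^sup>+x. ennreal ((b \<bullet> x)\<^sup>2) \<partial>\<mu>) = (\<integral>\<^sup>+x. liminf (\<lambda>n. ennreal (f n x)) \<partial>\<mu>)"
    by (intro nn_integral_cong lim_imp_Liminf[symmetric] tendsto_ennrealI lim) simp
  also have "\<dots> \<le> liminf (\<lambda>n. \<integral>\<^sup>+x. ennreal (f n x) \<partial>\<mu>)"
    by (rule nn_integral_liminf) measurable
  also have "\<dots> \<le> liminf (\<lambda>n. ennreal (2 * K))"
    by (intro Liminf_mono always_eventually allI int)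
  finally show ?thesis by (simp add: Liminf_const)
qed

text \<open>At \<open>s *\<^sub>R b\<close> the exponent has real part at most
  \<open>s\<^sup>2 * m / 2\<close> and imaginary part at most \<open>2 * s * m\<close> in modulus;
  the latter is only of first order in \<open>s\<close> because the centring is not the exact mean.
  Together they bound \<open>1 - Re (exp \<psi>)\<close> by
  \<open>(m / 2 + 2 * m\<^sup>2) * s\<^sup>2\<close>, and twice that constant is at most
  \<open>5 * m\<close> for \<open>m \<le> 1\<close>.\<close>

lemma ID0_small_second_moment:
  fixes N :: "'a::euclidean_space measure"
  assumes N: "Mclass 0 N" and \<mu>: "is_ID0 N 0 \<mu>" and small: "AE x in N. norm x \<le> 1" and b: "b \<in> Basis"
    and m: "(\<integral>x. min ((norm x)\<^sup>2) 1 \<partial>N) \<le> m" "m \<le> 1"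
  shows "(\<integral>\<^sup>+x. ennreal ((b \<bullet> x)\<^sup>2) \<partial>\<mu>) \<le> ennreal (5 * m)"
proof -
  interpret levy_measure N by unfold_locales fact
  have P: "prob_space \<mu>" "sets \<mu> = sets borel" using \<mu> by (simp_all add: is_ID0_iff)
  have "0 \<le> (\<integral>x. min ((norm x)\<^sup>2) 1 \<partial>N)" by (rule Bochner_Integration.integral_nonneg) simp
  then have m0: "0 \<le> m" using m(1) by linarith
  have "1 - Re (cf \<mu> (s *\<^sub>R b)) \<le> (m / 2 + 2 * m\<^sup>2) * s\<^sup>2" if s: "0 < s" "s \<le> 1" for s
  proof -
    let ?z = "s *\<^sub>R b"
    define \<psi> where "\<psi> = levy_exponent N ?z"
    have ik: "integrable N (levy_kernel ?z)" by (rule integrable_levy_kernel)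
    have zx: "\<bar>?z \<bullet> x\<bar> \<le> s * norm x" for x
      using Cauchy_Schwarz_ineq2[of ?z x] b s by simp
    have ReE: "- Re \<psi> = (\<integral>x. - Re (levy_kernel ?z x) \<partial>N)"
      unfolding \<psi>_def levy_exponent_def using integral_bounded_linear[OF bounded_linear_Re ik] by simp
    have Rek: "- Re (levy_kernel ?z x) = 1 - cos (?z \<bullet> x)" for x
      by (simp add: levy_kernel_def Re_exp)
    have u: "0 \<le> - Re \<psi>" unfolding ReE Rek by (rule Bochner_Integration.integral_nonneg) simp
    have "- Re \<psi> \<le> (\<integral>x. s\<^sup>2 / 2 * min ((norm x)\<^sup>2) 1 \<partial>N)"
      unfolding ReE
    proof (rule integral_mono_AE)
      show "integrable N (\<lambda>x. - Re (levy_kernel ?z x))" using ik by simp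
      show "AE x in N. - Re (levy_kernel ?z x) \<le> s\<^sup>2 / 2 * min ((norm x)\<^sup>2) 1"
        using small
      proof eventually_elim
        case (elim x)
        have "(?z \<bullet> x)\<^sup>2 \<le> (s * norm x)\<^sup>2" using zx[of x] s by (simp add: abs_le_square_iff[symmetric] abs_mult)
        then have "1 - cos (?z \<bullet> x) \<le> s\<^sup>2 / 2 * (norm x)\<^sup>2"
          using one_minus_cos_le[of "?z \<bullet> x"] by (simp add: power_mult_distrib)
        then show ?case unfolding Rek using elim by (simp add: power_le_one min_absorb1)
      qed
    qed (use integrable_min in simp)
    also have "\<dots> = s\<^sup>2 / 2 * (\<integral>x. min ((norm x)\<^sup>2) 1 \<partial>N)" by (rule integral_mult_right_zero)
    also have "\<dots> \<le> s\<^sup>2 / 2 * m" using m(1) by (intro mult_left_mono) auto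
    finally have u2: "- Re \<psi> \<le> s\<^sup>2 / 2 * m" .
    have ImE: "Im \<psi> = (\<integral>x. Im (levy_kernel ?z x) \<partial>N)"
      unfolding \<psi>_def levy_exponent_def using integral_bounded_linear[OF bounded_linear_Im ik] by simp
    have "\<bar>Im \<psi>\<bar> \<le> (\<integral>x. \<bar>Im (levy_kernel ?z x)\<bar> \<partial>N)" unfolding ImE by (rule integral_abs_bound)
    also have "\<dots> \<le> (\<integral>x. 2 * s * min ((norm x)\<^sup>2) 1 \<partial>N)"
    proof (rule integral_mono_AE)
      show "integrable N (\<lambda>x. \<bar>Im (levy_kernel ?z x)\<bar>)" using ik by simp
      show "AE x in N. \<bar>Im (levy_kernel ?z x)\<bar> \<le> 2 * s * min ((norm x)\<^sup>2) 1"
        using small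
      proof eventually_elim
        case (elim x)
        define \<theta> where "\<theta> = ?z \<bullet> x"
        have th: "\<bar>\<theta>\<bar> \<le> s * norm x" unfolding \<theta>_def by (rule zx)
        have pos: "0 < 1 + (norm x)\<^sup>2" by (simp add: add_pos_nonneg)
        \<comment> \<open>The defect of the sine and the defect of the centring are each at most
          \<open>s * (norm x)\<^sup>2\<close>.\<close>
        have "Im (levy_kernel ?z x) = (sin \<theta> - \<theta>) + \<theta> * ((norm x)\<^sup>2 / (1 + (norm x)\<^sup>2))"
          using pos unfolding levy_kernel_def cis_conv_exp[symmetric] \<theta>_def[symmetric] by (simp add: field_simps)
        moreover have "\<bar>sin \<theta> - \<theta>\<bar> \<le> s * (norm x)\<^sup>2"
        proof -
          have "\<bar>sin \<theta> - \<theta>\<bar> = \<bar>Im (iexp \<theta> - (\<Sum>k\<le>1. (\<i> * \<theta>)^k / fact k))\<bar>"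
            by (simp add: cis_conv_exp[symmetric])
          also have "\<dots> \<le> \<bar>\<theta>\<bar>\<^sup>2 / 2"
            using order_trans[OF abs_Im_le_cmod iexp_approx1[of \<theta> 1]] by (simp add: numeral_2_eq_2)
          also have "\<dots> \<le> (s * norm x)\<^sup>2 / 2" using th by (intro divide_right_mono power_mono) auto
          also have "\<dots> = s * s * (norm x)\<^sup>2 / 2" by (simp add: power_mult_distrib power2_eq_square)
          also have "\<dots> \<le> s * 1 * (norm x)\<^sup>2 / 1" using s by (intro frac_le mult_right_mono mult_left_mono) auto
          finally show ?thesis by simp
        qed
        moreover have "\<bar>\<theta> * ((norm x)\<^sup>2 / (1 + (norm x)\<^sup>2))\<bar> \<le> s * (norm x)\<^sup>2"
        proof -
          have "\<bar>\<theta>\<bar> \<le> s" using th elim s mult_left_mono[of "norm x" 1 s] by linarith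
          moreover have "(norm x)\<^sup>2 / (1 + (norm x)\<^sup>2) \<le> (norm x)\<^sup>2 / 1" by (intro divide_left_mono) (auto intro: pos)
          ultimately have "\<bar>\<theta>\<bar> * ((norm x)\<^sup>2 / (1 + (norm x)\<^sup>2)) \<le> s * ((norm x)\<^sup>2 / 1)" using s by (intro mult_mono) auto
          then show ?thesis by (simp add: abs_mult)
        qed
        ultimately have "\<bar>Im (levy_kernel ?z x)\<bar> \<le> 2 * s * (norm x)\<^sup>2" by linarith
        then show ?case using elim by (simp add: power_le_one min_absorb1)
      qed
    qed (use integrable_min in simp)
    also have "\<dots> = 2 * s * (\<integral>x. min ((norm x)\<^sup>2) 1 \<partial>N)" by (rule integral_mult_right_zero)
    also have "\<dots> \<le> 2 * s * m" using m(1) s by (intro mult_left_mono) auto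
    finally have v: "\<bar>Im \<psi>\<bar> \<le> 2 * s * m" .
    have "cf \<mu> ?z = exp \<psi>" using \<mu> by (simp add: is_ID0_iff \<psi>_def)
    then have "1 - Re (cf \<mu> ?z) = (1 - exp (Re \<psi>)) + exp (Re \<psi>) * (1 - cos (Im \<psi>))"
      by (simp add: Re_exp algebra_simps)
    also have "\<dots> \<le> - Re \<psi> + 1 * ((Im \<psi>)\<^sup>2 / 2)"
    proof (rule add_mono)
      show "1 - exp (Re \<psi>) \<le> - Re \<psi>" using exp_ge_add_one_self[of "Re \<psi>"] by linarith
      show "exp (Re \<psi>) * (1 - cos (Im \<psi>)) \<le> 1 * ((Im \<psi>)\<^sup>2 / 2)"
        using u one_minus_cos_le[of "Im \<psi>"] by (intro mult_mono) auto
    qed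
    also have "(Im \<psi>)\<^sup>2 \<le> (2 * s * m)\<^sup>2" using v s m0 by (simp add: abs_le_square_iff[symmetric] abs_mult)
    finally have "1 - Re (cf \<mu> ?z) \<le> s\<^sup>2 / 2 * m + (2 * s * m)\<^sup>2 / 2" using u2 by simp
    also have "\<dots> = (m / 2 + 2 * m\<^sup>2) * s\<^sup>2" by (simp add: algebra_simps power2_eq_square)
    finally show ?thesis .
  qed
  from second_moment_le[OF P this] have "(\<integral>\<^sup>+x. ennreal ((b \<bullet> x)\<^sup>2) \<partial>\<mu>) \<le> ennreal (2 * (m / 2 + 2 * m\<^sup>2))" .
  also have "\<dots> \<le> ennreal (5 * m)"
    using m(2) m0 mult_left_mono[of m 1 m] by (intro ennreal_leI) (simp add: power2_eq_square)
  finally show ?thesis .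
qed

text \<open>Only the coordinates below \<open>n\<close> occur, so the infinite product is restricted
  to \<open>{..<n}\<close>, where the integral of a product factors.\<close>

lemma cf_partial_sum_PiM:
  fixes \<mu> :: "nat \<Rightarrow> 'a::euclidean_space measure"
  assumes \<mu>: "\<And>k. prob_space (\<mu> k)" "\<And>k. sets (\<mu> k) = sets borel"
  shows "(CLINT \<omega>|Pi\<^sub>M UNIV \<mu>. iexp (z \<bullet> (\<Sum>k<n. \<omega> k))) = (\<Prod>k<n. cf (\<mu> k) z)"
proof -
  interpret product_prob_space \<mu> UNIV by (rule product_prob_spaceI) (rule \<mu>(1))
  let ?J = "{..<n}"
  have comp: "(\<lambda>\<omega>. \<omega> k) \<in> measurable (Pi\<^sub>M K \<mu>) borel" if "k \<in> K" for k K
    using measurable_component_singleton[OF that, of \<mu>] by (simp add: measurable_cong_sets[OF refl \<mu>(2)])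
  have eq: "iexp (z \<bullet> (\<Sum>k<n. \<omega> k)) = (\<Prod>k<n. iexp (z \<bullet> \<omega> k))" for \<omega> :: "nat \<Rightarrow> 'a"
    by (simp add: inner_sum_right exp_sum[symmetric] sum_distrib_left)
  have m1: "(\<lambda>\<omega>. \<Prod>k<n. iexp (z \<bullet> \<omega> k)) \<in> borel_measurable (Pi\<^sub>M ?J \<mu>)"
  proof (rule borel_measurable_prod)
    fix k assume "k \<in> ?J"
    then have [measurable]: "(\<lambda>\<omega>. \<omega> k) \<in> measurable (Pi\<^sub>M ?J \<mu>) borel" by (rule comp)
    show "(\<lambda>\<omega>. iexp (z \<bullet> \<omega> k)) \<in> borel_measurable (Pi\<^sub>M ?J \<mu>)" by measurable
  qed
  have "(CLINT \<omega>|Pi\<^sub>M UNIV \<mu>. iexp (z \<bullet> (\<Sum>k<n. \<omega> k))) = (CLINT \<omega>|Pi\<^sub>M UNIV \<mu>. (\<Prod>k<n. iexp (z \<bullet> (restrict \<omega> ?J) k)))"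
    unfolding eq by (intro Bochner_Integration.integral_cong prod.cong) auto
  also have "\<dots> = (CLINT \<omega>|distr (Pi\<^sub>M UNIV \<mu>) (Pi\<^sub>M ?J \<mu>) (\<lambda>\<omega>. restrict \<omega> ?J). (\<Prod>k<n. iexp (z \<bullet> \<omega> k)))"
    by (rule integral_distr[symmetric, OF measurable_restrict_subset m1]) simp
  also have "distr (Pi\<^sub>M UNIV \<mu>) (Pi\<^sub>M ?J \<mu>) (\<lambda>\<omega>. restrict \<omega> ?J) = Pi\<^sub>M ?J \<mu>"
    by (rule distr_PiM_restrict_finite) auto
  also have "(CLINT \<omega>|Pi\<^sub>M ?J \<mu>. (\<Prod>k<n. iexp (z \<bullet> \<omega> k))) = (\<Prod>k<n. cf (\<mu> k) z)"
    unfolding cf_def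
    by (rule product_integral_prod) (auto intro!: integrable_finite_bounded[OF prob_space.finite_measure[OF \<mu>(1)] \<mu>(2), where B=1])
  finally show ?thesis .
qed

text \<open>The arithmetic-geometric mean inequality with a free scale \<open>c\<close>: it converts
  second moments into first moments at the price of \<open>c / 2\<close>.\<close>

lemma abs_le_square_over:
  fixes y c :: real
  assumes "0 < c"
  shows "\<bar>y\<bar> \<le> y\<^sup>2 / (2 * c) + c / 2"
proof -
  have "2 * \<bar>y\<bar> * c \<le> y\<^sup>2 + c\<^sup>2" using sum_squares_bound[of "\<bar>y\<bar>" c] by simp
  then show ?thesis using assms by (simp add: field_simps power2_eq_square)
qed

text \<open>The shells are cut so that, from the second on, the independent shell variables have
  summable expected norms. The random series then converges absolutely almost surely, and dominated
  convergence identifies the transform of its sum with the limit of the finite products.\<close>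

theorem (in levy_measure) exists_ID0:
  obtains \<nu> where "is_ID0 M 0 \<nu>"
proof -
  note [measurable_cong] = sets_M
  define J where "J s = (\<integral>x. indicator {x. norm x \<le> s} x * min ((norm x)\<^sup>2) 1 \<partial>M)" for s
  have "\<exists>n. J (inverse (real (Suc n))) < (1/4) ^ k \<and> inverse (real (Suc n)) < inverse (real (Suc k))" for k
  proof -
    have "\<forall>\<^sub>F n in sequentially. J (inverse (real (Suc n))) < (1/4) ^ k \<and> inverse (real (Suc n)) < inverse (real (Suc k))"
      unfolding J_def
      by (intro eventually_conj order_tendstoD(2)[OF small_jumps_tendsto_0] order_tendstoD(2)[OF LIMSEQ_inverse_real_of_nat]) auto
    then show ?thesis by (auto simp: eventually_sequentially)
  qed
  \<comment> \<open>The radius is so small that the remaining small-jump integral is below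
    \<open>(1/4) ^ k\<close>; being also below \<open>1 / Suc k\<close>, the radii shrink to 0 and
    the shells exhaust everything but the origin.\<close>
  then obtain N where N: "\<And>k. J (inverse (real (Suc (N k)))) < (1/4) ^ k"
      "\<And>k. inverse (real (Suc (N k))) < inverse (real (Suc k))"
    by metis
  define r where "r k = inverse (real (Suc (N k)))" for k
  have r: "0 < r k" "r k < inverse (real (Suc k))" "r k \<le> 1" "(\<integral>x. indicator {x. norm x \<le> r k} x * min ((norm x)\<^sup>2) 1 \<partial>M) < (1/4) ^ k" for k
    using N[of k] unfolding r_def J_def by (auto simp: inverse_le_1_iff)
  define B where "B k = {x::'a. norm x > r k}" for k
  \<comment> \<open>The radii \<open>r k\<close> need not decrease in \<open>k\<close>, so the sets
    are made disjoint formally; what is used of the order is that \<open>A (Suc k)\<close> avoids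
    \<open>B k\<close>.\<close>
  define A where "A = disjointed B"
  have Bm: "range B \<subseteq> sets borel" by (auto simp: B_def)
  then have Am: "A k \<in> sets borel" for k
    unfolding A_def using sets.range_disjointed_sets[OF Bm] by blast
  have Adisj: "disjoint_family A" unfolding A_def by (rule disjoint_family_disjointed)
  have AU: "(\<Union>k. A k) = - {0}"
  proof -
    have "(\<Union>k. A k) = (\<Union>k. B k)" unfolding A_def by (rule UN_disjointed_eq)
    also have "\<dots> = - {0}"
    proof -
      have "\<exists>k. r k < norm x" if x: "x \<noteq> 0" for x :: 'a
      proof -
        obtain k where "inverse (real (Suc k)) < norm x" using reals_Archimedean[of "norm x"] x by auto
        then show ?thesis using r(2)[of k] by (intro exI[of _ k]) linarith
      qed
      moreover have "\<not> r k < norm (0::'a)" for k using r(1)[of k] by simp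
      ultimately show ?thesis by (auto simp: B_def)
    qed
    finally show ?thesis .
  qed
  have AB: "A k \<subseteq> B k" for k unfolding A_def by (rule disjointed_subset)
  have Asmall: "norm x \<le> r k" if "x \<in> A (Suc k)" for x k
    using that by (auto simp: A_def disjointed_def B_def not_less)
  define Q where "Q k = density M (indicator (A k))" for k
  have Qs [measurable_cong]: "sets (Q k) = sets borel" for k by (simp add: Q_def sets_M)
  have Qint: "(\<integral>x. f x \<partial>Q k) = (\<integral>x. indicator (A k) x *\<^sub>R f x \<partial>M)" if "f \<in> borel_measurable borel" for k and f :: "'a \<Rightarrow> 'b::{banach, second_countable_topology}"
  proof -
    have "Q k = density M (\<lambda>x. ennreal (indicator (A k) x))" by (simp add: Q_def ennreal_indicator)
    then show ?thesis using that Am[of k] by (simp add: integral_density)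
  qed
  have Qfin: "finite_measure (Q k)" for k
  proof
    have "emeasure (Q k) (space (Q k)) = emeasure M (A k)"
      using Am[of k] by (simp add: Q_def emeasure_density sets_M nn_integral_indicator)
    also have "\<dots> < \<infinity>" using AB[of k] r(1)[of k] by (intro emeasure_finite_away) (auto simp: B_def)
    finally show "emeasure (Q k) (space (Q k)) \<noteq> \<infinity>" by simp
  qed
  have QM: "Mclass 0 (Q k)" for k
  proof -
    have "emeasure (Q k) {0} = (\<integral>\<^sup>+x. indicator (A k) x * indicator {0} x \<partial>M)"
      unfolding Q_def using Am[of k] by (subst emeasure_density) (auto simp: sets_M)
    also have "\<dots> \<le> (\<integral>\<^sup>+x. indicator {0} x \<partial>M)" by (intro nn_integral_mono) (auto simp: indicator_def)
    also have "\<dots> = 0" using Mclass_0 by (simp add: Mclass_0_iff)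
    finally have "emeasure (Q k) {0} = 0" by simp
    moreover have "(\<integral>\<^sup>+ x. ennreal (min ((norm x)\<^sup>2) 1) \<partial>Q k) \<le> (\<integral>\<^sup>+ x. 1 \<partial>Q k)" by (intro nn_integral_mono) simp
    moreover have "(\<integral>\<^sup>+ x. 1 \<partial>Q k) < \<infinity>" using finite_measure.emeasure_finite[OF Qfin] by (simp add: less_top)
    ultimately show ?thesis using Qs by (auto simp: Mclass_0_iff intro: order_le_less_trans)
  qed
  have "\<exists>\<mu>. is_ID0 (Q k) 0 \<mu>" for k by (rule finite_levy_measure_ID0[OF Qfin Qs])
  then obtain \<mu> where \<mu>: "\<And>k. is_ID0 (Q k) 0 (\<mu> k)" by metis
  have P: "prob_space (\<mu> k)" and Ps [measurable_cong]: "sets (\<mu> k) = sets borel" for k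
    using \<mu>[of k] by (simp_all add: is_ID0_iff)
  have cfk: "cf (\<mu> k) z = exp (levy_exponent (Q k) z)" for k z using \<mu>[of k] by (simp add: is_ID0_iff)
  define \<Omega> where "\<Omega> = Pi\<^sub>M (UNIV :: nat set) \<mu>"
  interpret O: prob_space \<Omega> unfolding \<Omega>_def by (rule prob_space_PiM) (rule P)
  have comp: "(\<lambda>\<omega>. \<omega> k) \<in> measurable \<Omega> borel" for k
    unfolding \<Omega>_def using measurable_component_singleton[of k UNIV \<mu>] by (simp add: measurable_cong_sets[OF refl Ps])
  have dist: "distr \<Omega> borel (\<lambda>\<omega>. \<omega> k) = \<mu> k" for k
  proof -
    have "distr \<Omega> (\<mu> k) (\<lambda>\<omega>. \<omega> k) = \<mu> k" unfolding \<Omega>_def by (rule distr_PiM_component) (auto intro: P)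
    then show ?thesis using distr_cong[OF refl Ps[symmetric], of \<Omega> "\<lambda>\<omega>. \<omega> k" "\<lambda>\<omega>. \<omega> k" k] by simp
  qed
  \<comment> \<open>Shell 0 may carry large jumps without any moment; it is left out, which does not
    affect summability. For the others the scale \<open>(1/2) ^ k\<close> balances the second moment
    \<open>5 * (1/4) ^ k\<close>, giving \<open>3 * (1/2) ^ k\<close> per coordinate.\<close>
  have moment: "(\<integral>\<^sup>+x. ennreal (norm x) \<partial>\<mu> (Suc k)) \<le> ennreal (3 * DIM('a) * (1/2) ^ k)" for k
  proof -
    have c: "0 < (1/2::real) ^ k" by simp
    have affine: "ennreal (u * y + v) = ennreal u * ennreal y + ennreal v" if "0 \<le> u" "0 \<le> y" "0 \<le> v" for u y v
      using that by (simp add: ennreal_mult ennreal_plus)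
    have mint: "(\<integral>x. min ((norm x)\<^sup>2) 1 \<partial>Q (Suc k)) \<le> (1/4) ^ k"
    proof -
      have "(\<integral>x. min ((norm x)\<^sup>2) 1 \<partial>Q (Suc k)) = (\<integral>x. indicator (A (Suc k)) x *\<^sub>R min ((norm x)\<^sup>2) 1 \<partial>M)"
        by (rule Qint) measurable
      also have "\<dots> \<le> (\<integral>x. indicator {x. norm x \<le> r k} x * min ((norm x)\<^sup>2) 1 \<partial>M)"
      proof (rule integral_mono)
        show "integrable M (\<lambda>x. indicator (A (Suc k)) x *\<^sub>R min ((norm x)\<^sup>2) 1)"
          using Am by (intro integrable_bound_min[where C=1]) (auto simp: indicator_def)
        show "indicator (A (Suc k)) x *\<^sub>R min ((norm x)\<^sup>2) 1 \<le> indicator {x. norm x \<le> r k} x * min ((norm x)\<^sup>2) 1" for x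
          using Asmall[of x k] by (auto simp: indicator_def)
      qed (rule integrable_small)
      finally show ?thesis using r(4)[of k] by simp
    qed
    have le1: "AE x in Q (Suc k). norm x \<le> 1"
    proof -
      have "norm x \<le> 1" if "x \<in> A (Suc k)" for x using Asmall[OF that] r(3)[of k] by linarith
      then have "AE x in M. 0 < (indicator (A (Suc k)) x :: ennreal) \<longrightarrow> norm x \<le> 1"
        by (intro AE_I2) (auto simp: indicator_def)
      then show ?thesis unfolding Q_def using Am[of "Suc k"] by (subst AE_density) (auto simp: sets_M intro!: borel_measurable_indicator)
    qed
    have "(\<integral>\<^sup>+x. ennreal (norm x) \<partial>\<mu> (Suc k)) \<le> (\<integral>\<^sup>+x. (\<Sum>b\<in>Basis. ennreal (1 / (2 * (1/2) ^ k)) * ennreal ((b \<bullet> x)\<^sup>2) + ennreal ((1/2) ^ k / 2)) \<partial>\<mu> (Suc k))"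
    proof (intro nn_integral_mono)
      fix x :: 'a
      have "norm x \<le> (\<Sum>b\<in>Basis. \<bar>x \<bullet> b\<bar>)" by (rule norm_le_l1)
      also have "\<dots> \<le> (\<Sum>b\<in>Basis. 1 / (2 * (1/2) ^ k) * (b \<bullet> x)\<^sup>2 + (1/2) ^ k / 2)"
      proof (intro sum_mono)
        show "\<bar>x \<bullet> b\<bar> \<le> 1 / (2 * (1/2) ^ k) * (b \<bullet> x)\<^sup>2 + (1/2) ^ k / 2" for b
          using abs_le_square_over[OF c, of "b \<bullet> x"] by (simp add: inner_commute)
      qed
      finally have "ennreal (norm x) \<le> ennreal (\<Sum>b\<in>Basis. 1 / (2 * (1/2) ^ k) * (b \<bullet> x)\<^sup>2 + (1/2) ^ k / 2)" by (rule ennreal_leI)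
      also have "\<dots> = (\<Sum>b\<in>Basis. ennreal (1 / (2 * (1/2) ^ k) * (b \<bullet> x)\<^sup>2 + (1/2) ^ k / 2))" by (rule sum_ennreal[symmetric]) simp
      also have "\<dots> = (\<Sum>b\<in>Basis. ennreal (1 / (2 * (1/2) ^ k)) * ennreal ((b \<bullet> x)\<^sup>2) + ennreal ((1/2) ^ k / 2))"
        by (intro sum.cong refl affine) simp_all
      finally show "ennreal (norm x) \<le> (\<Sum>b\<in>Basis. ennreal (1 / (2 * (1/2) ^ k)) * ennreal ((b \<bullet> x)\<^sup>2) + ennreal ((1/2) ^ k / 2))" .
    qed
    also have "\<dots> = (\<Sum>b\<in>Basis. ennreal (1 / (2 * (1/2) ^ k)) * (\<integral>\<^sup>+x. ennreal ((b \<bullet> x)\<^sup>2) \<partial>\<mu> (Suc k)) + ennreal ((1/2) ^ k / 2))"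
    proof (subst nn_integral_sum)
      have [measurable]: "(\<lambda>x. b \<bullet> x) \<in> borel_measurable (\<mu> (Suc k))" for b
        by (subst measurable_cong_sets[OF Ps refl]) measurable
      have "(\<integral>\<^sup>+x. ennreal (1 / (2 * (1/2) ^ k)) * ennreal ((b \<bullet> x)\<^sup>2) + ennreal ((1/2) ^ k / 2) \<partial>\<mu> (Suc k)) =
          ennreal (1 / (2 * (1/2) ^ k)) * (\<integral>\<^sup>+x. ennreal ((b \<bullet> x)\<^sup>2) \<partial>\<mu> (Suc k)) + ennreal ((1/2) ^ k / 2)" for b
        by (subst nn_integral_add) (simp_all add: nn_integral_cmult prob_space.emeasure_space_1[OF P])
      then show "(\<Sum>b\<in>Basis. \<integral>\<^sup>+x. ennreal (1 / (2 * (1/2) ^ k)) * ennreal ((b \<bullet> x)\<^sup>2) + ennreal ((1/2) ^ k / 2) \<partial>\<mu> (Suc k)) =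
          (\<Sum>b\<in>Basis. ennreal (1 / (2 * (1/2) ^ k)) * (\<integral>\<^sup>+x. ennreal ((b \<bullet> x)\<^sup>2) \<partial>\<mu> (Suc k)) + ennreal ((1/2) ^ k / 2))"
        by (simp only:)
    qed (subst measurable_cong_sets[OF Ps refl], measurable)
    also have "\<dots> \<le> (\<Sum>b\<in>(Basis::'a set). ennreal (1 / (2 * (1/2) ^ k)) * ennreal (5 * (1/4) ^ k) + ennreal ((1/2) ^ k / 2))"
      by (intro sum_mono add_mono mult_left_mono ID0_small_second_moment[OF QM \<mu> le1 _ mint]) (auto simp: power_le_one)
    also have "\<dots> = (\<Sum>b\<in>(Basis::'a set). ennreal (3 * (1/2) ^ k))"
    proof (intro sum.cong refl)
      have "(1/4::real) ^ k = (1/2) ^ k * (1/2) ^ k" by (simp add: power_mult_distrib[symmetric])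
      then have "1 / (2 * (1/2) ^ k) * (5 * (1/4) ^ k) + (1/2) ^ k / 2 = (3 * (1/2) ^ k :: real)" by simp
      then show "ennreal (1 / (2 * (1/2) ^ k)) * ennreal (5 * (1/4) ^ k) + ennreal ((1/2) ^ k / 2) = ennreal (3 * (1/2) ^ k)"
        by (subst affine[symmetric]) simp_all
    qed
    also have "\<dots> = ennreal (3 * DIM('a) * (1/2) ^ k)"
      by (subst sum_ennreal) (simp_all add: mult_ac)
    finally show ?thesis .
  qed
  note [measurable] = comp
  have "(\<integral>\<^sup>+\<omega>. (\<Sum>k. ennreal (norm (\<omega> (Suc k)))) \<partial>\<Omega>) = (\<Sum>k. \<integral>\<^sup>+\<omega>. ennreal (norm (\<omega> (Suc k))) \<partial>\<Omega>)"
    by (rule nn_integral_suminf) measurable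
  also have "\<dots> = (\<Sum>k. \<integral>\<^sup>+x. ennreal (norm x) \<partial>\<mu> (Suc k))"
    unfolding dist[symmetric] by (subst nn_integral_distr) auto
  also have "\<dots> \<le> (\<Sum>k. ennreal (3 * DIM('a) * (1/2) ^ k))" by (intro suminf_le summableI moment)
  also have "\<dots> = ennreal (3 * DIM('a) * (1 / (1 - 1/2)))"
    by (intro suminf_ennreal_eq sums_mult geometric_sums) auto
  also have "\<dots> < \<infinity>" by simp
  finally have "AE \<omega> in \<Omega>. (\<Sum>k. ennreal (norm (\<omega> (Suc k)))) \<noteq> \<infinity>"
    by (intro nn_integral_PInf_AE) auto
  then have sm: "AE \<omega> in \<Omega>. summable \<omega>"
  proof eventually_elim
    case (elim \<omega>)
    then have "summable (\<lambda>k. norm (\<omega> (Suc k)))" by (intro summable_suminf_not_top) auto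
    then have "summable (\<lambda>k. \<omega> (Suc k))" by (rule summable_norm_cancel)
    then show ?case by (simp add: summable_Suc_iff)
  qed
  define S where "S \<omega> = (\<Sum>k. \<omega> k)" for \<omega> :: "nat \<Rightarrow> 'a"
  have Sm [measurable]: "S \<in> borel_measurable \<Omega>" unfolding S_def by measurable
  have expo: "(\<lambda>n. \<Sum>k<n. levy_exponent (Q k) z) \<longlonglongrightarrow> levy_exponent M z" for z
  proof -
    have ik: "integrable M (\<lambda>x. indicator (A k) x *\<^sub>R levy_kernel z x)" for k
      using norm_levy_kernel_le[of z] Am
      by (intro integrable_bound_min[where C="2 + norm z + (norm z)\<^sup>2"]) (auto simp: indicator_def)
    have ind: "(\<Sum>k<n. indicator (A k) x) = (indicator (\<Union>k<n. A k) x :: real)" for n x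
      using disjoint_family_on_mono[OF _ Adisj, of "{..<n}"] by (simp add: indicator_UN_disjoint)
    have "(\<Sum>k<n. levy_exponent (Q k) z) = (CLINT x|M. indicator (\<Union>k<n. A k) x *\<^sub>R levy_kernel z x)" for n
    proof -
      have "(\<Sum>k<n. levy_exponent (Q k) z) = (\<Sum>k<n. CLINT x|M. indicator (A k) x *\<^sub>R levy_kernel z x)"
        unfolding levy_exponent_def by (intro sum.cong refl Qint) measurable
      also have "\<dots> = (CLINT x|M. (\<Sum>k<n. indicator (A k) x *\<^sub>R levy_kernel z x))"
        by (rule Bochner_Integration.integral_sum[symmetric]) (rule ik)
      finally show ?thesis unfolding scaleR_left.sum[symmetric] ind .
    qed
    moreover have "(\<lambda>n. CLINT x|M. indicator (\<Union>k<n. A k) x *\<^sub>R levy_kernel z x) \<longlonglongrightarrow> (CLINT x|M. levy_kernel z x)"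
    proof (rule integral_dominated_convergence[where w="\<lambda>x. norm (levy_kernel z x)"])
      show "AE x in M. (\<lambda>n. indicator (\<Union>k<n. A k) x *\<^sub>R levy_kernel z x) \<longlonglongrightarrow> levy_kernel z x"
        using AE_nonzero
      proof eventually_elim
        case (elim x)
        then have "x \<in> (\<Union>k. A k)" unfolding AU by simp
        then obtain k where k: "x \<in> A k" by blast
        have "indicator (\<Union>k<n. A k) x *\<^sub>R levy_kernel z x = levy_kernel z x" if "Suc k \<le> n" for n
        proof -
          have "x \<in> (\<Union>k<n. A k)" using k that by auto
          then show ?thesis by simp
        qed
        then show ?case by (intro tendsto_eventually eventually_sequentiallyI[of "Suc k"]) auto
      qed
      show "(\<lambda>x. indicator (\<Union>k<n. A k) x *\<^sub>R levy_kernel z x) \<in> borel_measurable M" for n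
        by (subst measurable_cong_sets[OF sets_M refl])
          (intro borel_measurable_scaleR borel_measurable_indicator sets.finite_UN borel_measurable_levy_kernel; simp add: Am)
    qed (use integrable_levy_kernel[of z] in \<open>auto simp: indicator_def\<close>)
    ultimately show ?thesis by (simp add: levy_exponent_def)
  qed
  have "cf (distr \<Omega> borel S) z = exp (levy_exponent M z)" for z
  proof -
    have "(\<lambda>n. CLINT \<omega>|\<Omega>. iexp (z \<bullet> (\<Sum>k<n. \<omega> k))) \<longlonglongrightarrow> (CLINT \<omega>|\<Omega>. iexp (z \<bullet> S \<omega>))"
    proof (rule integral_dominated_convergence[where w="\<lambda>_. 1"])
      show "AE \<omega> in \<Omega>. (\<lambda>n. iexp (z \<bullet> (\<Sum>k<n. \<omega> k))) \<longlonglongrightarrow> iexp (z \<bullet> S \<omega>)"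
        using sm
      proof eventually_elim
        case (elim \<omega>)
        then have "(\<lambda>n. \<Sum>k<n. \<omega> k) \<longlonglongrightarrow> S \<omega>" unfolding S_def by (rule summable_LIMSEQ)
        then show ?case by (intro tendsto_intros)
      qed
    qed auto
    moreover have "(CLINT \<omega>|\<Omega>. iexp (z \<bullet> (\<Sum>k<n. \<omega> k))) = exp (\<Sum>k<n. levy_exponent (Q k) z)" for n
      unfolding \<Omega>_def cf_partial_sum_PiM[OF P Ps] cfk by (simp add: exp_sum)
    moreover have "(\<lambda>n. exp (\<Sum>k<n. levy_exponent (Q k) z)) \<longlonglongrightarrow> exp (levy_exponent M z)"
      by (intro tendsto_exp expo)
    ultimately show ?thesis using LIMSEQ_unique by (simp add: cf_distr[OF Sm]) blast
  qed
  then have "is_ID0 M 0 (distr \<Omega> borel S)" by (simp add: is_ID0_iff O.prob_space_distr[OF Sm])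
  then show ?thesis using that by blast
qed

subsection \<open>Tempered stable tails: Abelian and Tauberian arguments\<close>

definition temper :: "real \<Rightarrow> real \<Rightarrow> real \<Rightarrow> real" where
  "temper p \<alpha> t = t powr (-1 - \<alpha>) * exp (- (t powr p))"

lemma borel_measurable_temper [measurable]: "temper p \<alpha> \<in> borel_measurable borel"
  unfolding temper_def by measurable

lemma temper_nonneg: "0 \<le> temper p \<alpha> t"
  by (simp add: temper_def)

lemma power_le_fact_exp:
  fixes x :: real
  assumes "0 \<le> x"
  shows "x ^ k \<le> fact k * exp x"
proof -
  have "(\<Sum>i\<in>{k}. x ^ i /\<^sub>R fact i) \<le> (\<Sum>i. x ^ i /\<^sub>R fact i)"
    using assms by (intro sum_le_suminf summable_exp_generic) auto
  then have "x ^ k / fact k \<le> exp x" by (simp add: exp_def divide_inverse mult.commute)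
  then show ?thesis by (simp add: field_simps)
qed

text \<open>A Gamma-type integral. On \<open>{0<..1}\<close> only the power matters; beyond 1 the
  term of order \<open>k\<close> of the exponential series, with \<open>k * p \<ge> a + 2\<close>,
  brings the integrand below a multiple of \<open>t powr (-2)\<close>.\<close>

lemma integrable_powr_exp:
  assumes p: "0 < p" and a: "-1 < a"
  shows "integrable lborel (\<lambda>t. indicator {0<..} t * (t powr a * exp (- (t powr p))) :: real)"
proof -
  obtain k :: nat where k: "(a + 2) / p < real k" using reals_Archimedean2 by blast
  have k': "a + 2 \<le> real k * p" using k p by (simp add: field_simps)
  have tail: "t powr a * exp (- (t powr p)) \<le> fact k * t powr (-1 - 1)" if "1 < t" for t
  proof -
    have "t powr (a + 2) \<le> t powr (p * real k)" using that k' by (intro powr_mono) (auto simp: mult.commute)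
    also have "\<dots> = (t powr p) ^ k" using that by (simp add: powr_power mult.commute)
    also have "\<dots> \<le> fact k * exp (t powr p)" by (rule power_le_fact_exp) simp
    finally have "t powr (a + 2) * exp (- (t powr p)) \<le> fact k"
      by (simp add: exp_minus field_simps)
    then have "t powr (a + 2) * exp (- (t powr p)) * t powr (-2) \<le> fact k * t powr (-2)"
      by (rule mult_right_mono) simp
    also have "t powr (a + 2) * exp (- (t powr p)) * t powr (-2) = t powr a * exp (- (t powr p))"
      using that by (simp add: powr_add powr_minus)
    finally show ?thesis by simp
  qed
  have i1: "integrable lborel (\<lambda>t. t powr a * indicator {0<..1} t)"
    using nn_integral_powr_Ioc[OF a, of 1] a by (intro integrableI_nonneg) (auto simp: ennreal_mult ennreal_indicator)
  have i2: "integrable lborel (\<lambda>t::real. t powr (-1 - 1) * indicator {1<..} t)"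
    using nn_integral_powr_Ioi[of 1 1] by (intro integrableI_nonneg) (auto simp: ennreal_mult ennreal_indicator)
  show ?thesis
  proof (rule Bochner_Integration.integrable_bound)
    show "integrable lborel (\<lambda>t. t powr a * indicator {0<..1} t + fact k * (t powr (-1 - 1) * indicator {1<..} t))"
      using i1 i2 by (intro Bochner_Integration.integrable_add integrable_mult_right)
    show "AE t in lborel. norm (indicator {0<..} t * (t powr a * exp (- (t powr p)))) \<le> norm (t powr a * indicator {0<..1} t + fact k * (t powr (-1 - 1) * indicator {1<..} t))"
    proof (rule AE_I2)
      fix t :: real
      have "t powr a * exp (- (t powr p)) \<le> t powr a * 1" by (intro mult_left_mono) auto
      then show "norm (indicator {0<..} t * (t powr a * exp (- (t powr p)))) \<le> norm (t powr a * indicator {0<..1} t + fact k * (t powr (-1 - 1) * indicator {1<..} t))"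
        using tail[of t] by (auto simp: indicator_def)
    qed
  qed measurable
qed

lemma integrable_temper_powr:
  assumes "0 < p" "\<alpha> < b"
  shows "integrable lborel (\<lambda>t. indicator {0<..} t * (t powr b * temper p \<alpha> t))"
proof -
  have "t powr b * temper p \<alpha> t = t powr (b - 1 - \<alpha>) * exp (- (t powr p))" for t
  proof -
    have "b - 1 - \<alpha> = b + (-1 - \<alpha>)" by simp
    then show ?thesis by (simp only: temper_def mult.assoc[symmetric] powr_add)
  qed
  then show ?thesis using integrable_powr_exp[of p "b - 1 - \<alpha>"] assms by simp
qed

lemma Mclass_imp_Mclass_0:
  assumes M: "Mclass \<gamma> M" and \<gamma>: "0 \<le> \<gamma>" "\<gamma> \<le> 2"
  shows "Mclass 0 M"
proof -
  have s: "sets M = sets borel" using M by (simp add: Mclass_def)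
  have "min ((norm x)\<^sup>2) 1 \<le> min ((norm x)\<^sup>2) (norm x powr \<gamma>)" for x :: 'a
  proof (cases "norm x \<le> 1")
    case True
    have "(norm x)\<^sup>2 \<le> norm x powr \<gamma>" if "x \<noteq> 0"
      using powr_mono'[of \<gamma> 2 "norm x"] True \<gamma> that by simp
    then show ?thesis by (cases "x = 0") auto
  next
    case False
    then show ?thesis using \<gamma> by (auto simp: ge_one_powr_ge_zero min.coboundedI2)
  qed
  then have "(\<integral>\<^sup>+ x. ennreal (min ((norm x)\<^sup>2) 1) \<partial>M) \<le> (\<integral>\<^sup>+ x. ennreal (min ((norm x)\<^sup>2) (norm x powr \<gamma>)) \<partial>M)"
    by (intro nn_integral_mono ennreal_leI)
  also have "\<dots> < \<infinity>" using M by (simp add: Mclass_def)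
  finally show ?thesis using M s unfolding Mclass_0_iff by (simp add: Mclass_def)
qed

locale tempered =
  fixes R :: "'a::euclidean_space measure" and p \<alpha> \<gamma> :: real
  assumes p: "0 < p" and \<alpha>: "\<alpha> < 2" "\<alpha> \<noteq> 0" and \<gamma>_def: "\<gamma> = max \<alpha> 0" and R: "Mclass \<gamma> R"
begin

lemma R0: "Mclass 0 R"
  using \<alpha> by (intro Mclass_imp_Mclass_0[OF R]) (auto simp: \<gamma>_def)

sublocale R: levy_measure R
  by unfold_locales (rule R0)

abbreviation M where "M \<equiv> TS_levy p \<alpha> R"

lemma M_eq: "M = radial_mixture (temper p \<alpha>) R"
  unfolding temper_def[abs_def] by (rule TS_levy_eq_radial_mixture[OF R.sets_M])

text \<open>The bound by \<open>n\<^sup>2\<close> comes from the second moment of the tempering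
  density, finite as \<open>\<alpha> < 2\<close>. The other power is \<open>n powr \<alpha>\<close>
  if \<open>0 < \<alpha>\<close>, by splitting at \<open>t = 1 / n\<close> and dropping the
  tempering; if \<open>\<alpha> < 0\<close> the density is integrable and a constant suffices. At
  \<open>\<alpha> = 0\<close> a logarithm of \<open>n\<close> would appear.\<close>

lemma inner_bound:
  obtains C where "0 \<le> C" "\<And>n. 0 < n \<Longrightarrow> (\<integral>\<^sup>+t\<in>{0<..}. ennreal (min ((t * n)\<^sup>2) 1) * ennreal (temper p \<alpha> t) \<partial>lborel) \<le> ennreal (C * min (n\<^sup>2) (n powr \<gamma>))"
proof -
  define I where "I = (\<integral>t. indicator {0<..} t * (t powr 2 * temper p \<alpha> t) \<partial>lborel)"
  have I: "integrable lborel (\<lambda>t. indicator {0<..} t * (t powr 2 * temper p \<alpha> t))" "0 \<le> I"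
    using integrable_temper_powr[OF p, of \<alpha> 2] \<alpha> by (auto simp: I_def temper_nonneg)
  have square: "(\<integral>\<^sup>+t\<in>{0<..}. ennreal (min ((t * n)\<^sup>2) 1) * ennreal (temper p \<alpha> t) \<partial>lborel) \<le> ennreal (I * n\<^sup>2)" if "0 < n" for n
  proof -
    have "(\<integral>\<^sup>+t\<in>{0<..}. ennreal (min ((t * n)\<^sup>2) 1) * ennreal (temper p \<alpha> t) \<partial>lborel) \<le> (\<integral>\<^sup>+t. ennreal (n\<^sup>2 * (indicator {0<..} t * (t powr 2 * temper p \<alpha> t))) \<partial>lborel)"
    proof (intro nn_integral_mono)
      fix t :: real
      have "min ((t * n)\<^sup>2) 1 * temper p \<alpha> t \<le> (t * n)\<^sup>2 * temper p \<alpha> t" by (intro mult_right_mono temper_nonneg) simp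
      also have "\<dots> = n\<^sup>2 * (t\<^sup>2 * temper p \<alpha> t)" by (simp add: power_mult_distrib)
      finally show "ennreal (min ((t * n)\<^sup>2) 1) * ennreal (temper p \<alpha> t) * indicator {0<..} t \<le> ennreal (n\<^sup>2 * (indicator {0<..} t * (t powr 2 * temper p \<alpha> t)))"
        by (auto simp: indicator_def ennreal_mult[symmetric] temper_nonneg intro!: ennreal_leI)
    qed
    also have "\<dots> = ennreal (n\<^sup>2 * I)"
      using I(1) unfolding I_def by (subst nn_integral_eq_integral) (auto simp: temper_nonneg)
    finally show ?thesis by (simp add: mult.commute)
  qed
  have "\<exists>C\<ge>0. \<forall>n>0. (\<integral>\<^sup>+t\<in>{0<..}. ennreal (min ((t * n)\<^sup>2) 1) * ennreal (temper p \<alpha> t) \<partial>lborel) \<le> ennreal (C * n powr \<gamma>)"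
  proof (cases "0 < \<alpha>")
    case True
    then have \<gamma>: "\<gamma> = \<alpha>" by (simp add: \<gamma>_def)
    show ?thesis
    proof (intro exI[of _ "1 / (2 - \<alpha>) + 1 / \<alpha>"] conjI allI impI)
      show "0 \<le> 1 / (2 - \<alpha>) + 1 / \<alpha>" using True \<alpha> by simp
      fix n :: real assume n: "0 < n"
      have "(\<integral>\<^sup>+t\<in>{0<..}. ennreal (min ((t * n)\<^sup>2) 1) * ennreal (temper p \<alpha> t) \<partial>lborel)
        \<le> (\<integral>\<^sup>+t. ennreal (n\<^sup>2) * (ennreal (t powr (1 - \<alpha>)) * indicator {0<..1/n} t) + ennreal (t powr (-1 - \<alpha>)) * indicator {1/n<..} t \<partial>lborel)"
      proof (intro nn_integral_mono)
        fix t :: real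
        have w: "temper p \<alpha> t \<le> t powr (-1 - \<alpha>)" by (simp add: temper_def mult_left_le)
        have "min ((t * n)\<^sup>2) 1 * temper p \<alpha> t \<le> n\<^sup>2 * t powr (1 - \<alpha>)" if "0 < t"
        proof -
          have "min ((t * n)\<^sup>2) 1 * temper p \<alpha> t \<le> (t * n)\<^sup>2 * t powr (-1 - \<alpha>)" by (intro mult_mono w temper_nonneg) auto
          also have "\<dots> = n\<^sup>2 * (t powr 2 * t powr (-1 - \<alpha>))" using that by (simp add: power_mult_distrib)
          also have "t powr 2 * t powr (-1 - \<alpha>) = t powr (1 - \<alpha>)" by (simp add: powr_add[symmetric] del: powr_numeral)
          finally show ?thesis .
        qed
        moreover have "min ((t * n)\<^sup>2) 1 * temper p \<alpha> t \<le> 1 * t powr (-1 - \<alpha>)" by (intro mult_mono w temper_nonneg) auto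
        ultimately show "ennreal (min ((t * n)\<^sup>2) 1) * ennreal (temper p \<alpha> t) * indicator {0<..} t \<le> ennreal (n\<^sup>2) * (ennreal (t powr (1 - \<alpha>)) * indicator {0<..1/n} t) + ennreal (t powr (-1 - \<alpha>)) * indicator {1/n<..} t"
          using n by (cases "t \<le> 1/n") (auto simp: indicator_def ennreal_mult[symmetric] temper_nonneg intro!: ennreal_leI)
      qed
      also have "\<dots> = ennreal (n\<^sup>2) * ennreal ((1/n) powr (2 - \<alpha>) / (2 - \<alpha>)) + ennreal ((1/n) powr (-\<alpha>) / \<alpha>)"
        using nn_integral_powr_Ioc[of "1 - \<alpha>" "1/n"] nn_integral_powr_Ioi[of \<alpha> "1/n"] n True \<alpha>
        by (subst nn_integral_add) (auto simp: nn_integral_cmult)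
      also have "\<dots> = ennreal (n\<^sup>2 * ((1/n) powr (2 - \<alpha>) / (2 - \<alpha>)) + (1/n) powr (-\<alpha>) / \<alpha>)"
        using True \<alpha> by (subst ennreal_mult[symmetric]) (simp_all del: times_divide_eq_right flip: ennreal_plus)
      also have "n\<^sup>2 * ((1/n) powr (2 - \<alpha>) / (2 - \<alpha>)) + (1/n) powr (-\<alpha>) / \<alpha> = (1 / (2 - \<alpha>) + 1 / \<alpha>) * n powr \<gamma>"
      proof -
        have e1: "(1/n) powr (-\<alpha>) = n powr \<alpha>" using n by (simp add: powr_divide powr_minus_divide)
        have "(1/n) powr (2 - \<alpha>) = n powr (\<alpha> - 2)" using n by (simp add: powr_divide powr_minus_divide[symmetric])
        then have e2: "n\<^sup>2 * (1/n) powr (2 - \<alpha>) = n powr \<alpha>" using n by (simp add: powr_diff)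
        show ?thesis unfolding e1 times_divide_eq_right e2 \<gamma> by (simp add: algebra_simps)
      qed
      finally show "(\<integral>\<^sup>+t\<in>{0<..}. ennreal (min ((t * n)\<^sup>2) 1) * ennreal (temper p \<alpha> t) \<partial>lborel) \<le> ennreal ((1 / (2 - \<alpha>) + 1 / \<alpha>) * n powr \<gamma>)" .
    qed
  next
    case False
    then have a: "\<alpha> < 0" "\<gamma> = 0" using \<alpha> by (auto simp: \<gamma>_def)
    define I0 where "I0 = (\<integral>t. indicator {0<..} t * (t powr 0 * temper p \<alpha> t) \<partial>lborel)"
    have I0: "integrable lborel (\<lambda>t. indicator {0<..} t * (t powr 0 * temper p \<alpha> t))" "0 \<le> I0"
      using integrable_temper_powr[OF p, of \<alpha> 0] a by (auto simp: I0_def temper_nonneg)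
    show ?thesis
    proof (intro exI[of _ I0] conjI allI impI I0(2))
      fix n :: real assume n: "0 < n"
      have "(\<integral>\<^sup>+t\<in>{0<..}. ennreal (min ((t * n)\<^sup>2) 1) * ennreal (temper p \<alpha> t) \<partial>lborel) \<le> (\<integral>\<^sup>+t. ennreal (indicator {0<..} t * (t powr 0 * temper p \<alpha> t)) \<partial>lborel)"
      proof (intro nn_integral_mono)
        fix t :: real
        have "min ((t * n)\<^sup>2) 1 * temper p \<alpha> t \<le> 1 * temper p \<alpha> t" by (intro mult_right_mono temper_nonneg) simp
        then show "ennreal (min ((t * n)\<^sup>2) 1) * ennreal (temper p \<alpha> t) * indicator {0<..} t \<le> ennreal (indicator {0<..} t * (t powr 0 * temper p \<alpha> t))"
          by (auto simp: indicator_def ennreal_mult[symmetric] temper_nonneg intro!: ennreal_leI)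
      qed
      also have "\<dots> = ennreal I0"
        using I0(1) unfolding I0_def by (subst nn_integral_eq_integral) (auto simp: temper_nonneg)
      finally show "(\<integral>\<^sup>+t\<in>{0<..}. ennreal (min ((t * n)\<^sup>2) 1) * ennreal (temper p \<alpha> t) \<partial>lborel) \<le> ennreal (I0 * n powr \<gamma>)"
        using n a(2) by simp
    qed
  qed
  then obtain C where C: "0 \<le> C" "\<And>n. 0 < n \<Longrightarrow> (\<integral>\<^sup>+t\<in>{0<..}. ennreal (min ((t * n)\<^sup>2) 1) * ennreal (temper p \<alpha> t) \<partial>lborel) \<le> ennreal (C * n powr \<gamma>)"
    by blast
  show ?thesis
  proof (rule that[of "max I C"])
    fix n :: real assume n: "0 < n"
    have "I * n\<^sup>2 \<le> max I C * n\<^sup>2" "C * n powr \<gamma> \<le> max I C * n powr \<gamma>" by (intro mult_right_mono; simp)+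
    then have "(\<integral>\<^sup>+t\<in>{0<..}. ennreal (min ((t * n)\<^sup>2) 1) * ennreal (temper p \<alpha> t) \<partial>lborel) \<le> ennreal (max I C * n\<^sup>2)"
        "(\<integral>\<^sup>+t\<in>{0<..}. ennreal (min ((t * n)\<^sup>2) 1) * ennreal (temper p \<alpha> t) \<partial>lborel) \<le> ennreal (max I C * n powr \<gamma>)"
      using square[OF n] C(2)[OF n] by (meson order_trans ennreal_leI)+
    then show "(\<integral>\<^sup>+t\<in>{0<..}. ennreal (min ((t * n)\<^sup>2) 1) * ennreal (temper p \<alpha> t) \<partial>lborel) \<le> ennreal (max I C * min (n\<^sup>2) (n powr \<gamma>))"
      by (simp add: min_def)
  qed (use I(2) in simp)
qed

text \<open>Integrating out the tempering variable by \<open>inner_bound\<close> leaves exactly the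
  integrand of \<open>Mclass \<gamma>\<close>, which is why \<open>R\<close> is taken from that
  class.\<close>

lemma Mclass_M: "Mclass 0 M"
proof -
  note wm = borel_measurable_temper[of p \<alpha>]
  have "emeasure M {0} = (\<integral>\<^sup>+x. (\<integral>\<^sup>+t\<in>{0<..}. indicator {0} (t *\<^sub>R x) * ennreal (temper p \<alpha> t) \<partial>lborel) \<partial>R)"
    unfolding M_eq by (intro emeasure_radial_mixture[OF R.sets_M wm]) auto
  also have "\<dots> = (\<integral>\<^sup>+x. 0 \<partial>R)"
  proof (intro nn_integral_cong_AE)
    show "AE x in R. (\<integral>\<^sup>+t\<in>{0<..}. indicator {0} (t *\<^sub>R x) * ennreal (temper p \<alpha> t) \<partial>lborel) = 0"
      using R.AE_nonzero
    proof eventually_elim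
      case (elim x)
      then have "indicator {0} (t *\<^sub>R x) * ennreal (temper p \<alpha> t) * indicator {0<..} t = 0" for t
        by (auto simp: indicator_def)
      then show ?case by (simp only: nn_integral_const) simp
    qed
  qed
  finally have 0: "emeasure M {0} = 0" by simp
  obtain C where C: "0 \<le> C" "\<And>n. 0 < n \<Longrightarrow> (\<integral>\<^sup>+t\<in>{0<..}. ennreal (min ((t * n)\<^sup>2) 1) * ennreal (temper p \<alpha> t) \<partial>lborel) \<le> ennreal (C * min (n\<^sup>2) (n powr \<gamma>))"
    using inner_bound by blast
  have "(\<integral>\<^sup>+ x. ennreal (min ((norm x)\<^sup>2) 1) \<partial>M) = (\<integral>\<^sup>+x. (\<integral>\<^sup>+t\<in>{0<..}. ennreal (min ((norm (t *\<^sub>R x))\<^sup>2) 1) * ennreal (temper p \<alpha> t) \<partial>lborel) \<partial>R)"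
    unfolding M_eq by (intro nn_integral_radial_mixture[OF R.sets_M wm]) auto
  also have "\<dots> \<le> (\<integral>\<^sup>+x. ennreal C * ennreal (min ((norm x)\<^sup>2) (norm x powr \<gamma>)) \<partial>R)"
  proof (intro nn_integral_mono_AE)
    show "AE x in R. (\<integral>\<^sup>+t\<in>{0<..}. ennreal (min ((norm (t *\<^sub>R x))\<^sup>2) 1) * ennreal (temper p \<alpha> t) \<partial>lborel) \<le> ennreal C * ennreal (min ((norm x)\<^sup>2) (norm x powr \<gamma>))"
      using R.AE_nonzero
    proof eventually_elim
      case (elim x)
      have "(\<integral>\<^sup>+t\<in>{0<..}. ennreal (min ((norm (t *\<^sub>R x))\<^sup>2) 1) * ennreal (temper p \<alpha> t) \<partial>lborel) = (\<integral>\<^sup>+t\<in>{0<..}. ennreal (min ((t * norm x)\<^sup>2) 1) * ennreal (temper p \<alpha> t) \<partial>lborel)"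
        by (simp add: power_mult_distrib)
      also have "\<dots> \<le> ennreal (C * min ((norm x)\<^sup>2) (norm x powr \<gamma>))" using elim by (intro C(2)) simp
      finally show ?case using C(1) by (simp add: ennreal_mult)
    qed
  qed
  also have "\<dots> = ennreal C * (\<integral>\<^sup>+x. ennreal (min ((norm x)\<^sup>2) (norm x powr \<gamma>)) \<partial>R)"
    by (intro nn_integral_cmult) (simp add: measurable_cong_sets[OF R.sets_M refl])
  also have "\<dots> < \<infinity>" using R by (simp add: Mclass_def ennreal_mult_less_top)
  finally show ?thesis using 0 by (simp add: Mclass_0_iff M_eq)
qed

sublocale M: levy_measure M
  by unfold_locales (rule Mclass_M)

text \<open>Larger \<open>t\<close> lowers the threshold \<open>r / t\<close>, so the expression is
  monotone in \<open>t\<close>; the indicator extends the monotonicity to the whole line.\<close>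

lemma tail_measurable:
  assumes "D \<in> sets borel" "0 < r"
  shows "(\<lambda>t. indicator {0<..} t * measure R (polar_tail (r / t) D)) \<in> borel_measurable borel"
proof (rule borel_measurable_mono, rule monoI)
  fix t t' :: real assume "t \<le> t'"
  show "indicator {0<..} t * measure R (polar_tail (r / t) D) \<le> indicator {0<..} t' * measure R (polar_tail (r / t') D)"
  proof (cases "0 < t")
    case True
    then show ?thesis using \<open>t \<le> t'\<close> assms
      by (simp add: R.measure_polar_tail_mono divide_left_mono)
  qed (simp add: indicator_def)
qed

text \<open>Tonelli on nonnegative integrands, followed by the scaling of polar tails; integrability
  in \<open>t\<close> is read off the finiteness of the tail of \<open>M\<close>.\<close>

lemma tail_formula:
  assumes D: "D \<in> sets borel" and r: "0 < r"
  shows "integrable lborel (\<lambda>t. indicator {0<..} t * (measure R (polar_tail (r / t) D) * temper p \<alpha> t))" (is "integrable _ ?f")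
    and "measure M (polar_tail r D) = (\<integral>t. indicator {0<..} t * (measure R (polar_tail (r / t) D) * temper p \<alpha> t) \<partial>lborel)"
proof -
  note [measurable_cong] = R.sets_M
  have PS: "pair_sigma_finite R (lborel :: real measure)"
    by (intro pair_sigma_finite.intro sigma_finite_lborel R.sigma_finite)
  have [measurable]: "(indicator (polar_tail r D) :: 'a \<Rightarrow> ennreal) \<in> borel_measurable borel"
    using D by simp
  have fm: "?f \<in> borel_measurable borel"
    using borel_measurable_times[OF tail_measurable[OF D r] borel_measurable_temper[of p \<alpha>]] by (simp add: mult.assoc)
  have f0: "0 \<le> ?f t" for t by (simp add: temper_nonneg)
  have "emeasure M (polar_tail r D) = (\<integral>\<^sup>+x. (\<integral>\<^sup>+t. indicator (polar_tail r D) (t *\<^sub>R x) * ennreal (temper p \<alpha> t) * indicator {0<..} t \<partial>lborel) \<partial>R)"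
    unfolding M_eq using D by (intro emeasure_radial_mixture[OF R.sets_M]) auto
  also have "\<dots> = (\<integral>\<^sup>+t. (\<integral>\<^sup>+x. indicator (polar_tail r D) (t *\<^sub>R x) * ennreal (temper p \<alpha> t) * indicator {0<..} t \<partial>R) \<partial>lborel)"
    by (rule pair_sigma_finite.Fubini'[OF PS, symmetric]) measurable
  also have "\<dots> = (\<integral>\<^sup>+t. ennreal (?f t) \<partial>lborel)"
  proof (intro nn_integral_cong)
    fix t :: real
    show "(\<integral>\<^sup>+x. indicator (polar_tail r D) (t *\<^sub>R x) * ennreal (temper p \<alpha> t) * indicator {0<..} t \<partial>R) = ennreal (?f t)"
    proof (cases "0 < t")
      case True
      have "(\<integral>\<^sup>+x. indicator (polar_tail r D) (t *\<^sub>R x) * ennreal (temper p \<alpha> t) * indicator {0<..} t \<partial>R) = (\<integral>\<^sup>+x. ennreal (temper p \<alpha> t) * indicator (polar_tail (r / t) D) x \<partial>R)"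
        using True by (intro nn_integral_cong) (auto simp: indicator_def scaleR_mem_polar_tail)
      also have "\<dots> = ennreal (temper p \<alpha> t) * emeasure R (polar_tail (r / t) D)"
        using D by (intro nn_integral_cmult_indicator) (simp add: R.sets_M)
      also have "emeasure R (polar_tail (r / t) D) = ennreal (measure R (polar_tail (r / t) D))"
        using R.emeasure_finite_away[OF _ polar_tail_subset, of "r / t" D] True r by (intro emeasure_eq_ennreal_measure) auto
      finally show ?thesis using True by (simp add: ennreal_mult[symmetric] temper_nonneg mult.commute)
    qed simp
  qed
  finally have eq: "emeasure M (polar_tail r D) = (\<integral>\<^sup>+t. ennreal (?f t) \<partial>lborel)" .
  have fin: "emeasure M (polar_tail r D) < \<infinity>" using M.emeasure_finite_away[OF r polar_tail_subset] .
  show i: "integrable lborel ?f" using fin fm f0 unfolding eq by (intro integrableI_nonneg) auto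
  show "measure M (polar_tail r D) = (\<integral>t. ?f t \<partial>lborel)"
    using nn_integral_eq_integral[OF i] f0 eq by (simp add: measure_def)
qed

end

section \<open>Moments, rescaling and comparison of tails\<close>

lemma moment_transfer:
  fixes F :: "nat \<Rightarrow> real \<Rightarrow> real" and F0 e g :: "real \<Rightarrow> real"
  assumes F: "\<And>n. integrable lborel (F n)" "\<And>n t. 0 \<le> F n t" and F0: "integrable lborel F0" "\<And>t. 0 \<le> F0 t"
    and e [measurable]: "e \<in> borel_measurable borel" and e0: "\<And>t. 0 \<le> e t \<and> e t \<le> 1"
    and moments: "\<And>k. (\<lambda>n. \<integral>t. F n t * e t ^ k \<partial>lborel) \<longlonglongrightarrow> (\<integral>t. F0 t * e t ^ k \<partial>lborel)"
    and g: "continuous_on UNIV g"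
  shows "(\<lambda>n. \<integral>t. F n t * g (e t) \<partial>lborel) \<longlonglongrightarrow> (\<integral>t. F0 t * g (e t) \<partial>lborel)"
proof (rule tendsto_by_approximation)
  fix d :: real assume "0 < d"
  have ib: "integrable lborel (\<lambda>t. H t * h (e t))"
    if H: "integrable lborel H" and h: "continuous_on UNIV h" for H h :: "real \<Rightarrow> real"
  proof -
    have "compact (h ` {0..1})" using h by (intro compact_continuous_image) (auto intro: continuous_on_subset)
    then have "bounded (h ` {0..1})" by (rule compact_imp_bounded)
    then obtain B where "\<forall>v\<in>{0..1}. \<bar>h v\<bar> \<le> B"
      unfolding bounded_iff by auto
    then have B: "\<And>v. v \<in> {0..1} \<Longrightarrow> \<bar>h v\<bar> \<le> B" by blast
    have [measurable]: "h \<in> borel_measurable borel" "H \<in> borel_measurable borel"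
      using h H by (auto intro: borel_measurable_continuous_onI)
    show ?thesis
    proof (rule Bochner_Integration.integrable_bound[OF integrable_mult_right[OF H, of B]])
      show "AE t in lborel. norm (H t * h (e t)) \<le> norm (B * H t)"
      proof (rule AE_I2)
        fix t
        have "\<bar>h (e t)\<bar> \<le> \<bar>B\<bar>" using B[of "e t"] e0[of t] by simp
        then have "\<bar>H t\<bar> * \<bar>h (e t)\<bar> \<le> \<bar>H t\<bar> * \<bar>B\<bar>" by (intro mult_left_mono) auto
        then show "norm (H t * h (e t)) \<le> norm (B * H t)" by (simp only: real_norm_def abs_mult mult.commute[of B] mult.commute[of "\<bar>B\<bar>"])
      qed
    qed measurable
  qed
  have "(\<lambda>n. \<integral>t. F n t * e t ^ 0 \<partial>lborel) \<longlonglongrightarrow> (\<integral>t. F0 t * e t ^ 0 \<partial>lborel)" by (rule moments)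
  then have mass: "(\<lambda>n. \<integral>t. F n t \<partial>lborel) \<longlonglongrightarrow> (\<integral>t. F0 t \<partial>lborel)" by simp
  then have "Bseq (\<lambda>n. \<integral>t. F n t \<partial>lborel)" by (intro convergent_imp_Bseq convergentI)
  then obtain K where K': "K > 0" "\<forall>n. norm (\<integral>t. F n t \<partial>lborel) \<le> K" unfolding Bseq_def by blast
  then have K: "K > 0" "(\<integral>t. F n t \<partial>lborel) \<le> K" for n
    using abs_ge_self[of "\<integral>t. F n t \<partial>lborel"] by (auto intro: order_trans)
  have K0: "(\<integral>t. F0 t \<partial>lborel) \<le> K" by (rule LIMSEQ_le_const2[OF mass]) (use K in auto)
  \<comment> \<open>The total masses are the moments of order 0 and stay below \<open>K\<close>, so
    a uniform polynomial error of \<open>d / K\<close> on \<open>{0..1}\<close> costs at most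
    \<open>d\<close> in the integral.\<close>
  have "0 < d / K" using \<open>0 < d\<close> K by simp
  moreover have "continuous_on {0..1} g" using g by (rule continuous_on_subset) simp
  ultimately obtain P where P: "real_polynomial_function P" "\<And>v. v \<in> {0..1} \<Longrightarrow> \<bar>g v - P v\<bar> < d / K"
    using Stone_Weierstrass_real_polynomial_function[of "{0..1::real}" g "d / K"] by auto
  obtain a N where aN: "P = (\<lambda>v. \<Sum>i\<le>N. a i * v ^ i)" using P(1) unfolding real_polynomial_function_iff_sum by blast
  have Pc: "continuous_on UNIV P" unfolding aN by (intro continuous_intros)
  have Pint: "(\<integral>t. H t * P (e t) \<partial>lborel) = (\<Sum>i\<le>N. a i * (\<integral>t. H t * e t ^ i \<partial>lborel))" if H: "integrable lborel H" for H
  proof -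
    have "H t * P (e t) = (\<Sum>i\<le>N. a i * (H t * e t ^ i))" for t
      unfolding aN by (simp add: sum_distrib_left mult_ac)
    then have "(\<integral>t. H t * P (e t) \<partial>lborel) = (\<integral>t. (\<Sum>i\<le>N. a i * (H t * e t ^ i)) \<partial>lborel)" by simp
    also have "\<dots> = (\<Sum>i\<le>N. \<integral>t. a i * (H t * e t ^ i) \<partial>lborel)"
      by (intro Bochner_Integration.integral_sum integrable_mult_right ib[OF H, of "\<lambda>v. v ^ i" for i] continuous_intros)
    finally show ?thesis by simp
  qed
  have "(\<lambda>n. \<integral>t. F n t * P (e t) \<partial>lborel) \<longlonglongrightarrow> (\<integral>t. F0 t * P (e t) \<partial>lborel)"
    unfolding Pint[OF F(1)] Pint[OF F0(1)] by (intro tendsto_intros moments)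
  moreover have "norm ((\<integral>t. H t * g (e t) \<partial>lborel) - (\<integral>t. H t * P (e t) \<partial>lborel)) \<le> d"
    if H: "integrable lborel H" "\<And>t. 0 \<le> H t" "(\<integral>t. H t \<partial>lborel) \<le> K" for H
  proof -
    have "norm ((\<integral>t. H t * g (e t) \<partial>lborel) - (\<integral>t. H t * P (e t) \<partial>lborel)) = norm (\<integral>t. H t * g (e t) - H t * P (e t) \<partial>lborel)"
      using ib[OF H(1) g] ib[OF H(1) Pc] by simp
    also have "\<dots> \<le> (\<integral>t. d / K * H t \<partial>lborel)"
    proof (rule norm_integral_le_integral)
      show "norm (H t * g (e t) - H t * P (e t)) \<le> d / K * H t" for t
      proof -
        have "norm (H t * g (e t) - H t * P (e t)) = \<bar>g (e t) - P (e t)\<bar> * H t"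
          unfolding right_diff_distrib[symmetric] using H(2)[of t] by (simp add: abs_mult mult.commute)
        also have "\<dots> \<le> d / K * H t" using P(2)[of "e t"] e0[of t] H(2)[of t] by (intro mult_right_mono) auto
        finally show ?thesis .
      qed
    qed (use ib[OF H(1) g] ib[OF H(1) Pc] H(1) in auto)
    also have "\<dots> = d / K * (\<integral>t. H t \<partial>lborel)" by (rule integral_mult_right_zero)
    also have "\<dots> \<le> d / K * K" using H(3) \<open>0 < d\<close> K by (intro mult_left_mono) auto
    finally show ?thesis using K by simp
  qed
  ultimately show "\<exists>u v. u \<longlonglongrightarrow> v \<and> (\<forall>\<^sub>F n in sequentially. norm ((\<integral>t. F n t * g (e t) \<partial>lborel) - u n) \<le> d) \<and> norm ((\<integral>t. F0 t * g (e t) \<partial>lborel) - v) \<le> d"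
    using F F0 K K0 by (intro exI[of _ "\<lambda>n. \<integral>t. F n t * P (e t) \<partial>lborel"] exI[of _ "\<integral>t. F0 t * P (e t) \<partial>lborel"]) auto
qed

lemma integral_scale_Ioi:
  fixes f :: "real \<Rightarrow> real"
  assumes "0 < c"
  shows "(\<integral>t. indicator {0<..} t * f t \<partial>lborel) = c * (\<integral>t. indicator {0<..} t * f (c * t) \<partial>lborel)"
proof -
  have "(\<integral>t. indicator {0<..} t * f t \<partial>lborel) = \<bar>c\<bar> *\<^sub>R (\<integral>t. indicator {0<..} (0 + c * t) * f (0 + c * t) \<partial>lborel)"
    using assms by (intro lborel_integral_real_affine) simp
  also have "(\<lambda>t. indicator {0<..} (0 + c * t) * f (0 + c * t)) = (\<lambda>t. indicator {0<..} t * f (c * t))"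
    using assms by (auto simp: fun_eq_iff indicator_def zero_less_mult_iff)
  finally show ?thesis using assms by simp
qed

text \<open>Of the \<open>k + 1\<close> factors \<open>exp (- (t powr p))\<close> one stays inside
  \<open>temper\<close> and the other \<open>k\<close> form the power. Dilation by \<open>c\<close>
  thus produces the moment of order \<open>k\<close>, with \<open>c = 1\<close> for order 0.\<close>

lemma temper_scale:
  assumes "0 < t" "0 < c" "c powr p = real (Suc k)"
  shows "temper p \<alpha> (c * t) = c powr (-1 - \<alpha>) * (temper p \<alpha> t * exp (- (t powr p)) ^ k)"
proof -
  have "- ((c * t) powr p) = - (t powr p) + real k * - (t powr p)"
    using assms by (simp add: powr_mult algebra_simps)
  then have "exp (- ((c * t) powr p)) = exp (- (t powr p)) * exp (- (t powr p)) ^ k"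
    by (simp only: exp_add exp_of_nat_mult)
  then show ?thesis using assms by (simp add: temper_def powr_mult)
qed

text \<open>If the tails of \<open>A\<close> and \<open>B\<close> are proportional with one constant
  \<open>l\<close> for all directions, regular variation passes over: the ratio for \<open>A\<close>
  factors through \<open>B\<close> at \<open>r * t\<close> and at \<open>r\<close>, and
  \<open>l\<close> cancels. It is used both from \<open>R\<close> to \<open>M\<close> and from
  \<open>M\<close> to \<open>R\<close>.\<close>

lemma RV0_transfer:
  fixes A B \<sigma> :: "'a::euclidean_space measure"
  assumes A: "Mclass 0 A" and \<sigma>: "sphere_measure \<sigma>" and \<eta>: "0 < \<eta>" and RV: "RV0 (-\<eta>) \<sigma> B" and l: "0 < l"
    and lim: "\<And>D. sphere_cont_set \<sigma> D \<Longrightarrow>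
      ((\<lambda>r. measure A (polar_tail r D) / measure B {x. norm x > r}) \<longlongrightarrow> l * (measure \<sigma> D / measure \<sigma> (sphere 0 1))) (at_right 0)"
  shows "RV0 (-\<eta>) \<sigma> A"
proof -
  interpret A: levy_measure A by unfold_locales fact
  have \<sigma>p: "0 < measure \<sigma> (sphere 0 1)" by (rule sphere_measure_pos[OF \<sigma>])
  define a where "a r = measure A {x. norm x > r}" for r
  define b where "b r = measure B {x. norm x > r}" for r
  interpret b: regularly_varying_tail b \<eta> unfolding b_def[abs_def] by (rule RV0_regularly_varying_tail[OF RV \<sigma> \<eta>])
  have rpos: "\<forall>\<^sub>F r in at_right 0. (0::real) < r" by (rule eventually_at_right_less)
  have ab: "((\<lambda>r. a r / b r) \<longlongrightarrow> l) (at_right 0)"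
  proof (rule Lim_transform_eventually)
    show "((\<lambda>r. measure A (polar_tail r (sphere 0 1)) / b r) \<longlongrightarrow> l) (at_right 0)"
      using lim[OF sphere_cont_set_sphere] \<sigma>p by (simp add: b_def)
    show "\<forall>\<^sub>F r in at_right 0. measure A (polar_tail r (sphere 0 1)) / b r = a r / b r"
      using rpos by eventually_elim (simp add: polar_tail_sphere a_def)
  qed
  have apos: "\<forall>\<^sub>F r in at_right 0. 0 < a r"
    using order_tendstoD(1)[OF ab l] b.pos by eventually_elim (simp add: zero_less_divide_iff)
  have main: "((\<lambda>r. measure A (polar_tail (r * t) D) / a r) \<longlongrightarrow> t powr (-\<eta>) * measure \<sigma> D / measure \<sigma> (sphere 0 1)) (at_right 0)"
    if t: "0 < t" and D: "sphere_cont_set \<sigma> D" for t D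
  proof -
    have rt: "filterlim (\<lambda>r. r * t) (at_right 0) (at_right 0)"
    proof -
      have "((\<lambda>r. r * t) \<longlongrightarrow> 0 * t) (at_right 0)" by (intro tendsto_intros)
      then show ?thesis unfolding filterlim_at using t rpos by (auto elim: eventually_mono)
    qed
    have "((\<lambda>r. (measure A (polar_tail (r * t) D) / b (r * t)) * (b (r * t) / b r) * inverse (a r / b r)) \<longlongrightarrow>
        l * (measure \<sigma> D / measure \<sigma> (sphere 0 1)) * t powr (-\<eta>) * inverse l) (at_right 0)"
      using l by (intro tendsto_mult tendsto_inverse ab b.ratio[OF t] filterlim_compose[OF lim[OF D, folded b_def] rt]) auto
    also have "l * (measure \<sigma> D / measure \<sigma> (sphere 0 1)) * t powr (-\<eta>) * inverse l = t powr (-\<eta>) * measure \<sigma> D / measure \<sigma> (sphere 0 1)"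
      using l by simp
    finally show ?thesis
    proof (rule Lim_transform_eventually)
      have "\<forall>\<^sub>F r in at_right 0. 0 < b (r * t)" using b.pos rt by (rule filterlim_iff[THEN iffD1, rule_format, rotated])
      with b.pos apos show "\<forall>\<^sub>F r in at_right 0. (measure A (polar_tail (r * t) D) / b (r * t)) * (b (r * t) / b r) * inverse (a r / b r) = measure A (polar_tail (r * t) D) / a r"
        by eventually_elim simp
    qed
  qed
  have "emeasure A UNIV \<noteq> 0"
  proof
    assume "emeasure A UNIV = 0"
    then have "a r = 0" for r
      using emeasure_mono[of "{x. norm x > r}" UNIV A] by (simp add: a_def measure_def A.sets_M)
    then show False using eventually_happens'[OF trivial_limit_at_right_real apos] by auto
  qed
  then show ?thesis unfolding RV0_iff using A main unfolding a_def by blast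
qed

text \<open>A continuous bump that, for \<open>a \<le> b\<close>, is positive exactly between
  \<open>a\<close> and \<open>b\<close>; it localises the Tauberian argument.\<close>

definition tent :: "real \<Rightarrow> real \<Rightarrow> real \<Rightarrow> real" where
  "tent a b v = max 0 ((v - a) * (b - v))"

lemma continuous_tent: "continuous_on A (tent a b)"
  unfolding tent_def by (intro continuous_intros)

lemma tent_nonneg: "0 \<le> tent a b v"
  by (simp add: tent_def)

lemma tent_pos_iff: "a \<le> b \<Longrightarrow> 0 < tent a b v \<longleftrightarrow> a < v \<and> v < b"
  by (auto simp: tent_def less_max_iff_disj zero_less_mult_iff)

lemma bounded_tent_01:
  obtains B where "\<And>v. 0 \<le> v \<Longrightarrow> v \<le> 1 \<Longrightarrow> \<bar>tent a b v\<bar> \<le> B"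
proof -
  have "compact (tent a b ` {0..1})" by (intro compact_continuous_image continuous_tent) simp
  then have "bounded (tent a b ` {0..1})" by (rule compact_imp_bounded)
  then obtain B where "\<forall>v\<in>{0..1}. \<bar>tent a b v\<bar> \<le> B" unfolding bounded_iff by auto
  then have "\<And>v. 0 \<le> v \<Longrightarrow> v \<le> 1 \<Longrightarrow> \<bar>tent a b v\<bar> \<le> B" by auto
  then show ?thesis by (rule that)
qed

section \<open>Proportionality of the tails of \<open>R\<close> and \<open>M\<close>\<close>

context tempered
begin

context
  fixes \<sigma> :: "'a measure" and \<eta> :: real
  assumes \<sigma>: "sphere_measure \<sigma>" and \<eta>: "\<gamma> < \<eta>" "\<eta> < 2"
begin

lemma \<eta>_pos: "0 < \<eta>" and \<alpha>_less: "\<alpha> < \<eta>"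
  using \<eta>(1) by (auto simp: \<gamma>_def)

text \<open>The limiting ratio of the tail of \<open>M\<close> to that of \<open>R\<close>: inside
  the tail integral the tail of \<open>R\<close> at \<open>r / t\<close>, divided by that at
  \<open>r\<close>, tends to \<open>t powr \<eta>\<close>. The integral is finite because
  \<open>\<alpha> < \<eta>\<close>.\<close>

definition temper_moment :: real where
  "temper_moment = (\<integral>t. indicator {0<..} t * (t powr \<eta> * temper p \<alpha> t) \<partial>lborel)"

lemma integral_Ioi_pos:
  fixes f :: "real \<Rightarrow> real"
  assumes i: "integrable lborel (\<lambda>t. indicator {0<..} t * f t)" and f: "\<And>t. 0 < t \<Longrightarrow> 0 \<le> f t"
    and lu: "0 < l" "l < u" "\<And>t. l < t \<Longrightarrow> t < u \<Longrightarrow> 0 < f t"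
  shows "0 < (\<integral>t. indicator {0<..} t * f t \<partial>lborel)"
proof -
  have nn: "0 \<le> indicator {0<..} t * f t" for t using f[of t] by (auto simp: indicator_def)
  have "0 \<le> (\<integral>t. indicator {0<..} t * f t \<partial>lborel)" by (rule Bochner_Integration.integral_nonneg) (rule nn)
  moreover have "(\<integral>t. indicator {0<..} t * f t \<partial>lborel) \<noteq> 0"
  proof
    assume "(\<integral>t. indicator {0<..} t * f t \<partial>lborel) = 0"
    then have "AE t in lborel. indicator {0<..} t * f t = 0"
      using integral_nonneg_eq_0_iff_AE[OF i] nn by simp
    then have "AE t in lborel. t \<notin> {l<..<u}"
    proof eventually_elim
      case (elim t)
      show ?case
      proof
        assume "t \<in> {l<..<u}"
        then show False using elim lu(1) lu(3)[of t] by (auto simp: indicator_def)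
      qed
    qed
    then have "{l<..<u} \<in> null_sets lborel" by (subst AE_iff_null_sets) auto
    then show False using lu(2) by (simp add: null_sets_def)
  qed
  ultimately show ?thesis by simp
qed

lemma temper_pos: "0 < t \<Longrightarrow> 0 < temper p \<alpha> t"
  by (simp add: temper_def)

lemma temper_moment_pos: "0 < temper_moment"
  unfolding temper_moment_def
  by (rule integral_Ioi_pos[OF integrable_temper_powr[OF p \<alpha>_less], of 1 2]) (auto simp: temper_nonneg temper_pos)

text \<open>Covers the range where \<open>r / t\<close> is too large for Potter bounds. After
  replacing \<open>t\<close> by \<open>r * t\<close> this range is \<open>t \<le> 1 / r0\<close>, on
  which the tempering factor is bounded below. The integral then compares with the tail of
  \<open>M\<close> at level 1, and the power \<open>r powr (-\<alpha>)\<close> comes out.\<close>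

lemma small_scale_remainder:
  assumes D: "D \<in> sets borel" and r0: "0 < r0"
  obtains C where "\<And>r. 0 < r \<Longrightarrow> (\<integral>t. indicator {0<..} t * (indicator {t. r0 \<le> r / t} t * (measure R (polar_tail (r / t) D) * temper p \<alpha> t)) \<partial>lborel) \<le> C * r powr (-\<alpha>)"
proof (rule that[of "exp ((1/r0) powr p) * measure M (polar_tail 1 D)"])
  fix r :: real assume r: "0 < r"
  let ?U = "\<lambda>s. measure R (polar_tail s D)"
  let ?E = "exp ((1/r0) powr p)"
  note i1 = tail_formula(1)[OF D zero_less_one]
  have m: "(\<lambda>t. indicator {0<..} t * (indicator {t. r0 \<le> r / (r * t)} t * (?U (r / (r * t)) * temper p \<alpha> (r * t)))) \<in> borel_measurable borel"
  proof -
    have [measurable]: "(\<lambda>t. indicator {0<..} t * ?U (1 / t)) \<in> borel_measurable borel" by (rule tail_measurable[OF D zero_less_one])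
    have "(\<lambda>t. (indicator {0<..} t * ?U (1 / t)) * (indicator {t. r0 \<le> 1 / t} t * temper p \<alpha> (r * t))) \<in> borel_measurable borel" by measurable
    also have "(\<lambda>t. (indicator {0<..} t * ?U (1 / t)) * (indicator {t. r0 \<le> 1 / t} t * temper p \<alpha> (r * t))) =
       (\<lambda>t. indicator {0<..} t * (indicator {t. r0 \<le> r / (r * t)} t * (?U (r / (r * t)) * temper p \<alpha> (r * t))))"
      using r by (simp add: fun_eq_iff indicator_def)
    finally show ?thesis .
  qed
  have le: "indicator {0<..} t * (indicator {t. r0 \<le> r / (r * t)} t * (?U (r / (r * t)) * temper p \<alpha> (r * t))) \<le>
      r powr (-1 - \<alpha>) * ?E * (indicator {0<..} t * (?U (1 / t) * temper p \<alpha> t))" for t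
  proof (cases "0 < t \<and> r0 \<le> 1 / t")
    case True
    then have t: "0 < t" "t \<le> 1 / r0" using r0 by (auto simp: field_simps)
    \<comment> \<open>Here \<open>exp (- (t powr p))\<close> is at least \<open>1 / ?E\<close>, so
      the bare power is at most \<open>?E * temper p \<alpha> t\<close>; the exponential at
      \<open>r * t\<close> is simply bounded by 1.\<close>
    have "t powr p \<le> (1/r0) powr p" using t p by (intro powr_mono2) auto
    then have "1 \<le> ?E * exp (- (t powr p))" by (simp add: exp_add[symmetric])
    then have "t powr (-1 - \<alpha>) * 1 \<le> t powr (-1 - \<alpha>) * (?E * exp (- (t powr p)))" by (intro mult_left_mono) auto
    then have A: "t powr (-1 - \<alpha>) \<le> ?E * temper p \<alpha> t" by (simp add: temper_def mult_ac)
    have "temper p \<alpha> (r * t) \<le> (r * t) powr (-1 - \<alpha>) * 1" unfolding temper_def by (intro mult_left_mono) auto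
    also have "\<dots> = r powr (-1 - \<alpha>) * t powr (-1 - \<alpha>)" using r t by (simp add: powr_mult)
    also have "\<dots> \<le> r powr (-1 - \<alpha>) * (?E * temper p \<alpha> t)" by (rule mult_left_mono[OF A]) simp
    finally have "?U (1 / t) * temper p \<alpha> (r * t) \<le> ?U (1 / t) * (r powr (-1 - \<alpha>) * (?E * temper p \<alpha> t))" by (rule mult_left_mono) simp
    then show ?thesis using True r by (simp add: mult_ac)
  next
    case False
    then have Z: "indicator {0<..} t * (indicator {t. r0 \<le> r / (r * t)} t * (?U (r / (r * t)) * temper p \<alpha> (r * t))) = 0"
      using r by (auto simp: indicator_def)
    show ?thesis unfolding Z by (simp add: temper_nonneg)
  qed
  have iR: "integrable lborel (\<lambda>t. r powr (-1 - \<alpha>) * ?E * (indicator {0<..} t * (?U (1 / t) * temper p \<alpha> t)))"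
    by (rule integrable_mult_right[OF i1])
  have "(\<integral>t. indicator {0<..} t * (indicator {t. r0 \<le> r / t} t * (?U (r / t) * temper p \<alpha> t)) \<partial>lborel) =
     r * (\<integral>t. indicator {0<..} t * (indicator {t. r0 \<le> r / (r * t)} t * (?U (r / (r * t)) * temper p \<alpha> (r * t))) \<partial>lborel)"
    using integral_scale_Ioi[OF r, of "\<lambda>t. indicator {t. r0 \<le> r / t} t * (?U (r / t) * temper p \<alpha> t)"] by (simp add: indicator_def)
  also have "\<dots> \<le> r * (\<integral>t. r powr (-1 - \<alpha>) * ?E * (indicator {0<..} t * (?U (1 / t) * temper p \<alpha> t)) \<partial>lborel)"
  proof (intro mult_left_mono integral_mono)
    show "integrable lborel (\<lambda>t. indicator {0<..} t * (indicator {t. r0 \<le> r / (r * t)} t * (?U (r / (r * t)) * temper p \<alpha> (r * t))))"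
    proof (rule Bochner_Integration.integrable_bound[OF iR])
      show "AE t in lborel. norm (indicator {0<..} t * (indicator {t. r0 \<le> r / (r * t)} t * (?U (r / (r * t)) * temper p \<alpha> (r * t)))) \<le> norm (r powr (-1 - \<alpha>) * ?E * (indicator {0<..} t * (?U (1 / t) * temper p \<alpha> t)))"
      proof (rule AE_I2)
        fix t
        have "0 \<le> indicator {0<..} t * (indicator {t. r0 \<le> r / (r * t)} t * (?U (r / (r * t)) * temper p \<alpha> (r * t)))" by (simp add: temper_nonneg)
        then show "norm (indicator {0<..} t * (indicator {t. r0 \<le> r / (r * t)} t * (?U (r / (r * t)) * temper p \<alpha> (r * t)))) \<le> norm (r powr (-1 - \<alpha>) * ?E * (indicator {0<..} t * (?U (1 / t) * temper p \<alpha> t)))"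
          using le[of t] unfolding real_norm_def by linarith
      qed
    qed (simp only: measurable_lborel2, rule m)
  qed (rule iR le less_imp_le[OF r])+
  also have "\<dots> = r * (r powr (-1 - \<alpha>) * ?E * measure M (polar_tail 1 D))"
    unfolding tail_formula(2)[OF D zero_less_one] by (simp only: integral_mult_right_zero)
  also have "\<dots> = ?E * measure M (polar_tail 1 D) * (r * r powr (-1 - \<alpha>))" by (simp only: mult_ac)
  also have "r * r powr (-1 - \<alpha>) = r powr (-\<alpha>)"
    using r powr_add[of r 1 "-1 - \<alpha>"] by simp
  finally show "(\<integral>t. indicator {0<..} t * (indicator {t. r0 \<le> r / t} t * (?U (r / t) * temper p \<alpha> t)) \<partial>lborel) \<le> ?E * measure M (polar_tail 1 D) * r powr (-\<alpha>)" .
qed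

text \<open>The tail integral divided by \<open>U r\<close> is split at \<open>r / t = r0\<close>.
  Small radii converge by domination, with the Potter exponent \<open>c\<close> for
  \<open>t \<le> 1\<close> and \<open>b\<close> for larger \<open>t\<close> in the majorant. The
  rest is of order \<open>r powr (-\<alpha>)\<close>, against
  \<open>U r \<ge> K * r powr (-c)\<close>.\<close>

lemma abelian:
  assumes RV: "RV0 (-\<eta>) \<sigma> R" and D: "sphere_cont_set \<sigma> D"
  shows "((\<lambda>r. measure M (polar_tail r D) / measure R {x. norm x > r}) \<longlongrightarrow>
    temper_moment * (measure \<sigma> D / measure \<sigma> (sphere 0 1))) (at_right 0)"
proof -
  define q where "q = measure \<sigma> D / measure \<sigma> (sphere 0 1)"
  define U where "U r = measure R {x. norm x > r}" for r
  let ?UD = "\<lambda>s. measure R (polar_tail s D)"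
  have Dm: "D \<in> sets borel" using D by (simp add: sphere_cont_set_def)
  interpret U: regularly_varying_tail U \<eta> unfolding U_def[abs_def] by (rule RV0_regularly_varying_tail[OF RV \<sigma> \<eta>_pos])
  \<comment> \<open>Strictly between \<open>\<gamma>\<close> and \<open>\<eta>\<close>: below
    \<open>\<eta>\<close> for the Potter bound, above \<open>\<alpha>\<close> so that
    \<open>t powr c * temper p \<alpha> t\<close> is integrable and
    \<open>r powr (c - \<alpha>)\<close> vanishes at 0.\<close>
  define c where "c = (\<gamma> + \<eta>) / 2"
  have c: "0 < c" "c < \<eta>" "\<alpha> < c" "\<gamma> < c" using \<eta>(1) by (auto simp: c_def \<gamma>_def)
  define b where "b = \<eta> + 1"
  obtain r0 where r0: "0 < r0" "\<And>r. 0 < r \<Longrightarrow> r < r0 \<Longrightarrow> 0 < U r"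
    "\<And>r t. 0 < r \<Longrightarrow> 0 < t \<Longrightarrow> t \<le> 1 \<Longrightarrow> r / t < r0 \<Longrightarrow> U (r / t) \<le> 2 powr c * t powr c * U r"
    using U.potter_lower[OF c(1,2)] by blast
  obtain r1 where r1: "0 < r1" "\<And>r t. 0 < r \<Longrightarrow> r < r1 \<Longrightarrow> 1 \<le> t \<Longrightarrow> U (r / t) \<le> 2 powr b * t powr b * U r"
    using U.potter_upper[of b] by (auto simp: b_def)
  obtain r2 K where r2: "0 < r2" "0 < K" "\<And>r. 0 < r \<Longrightarrow> r < r2 \<Longrightarrow> K * r powr (-c) \<le> U r"
    using U.lower_growth[OF c(1,2)] by blast
  obtain C where C: "\<And>r. 0 < r \<Longrightarrow> (\<integral>t. indicator {0<..} t * (indicator {t. r0 \<le> r / t} t * (?UD (r / t) * temper p \<alpha> t)) \<partial>lborel) \<le> C * r powr (-\<alpha>)"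
    using small_scale_remainder[OF Dm r0(1)] by blast
  show ?thesis
    unfolding q_def[symmetric] U_def[symmetric] tendsto_at_iff_sequentially
  proof safe
    fix X :: "nat \<Rightarrow> real" assume X: "\<forall>n. X n \<in> {0<..} - {0}" "X \<longlonglongrightarrow> 0"
    define rm where "rm = min r0 (min r1 r2)"
    have rm: "0 < rm" using r0(1) r1(1) r2(1) by (simp add: rm_def)
    from order_tendstoD(2)[OF X(2) rm] obtain N where N: "\<And>n. N \<le> n \<Longrightarrow> X n < rm" by (auto simp: eventually_sequentially)
    \<comment> \<open>The shift makes the Potter bounds valid from the first index on, as domination
      requires; \<open>LIMSEQ_offset\<close> undoes it at the end.\<close>
    define Y where "Y n = X (n + N)" for n
    have Y: "0 < Y n" "Y n < r0" "Y n < r1" "Y n < r2" for n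
      using X(1) N[of "n + N"] by (auto simp: Y_def rm_def)
    have Y0: "Y \<longlonglongrightarrow> 0" unfolding Y_def by (rule LIMSEQ_ignore_initial_segment[OF X(2)])
    have Yf: "filterlim Y (at_right 0) sequentially"
      unfolding filterlim_at using Y0 Y(1) by (auto intro!: always_eventually simp: less_imp_neq[OF Y(1), symmetric])
    have Upos: "0 < U (Y n)" for n using r0(2)[OF Y(1,2)] .
    let ?w = "temper p \<alpha>"
    define G where "G n t = indicator {0<..} t * (?UD (Y n / t) * ?w t)" for n t
    have Gi: "integrable lborel (G n)" for n unfolding G_def by (rule tail_formula(1)[OF Dm Y(1)])
    have GT: "measure M (polar_tail (Y n) D) = (\<integral>t. G n t \<partial>lborel)" for n unfolding G_def by (rule tail_formula(2)[OF Dm Y(1)])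
    have G0: "0 \<le> G n t" for n t by (simp add: G_def temper_nonneg)
    define A where "A n t = indicator {t. Y n / t < r0} t * G n t" for n t
    define B where "B n t = indicator {t. r0 \<le> Y n / t} t * G n t" for n t
    have GAB: "G n t = A n t + B n t" for n t by (auto simp: A_def B_def indicator_def)
    have [measurable]: "G n \<in> borel_measurable borel" for n using Gi[of n] by auto
    have [measurable]: "A n \<in> borel_measurable borel" "B n \<in> borel_measurable borel" for n
      unfolding A_def[abs_def] B_def[abs_def] by measurable
    have Ai: "integrable lborel (A n)" for n
      by (rule Bochner_Integration.integrable_bound[OF Gi[of n]]) (auto simp: A_def indicator_def)
    have Bi: "integrable lborel (B n)" for n
      by (rule Bochner_Integration.integrable_bound[OF Gi[of n]]) (auto simp: B_def indicator_def)
    have UDle: "?UD s \<le> U s" if "0 < s" for s unfolding U_def by (rule R.measure_polar_tail_le[OF that Dm])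
    have limA: "(\<lambda>n. \<integral>t. A n t / U (Y n) \<partial>lborel) \<longlonglongrightarrow> (\<integral>t. q * (indicator {0<..} t * (t powr \<eta> * ?w t)) \<partial>lborel)"
    proof (rule integral_dominated_convergence[where w="\<lambda>t. 2 powr c * (indicator {0<..} t * (t powr c * ?w t)) + 2 powr b * (indicator {0<..} t * (t powr b * ?w t))"])
      show "integrable lborel (\<lambda>t. 2 powr c * (indicator {0<..} t * (t powr c * ?w t)) + 2 powr b * (indicator {0<..} t * (t powr b * ?w t)))"
        using c \<alpha>_less by (intro Bochner_Integration.integrable_add integrable_mult_right integrable_temper_powr p) (auto simp: b_def)
      show "AE t in lborel. norm (A n t / U (Y n)) \<le> 2 powr c * (indicator {0<..} t * (t powr c * ?w t)) + 2 powr b * (indicator {0<..} t * (t powr b * ?w t))" for n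
      proof (rule AE_I2)
        fix t :: real
        show "norm (A n t / U (Y n)) \<le> 2 powr c * (indicator {0<..} t * (t powr c * ?w t)) + 2 powr b * (indicator {0<..} t * (t powr b * ?w t))"
        proof (cases "0 < t \<and> Y n / t < r0")
          case True
          have "?UD (Y n / t) \<le> U (Y n / t)" using True Y(1)[of n] by (intro UDle) simp
          also have "\<dots> \<le> (2 powr c * t powr c + 2 powr b * t powr b) * U (Y n)"
          proof (cases "t \<le> 1")
            case le: True
            have "U (Y n / t) \<le> 2 powr c * t powr c * U (Y n)" using True le by (intro r0(3) Y) auto
            also have "\<dots> \<le> (2 powr c * t powr c + 2 powr b * t powr b) * U (Y n)"
              using Upos[of n] by (intro mult_right_mono) auto
            finally show ?thesis .
          next
            case False
            have "U (Y n / t) \<le> 2 powr b * t powr b * U (Y n)" using False by (intro r1(2) Y) auto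
            also have "\<dots> \<le> (2 powr c * t powr c + 2 powr b * t powr b) * U (Y n)"
              using Upos[of n] by (intro mult_right_mono) auto
            finally show ?thesis .
          qed
          finally have "?UD (Y n / t) / U (Y n) \<le> 2 powr c * t powr c + 2 powr b * t powr b"
            using Upos[of n] by (simp add: divide_le_eq)
          then have "?UD (Y n / t) / U (Y n) * ?w t \<le> (2 powr c * t powr c + 2 powr b * t powr b) * ?w t"
            by (rule mult_right_mono) (rule temper_nonneg)
          moreover have "norm (A n t / U (Y n)) = ?UD (Y n / t) / U (Y n) * ?w t"
            using True Upos[of n] by (simp add: A_def G_def temper_nonneg abs_mult)
          ultimately show ?thesis using True by (simp add: algebra_simps)
        next
          case False
          then have "A n t = 0" by (auto simp: A_def G_def indicator_def)
          then show ?thesis by (simp add: temper_nonneg)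
        qed
      qed
      show "AE t in lborel. (\<lambda>n. A n t / U (Y n)) \<longlonglongrightarrow> q * (indicator {0<..} t * (t powr \<eta> * ?w t))"
      proof (rule AE_I2)
        fix t :: real
        show "(\<lambda>n. A n t / U (Y n)) \<longlonglongrightarrow> q * (indicator {0<..} t * (t powr \<eta> * ?w t))"
        proof (cases "0 < t")
          case True
          have "((\<lambda>r. measure R (polar_tail (r * (1/t)) D) / U r) \<longlongrightarrow> (1/t) powr (-\<eta>) * measure \<sigma> D / measure \<sigma> (sphere 0 1)) (at_right 0)"
            using RV D True unfolding RV0_iff U_def by (meson zero_less_divide_1_iff)
          from filterlim_compose[OF this Yf] have "(\<lambda>n. ?UD (Y n / t) / U (Y n)) \<longlonglongrightarrow> q * t powr \<eta>"
            using True by (simp add: q_def powr_divide powr_minus_divide mult.commute)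
          then have "(\<lambda>n. ?UD (Y n / t) / U (Y n) * ?w t) \<longlonglongrightarrow> q * t powr \<eta> * ?w t" by (rule tendsto_mult_right)
          then have "(\<lambda>n. A n t / U (Y n)) \<longlonglongrightarrow> q * t powr \<eta> * ?w t"
          proof (rule Lim_transform_eventually)
            have "0 < r0 * t" using r0(1) True by simp
            from order_tendstoD(2)[OF Y0 this]
            show "\<forall>\<^sub>F n in sequentially. ?UD (Y n / t) / U (Y n) * ?w t = A n t / U (Y n)"
              by eventually_elim (use True in \<open>simp add: A_def G_def divide_less_eq\<close>)
          qed
          then show ?thesis using True by (simp add: mult.assoc)
        next
          case False
          then show ?thesis by (simp add: A_def G_def)
        qed
      qed
      show "(\<lambda>t. A n t / U (Y n)) \<in> borel_measurable lborel" for n unfolding A_def by measurable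
    qed measurable
    have limB: "(\<lambda>n. (\<integral>t. B n t \<partial>lborel) / U (Y n)) \<longlonglongrightarrow> 0"
    proof (rule tendsto_sandwich[where f="\<lambda>_. 0" and h="\<lambda>n. \<bar>C\<bar> / K * Y n powr (c - \<alpha>)"])
      show "\<forall>\<^sub>F n in sequentially. 0 \<le> (\<integral>t. B n t \<partial>lborel) / U (Y n)"
        using Upos by (intro always_eventually allI divide_nonneg_pos Bochner_Integration.integral_nonneg) (auto simp: B_def G0)
      show "\<forall>\<^sub>F n in sequentially. (\<integral>t. B n t \<partial>lborel) / U (Y n) \<le> \<bar>C\<bar> / K * Y n powr (c - \<alpha>)"
      proof (intro always_eventually allI)
        fix n
        have "(\<integral>t. B n t \<partial>lborel) = (\<integral>t. indicator {0<..} t * (indicator {t. r0 \<le> Y n / t} t * (?UD (Y n / t) * ?w t)) \<partial>lborel)"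
          by (simp add: B_def G_def mult_ac)
        also have "\<dots> \<le> C * Y n powr (-\<alpha>)" by (rule C[OF Y(1)])
        also have "\<dots> \<le> \<bar>C\<bar> * Y n powr (-\<alpha>)" by (intro mult_right_mono) auto
        finally have "(\<integral>t. B n t \<partial>lborel) / U (Y n) \<le> \<bar>C\<bar> * Y n powr (-\<alpha>) / (K * Y n powr (-c))"
          using r2(2) r2(3)[OF Y(1,4), of n] Y(1)[of n] by (intro frac_le) auto
        also have "\<dots> = \<bar>C\<bar> / K * (Y n powr (-\<alpha>) / Y n powr (-c))" by simp
        also have "Y n powr (-\<alpha>) / Y n powr (-c) = Y n powr (c - \<alpha>)" by (simp add: powr_diff[symmetric])
        finally show "(\<integral>t. B n t \<partial>lborel) / U (Y n) \<le> \<bar>C\<bar> / K * Y n powr (c - \<alpha>)" .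
      qed
      have "(\<lambda>n. \<bar>C\<bar> / K * Y n powr (c - \<alpha>)) \<longlonglongrightarrow> \<bar>C\<bar> / K * 0 powr (c - \<alpha>)"
        using c(3) Y(1) by (intro tendsto_mult tendsto_const tendsto_powr' Y0) (auto intro!: always_eventually less_imp_le)
      then show "(\<lambda>n. \<bar>C\<bar> / K * Y n powr (c - \<alpha>)) \<longlonglongrightarrow> 0" by simp
    qed simp
    have "(\<lambda>n. (\<integral>t. A n t / U (Y n) \<partial>lborel) + (\<integral>t. B n t \<partial>lborel) / U (Y n)) \<longlonglongrightarrow> (\<integral>t. q * (indicator {0<..} t * (t powr \<eta> * ?w t)) \<partial>lborel) + 0"
      by (rule tendsto_add[OF limA limB])
    moreover have "(\<integral>t. A n t / U (Y n) \<partial>lborel) + (\<integral>t. B n t \<partial>lborel) / U (Y n) = measure M (polar_tail (Y n) D) / U (Y n)" for n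
    proof -
      have "(\<integral>t. G n t \<partial>lborel) = (\<integral>t. A n t \<partial>lborel) + (\<integral>t. B n t \<partial>lborel)"
        unfolding GAB by (rule Bochner_Integration.integral_add[OF Ai Bi])
      then show ?thesis unfolding GT by (simp add: add_divide_distrib)
    qed
    ultimately have "(\<lambda>n. measure M (polar_tail (Y n) D) / U (Y n)) \<longlonglongrightarrow> temper_moment * q"
      by (simp add: temper_moment_def mult.commute)
    then show "((\<lambda>r. measure M (polar_tail r D) / U r) \<circ> X) \<longlonglongrightarrow> temper_moment * q"
      unfolding Y_def comp_def by (rule LIMSEQ_offset)
  qed
qed

text \<open>Replacing \<open>t\<close> by \<open>c * t\<close> in the tail formula and in
  \<open>temper_moment\<close>, \<open>temper_scale\<close> restores the original density times the
  k-th power. Both moments carry the same factor \<open>c powr \<alpha>\<close>, so what remains is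
  the tail of \<open>M\<close> at \<open>r * c\<close> against \<open>c powr (-\<eta>)\<close>, the
  content of regular variation.\<close>

lemma temper_laplace_moments:
  assumes c: "0 < c" "c powr p = real (Suc k)" and r: "0 < r" and D: "D \<in> sets borel"
  shows "(\<integral>t. indicator {0<..} t * (measure R (polar_tail (r / t) D) * temper p \<alpha> t) * exp (- (t powr p)) ^ k \<partial>lborel) =
      c powr \<alpha> * measure M (polar_tail (r * c) D)"
    and "(\<integral>t. indicator {0<..} t * (t powr \<eta> * temper p \<alpha> t) * exp (- (t powr p)) ^ k \<partial>lborel) =
      c powr \<alpha> * (c powr (-\<eta>) * temper_moment)"
proof -
  have rc: "0 < r * c" using r c by simp
  have cc: "c * c powr (-1 - \<alpha>) = c powr (-\<alpha>)" using c powr_add[of c 1 "-1 - \<alpha>"] by simp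
  have cinv: "c powr \<alpha> * c powr (-\<alpha>) = 1" using c by (simp add: powr_add[symmetric])
  let ?I1 = "\<integral>t. indicator {0<..} t * (measure R (polar_tail (r / t) D) * temper p \<alpha> t) * exp (- (t powr p)) ^ k \<partial>lborel"
  have "measure M (polar_tail (r * c) D) = c * (\<integral>t. indicator {0<..} t * (measure R (polar_tail (r * c / (c * t)) D) * temper p \<alpha> (c * t)) \<partial>lborel)"
    unfolding tail_formula(2)[OF D rc] by (rule integral_scale_Ioi[OF c(1)])
  also have "(\<integral>t. indicator {0<..} t * (measure R (polar_tail (r * c / (c * t)) D) * temper p \<alpha> (c * t)) \<partial>lborel) = (\<integral>t. c powr (-1 - \<alpha>) * (indicator {0<..} t * (measure R (polar_tail (r / t) D) * temper p \<alpha> t) * exp (- (t powr p)) ^ k) \<partial>lborel)"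
    using c by (intro Bochner_Integration.integral_cong) (auto simp: indicator_def temper_scale[OF _ c])
  also have "\<dots> = c powr (-1 - \<alpha>) * ?I1" by (rule integral_mult_right_zero)
  finally have "measure M (polar_tail (r * c) D) = c powr (-\<alpha>) * ?I1" by (simp only: mult.assoc[symmetric] cc)
  then show "?I1 = c powr \<alpha> * measure M (polar_tail (r * c) D)" by (simp only: mult.assoc[symmetric] cinv mult_1_left)
  let ?I2 = "\<integral>t. indicator {0<..} t * (t powr \<eta> * temper p \<alpha> t) * exp (- (t powr p)) ^ k \<partial>lborel"
  have "temper_moment = c * (\<integral>t. indicator {0<..} t * ((c * t) powr \<eta> * temper p \<alpha> (c * t)) \<partial>lborel)"
    unfolding temper_moment_def by (rule integral_scale_Ioi[OF c(1)])
  also have "(\<integral>t. indicator {0<..} t * ((c * t) powr \<eta> * temper p \<alpha> (c * t)) \<partial>lborel) = (\<integral>t. c powr \<eta> * c powr (-1 - \<alpha>) * (indicator {0<..} t * (t powr \<eta> * temper p \<alpha> t) * exp (- (t powr p)) ^ k) \<partial>lborel)"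
    using c by (intro Bochner_Integration.integral_cong) (auto simp: indicator_def temper_scale[OF _ c] powr_mult)
  also have "\<dots> = c powr \<eta> * c powr (-1 - \<alpha>) * ?I2" by (rule integral_mult_right_zero)
  finally have "temper_moment = c powr \<eta> * (c powr (-\<alpha>) * ?I2)" by (simp only: cc[symmetric] mult_ac)
  then have "c powr \<alpha> * (c powr (-\<eta>) * temper_moment) = (c powr \<alpha> * c powr (-\<alpha>)) * ((c powr (-\<eta>) * c powr \<eta>) * ?I2)" by (simp only: mult_ac)
  then show "?I2 = c powr \<alpha> * (c powr (-\<eta>) * temper_moment)"
    using c by (simp add: powr_add[symmetric])
qed

text \<open>Karamata's argument: the substitution \<open>v = exp (- t\<^sup>p)\<close> turns dilations into moments.\<close>
lemma tauberian:
  assumes RV: "RV0 (-\<eta>) \<sigma> M" and D: "sphere_cont_set \<sigma> D"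
  shows "((\<lambda>r. measure R (polar_tail r D) / measure M {x. norm x > r}) \<longlongrightarrow>
    1 / temper_moment * (measure \<sigma> D / measure \<sigma> (sphere 0 1))) (at_right 0)"
proof -
  define q where "q = measure \<sigma> D / measure \<sigma> (sphere 0 1)"
  define \<kappa> where "\<kappa> = temper_moment"
  have \<kappa>: "0 < \<kappa>" unfolding \<kappa>_def by (rule temper_moment_pos)
  have q0: "0 \<le> q" by (simp add: q_def)
  define T where "T r = measure M {x. norm x > r}" for r
  let ?UD = "\<lambda>s. measure R (polar_tail s D)"
  let ?w = "temper p \<alpha>"
  have Dm: "D \<in> sets borel" using D by (simp add: sphere_cont_set_def)
  interpret T: regularly_varying_tail T \<eta>
    unfolding T_def[abs_def] by (rule RV0_regularly_varying_tail[OF RV \<sigma> \<eta>_pos])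
  have iF0: "integrable lborel (\<lambda>t. indicator {0<..} t * (t powr \<eta> * ?w t))"
    by (rule integrable_temper_powr[OF p \<alpha>_less])
  have UDanti: "?UD s' \<le> ?UD s" if "0 < s" "s \<le> s'" for s s' by (rule R.measure_polar_tail_mono[OF that Dm])
  show ?thesis
    unfolding q_def[symmetric] T_def[symmetric] \<kappa>_def[symmetric] tendsto_at_iff_sequentially
  proof safe
    fix X :: "nat \<Rightarrow> real" assume X: "\<forall>n. X n \<in> {0<..} - {0}" "X \<longlonglongrightarrow> 0"
    obtain r0 where r0: "0 < r0" "\<And>r. 0 < r \<Longrightarrow> r < r0 \<Longrightarrow> 0 < T r"
      using T.pos unfolding eventually_at_right_0_real by blast
    from order_tendstoD(2)[OF X(2) r0(1)] obtain N where N: "\<And>n. N \<le> n \<Longrightarrow> X n < r0" by (auto simp: eventually_sequentially)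
    define Y where "Y n = X (n + N)" for n
    have Y: "0 < Y n" "0 < T (Y n)" for n
      using X(1) N[of "n + N"] r0(2)[of "Y n"] by (auto simp: Y_def)
    have Y0: "Y \<longlonglongrightarrow> 0" unfolding Y_def by (rule LIMSEQ_ignore_initial_segment[OF X(2)])
    have Yf: "filterlim Y (at_right 0) sequentially"
      unfolding filterlim_at using Y0 Y(1) by (auto intro!: always_eventually simp: less_imp_neq[OF Y(1), symmetric])
    define G where "G n t = indicator {0<..} t * (?UD (Y n / t) * ?w t)" for n t
    define F where "F n t = inverse (T (Y n)) * G n t" for n t
    \<comment> \<open>The candidate limit of the densities \<open>F n\<close>: their pointwise limit
      if the tail of \<open>R\<close> in the directions \<open>D\<close> were known to be asymptotic
      to \<open>q / \<kappa>\<close> times \<open>T\<close>.\<close>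
    define F0 where "F0 t = q / \<kappa> * (indicator {0<..} t * (t powr \<eta> * ?w t))" for t
    define e where "e t = exp (- (t powr p))" for t
    have e01: "0 \<le> e t \<and> e t \<le> 1" for t by (simp add: e_def)
    have em [measurable]: "e \<in> borel_measurable borel" unfolding e_def by measurable
    have Gi: "integrable lborel (G n)" for n unfolding G_def by (rule tail_formula(1)[OF Dm Y(1)])
    have Fi: "integrable lborel (F n)" for n unfolding F_def by (rule integrable_mult_right[OF Gi])
    have F0i: "integrable lborel F0" unfolding F0_def by (rule integrable_mult_right[OF iF0])
    have Fnn: "0 \<le> F n t" for n t using Y(2)[of n] by (simp add: F_def G_def temper_nonneg)
    have F0nn: "0 \<le> F0 t" for t using q0 \<kappa> by (simp add: F0_def temper_nonneg)
    have moments: "(\<lambda>n. \<integral>t. F n t * e t ^ k \<partial>lborel) \<longlonglongrightarrow> (\<integral>t. F0 t * e t ^ k \<partial>lborel)" for k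
    proof -
      define c where "c = real (Suc k) powr (1 / p)"
      have c: "0 < c" "c powr p = real (Suc k)" using p by (simp_all add: c_def powr_powr)
      have eqF: "(\<integral>t. F n t * e t ^ k \<partial>lborel) = c powr \<alpha> * (measure M (polar_tail (Y n * c) D) / T (Y n))" for n
      proof -
        have "(\<integral>t. F n t * e t ^ k \<partial>lborel) = (\<integral>t. inverse (T (Y n)) * (G n t * e t ^ k) \<partial>lborel)" by (simp only: F_def mult.assoc)
        also have "\<dots> = inverse (T (Y n)) * (\<integral>t. G n t * e t ^ k \<partial>lborel)" by (rule integral_mult_right_zero)
        also have "(\<integral>t. G n t * e t ^ k \<partial>lborel) = c powr \<alpha> * measure M (polar_tail (Y n * c) D)"
          unfolding G_def e_def by (rule temper_laplace_moments(1)[OF c Y(1) Dm])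
        finally show ?thesis by (simp add: divide_inverse mult_ac)
      qed
      have eqF0: "(\<integral>t. F0 t * e t ^ k \<partial>lborel) = c powr \<alpha> * (c powr (-\<eta>) * q)"
      proof -
        have "(\<integral>t. F0 t * e t ^ k \<partial>lborel) = (\<integral>t. q / \<kappa> * (indicator {0<..} t * (t powr \<eta> * ?w t) * e t ^ k) \<partial>lborel)" by (simp only: F0_def mult.assoc)
        also have "\<dots> = q / \<kappa> * (\<integral>t. indicator {0<..} t * (t powr \<eta> * ?w t) * e t ^ k \<partial>lborel)" by (rule integral_mult_right_zero)
        also have "(\<integral>t. indicator {0<..} t * (t powr \<eta> * ?w t) * e t ^ k \<partial>lborel) = c powr \<alpha> * (c powr (-\<eta>) * \<kappa>)"
          unfolding e_def \<kappa>_def by (rule temper_laplace_moments(2)[OF c zero_less_one Dm])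
        finally show ?thesis using \<kappa> by simp
      qed
      have "((\<lambda>r. measure M (polar_tail (r * c) D) / T r) \<longlongrightarrow> c powr (-\<eta>) * measure \<sigma> D / measure \<sigma> (sphere 0 1)) (at_right 0)"
        using RV D c(1) unfolding RV0_iff T_def by blast
      from filterlim_compose[OF this Yf]
      have "(\<lambda>n. measure M (polar_tail (Y n * c) D) / T (Y n)) \<longlonglongrightarrow> c powr (-\<eta>) * q" by (simp add: q_def)
      then show ?thesis unfolding eqF eqF0 by (rule tendsto_mult_left)
    qed
    \<comment> \<open>Here \<open>g (e t)\<close> is a bump supported in \<open>l < t < u\<close>
      and \<open>W\<close> its integral against the tempering density alone. Monotonicity of the
      tail on the window will turn convergence of windowed integrals into bounds on the tail at
      \<open>Y n\<close>.\<close>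
    have window: "\<exists>W>0. (\<lambda>n. \<integral>t. F n t * g (e t) \<partial>lborel) \<longlonglongrightarrow> (\<integral>t. F0 t * g (e t) \<partial>lborel) \<and>
        integrable lborel (\<lambda>t. indicator {0<..} t * (?w t * g (e t))) \<and> (\<forall>n. integrable lborel (\<lambda>t. F n t * g (e t))) \<and> integrable lborel (\<lambda>t. F0 t * g (e t)) \<and>
        W = (\<integral>t. indicator {0<..} t * (?w t * g (e t)) \<partial>lborel) \<and>
        (\<forall>v. 0 \<le> g v) \<and> (\<forall>t>0. g (e t) \<noteq> 0 \<longrightarrow> l < t \<and> t < u)"
      if lu: "0 < l" "l < u" and g: "g = tent (exp (- (u powr p))) (exp (- (l powr p)))" for l u g
    proof -
      \<comment> \<open>The map \<open>e\<close> is decreasing on positive \<open>t\<close>, so the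
        endpoints of the tent appear in reverse order.\<close>
      have less: "exp (- (u powr p)) \<le> exp (- (l powr p))" using lu p by (simp add: powr_mono2)
      have supp: "0 < g (e t) \<longleftrightarrow> l < t \<and> t < u" if "0 < t" for t
      proof -
        have "0 < g (e t) \<longleftrightarrow> t powr p < u powr p \<and> l powr p < t powr p"
          unfolding g tent_pos_iff[OF less] by (simp add: e_def)
        also have "\<dots> \<longleftrightarrow> l < t \<and> t < u"
          using lu that p powr_less_mono2[of p t u] powr_less_mono2[of p l t] powr_mono2[of p u t] powr_mono2[of p t l] by (auto simp: not_less[symmetric])
        finally show ?thesis .
      qed
      obtain B where B: "\<And>v. 0 \<le> v \<Longrightarrow> v \<le> 1 \<Longrightarrow> \<bar>g v\<bar> \<le> B" unfolding g using bounded_tent_01 by blast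
      have gc: "continuous_on UNIV g" unfolding g by (rule continuous_tent)
      have gm [measurable]: "g \<in> borel_measurable borel" by (rule borel_measurable_continuous_onI[OF gc])
      have ig: "integrable lborel (\<lambda>t. H t * g (e t))" if H: "integrable lborel H" for H
      proof (rule Bochner_Integration.integrable_bound[OF integrable_mult_left[OF H, of B]])
        have [measurable]: "H \<in> borel_measurable borel" using H by auto
        show "(\<lambda>t. H t * g (e t)) \<in> borel_measurable lborel" by measurable
        show "AE t in lborel. norm (H t * g (e t)) \<le> norm (H t * B)"
        proof (rule AE_I2)
          fix t
          have "\<bar>g (e t)\<bar> \<le> \<bar>B\<bar>" using B[of "e t"] e01[of t] by simp
          then have "\<bar>H t\<bar> * \<bar>g (e t)\<bar> \<le> \<bar>H t\<bar> * \<bar>B\<bar>" by (intro mult_left_mono) auto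
          then show "norm (H t * g (e t)) \<le> norm (H t * B)" by (simp only: real_norm_def abs_mult)
        qed
      qed
      \<comment> \<open>the density itself need not be integrable near 0, so the window is cut out of \<open>F0\<close>\<close>
      have iw: "integrable lborel (\<lambda>t. indicator {0<..} t * (?w t * g (e t)))"
      proof (rule Bochner_Integration.integrable_bound[OF integrable_mult_left[OF ig[OF iF0], of "l powr (-\<eta>)"]])
        show "AE t in lborel. norm (indicator {0<..} t * (?w t * g (e t))) \<le> norm (indicator {0<..} t * (t powr \<eta> * ?w t) * g (e t) * l powr (-\<eta>))"
        proof (rule AE_I2)
          fix t :: real
          have g0: "0 \<le> g (e t)" unfolding g by (rule tent_nonneg)
          show "norm (indicator {0<..} t * (?w t * g (e t))) \<le> norm (indicator {0<..} t * (t powr \<eta> * ?w t) * g (e t) * l powr (-\<eta>))"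
          proof (cases "0 < t \<and> 0 < g (e t)")
            case True
            then have "l < t" using supp by blast
            then have "l powr \<eta> \<le> t powr \<eta>" using lu \<eta>_pos by (intro powr_mono2) auto
            then have "1 \<le> t powr \<eta> * l powr (-\<eta>)" using lu by (simp add: powr_minus_divide)
            then have "?w t * g (e t) * 1 \<le> ?w t * g (e t) * (t powr \<eta> * l powr (-\<eta>))"
              using g0 by (intro mult_left_mono) (auto simp: temper_nonneg)
            then show ?thesis using True g0 by (simp add: temper_nonneg abs_mult mult_ac)
          next
            case False
            then show ?thesis using g0 by (auto simp: indicator_def)
          qed
        qed
      qed measurable
      have "0 < (\<integral>t. indicator {0<..} t * (?w t * g (e t)) \<partial>lborel)"
      proof (rule integral_Ioi_pos[OF iw _ lu])
        show "0 \<le> ?w t * g (e t)" for t unfolding g by (intro mult_nonneg_nonneg temper_nonneg tent_nonneg)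
        show "0 < ?w t * g (e t)" if "l < t" "t < u" for t
          using supp[of t] that lu temper_pos[of t] by simp
      qed
      moreover have "(\<lambda>n. \<integral>t. F n t * g (e t) \<partial>lborel) \<longlonglongrightarrow> (\<integral>t. F0 t * g (e t) \<partial>lborel)"
        by (rule moment_transfer[OF Fi Fnn F0i F0nn em e01 moments gc])
      moreover have "\<forall>v. 0 \<le> g v" unfolding g by (simp add: tent_nonneg)
      moreover have "\<forall>t>0. g (e t) \<noteq> 0 \<longrightarrow> l < t \<and> t < u"
        using supp calculation(3) by (metis order_le_less)
      ultimately show ?thesis using iw ig[OF Fi] ig[OF F0i] by blast
    qed
    have "(\<lambda>n. ?UD (Y n) / T (Y n)) \<longlonglongrightarrow> q / \<kappa>"
    proof (rule order_tendstoI)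
      fix a assume a: "q / \<kappa> < a"
      have "((\<lambda>\<epsilon>. q / \<kappa> * (1 + \<epsilon>) powr \<eta>) \<longlongrightarrow> q / \<kappa> * (1 + 0) powr \<eta>) (at_right 0)" by (intro tendsto_intros) auto
      from order_tendstoD(2)[OF this, of a] a have "\<forall>\<^sub>F \<epsilon> in at_right 0. q / \<kappa> * (1 + \<epsilon>) powr \<eta> < a" by simp
      with eventually_at_right_less[of "0::real"] have "\<forall>\<^sub>F \<epsilon> in at_right 0. 0 < \<epsilon> \<and> q / \<kappa> * (1 + \<epsilon>) powr \<eta> < a"
        by eventually_elim simp
      then obtain \<epsilon> where \<epsilon>: "0 < \<epsilon>" "q / \<kappa> * (1 + \<epsilon>) powr \<eta> < a" using eventually_happens'[OF trivial_limit_at_right_real] by blast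
      \<comment> \<open>For the upper bound the window lies to the right of 1: there
        \<open>Y n / t \<le> Y n\<close>, so the tail inside dominates the tail at
        \<open>Y n\<close>. The loss is the factor
        \<open>(1 + \<epsilon>) powr \<eta>\<close>.\<close>
      define g where "g = tent (exp (- ((1 + \<epsilon>) powr p))) (exp (- (1 powr p)))"
      have lu: "0 < (1::real)" "1 < 1 + \<epsilon>" using \<epsilon> by auto
      obtain W where W: "0 < W" "(\<lambda>n. \<integral>t. F n t * g (e t) \<partial>lborel) \<longlonglongrightarrow> (\<integral>t. F0 t * g (e t) \<partial>lborel)"
        "integrable lborel (\<lambda>t. indicator {0<..} t * (?w t * g (e t)))" "\<And>n. integrable lborel (\<lambda>t. F n t * g (e t))" "integrable lborel (\<lambda>t. F0 t * g (e t))"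
        "W = (\<integral>t. indicator {0<..} t * (?w t * g (e t)) \<partial>lborel)" "\<And>v. 0 \<le> g v" "\<And>t. 0 < t \<Longrightarrow> g (e t) \<noteq> 0 \<Longrightarrow> 1 < t \<and> t < 1 + \<epsilon>"
        using window[OF lu g_def] by blast
      have "(\<integral>t. F0 t * g (e t) \<partial>lborel) \<le> (\<integral>t. q / \<kappa> * (1 + \<epsilon>) powr \<eta> * (indicator {0<..} t * (?w t * g (e t))) \<partial>lborel)"
      proof (rule integral_mono[OF W(5) integrable_mult_right[OF W(3)]])
        fix t :: real
        show "F0 t * g (e t) \<le> q / \<kappa> * (1 + \<epsilon>) powr \<eta> * (indicator {0<..} t * (?w t * g (e t)))"
        proof (cases "0 < t \<and> g (e t) \<noteq> 0")
          case True
          then have "t powr \<eta> \<le> (1 + \<epsilon>) powr \<eta>" using W(8)[of t] \<eta>_pos by (intro powr_mono2) auto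
          then have "q / \<kappa> * (?w t * g (e t)) * t powr \<eta> \<le> q / \<kappa> * (?w t * g (e t)) * (1 + \<epsilon>) powr \<eta>"
            using W(7) q0 \<kappa> by (intro mult_left_mono mult_nonneg_nonneg) (auto simp: temper_nonneg)
          then show ?thesis using True by (simp add: F0_def mult_ac)
        qed (auto simp: F0_def indicator_def)
      qed
      also have "\<dots> = q / \<kappa> * (1 + \<epsilon>) powr \<eta> * W" unfolding W(6) by (rule integral_mult_right_zero)
      also have "\<dots> < a * W" using \<epsilon>(2) W(1) by (rule mult_strict_right_mono)
      finally have "(\<integral>t. F0 t * g (e t) \<partial>lborel) < a * W" .
      from order_tendstoD(2)[OF W(2) this]
      show "\<forall>\<^sub>F n in sequentially. ?UD (Y n) / T (Y n) < a"
      proof eventually_elim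
        case (elim n)
        have "?UD (Y n) / T (Y n) * W = (\<integral>t. ?UD (Y n) / T (Y n) * (indicator {0<..} t * (?w t * g (e t))) \<partial>lborel)"
          unfolding W(6) by (rule integral_mult_right_zero[symmetric])
        also have "\<dots> \<le> (\<integral>t. F n t * g (e t) \<partial>lborel)"
        proof (rule integral_mono[OF integrable_mult_right[OF W(3)] W(4)])
          fix t :: real
          show "?UD (Y n) / T (Y n) * (indicator {0<..} t * (?w t * g (e t))) \<le> F n t * g (e t)"
          proof (cases "0 < t \<and> g (e t) \<noteq> 0")
            case True
            then have "1 < t" using W(8) by blast
            then have "Y n / t \<le> Y n" using Y(1)[of n] by (simp add: divide_le_eq)
            then have "?UD (Y n) \<le> ?UD (Y n / t)" using Y(1)[of n] True by (intro UDanti) auto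
            then have "?UD (Y n) * (inverse (T (Y n)) * (?w t * g (e t))) \<le> ?UD (Y n / t) * (inverse (T (Y n)) * (?w t * g (e t)))"
              using W(7) Y(2)[of n] by (intro mult_right_mono) (auto simp: temper_nonneg)
            then show ?thesis using True by (simp add: F_def G_def divide_inverse mult_ac)
          qed (auto simp: F_def G_def indicator_def)
        qed
        finally have "?UD (Y n) / T (Y n) * W < a * W" using elim by linarith
        then show ?case using W(1) by (rule mult_right_less_imp_less[OF _ less_imp_le])
      qed
    next
      fix a assume a: "a < q / \<kappa>"
      have "((\<lambda>\<epsilon>. q / \<kappa> * (1 - \<epsilon>) powr \<eta>) \<longlongrightarrow> q / \<kappa> * (1 - 0) powr \<eta>) (at_right 0)" by (intro tendsto_intros) auto
      from order_tendstoD(1)[OF this, of a] a have "\<forall>\<^sub>F \<epsilon> in at_right 0. a < q / \<kappa> * (1 - \<epsilon>) powr \<eta>" by simp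
      with eventually_at_right_real[of 0 "1::real"] have "\<forall>\<^sub>F \<epsilon> in at_right 0. (0 < \<epsilon> \<and> \<epsilon> < 1) \<and> a < q / \<kappa> * (1 - \<epsilon>) powr \<eta>"
        by (auto elim: eventually_elim2)
      then obtain \<epsilon> where \<epsilon>: "0 < \<epsilon>" "\<epsilon> < 1" "a < q / \<kappa> * (1 - \<epsilon>) powr \<eta>" using eventually_happens'[OF trivial_limit_at_right_real] by blast
      \<comment> \<open>For the lower bound the window lies to the left of 1, where the tail at
        \<open>Y n / t\<close> is at most the tail at \<open>Y n\<close>. The loss is the factor
        \<open>(1 - \<epsilon>) powr \<eta>\<close>.\<close>
      define g where "g = tent (exp (- (1 powr p))) (exp (- ((1 - \<epsilon>) powr p)))"
      have lu: "0 < 1 - \<epsilon>" "1 - \<epsilon> < 1" using \<epsilon> by auto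
      obtain W where W: "0 < W" "(\<lambda>n. \<integral>t. F n t * g (e t) \<partial>lborel) \<longlonglongrightarrow> (\<integral>t. F0 t * g (e t) \<partial>lborel)"
        "integrable lborel (\<lambda>t. indicator {0<..} t * (?w t * g (e t)))" "\<And>n. integrable lborel (\<lambda>t. F n t * g (e t))" "integrable lborel (\<lambda>t. F0 t * g (e t))"
        "W = (\<integral>t. indicator {0<..} t * (?w t * g (e t)) \<partial>lborel)" "\<And>v. 0 \<le> g v" "\<And>t. 0 < t \<Longrightarrow> g (e t) \<noteq> 0 \<Longrightarrow> 1 - \<epsilon> < t \<and> t < 1"
        using window[OF lu g_def] by blast
      have "a * W < q / \<kappa> * (1 - \<epsilon>) powr \<eta> * W" using \<epsilon>(3) W(1) by (rule mult_strict_right_mono)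
      also have "\<dots> = (\<integral>t. q / \<kappa> * (1 - \<epsilon>) powr \<eta> * (indicator {0<..} t * (?w t * g (e t))) \<partial>lborel)" unfolding W(6) by (rule integral_mult_right_zero[symmetric])
      also have "\<dots> \<le> (\<integral>t. F0 t * g (e t) \<partial>lborel)"
      proof (rule integral_mono[OF integrable_mult_right[OF W(3)] W(5)])
        fix t :: real
        show "q / \<kappa> * (1 - \<epsilon>) powr \<eta> * (indicator {0<..} t * (?w t * g (e t))) \<le> F0 t * g (e t)"
        proof (cases "0 < t \<and> g (e t) \<noteq> 0")
          case True
          then have "(1 - \<epsilon>) powr \<eta> \<le> t powr \<eta>" using W(8)[of t] \<epsilon>(2) \<eta>_pos by (intro powr_mono2) auto
          then have "q / \<kappa> * (?w t * g (e t)) * (1 - \<epsilon>) powr \<eta> \<le> q / \<kappa> * (?w t * g (e t)) * t powr \<eta>"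
            using W(7) q0 \<kappa> by (intro mult_left_mono mult_nonneg_nonneg) (auto simp: temper_nonneg)
          then show ?thesis using True by (simp add: F0_def mult_ac)
        qed (auto simp: F0_def indicator_def)
      qed
      finally have "a * W < (\<integral>t. F0 t * g (e t) \<partial>lborel)" .
      from order_tendstoD(1)[OF W(2) this]
      show "\<forall>\<^sub>F n in sequentially. a < ?UD (Y n) / T (Y n)"
      proof eventually_elim
        case (elim n)
        have "(\<integral>t. F n t * g (e t) \<partial>lborel) \<le> (\<integral>t. ?UD (Y n) / T (Y n) * (indicator {0<..} t * (?w t * g (e t))) \<partial>lborel)"
        proof (rule integral_mono[OF W(4) integrable_mult_right[OF W(3)]])
          fix t :: real
          show "F n t * g (e t) \<le> ?UD (Y n) / T (Y n) * (indicator {0<..} t * (?w t * g (e t)))"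
          proof (cases "0 < t \<and> g (e t) \<noteq> 0")
            case True
            then have "t < 1" using W(8) by blast
            then have "Y n \<le> Y n / t" using Y(1)[of n] True by (simp add: le_divide_eq)
            then have "?UD (Y n / t) \<le> ?UD (Y n)" using Y(1)[of n] by (intro UDanti) auto
            then have "?UD (Y n / t) * (inverse (T (Y n)) * (?w t * g (e t))) \<le> ?UD (Y n) * (inverse (T (Y n)) * (?w t * g (e t)))"
              using W(7) Y(2)[of n] by (intro mult_right_mono) (auto simp: temper_nonneg)
            then show ?thesis using True by (simp add: F_def G_def divide_inverse mult_ac)
          qed (auto simp: F_def G_def indicator_def)
        qed
        also have "\<dots> = ?UD (Y n) / T (Y n) * W"
          unfolding W(6) by (rule integral_mult_right_zero)
        finally have "a * W < ?UD (Y n) / T (Y n) * W" using elim by linarith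
        then show ?case using W(1) by (rule mult_right_less_imp_less[OF _ less_imp_le])
      qed
    qed
    then have "(\<lambda>n. ?UD (X (n + N)) / T (X (n + N))) \<longlonglongrightarrow> 1 / \<kappa> * q" by (simp add: Y_def)
    then show "((\<lambda>r. ?UD r / T r) \<circ> X) \<longlonglongrightarrow> 1 / \<kappa> * q"
      unfolding comp_def by (rule LIMSEQ_offset)
  qed
qed

text \<open>\<open>temper_moment\<close> is finite and positive, so the two comparisons are
  proportionalities with mutually inverse constants, and \<open>RV0_transfer\<close> applies in
  either direction.\<close>

theorem RV0_TS_levy_iff: "RV0 (-\<eta>) \<sigma> M \<longleftrightarrow> RV0 (-\<eta>) \<sigma> R"
proof
  assume RV: "RV0 (-\<eta>) \<sigma> M"
  show "RV0 (-\<eta>) \<sigma> R"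
    by (rule RV0_transfer[OF R0 \<sigma> \<eta>_pos RV _ tauberian[OF RV]]) (use temper_moment_pos in simp)
next
  assume RV: "RV0 (-\<eta>) \<sigma> R"
  show "RV0 (-\<eta>) \<sigma> M"
    by (rule RV0_transfer[OF Mclass_M \<sigma> \<eta>_pos RV temper_moment_pos abelian[OF RV]])
qed

end

end

section \<open>The characterisation of stable limits and its tempered form\<close>

theorem levy_process_stable_limit_iff:
  fixes P :: "'w measure" and X :: "real \<Rightarrow> 'w \<Rightarrow> 'a::euclidean_space"
  assumes eta: "0 < \<eta>" "\<eta> < 2" and \<sigma>: "sphere_measure \<sigma>"
    and levy: "levy_process P X" and M: "Mclass 0 M" and X1: "is_ID0 M b (distr P borel (X 1))"
  shows "(\<exists>(a::real \<Rightarrow> real) (\<zeta>::real \<Rightarrow> 'a). (\<forall>t>0. a t > 0) \<and>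
             (\<exists>\<nu>. is_ID0 (stable_levy \<eta> \<sigma>) 0 \<nu> \<and>
                 weak_conv_on (\<lambda>t. distr P borel (\<lambda>\<omega>. a t *\<^sub>R (X t \<omega> - \<zeta> t))) \<nu> (at_right 0)))
           \<longleftrightarrow> RV0 (-\<eta>) \<sigma> M" (is "?L \<longleftrightarrow> _")
proof
  assume ?L
  then obtain a \<zeta> \<nu> where "\<And>t. 0 < t \<Longrightarrow> 0 < a t" "is_ID0 (stable_levy \<eta> \<sigma>) 0 \<nu>"
      "weak_conv_on (\<lambda>t. distr P borel (\<lambda>\<omega>. a t *\<^sub>R (X t \<omega> - \<zeta> t))) \<nu> (at_right 0)"
    by blast
  then show "RV0 (-\<eta>) \<sigma> M" by (rule weak_limit_imp_RV0[OF eta \<sigma> levy M X1])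
next
  assume RV: "RV0 (-\<eta>) \<sigma> M"
  interpret S: levy_measure "stable_levy \<eta> \<sigma>"
    by (rule levy_measure.intro[OF Mclass_stable_levy[OF \<sigma> eta]])
  \<comment> \<open>The statement asks for the limit law itself, so in this direction its existence
    is part of the claim.\<close>
  obtain \<nu> where \<nu>: "is_ID0 (stable_levy \<eta> \<sigma>) 0 \<nu>"
    by (rule S.exists_ID0)
  show ?L
  proof (rule RV0_imp_weak_limit[OF eta \<sigma> levy M X1 \<nu> RV])
    fix a \<zeta>
    assume "\<And>t. 0 < t \<Longrightarrow> 0 < a t"
      "weak_conv_on (\<lambda>t. distr P borel (\<lambda>\<omega>. a t *\<^sub>R (X t \<omega> - \<zeta> t))) \<nu> (at_right 0)"
    with \<nu> show ?L by (intro exI[of _ a] exI[of _ \<zeta>] exI[of _ \<nu>] conjI) auto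
  qed
qed

theorem theorem2:
  fixes P :: "'w measure" and X :: "real \<Rightarrow> 'w \<Rightarrow> 'a::euclidean_space"
    and M :: "'a measure" and b :: 'a and \<sigma> :: "'a measure" and \<eta> :: real
  assumes eta: "0 < \<eta>" "\<eta> < 2"
    and sigma: "sphere_measure \<sigma>"
    and levy: "levy_process P X"
    and Levy_measure: "Mclass 0 M"
    and X1: "is_ID0 M b (distr P borel (X 1))"
  shows "((\<exists>(a::real \<Rightarrow> real) (\<zeta>::real \<Rightarrow> 'a). (\<forall>t>0. a t > 0) \<and>
             (\<exists>\<nu>. is_ID0 (stable_levy \<eta> \<sigma>) 0 \<nu> \<and>
                 weak_conv_on (\<lambda>t. distr P borel (\<lambda>\<omega>. a t *\<^sub>R (X t \<omega> - \<zeta> t))) \<nu> (at_right 0)))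
           \<longleftrightarrow> RV0 (-\<eta>) \<sigma> M)
       \<and> (\<forall>p \<alpha> (R::'a measure) b'. 0 < p \<and> \<alpha> < 2 \<and> \<alpha> \<noteq> 0 \<and> max \<alpha> 0 < \<eta> \<and>
            Mclass (max \<alpha> 0) R \<and> is_ID0 (TS_levy p \<alpha> R) b' (distr P borel (X 1)) \<longrightarrow>
            ((\<exists>(a::real \<Rightarrow> real) (\<zeta>::real \<Rightarrow> 'a). (\<forall>t>0. a t > 0) \<and>
               (\<exists>\<nu>. is_ID0 (stable_levy \<eta> \<sigma>) 0 \<nu> \<and>
                   weak_conv_on (\<lambda>t. distr P borel (\<lambda>\<omega>. a t *\<^sub>R (X t \<omega> - \<zeta> t))) \<nu> (at_right 0)))
             \<longleftrightarrow> RV0 (-\<eta>) \<sigma> R))"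
proof (intro conjI allI impI)
  show "(\<exists>(a::real \<Rightarrow> real) (\<zeta>::real \<Rightarrow> 'a). (\<forall>t>0. a t > 0) \<and>
             (\<exists>\<nu>. is_ID0 (stable_levy \<eta> \<sigma>) 0 \<nu> \<and>
                 weak_conv_on (\<lambda>t. distr P borel (\<lambda>\<omega>. a t *\<^sub>R (X t \<omega> - \<zeta> t))) \<nu> (at_right 0)))
           \<longleftrightarrow> RV0 (-\<eta>) \<sigma> M"
    by (rule levy_process_stable_limit_iff[OF eta sigma levy Levy_measure X1])
next
  fix p \<alpha> and R :: "'a measure" and b'
  assume A: "0 < p \<and> \<alpha> < 2 \<and> \<alpha> \<noteq> 0 \<and> max \<alpha> 0 < \<eta> \<and>
            Mclass (max \<alpha> 0) R \<and> is_ID0 (TS_levy p \<alpha> R) b' (distr P borel (X 1))"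
  \<comment> \<open>The law of \<open>X 1\<close> is now read with the tempered Levy measure and
    drift \<open>b'\<close>. The general characterisation is applied to that measure, and regular
    variation is moved from it to \<open>R\<close>.\<close>
  have T: "tempered R p \<alpha> (max \<alpha> 0)" using A by (intro tempered.intro) auto
  have "RV0 (-\<eta>) \<sigma> (TS_levy p \<alpha> R) \<longleftrightarrow> RV0 (-\<eta>) \<sigma> R"
    using A eta by (intro tempered.RV0_TS_levy_iff[OF T] sigma) auto
  then show "(\<exists>(a::real \<Rightarrow> real) (\<zeta>::real \<Rightarrow> 'a). (\<forall>t>0. a t > 0) \<and>
               (\<exists>\<nu>. is_ID0 (stable_levy \<eta> \<sigma>) 0 \<nu> \<and>
                   weak_conv_on (\<lambda>t. distr P borel (\<lambda>\<omega>. a t *\<^sub>R (X t \<omega> - \<zeta> t))) \<nu> (at_right 0)))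
             \<longleftrightarrow> RV0 (-\<eta>) \<sigma> R"
    using levy_process_stable_limit_iff[OF eta sigma levy tempered.Mclass_M[OF T] conjunct2[OF conjunct2[OF conjunct2[OF conjunct2[OF conjunct2[OF A]]]]]]
    by (rule trans[rotated])
qed

end
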